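(* Let $a_0,a_1,a_2,a_3\in\,]0,\pi[$ and fix one of the two types of hexagons. The following is a full list of connected components of the space of hexagons of this type in $S:=S(a_0,a_1,a_2,a_3)$. (a) Let $\sum_ja_j<\pi$ or $3\pi<\sum_ja_j$. Then there are two components. One is topologically a $2$-sphere and the isometry $R_0R_3$ is elliptic for every point in this component. The other component is topologically a plane and $R_0R_3$ is hyperbolic for every point in this component. (b) Let $\sum_ja_j=\pi$ or $\sum_ja_j=3\pi$. Then there are two components. One is a single point, degenerate with respect to $t_3$, and $R_0R_3$ is elliptic for this point. The other component is topologically a plane and $R_0R_3$ is hyperbolic for every point in this component. (c) Let $a_0+a_3<\pi<a_1+a_2$ or $a_1+a_2<\pi<a_0+a_3$. Then there is a unique component, topologically a plane. There are points in the component whose isometry $R_0R_3$ is elliptic, points for which it is parabolic, and points for which it is hyperbolic. (d) Let $a_0+a_3=a_1+a_2=\pi$. Then there is a unique component, topologically a plane. The isometry $R_0R_3$ is hyperbolic or the identity for every point in this component. (e) In all the remaining cases (i.e., $\pi<\sum_ja_j$ with $a_0+a_3<\pi$ and $a_1+a_2<\pi$; or $\sum_ja_j<3\pi$ with $\pi<a_0+a_3$ and $\pi<a_1+a_2$; or $a_0+a_3=\pi$ with $a_1+a_2\ne\pi$; or $a_1+a_2=\pi$ with $a_0+a_3\ne\pi$), there is a unique component, topologically a plane. The isometry $R_0R_3$ is hyperbolic for every point in this component. Moreover, every component $C$, except the one consisting of a single point, contains a curve $L_2\subset C$ dividing $C$ into $2$ parts such that $t_3C=t_3L_2$ and every fibre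 of $t_3:L_2\to\mathbb R$ contains at most $2$ points, with the unique exception in case (d), where the fibre over $t_3=1$ is topologically a ray. The curve $L_2$ is topologically a circle or a line when $C$ is topologically a $2$-sphere or a plane, respectively. The curve $L_2$ admits a smooth parameterization by $t_3$ at the points where the isometry $R_0R_3$ is hyperbolic.
   Context: Let $V$ be a $2$-dimensional complex vector space with a hermitian form $\langle-,-\rangle$ (linear in the first argument) of signature $(1,1)$, and let $\mathrm BV:=\{p\in\mathbb P_{\mathbb C}V\mid\langle p,p\rangle>0\}$. This is the hyperbolic plane of curvature $-1$, oriented by its complex structure, with $\cosh^2\frac{\mathrm{dist}(p,q)}2=\mathrm{ta}(p,q):=\frac{\langle p,q\rangle\langle q,p\rangle}{\langle p,p\rangle\langle q,q\rangle}$; $\mathrm{PU}V$ is its group of orientation-preserving isometries. For $c\in\mathrm BV$ and $k\in\mathbb C$, $|k|=1$, the map $R_{c,k}:p\mapsto(\overline k-k)\frac{\langle p,c\rangle}{\langle c,c\rangle}c+kp$ lies in $\mathrm{SU}V$ and acts on $\mathrm BV$ as the counterclockwise rotation about $c$ by the angle $2\arg k$. The space $S(a_0,a_1,a_2,a_3)$. Put $k_j:=e^{a_ji}$. A hexagon of the first (respectively, second) type is a quadruple $(c_0,c_1,c_2,c_3)\in(\mathrm BV)^4$, considered up to the diagonal action of $\mathrm{PU}V$, such that $R_3R_2R_1R_0=1$ (respectively, $R_0R_1R_2R_3=1$) in $\mathrm{PU}V$, where $R_j:=R_{c_j,k_j}$. $S(a_0,a_1,a_2,a_3)$ is the disjoint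 union of the spaces of hexagons of the two types, with the natural topology. For a hexagon $P$ put $p_3:=c_0$ and $p_1:=R_1p_3$, $p_2:=R_2p_1$ (then $p_3=R_3p_2$) for the first type; $p_1:=R_1^{-1}p_3$, $p_2:=R_2^{-1}p_1$ (then $p_3=R_3^{-1}p_2$) for the second type. Put $t_jP:=\mathrm{ta}(c_j,p_j)\geqslant1$ for $j=1,2,3$. The map $P\mapsto(t_1P,t_2P,t_3P)\in\mathbb R^3$ is injective on the hexagons of each type, and smoothness is understood with respect to these coordinates. A point $P\in S$ is degenerate with respect to $t_3$ if the only point $P'\in S$ of the same type as $P$ with $t_3P'=t_3P$ is $P$ itself. (For the second type, the natural isometry is $R_3R_0$; it is conjugate to $R_0R_3$.) *)

theory Defs
  imports "HOL-Analysis.Analysis"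
begin

definition quotient_topology :: "'a topology \<Rightarrow> ('a \<Rightarrow> 'b) \<Rightarrow> 'b topology" where
  "quotient_topology X q =
     topology (\<lambda>U. U \<subseteq> q ` topspace X \<and> openin X {x \<in> topspace X. q x \<in> U})"

text \<open>Infinitely differentiable on an open set of reals.\<close>

definition smooth_real_on :: "real set \<Rightarrow> (real \<Rightarrow> real) \<Rightarrow> bool" where
  "smooth_real_on I f \<longleftrightarrow> (\<forall>n. \<forall>s\<in>I. (deriv ^^ n) f field_differentiable at s)"

datatype hexagon_type = First_Type | Second_Type

text \<open>
  The complex plane \<open>V\<close> with a form of signature \<open>(1,1)\<close>: since the dimension is 2, the orthogonal
  vectors in the assumption \<open>signature\<close> form a basis.  Values \<open>h v v\<close> are real by \<open>hermitian\<close>, hence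
  the use of \<open>Re\<close> in order relations.
\<close>

locale hermitian_plane = vector_space scl
  for scl :: "complex \<Rightarrow> 'v::ab_group_add \<Rightarrow> 'v" (infixr \<open>*\<^sub>V\<close> 75) +
  fixes h :: "'v \<Rightarrow> 'v \<Rightarrow> complex"
  assumes dimension: "dim UNIV = 2"
    and form_add_left: "h (u + v) w = h u w + h v w"
    and form_scale_left: "h (z *\<^sub>V u) w = z * h u w"
    and hermitian: "h v u = cnj (h u v)"
    and signature: "\<exists>e f. h e f = 0 \<and> Re (h e e) > 0 \<and> Re (h f f) < 0"
begin

text \<open>Points of the projective line are the one-dimensional subspaces of \<open>V\<close>.\<close>

definition BV :: "'v set set" where
  "BV = {span {v} | v. Re (h v v) > 0}"

definition absolute :: "'v set set" where
  "absolute = {span {v} | v. v \<noteq> 0 \<and> h v v = 0}"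

definition rep :: "'v set \<Rightarrow> 'v" where
  "rep p = (SOME v. v \<in> p \<and> v \<noteq> 0)"

text \<open>
  The formulas for \<open>ta\<close> and \<open>rot\<close> are homogeneous of degree 0 in the representatives, so the choices
  made by \<open>rep\<close> are immaterial.
\<close>

definition ta :: "'v set \<Rightarrow> 'v set \<Rightarrow> real" where
  "ta p q = Re (h (rep p) (rep q) * h (rep q) (rep p) / (h (rep p) (rep p) * h (rep q) (rep q)))"

text \<open>
  The metric of the hyperbolic plane, \<open>cosh\<^sup>2 (dist p q / 2) = ta p q\<close>.  Its value outside \<open>BV\<close> is
  irrelevant, but \<^locale>\<open>Metric_space\<close> requires it to be nonnegative and symmetric.
\<close>

definition hdist :: "'v set \<Rightarrow> 'v set \<Rightarrow> real" where
  "hdist p q = (if p \<in> BV \<and> q \<in> BV then 2 * arcosh (sqrt (ta p q)) else 0)"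

definition BV_topology :: "'v set topology" where
  "BV_topology = Metric_space.mtopology BV hdist"

definition rot :: "'v set \<Rightarrow> complex \<Rightarrow> 'v \<Rightarrow> 'v" where
  "rot c k v = ((cnj k - k) * (h v (rep c) / h (rep c) (rep c))) *\<^sub>V rep c + k *\<^sub>V v"

text \<open>
  \<open>PUV\<close> is the quotient of the group of unitary maps by the unitary scalars; it acts on projective
  points, being subspaces, by taking images.  A unitary map is automatically bijective because the
  form is nondegenerate and \<open>V\<close> is finite-dimensional.
\<close>

definition unitary :: "('v \<Rightarrow> 'v) \<Rightarrow> bool" where
  "unitary f \<longleftrightarrow> Vector_Spaces.linear scl scl f \<and> (\<forall>u v. h (f u) (f v) = h u v)"

definition trivial_in_PU :: "('v \<Rightarrow> 'v) \<Rightarrow> bool" where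
  "trivial_in_PU f \<longleftrightarrow> (\<exists>z. cmod z = 1 \<and> (\<forall>v. f v = z *\<^sub>V v))"

definition elliptic :: "('v \<Rightarrow> 'v) \<Rightarrow> bool" where
  "elliptic f \<longleftrightarrow> \<not> trivial_in_PU f \<and> (\<exists>p\<in>BV. f ` p = p)"

definition parabolic :: "('v \<Rightarrow> 'v) \<Rightarrow> bool" where
  "parabolic f \<longleftrightarrow> \<not> (\<exists>p\<in>BV. f ` p = p) \<and> card {p \<in> absolute. f ` p = p} = 1"

definition hyperbolic :: "('v \<Rightarrow> 'v) \<Rightarrow> bool" where
  "hyperbolic f \<longleftrightarrow> \<not> (\<exists>p\<in>BV. f ` p = p) \<and> card {p \<in> absolute. f ` p = p} = 2"

text \<open>Quadruples of points are functions on \<open>{..3}\<close> (undefined elsewhere).\<close>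

definition R :: "(nat \<Rightarrow> real) \<Rightarrow> (nat \<Rightarrow> 'v set) \<Rightarrow> nat \<Rightarrow> 'v \<Rightarrow> 'v" where
  "R a c j = rot (c j) (cis (a j))"

definition quadruples :: "hexagon_type \<Rightarrow> (nat \<Rightarrow> real) \<Rightarrow> (nat \<Rightarrow> 'v set) set" where
  "quadruples ty a = {c \<in> {..3} \<rightarrow>\<^sub>E BV. trivial_in_PU
     (case ty of
        First_Type \<Rightarrow> R a c 3 \<circ> R a c 2 \<circ> R a c 1 \<circ> R a c 0
      | Second_Type \<Rightarrow> R a c 0 \<circ> R a c 1 \<circ> R a c 2 \<circ> R a c 3)}"

definition orbit :: "(nat \<Rightarrow> 'v set) \<Rightarrow> (nat \<Rightarrow> 'v set) set" where
  "orbit c = {\<lambda>j\<in>{..3}. f ` c j | f. unitary f}"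

definition hexagon_space ::
    "hexagon_type \<Rightarrow> (nat \<Rightarrow> real) \<Rightarrow> (nat \<Rightarrow> 'v set) set topology" where
  "hexagon_space ty a = quotient_topology
     (subtopology (product_topology (\<lambda>_. BV_topology) {..3}) (quadruples ty a)) orbit"

text \<open>
  The functions below are defined on quadruples; on a hexagon, i.e. an orbit, they are evaluated
  at an arbitrary member.  The numbers \<open>t\<close> are invariant, and the map \<open>R\<^sub>0R\<^sub>3\<close> is well defined up to
  conjugation by a unitary map, which does not affect its kind.
\<close>

definition rotate_point ::
    "hexagon_type \<Rightarrow> (nat \<Rightarrow> real) \<Rightarrow> (nat \<Rightarrow> 'v set) \<Rightarrow> nat \<Rightarrow> 'v set \<Rightarrow> 'v set" where
  "rotate_point ty a c j p = (case ty of
     First_Type \<Rightarrow> R a c j ` p | Second_Type \<Rightarrow> inv (R a c j) ` p)"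

definition vertex ::
    "hexagon_type \<Rightarrow> (nat \<Rightarrow> real) \<Rightarrow> (nat \<Rightarrow> 'v set) \<Rightarrow> nat \<Rightarrow> 'v set" where
  "vertex ty a c j =
     (if j = 1 then rotate_point ty a c 1 (c 0)
      else if j = 2 then rotate_point ty a c 2 (rotate_point ty a c 1 (c 0))
      else c 0)"

definition t ::
    "hexagon_type \<Rightarrow> (nat \<Rightarrow> real) \<Rightarrow> nat \<Rightarrow> (nat \<Rightarrow> 'v set) set \<Rightarrow> real" where
  "t ty a j P = (let c = SOME c. c \<in> P in ta (c j) (vertex ty a c j))"

definition R03 :: "(nat \<Rightarrow> real) \<Rightarrow> (nat \<Rightarrow> 'v set) set \<Rightarrow> 'v \<Rightarrow> 'v" where
  "R03 a P = (let c = SOME c. c \<in> P in R a c 0 \<circ> R a c 3)"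

definition degenerate_t3 ::
    "hexagon_type \<Rightarrow> (nat \<Rightarrow> real) \<Rightarrow> (nat \<Rightarrow> 'v set) set \<Rightarrow> bool" where
  "degenerate_t3 ty a P \<longleftrightarrow>
     (\<forall>P' \<in> topspace (hexagon_space ty a). t ty a 3 P' = t ty a 3 P \<longrightarrow> P' = P)"

text \<open>
  The curve \<open>L\<close> has a smooth parameterization by \<open>t\<^sub>3\<close> near its point \<open>P\<close>, smoothness referring to the
  coordinates \<open>(t\<^sub>1, t\<^sub>2, t\<^sub>3)\<close>.
\<close>

definition smooth_by_t3_at ::
    "hexagon_type \<Rightarrow> (nat \<Rightarrow> real) \<Rightarrow> (nat \<Rightarrow> 'v set) set set \<Rightarrow> (nat \<Rightarrow> 'v set) set \<Rightarrow> bool" where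
  "smooth_by_t3_at ty a L P \<longleftrightarrow>
     (\<exists>I \<gamma>. open I \<and> is_interval I \<and> t ty a 3 P \<in> I \<and> \<gamma> (t ty a 3 P) = P \<and>
        openin (subtopology (hexagon_space ty a) L) (\<gamma> ` I) \<and>
        homeomorphic_map (top_of_set I) (subtopology (hexagon_space ty a) (\<gamma> ` I)) \<gamma> \<and>
        (\<forall>s\<in>I. t ty a 3 (\<gamma> s) = s) \<and>
        (\<forall>j\<in>{1, 2, 3}. smooth_real_on I (\<lambda>s. t ty a j (\<gamma> s))))"

end

abbreviation is_sphere :: "'a topology \<Rightarrow> bool" where
  "is_sphere X \<equiv> X homeomorphic_space top_of_set (sphere (0 :: real^3) 1)"

abbreviation is_plane :: "'a topology \<Rightarrow> bool" where
  "is_plane X \<equiv> X homeomorphic_space (euclidean :: (real^2) topology)"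

abbreviation is_circle :: "'a topology \<Rightarrow> bool" where
  "is_circle X \<equiv> X homeomorphic_space top_of_set (sphere (0 :: real^2) 1)"

abbreviation is_line :: "'a topology \<Rightarrow> bool" where
  "is_line X \<equiv> X homeomorphic_space (euclidean :: real topology)"

abbreviation is_ray :: "'a topology \<Rightarrow> bool" where
  "is_ray X \<equiv> X homeomorphic_space top_of_set {0 :: real..}"

end

theory Submission imports Defs begin

text \<open>With \<open>X = 2 t\<^sub>1 - 1\<close>, \<open>Y = 2 t\<^sub>2 - 1\<close>, \<open>T = 2 t\<^sub>3 - 1\<close>, and the lifted relation
  \<open>R\<^sub>3 R\<^sub>2 R\<^sub>1 R\<^sub>0 = z\<close>, \<open>z = \<plusminus> 1\<close>, in \<open>SU(1,1)\<close>, the map \<open>(X, Y, T)\<close> is proper and injective. It identifies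
  the hexagons of the first type with the union over \<open>z\<close> of the solution sets of one equation, quadratic
  in \<open>X\<close> and \<open>Y\<close>; the second type reduces to the first by conjugating the complex structure.
  For fixed \<open>T\<close> the equation is a conic with axis \<open>q = 0\<close> in suitable coordinates \<open>P, q\<close>; it is an ellipse, a
  parabola or a hyperbola according to whether \<open>R\<^sub>0 R\<^sub>3\<close> is elliptic, parabolic or hyperbolic, and only
  one branch of the hyperbola has \<open>X, Y \<ge> 1\<close>. For \<open>z = - 1\<close> the conics are ellipses, and they form a
  sphere, a point or the empty set; for \<open>z = 1\<close> they form a plane. The curve \<open>L\<^sub>2\<close> is \<open>q = 0\<close>.\<close>

text \<open>The sign \<open>z\<close> is the ambiguity of lifting the relation from PU to SU. The
  equation arises as follows. With \<open>c\<^sub>0\<close> moved to the origin,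
  \<open>R\<^sub>0\<close> is diagonal and the other centres are complex numbers
  \<open>n\<^sub>1, n\<^sub>2, n\<^sub>3\<close> up to a common phase. Comparing one matrix entry in
  the relation expresses \<open>n\<^sub>1 * cnj n\<^sub>3\<close> through \<open>X\<close>,
  \<open>Y\<close>, \<open>T\<close>; taking moduli gives \<open>E\<close>, and conversely
  \<open>E\<close> is what is needed to find \<open>n\<^sub>1\<close> and \<open>n\<^sub>3\<close>,
  after which the relation yields \<open>R\<^sub>2\<close>. The angle sums enter through signs.
  While half the trace is at least - 1, \<open>z * p T\<close> has the sign of
  \<open>c0 + c3\<close>, and a conic that is not a hyperbola can reach \<open>P > 0\<close> only if
  \<open>b T = - p T * (c1 + c2)\<close> is positive. Two obstacles shape the proof:
  \<open>E\<close> also has solutions outside \<open>X, Y \<ge> 1\<close>, which must be cut off by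
  a sign condition alone; and if both angle sums are pi, the conic over \<open>T = 1\<close> is a
  double line, where the general formulas become 0 / 0.\<close>

text \<open>\<open>c\<^sub>j\<close> and \<open>s\<^sub>j\<close> stand for \<open>cos a\<^sub>j\<close> and \<open>sin a\<^sub>j\<close>, and \<open>tau T\<close> is half the trace of \<open>R\<^sub>0 R\<^sub>3\<close>.\<close>

locale circle_data =
  fixes c0 s0 c1 s1 c2 s2 c3 s3 z :: real
  assumes unit: "c0\<^sup>2 + s0\<^sup>2 = 1" "c1\<^sup>2 + s1\<^sup>2 = 1" "c2\<^sup>2 + s2\<^sup>2 = 1" "c3\<^sup>2 + s3\<^sup>2 = 1"
    and pos: "0 < s0" "0 < s1" "0 < s2" "0 < s3"
    and z: "z = 1 \<or> z = - 1"
begin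

definition tau :: "real \<Rightarrow> real" where "tau T = c0 * c3 - s0 * s3 * T"
definition u :: "real \<Rightarrow> real" where "u T = z * tau T"
text \<open>With \<open>c\<^sub>0\<close> at the origin, \<open>u T - i * p T\<close> is
  \<open>z\<close> times the first diagonal entry \<open>(c0 - i * s0) * (c3 - i * s3 * T)\<close>
  of \<open>R\<^sub>0 R\<^sub>3\<close>.\<close>

definition p :: "real \<Rightarrow> real" where "p T = z * (s0 * c3 + c0 * s3 * T)"
text \<open>The negative of the determinant of the symmetric 3 by 3 matrix with unit diagonal and
  off-diagonal entries \<open>c1\<close>, \<open>c2\<close>, \<open>u T\<close>. The product form
  shows its sign relative to the cosines of the sum and the difference of the two angles.\<close>

definition N :: "real \<Rightarrow> real" where "N T = (c1 * c2 - s1 * s2 - u T) * (c1 * c2 + s1 * s2 - u T)"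
definition E :: "real \<Rightarrow> real \<Rightarrow> real \<Rightarrow> bool" where
  "E X Y T \<longleftrightarrow> (s1 * X)\<^sup>2 + (s2 * Y)\<^sup>2 + 2 * u T * (s1 * X) * (s2 * Y)
     + 2 * p T * (c1 * (s2 * Y) + c2 * (s1 * X)) + (p T)\<^sup>2 + N T = 0"
text \<open>The bound on \<open>u T\<close> is a trace condition. Since
  \<open>R\<^sub>2 R\<^sub>1\<close> is \<open>z\<close> times the inverse of
  \<open>R\<^sub>0 R\<^sub>3\<close>, half its trace is \<open>u T\<close>; on the other hand it is
  \<open>c1 * c2 - s1 * s2 * cosh r\<close> with \<open>r\<close> the distance between
  \<open>c\<^sub>1\<close> and \<open>c\<^sub>2\<close>.\<close>

definition M :: "(real \<times> real \<times> real) set" where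
  "M = {(X, Y, T). 1 \<le> X \<and> 1 \<le> Y \<and> 1 \<le> T \<and> u T \<le> c1 * c2 - s1 * s2 \<and> E X Y T}"
text \<open>In terms of \<open>P = s1 * X + s2 * Y\<close> and a shifted, scaled difference
  \<open>q\<close>, the equation \<open>E\<close> becomes
  \<open>(1 + u T) / 2 * P\<^sup>2 - b T * P + K T + q\<^sup>2 = 0\<close>; \<open>d\<close> is the
  discriminant in \<open>P\<close> on the axis \<open>q = 0\<close>.\<close>

definition b :: "real \<Rightarrow> real" where "b T = - p T * (c1 + c2)"
definition K :: "real \<Rightarrow> real" where
  "K T = (p T)\<^sup>2 + N T - (p T)\<^sup>2 * (c2 - c1)\<^sup>2 / (2 * (1 - u T))"
definition d :: "real \<Rightarrow> real" where "d T = (b T)\<^sup>2 - 2 * (1 + u T) * K T"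

lemma zz: "z * z = 1" "z\<^sup>2 = 1"
  using z by auto

lemma sq: "c0\<^sup>2 = 1 - s0\<^sup>2" "c1\<^sup>2 = 1 - s1\<^sup>2" "c2\<^sup>2 = 1 - s2\<^sup>2" "c3\<^sup>2 = 1 - s3\<^sup>2"
  using unit by auto

text \<open>The left-hand side is the squared modulus of
  \<open>(c0 - i * s0) * (c3 - i * s3 * T)\<close>, hence a product. Its excess over 1 is the
  squared modulus of the off-diagonal entry of \<open>R\<^sub>0 R\<^sub>3\<close>.\<close>

lemma tau_p: "(tau T)\<^sup>2 + (p T)\<^sup>2 = 1 + s3\<^sup>2 * (T\<^sup>2 - 1)"
proof -
  have "(tau T)\<^sup>2 + (p T)\<^sup>2 = (c0\<^sup>2 + s0\<^sup>2) * (c3\<^sup>2 + s3\<^sup>2 * T\<^sup>2)"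
    unfolding tau_def p_def power_mult_distrib zz by algebra
  then show ?thesis by (simp add: unit sq algebra_simps)
qed

lemma u_sq: "(u T)\<^sup>2 = (tau T)\<^sup>2"
  by (simp add: u_def power_mult_distrib zz)

lemma u_p: "(u T)\<^sup>2 + (p T)\<^sup>2 = 1 + s3\<^sup>2 * (T\<^sup>2 - 1)"
  using tau_p by (simp add: u_sq)

lemma s0_p: "s0 * p T = z * c3 - c0 * u T"
proof -
  have "s0 * p T = z * (s0\<^sup>2 * c3 + c0 * s0 * s3 * T)"
    unfolding p_def by algebra
  also have "s0\<^sup>2 = 1 - c0\<^sup>2" using unit by simp
  finally show ?thesis unfolding u_def tau_def by algebra
qed

lemma cos_diff_less: "c1 * c2 - s1 * s2 < 1"
  using sum_squares_bound[of c1 c2] sum_squares_bound[of s1 s2] mult_pos_pos[OF pos(2,3)] unit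
  by (auto simp: power2_eq_square) 

lemma N_alt: "N T = (u T)\<^sup>2 + c1\<^sup>2 + c2\<^sup>2 - 1 - 2 * c1 * c2 * u T"
proof -
  have "N T = (u T)\<^sup>2 + c1\<^sup>2 * c2\<^sup>2 - s1\<^sup>2 * s2\<^sup>2 - 2 * c1 * c2 * u T"
    unfolding N_def by algebra
  moreover have "s1\<^sup>2 = 1 - c1\<^sup>2" "s2\<^sup>2 = 1 - c2\<^sup>2" using unit by simp_all
  ultimately show ?thesis by (simp add: algebra_simps)
qed

definition ok :: "real \<Rightarrow> bool" where "ok T \<longleftrightarrow> 1 \<le> T \<and> u T \<le> c1 * c2 - s1 * s2"

lemma u_less_1: "ok T \<Longrightarrow> u T < 1"
  using cos_diff_less by (simp add: ok_def)

lemma N_nonneg: "ok T \<Longrightarrow> 0 \<le> N T"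
  using mult_pos_pos[OF pos(2,3)] by (simp add: ok_def N_def)

lemma tau_less_1: "1 \<le> T \<Longrightarrow> tau T < 1"
proof -
  assume "1 \<le> T"
  then have "s0 * s3 * 1 \<le> s0 * s3 * T" using mult_pos_pos[OF pos(1,4)] by (intro mult_left_mono) auto
  then show ?thesis
  using sum_squares_bound[of c0 c3] sum_squares_bound[of s0 s3] mult_pos_pos[OF pos(1,4)] unit
    by (simp add: tau_def power2_eq_square)
qed

lemma s3_T_nonneg: "1 \<le> T \<Longrightarrow> 0 \<le> s3\<^sup>2 * (T\<^sup>2 - 1)"
  using one_le_power[of T 2] by simp

text \<open>The factorisation comes from \<open>u_p\<close>. It shows that on the range
  \<open>ok\<close> the discriminant vanishes exactly where \<open>T = 1\<close> or
  \<open>N T = 0\<close>, that is, where the conic can shrink to a point.\<close>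

lemma d_eq: assumes "u T < 1" shows "(1 - u T) * d T = 2 * N T * (s3\<^sup>2 * (T\<^sup>2 - 1))"
proof -
  define m where "m = 1 - u T"
  have m: "m \<noteq> 0" "u T = 1 - m" using assms by (auto simp: m_def)
  have e: "m * K T * 2 = 2 * m * ((p T)\<^sup>2 + N T) - (p T)\<^sup>2 * (c2 - c1)\<^sup>2"
    unfolding K_def m(2) using m(1) by (simp add: field_simps)
  have "m * d T = m * (b T)\<^sup>2 - (2 - m) * (m * K T * 2)"
    unfolding d_def m(2) by algebra
  also have "\<dots> = 2 * N T * ((u T)\<^sup>2 + (p T)\<^sup>2 - 1)"
    unfolding e b_def N_alt m(2) by algebra
  finally show ?thesis unfolding m_def u_p by simp
qed

lemma d_nonneg: assumes "ok T" shows "0 \<le> d T"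
proof -
  have "0 \<le> (1 - u T) * d T"
    unfolding d_eq[OF u_less_1[OF assms]] using N_nonneg[OF assms] s3_T_nonneg assms
    by (intro mult_nonneg_nonneg) (auto simp: ok_def)
  then show ?thesis using u_less_1[OF assms] by (simp add: zero_le_mult_iff)
qed

text \<open>The squared chord between \<open>(c1, - s1)\<close> and \<open>(c2, s2)\<close> on the
  unit circle is \<open>2 - 2 * (c1 * c2 - s1 * s2)\<close>, which is at most
  \<open>2 * (1 - u T)\<close>, and its vertical part \<open>s1 + s2\<close> is positive.\<close>

lemma half_gap: assumes "ok T" shows "(c2 - c1)\<^sup>2 / (2 * (1 - u T)) < 1"
proof -
  have "(c2 - c1)\<^sup>2 + (s1 + s2)\<^sup>2 = 2 - 2 * (c1 * c2 - s1 * s2)"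
    using unit by (simp add: power2_eq_square algebra_simps)
  moreover have "(s1 + s2)\<^sup>2 > 0" using pos by (simp add: add_pos_pos pos_add_strict)
  moreover have "u T \<le> c1 * c2 - s1 * s2" using assms by (simp add: ok_def)
  ultimately have "(c2 - c1)\<^sup>2 < 2 * (1 - u T)" by (smt (verit))
  then show ?thesis using u_less_1[OF assms] by simp
qed

lemma K_alt: "K T = (p T)\<^sup>2 * (1 - (c2 - c1)\<^sup>2 / (2 * (1 - u T))) + N T"
  by (simp add: K_def algebra_simps)

text \<open>Positivity of \<open>K\<close> keeps the conic away from the line \<open>P = 0\<close>,
  so the sign of \<open>P\<close> distinguishes its branches.\<close>

lemma K_pos: assumes "ok T" "\<not> (p T = 0 \<and> N T = 0)" shows "0 < K T"
proof (cases "p T = 0")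
  case True then show ?thesis using assms N_nonneg[OF assms(1)] by (simp add: K_alt)
next
  case False
  then have "0 < (p T)\<^sup>2 * (1 - (c2 - c1)\<^sup>2 / (2 * (1 - u T)))"
    using half_gap[OF assms(1)] by (intro mult_pos_pos) auto
  then show ?thesis using N_nonneg[OF assms(1)] by (simp add: K_alt)
qed

text \<open>Completing the square in \<open>s' * Y\<close> expresses one square as \<open>-
  s\<^sup>2 * (s3\<^sup>2 * (T\<^sup>2 - 1)) * (1 - X\<^sup>2)\<close> minus another square. If
  \<open>X\<^sup>2 < 1\<close>, everything must vanish, which leaves only the excluded parameter.
  The letters \<open>k\<close>, \<open>s\<close>, \<open>k'\<close>, \<open>s'\<close> are free so
  that \<open>X\<close> and \<open>Y\<close> can exchange roles.\<close>

lemma abs_ge_1: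
  fixes k s k' s' X Y
  assumes T: "ok T" and nd: "\<not> (p T = 0 \<and> N T = 0)"
    and k: "k\<^sup>2 + s\<^sup>2 = 1" "s > 0"
    and N: "N T = (u T)\<^sup>2 + k\<^sup>2 + k'\<^sup>2 - 1 - 2 * k * k' * u T"
    and E: "(s * X)\<^sup>2 + (s' * Y)\<^sup>2 + 2 * u T * (s * X) * (s' * Y)
     + 2 * p T * (k * (s' * Y) + k' * (s * X)) + (p T)\<^sup>2 + N T = 0"
  shows "1 \<le> X\<^sup>2"
proof (rule ccontr)
  assume "\<not> ?thesis"
  then have X: "0 < 1 - X\<^sup>2" by simp
  define R where "R = k * u T - k'"
  have ss: "s\<^sup>2 = 1 - k\<^sup>2" using k by simp
  have R2: "R\<^sup>2 = s\<^sup>2 * (1 - (u T)\<^sup>2) + N T"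
    unfolding R_def N ss by algebra
  have "(s' * Y + u T * (s * X) + p T * k)\<^sup>2 = s\<^sup>2 * (1 - (u T)\<^sup>2 - (p T)\<^sup>2) * (1 - X\<^sup>2) - (R - s * X * p T)\<^sup>2"
    using E N ss unfolding R_def by algebra
  moreover have q: "1 - (u T)\<^sup>2 - (p T)\<^sup>2 = - (s3\<^sup>2 * (T\<^sup>2 - 1))" using u_p[of T] by simp
  moreover have "0 \<le> (s' * Y + u T * (s * X) + p T * k)\<^sup>2" "0 \<le> (R - s * X * p T)\<^sup>2" by auto
  moreover have T1: "0 \<le> s3\<^sup>2 * (T\<^sup>2 - 1)"
    using T s3_T_nonneg by (simp add: ok_def)
  moreover have "0 \<le> s\<^sup>2 * (s3\<^sup>2 * (T\<^sup>2 - 1)) * (1 - X\<^sup>2)" using T1 X by simp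
  ultimately have 0: "s\<^sup>2 * (s3\<^sup>2 * (T\<^sup>2 - 1)) * (1 - X\<^sup>2) = 0" "(R - s * X * p T)\<^sup>2 = 0"
    by (simp_all only: mult_minus_left mult_minus_right)
  \<comment> \<open>Now \<open>R = s * X * p T\<close>, and \<open>R2\<close> turns into a vanishing
    sum of the nonnegative terms \<open>N T\<close> and
    \<open>s\<^sup>2 * (p T)\<^sup>2 * (1 - X\<^sup>2)\<close>; both are zero, against
    \<open>nd\<close>.\<close>
  then have "s3\<^sup>2 * (T\<^sup>2 - 1) = 0" using X k by auto
  with q have "1 - (u T)\<^sup>2 = (p T)\<^sup>2" by simp
  moreover have "R = s * X * p T" using 0 by simp
  ultimately have "N T + s\<^sup>2 * (p T)\<^sup>2 * (1 - X\<^sup>2) = 0" using R2 by algebra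
  moreover have "0 \<le> N T" "0 \<le> s\<^sup>2 * (p T)\<^sup>2 * (1 - X\<^sup>2)" using N_nonneg[OF T] X by auto
  ultimately have "N T = 0" "s\<^sup>2 * (p T)\<^sup>2 * (1 - X\<^sup>2) = 0" by linarith+
  then show False using nd X k by auto
qed

text \<open>The left-hand side of \<open>E\<close> is a sum of two squares, \<open>N T\<close>, and
  a multiple of \<open>- X * Y\<close> with nonnegative coefficient. For \<open>X * Y < 0\<close>
  all terms are nonnegative and the second square is positive.\<close>

lemma same_sign:
  assumes T: "ok T" and E: "E X Y T" and X: "X \<noteq> 0"
  shows "\<not> X * Y < 0"
proof
  assume n: "X * Y < 0"
  have "(c2 * (s1 * X) + c1 * (s2 * Y) + p T)\<^sup>2 + (s2 * (s1 * X) - s1 * (s2 * Y))\<^sup>2 + N T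
      + 2 * (c1 * c2 - s1 * s2 - u T) * (- (X * Y) * (s1 * s2)) = 0"
    using E unit(2,3) unfolding E_def by algebra
  moreover have "0 \<le> (c1 * c2 - s1 * s2 - u T) * (- (X * Y) * (s1 * s2))"
    using T n pos by (intro mult_nonneg_nonneg) (auto simp: ok_def)
  moreover have "s2 * (s1 * X) - s1 * (s2 * Y) \<noteq> 0"
  proof -
    have "X \<noteq> Y" using n by (auto simp: mult_less_0_iff)
    moreover have "s2 * (s1 * X) - s1 * (s2 * Y) = s1 * s2 * (X - Y)" by algebra
    ultimately show ?thesis using pos by auto
  qed
  then have "0 < (s2 * (s1 * X) - s1 * (s2 * Y))\<^sup>2" by simp
  moreover have "0 \<le> (c2 * (s1 * X) + c1 * (s2 * Y) + p T)\<^sup>2" by simp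
  ultimately show False using N_nonneg[OF T] by linarith
qed

text \<open>Solutions have \<open>X\<close> and \<open>Y\<close> of modulus at least 1 and of the
  same sign, so they lie in two opposite quadrants, which the sign of a single linear form
  separates.\<close>

lemma ge_1_iff:
  assumes T: "ok T" and nd: "\<not> (p T = 0 \<and> N T = 0)" and E: "E X Y T"
  shows "1 \<le> X \<and> 1 \<le> Y \<longleftrightarrow> 0 < s1 * X + s2 * Y"
proof
  assume "1 \<le> X \<and> 1 \<le> Y"
  then have "0 < s1 * X" "0 < s2 * Y" using pos by auto
  then show "0 < s1 * X + s2 * Y" by simp
next
  assume P: "0 < s1 * X + s2 * Y"
  have X: "1 \<le> X\<^sup>2"
    by (rule abs_ge_1[OF T nd unit(2) pos(2) N_alt]) (use E in \<open>simp add: E_def\<close>)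
  have Y: "1 \<le> Y\<^sup>2"
    by (rule abs_ge_1[OF T nd unit(3) pos(3), where k' = c1 and s' = s1 and Y = X])
      (use E in \<open>simp_all add: E_def N_alt algebra_simps\<close>)
  have "X \<noteq> 0" using X by auto
  then have "\<not> X * Y < 0" using same_sign[OF T E] by simp
  moreover have "1 \<le> \<bar>X\<bar>" "1 \<le> \<bar>Y\<bar>" using X Y by (simp_all add: abs_le_square_iff[of 1, simplified])
  ultimately have "(1 \<le> X \<and> 1 \<le> Y) \<or> (X < 0 \<and> Y < 0)"
    by (auto simp: mult_less_0_iff abs_if split: if_splits)
  moreover have "\<not> (X < 0 \<and> Y < 0)"
  proof
    assume "X < 0 \<and> Y < 0"
    then have "s1 * X < 0" "s2 * Y < 0" using pos by (auto simp: mult_less_0_iff)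
    then show False using P by simp
  qed
  ultimately show "1 \<le> X \<and> 1 \<le> Y" by blast
qed

end

section \<open>Proper maps, and a cone over a quarter plane that is homeomorphic to the
  plane\<close>

lemma closed_image_proper:
  fixes f :: "'a::heine_borel \<Rightarrow> 'b::metric_space"
  assumes "closed S" "continuous_on S f" "\<And>B. bounded B \<Longrightarrow> bounded {x \<in> S. f x \<in> B}"
  shows "closed (f ` S)"
  unfolding closed_sequential_limits
proof (intro allI impI, elim conjE)
  fix y l assume y: "\<forall>n. y n \<in> f ` S" and l: "y \<longlonglongrightarrow> l"
  then have "\<forall>n. \<exists>x. x \<in> S \<and> y n = f x" by blast
  then obtain x where x: "\<And>n. x n \<in> S" "\<And>n. y n = f (x n)" by metis
  have "bounded (range y)" using l convergent_imp_bounded convergent_def by blast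
  then have "bounded {x \<in> S. f x \<in> range y}" by (rule assms(3))
  moreover have "range x \<subseteq> {x \<in> S. f x \<in> range y}" using x by auto
  ultimately have "bounded (range x)" by (rule bounded_subset)
  then obtain m r where r: "strict_mono r" "(x \<circ> r) \<longlonglongrightarrow> m"
    using bounded_imp_convergent_subsequence by blast
  have m: "m \<in> S" using assms(1) r(2) x(1) unfolding closed_sequential_limits by (metis comp_apply)
  have "(\<lambda>n. f ((x \<circ> r) n)) \<longlonglongrightarrow> f m"
    by (rule continuous_on_tendsto_compose[OF assms(2) r(2) m]) (simp add: x)
  moreover have "(\<lambda>n. f ((x \<circ> r) n)) = y \<circ> r" using x(2) by auto
  ultimately have "f m = l" using LIMSEQ_subseq_LIMSEQ[OF l r(1)] LIMSEQ_unique by metis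
  then show "l \<in> f ` S" using m by auto
qed

lemma closed_Collect_eq_on:
  fixes f g :: "'a::t2_space \<Rightarrow> real"
  assumes "continuous_on S f" "continuous_on S g" "closed S"
  shows "closed {x \<in> S. f x = g x}"
proof -
  have "{x \<in> S. f x = g x} = {x \<in> S. f x \<le> g x} \<inter> {x \<in> S. g x \<le> f x}" by auto
  then show ?thesis using assms by (auto intro!: closed_Int continuous_on_closed_Collect_le)
qed

text \<open>A proper injection is a closed map onto its image. This spares a continuous formula for
  the inverse, which for the cone below is found only by the intermediate value theorem.\<close>

lemma homeomorphism_proper:
  fixes f :: "'a::heine_borel \<Rightarrow> 'b::metric_space"
  assumes "closed S" "continuous_on S f" "inj_on f S"
    "\<And>B. bounded B \<Longrightarrow> bounded {x \<in> S. f x \<in> B}"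
  shows "\<exists>g. homeomorphism S (f ` S) f g"
proof -
  have "closedin (top_of_set (f ` S)) (f ` U)" if "closedin (top_of_set S) U" for U
  proof -
    have U: "closed U" "U \<subseteq> S" using that assms(1) by (auto simp: closedin_closed_eq)
    have "bounded {x \<in> U. f x \<in> B}" if "bounded B" for B
      by (rule bounded_subset[OF assms(4)[OF that]]) (use U in auto)
    then have "closed (f ` U)"
      using closed_image_proper[OF U(1) continuous_on_subset[OF assms(2) U(2)]] by blast
    then show ?thesis using U by (auto intro: closed_subset)
  qed
  then show ?thesis
    using homeomorphism_injective_closed_map[OF assms(2) refl assms(3)] by metis
qed

text \<open>The set below is the double of a quarter plane with coordinates \<open>A = P - Pm T\<close> and
  \<open>B = \<delta> T + \<nu> T * A\<close>, that is, the cone \<open>q\<^sup>2 = A * B\<close>.\<close>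

lemma cone_homeomorphism:
  fixes Pm \<delta> \<nu> :: "real \<Rightarrow> real"
  assumes Pm: "continuous_on {Tm..} Pm" and \<delta>: "continuous_on {Tm..} \<delta>" and \<nu>: "continuous_on {Tm..} \<nu>"
    and \<nu>_mono: "\<And>T T'. Tm \<le> T \<Longrightarrow> T < T' \<Longrightarrow> \<nu> T \<le> \<nu> T'" and \<nu>0: "\<nu> Tm \<le> 0"
    and \<nu>_ev: "Tm \<le> T0" "0 \<le> \<nu> T0"
    and \<delta>_mono: "\<And>T T'. Tm \<le> T \<Longrightarrow> T < T' \<Longrightarrow> \<delta> T < \<delta> T'" and \<delta>0: "\<delta> Tm = 0"
    and k: "k > 0" "\<And>T. Tm \<le> T \<Longrightarrow> k * (T - Tm) \<le> \<delta> T"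
  defines "S \<equiv> {(P, q, T). Tm \<le> T \<and> Pm T \<le> P \<and> 0 \<le> \<delta> T + \<nu> T * (P - Pm T) \<and>
      q\<^sup>2 = (P - Pm T) * (\<delta> T + \<nu> T * (P - Pm T))}"
  shows "\<exists>g. homeomorphism S UNIV (\<lambda>(P, q, T). (P - Pm T - (\<delta> T + \<nu> T * (P - Pm T)), 2 * q)) g"
proof -
  define f where "f = (\<lambda>(P :: real, q :: real, T). (P - Pm T - (\<delta> T + \<nu> T * (P - Pm T)), 2 * q))"
  define D where "D = {x :: real \<times> real \<times> real. Tm \<le> snd (snd x)}"
  have D: "closed D" unfolding D_def by (intro closed_Collect_le continuous_intros)
  have cT: "continuous_on D (\<lambda>x. g (snd (snd x)))" if "continuous_on {Tm..} g" for g :: "real \<Rightarrow> real"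
    by (rule continuous_on_compose2[OF that]) (auto simp: D_def intro!: continuous_intros)
  have S: "S = {x \<in> D. Pm (snd (snd x)) \<le> fst x} \<inter>
       {x \<in> D. 0 \<le> \<delta> (snd (snd x)) + \<nu> (snd (snd x)) * (fst x - Pm (snd (snd x)))} \<inter>
       {x \<in> D. (fst (snd x))\<^sup>2 = (fst x - Pm (snd (snd x))) *
         (\<delta> (snd (snd x)) + \<nu> (snd (snd x)) * (fst x - Pm (snd (snd x))))}"
    by (auto simp: S_def D_def)
  have "closed S"
    unfolding S by (intro closed_Int continuous_on_closed_Collect_le closed_Collect_eq_on
       D continuous_intros cT Pm \<delta> \<nu>)
  moreover have "continuous_on S f"
  proof -
    have "S \<subseteq> D" by (auto simp: S_def D_def)
    then show ?thesis
      unfolding f_def case_prod_beta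
      by (intro continuous_intros continuous_on_subset[OF cT] Pm \<delta> \<nu>)
  qed
  \<comment> \<open>For fixed \<open>A \<ge> 0\<close> the quantity \<open>B\<close> increases
    strictly with \<open>T\<close>, so \<open>A\<close> and \<open>B\<close> determine
    \<open>T\<close>.\<close>
  moreover have B_mono: "\<delta> T + \<nu> T * A < \<delta> T' + \<nu> T' * A" if "Tm \<le> T" "T < T'" "0 \<le> A" for A T T'
    using \<delta>_mono[OF that(1,2)] mult_right_mono[OF \<nu>_mono[OF that(1,2)] that(3)] by linarith
  \<comment> \<open>On \<open>q\<^sup>2 = A * B\<close> the point \<open>(A - B, 2 * q)\<close> has
    norm \<open>A + B\<close>. Hence the image determines \<open>A\<close> and \<open>B\<close>, and
    a bound on the image bounds both.\<close>
  have AB: "A = A' \<and> B = B'" if "A - B = A' - B'" "A * B = A' * B'" "0 \<le> A" "0 \<le> B" "0 \<le> A'" "0 \<le> B'"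
    for A B A' B' :: real
  proof -
    have "(A + B)\<^sup>2 = (A' + B')\<^sup>2" using that(1,2) by algebra
    then have "A + B = A' + B'" using that(3-) power2_eq_iff_nonneg by auto
    with that(1) show ?thesis by simp
  qed
  moreover have "inj_on f S"
  proof (rule inj_onI)
    fix x y assume "x \<in> S" "y \<in> S" and eq: "f x = f y"
    obtain P q T where x: "x = (P, q, T)" by (metis prod.exhaust)
    obtain P' q' T' where y: "y = (P', q', T')" by (metis prod.exhaust)
    have q: "q = q'" using eq by (simp add: f_def x y)
    have 1: "P - Pm T = P' - Pm T' \<and> \<delta> T + \<nu> T * (P - Pm T) = \<delta> T' + \<nu> T' * (P' - Pm T')"
      using \<open>x \<in> S\<close> \<open>y \<in> S\<close> eq q by (intro AB) (auto simp: f_def S_def x y)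
    have "T = T'"
    proof (rule ccontr)
      assume "T \<noteq> T'"
      then consider "T < T'" | "T' < T" by linarith
      then show False
        using 1 B_mono[of T T' "P - Pm T"] B_mono[of T' T "P - Pm T"] \<open>x \<in> S\<close> \<open>y \<in> S\<close>
        by cases (auto simp: S_def x y)
    qed
    then show "x = y" using 1 q by (simp add: x y)
  qed
  moreover have "bounded {x \<in> S. f x \<in> C}" if C: "bounded C" for C
  proof -
    obtain r where r: "\<And>y. y \<in> C \<Longrightarrow> norm y \<le> r" using C by (auto simp: bounded_iff)
    \<comment> \<open>Past \<open>T0\<close> the slope \<open>\<nu>\<close> is nonnegative, so
      \<open>B \<ge> \<delta> T \<ge> k * (T - Tm)\<close>; with
      \<open>B \<le> \<bar>r\<bar>\<close> this bounds \<open>T\<close> by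
      \<open>T1\<close>.\<close>
    define T1 where "T1 = max T0 (Tm + \<bar>r\<bar> / k)"
    have "T1 \<ge> Tm" using \<nu>_ev by (auto simp: T1_def)
    have "compact (Pm ` {Tm..T1})"
      by (intro compact_continuous_image continuous_on_subset[OF Pm]) auto
    then obtain m where m: "\<And>T. Tm \<le> T \<Longrightarrow> T \<le> T1 \<Longrightarrow> \<bar>Pm T\<bar> \<le> m"
      using compact_imp_bounded by (fastforce simp: bounded_iff)
    have "{x \<in> S. f x \<in> C} \<subseteq> {- m..m + \<bar>r\<bar>} \<times> ({- \<bar>r\<bar>..\<bar>r\<bar>} \<times> {Tm..T1})"
    proof
      fix x assume "x \<in> {x \<in> S. f x \<in> C}"
      obtain P q T where x: "x = (P, q, T)" by (metis prod.exhaust)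
      define A B where "A = P - Pm T" and "B = \<delta> T + \<nu> T * (P - Pm T)"
      have S: "Tm \<le> T" "0 \<le> A" "0 \<le> B" "q\<^sup>2 = A * B" and "f x \<in> C"
        using \<open>x \<in> _\<close> by (auto simp: S_def x A_def B_def)
      then have "norm (A - B, 2 * q) \<le> r" using r by (force simp: f_def x A_def B_def)
      moreover have "norm (A - B, 2 * q) = A + B"
      proof -
        have "(A - B)\<^sup>2 + (2 * q)\<^sup>2 = (A + B)\<^sup>2" using S(4) by algebra
        then show ?thesis using S by (simp add: norm_Pair)
      qed
      moreover have "\<bar>2 * q\<bar> \<le> norm (A - B, 2 * q)" using norm_snd_le[of "2 * q" "A - B"] by simp
      ultimately have 2: "A \<le> \<bar>r\<bar>" "B \<le> \<bar>r\<bar>" "\<bar>q\<bar> \<le> \<bar>r\<bar>" using S by auto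
      have "T \<le> T1"
      proof (rule ccontr)
        assume "\<not> ?thesis"
        then have "T0 < T" "Tm + \<bar>r\<bar> / k < T" by (auto simp: T1_def)
        then have "0 \<le> \<nu> T * A" using \<nu>_mono[of T0 T] \<nu>_ev S by (intro mult_nonneg_nonneg) auto
        moreover have "\<bar>r\<bar> < k * (T - Tm)"
          using \<open>Tm + \<bar>r\<bar> / k < T\<close> k(1) by (simp add: field_simps)
        ultimately show False using k(2)[OF S(1)] 2 by (simp add: A_def B_def)
      qed
      then show "x \<in> {- m..m + \<bar>r\<bar>} \<times> ({- \<bar>r\<bar>..\<bar>r\<bar>} \<times> {Tm..T1})"
        using m[OF S(1)] 2 S by (auto simp: x A_def)
    qed
    then show ?thesis
      by (rule bounded_subset[rotated]) (intro bounded_Times bounded_closed_interval)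
  qed
  moreover have "f ` S = UNIV"
  proof -
    have "(v, w) \<in> f ` S" for v w
    proof -
      define r where "r = norm (v, w)"
      have r: "r\<^sup>2 = v\<^sup>2 + w\<^sup>2" "\<bar>v\<bar> \<le> r"
        using norm_fst_le[of v w] by (simp_all add: r_def norm_Pair)
      define A B where "A = (r + v) / 2" and "B = (r - v) / 2"
      have A: "0 \<le> A" "0 \<le> B" "A * B = (w / 2)\<^sup>2" "A - B = v"
        using r by (auto simp: A_def B_def field_simps power2_eq_square)
      define T1 where "T1 = max T0 (Tm + B / k)"
      \<comment> \<open>The left-hand side is at most 0 at \<open>Tm\<close>, because
        \<open>\<delta>\<close> vanishes there and \<open>\<nu>\<close> is not positive, and it is
        at least \<open>k * (T1 - Tm) \<ge> B\<close> at \<open>T1\<close>.\<close>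
      have "\<exists>T\<ge>Tm. T \<le> T1 \<and> \<delta> T + \<nu> T * A = B"
      proof (rule IVT')
        show "\<delta> Tm + \<nu> Tm * A \<le> B" using \<delta>0 \<nu>0 A by (simp add: mult_nonpos_nonneg order_trans[of _ 0])
        have T1: "Tm \<le> T1" "T0 \<le> T1" "Tm + B / k \<le> T1" using \<nu>_ev by (auto simp: T1_def)
        show "Tm \<le> T1" by fact
        have "B \<le> k * (T1 - Tm)" using T1(3) k(1) by (simp add: field_simps)
        moreover have "0 \<le> \<nu> T1"
          using \<nu>_mono[of T0 T1] \<nu>_ev T1 by (cases "T0 = T1") auto
        ultimately show "B \<le> \<delta> T1 + \<nu> T1 * A" using k(2)[OF T1(1)] A(1)
          by (smt (verit) mult_nonneg_nonneg)
        show "continuous_on {Tm..T1} (\<lambda>T. \<delta> T + \<nu> T * A)"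
          by (intro continuous_intros continuous_on_subset[OF \<delta>] continuous_on_subset[OF \<nu>]) auto
      qed
      then obtain T where T: "Tm \<le> T" "\<delta> T + \<nu> T * A = B" by blast
      have "(A + Pm T, w / 2, T) \<in> S" using T A by (auto simp: S_def)
      moreover have "f (A + Pm T, w / 2, T) = (v, w)" using T A by (auto simp: f_def)
      ultimately show ?thesis by (metis image_eqI)
    qed
    then show ?thesis by auto
  qed
  ultimately show ?thesis using homeomorphism_proper[of S f] unfolding f_def by simp
qed

section \<open>Coordinates in which the conics are symmetric about an axis\<close>

context circle_data
begin

text \<open>With \<open>x = s1 * X\<close> and \<open>y = s2 * Y\<close>, the quadratic part of
  \<open>E\<close> is \<open>(1 + u) / 2 * (x + y)\<^sup>2 + (1 - u) / 2 * (x - y)\<^sup>2\<close>.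
  The shift \<open>sh\<close> completes the square in the difference and \<open>w\<close> normalises
  its coefficient.\<close>

definition sh :: "real \<Rightarrow> real" where "sh T = p T * (c2 - c1) / (1 - u T)"
definition w :: "real \<Rightarrow> real" where "w T = sqrt ((1 - u T) / 2)"
definition fw :: "real \<times> real \<times> real \<Rightarrow> real \<times> real \<times> real" where
  "fw = (\<lambda>(X, Y, T). (s1 * X + s2 * Y, w T * (s1 * X - s2 * Y + sh T), T))"
definition bw :: "real \<times> real \<times> real \<Rightarrow> real \<times> real \<times> real" where
  "bw = (\<lambda>(P, q, T). ((P + (q / w T - sh T)) / (2 * s1), (P - (q / w T - sh T)) / (2 * s2), T))"
definition F :: "real \<Rightarrow> real \<Rightarrow> real \<Rightarrow> bool" where
  "F P q T \<longleftrightarrow> (1 + u T) / 2 * P\<^sup>2 - b T * P + K T + q\<^sup>2 = 0"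

lemma continuous_T [continuous_intros]:
  assumes "continuous_on A f"
  shows "continuous_on A (\<lambda>x. u (f x))" "continuous_on A (\<lambda>x. p (f x))" "continuous_on A (\<lambda>x. N (f x))"
    "continuous_on A (\<lambda>x. b (f x))" "continuous_on A (\<lambda>x. tau (f x))"
    "(\<And>x. x \<in> A \<Longrightarrow> u (f x) < 1) \<Longrightarrow> continuous_on A (\<lambda>x. K (f x))"
    "(\<And>x. x \<in> A \<Longrightarrow> u (f x) < 1) \<Longrightarrow> continuous_on A (\<lambda>x. d (f x))"
    "(\<And>x. x \<in> A \<Longrightarrow> u (f x) < 1) \<Longrightarrow> continuous_on A (\<lambda>x. sh (f x))"
    "continuous_on A (\<lambda>x. w (f x))"
  using assms unfolding u_def p_def N_def b_def K_def d_def tau_def sh_def w_def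
  by (force intro!: continuous_intros)+

lemma w_pos: "u T < 1 \<Longrightarrow> 0 < w T"
  by (simp add: w_def)

lemma bw_fw: "u (snd (snd x)) < 1 \<Longrightarrow> bw (fw x) = x"
  using pos w_pos[of "snd (snd x)"] by (auto simp: bw_def fw_def case_prod_beta prod_eq_iff)

lemma fw_bw: "u (snd (snd x)) < 1 \<Longrightarrow> fw (bw x) = x"
  using pos w_pos[of "snd (snd x)"] by (auto simp: bw_def fw_def case_prod_beta prod_eq_iff field_simps)

lemma snd_fw [simp]: "snd (snd (fw x)) = snd (snd x)" "snd (snd (bw x)) = snd (snd x)"
  by (auto simp: fw_def bw_def case_prod_beta)

lemma homeomorphism_fw:
  assumes "\<And>x. x \<in> A \<Longrightarrow> u (snd (snd x)) < 1"
  shows "homeomorphism A (fw ` A) fw bw"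
proof (rule homeomorphismI)
  show "continuous_on A fw" unfolding fw_def case_prod_beta using assms by (intro continuous_intros) auto
  show "continuous_on (fw ` A) bw" unfolding bw_def case_prod_beta using pos w_pos assms
    by (intro continuous_intros) (auto simp: less_imp_neq[symmetric] intro!: less_imp_neq[symmetric])
qed (use assms bw_fw in auto)

lemma E_iff_F:
  assumes "u T < 1"
  shows "E X Y T \<longleftrightarrow> F (s1 * X + s2 * Y) (w T * (s1 * X - s2 * Y + sh T)) T"
proof -
  define m where "m = 1 - u T"
  have m: "m > 0" "u T = 1 - m" using assms by (auto simp: m_def)
  have "(w T)\<^sup>2 = m / 2" using m by (simp add: w_def)
  then have "(w T * (s1 * X - s2 * Y + sh T))\<^sup>2 = m / 2 * (s1 * X - s2 * Y + p T * (c2 - c1) / m)\<^sup>2"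
    by (simp add: power_mult_distrib sh_def m(2))
  also have "\<dots> = m / 2 * (s1 * X - s2 * Y)\<^sup>2 + (s1 * X - s2 * Y) * (p T * (c2 - c1)) + (p T)\<^sup>2 * (c2 - c1)\<^sup>2 / (2 * m)"
    using m by (simp add: field_simps power2_eq_square)
  finally have q: "(w T * (s1 * X - s2 * Y + sh T))\<^sup>2 = \<dots>" .
  define r where "r = (p T)\<^sup>2 * (c2 - c1)\<^sup>2 / (2 * m)"
  have K: "K T = (p T)\<^sup>2 + N T - r" by (simp add: K_def r_def m_def)
  have "(s1 * X)\<^sup>2 + (s2 * Y)\<^sup>2 + 2 * u T * (s1 * X) * (s2 * Y)
     + 2 * p T * (c1 * (s2 * Y) + c2 * (s1 * X)) + (p T)\<^sup>2 + N T =
     (1 + u T) / 2 * (s1 * X + s2 * Y)\<^sup>2 - b T * (s1 * X + s2 * Y) + K T +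
     (w T * (s1 * X - s2 * Y + sh T))\<^sup>2"
    unfolding q K b_def r_def[symmetric] m(2)
    by (simp add: power2_eq_square field_simps)
  then show ?thesis unfolding E_def F_def by simp
qed

definition S :: "(real \<times> real \<times> real) set" where
  "S = {(P, q, T). ok T \<and> 0 < P \<and> F P q T}"

lemma M_ok: "(X, Y, T) \<in> M \<Longrightarrow> ok T"
  by (simp add: M_def ok_def)

text \<open>Away from the double line, \<open>ge_1_iff\<close> replaces the two inequalities on
  \<open>X\<close> and \<open>Y\<close> by \<open>0 < P\<close>.\<close>

lemma fw_M_iff:
  assumes "ok T" "\<not> (p T = 0 \<and> N T = 0)"
  shows "(P, q, T) \<in> fw ` M \<longleftrightarrow> (P, q, T) \<in> S"
proof -
  have u: "u T < 1" using u_less_1[OF assms(1)] .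
  obtain X Y where XY: "bw (P, q, T) = (X, Y, T)" by (simp add: bw_def)
  have fw: "fw (X, Y, T) = (P, q, T)" using fw_bw[of "(P, q, T)"] u XY by simp
  have "(P, q, T) \<in> fw ` M \<longleftrightarrow> (X, Y, T) \<in> M"
  proof
    assume "(P, q, T) \<in> fw ` M"
    then obtain x where x: "x \<in> M" "fw x = (P, q, T)" by force
    then have "snd (snd x) = T" by (metis snd_conv snd_fw(1))
    then have "bw (fw x) = x" using u by (intro bw_fw) simp
    then show "(X, Y, T) \<in> M" using x XY by simp
  next
    assume "(X, Y, T) \<in> M" then show "(P, q, T) \<in> fw ` M" using fw by (metis image_eqI)
  qed
  also have "\<dots> \<longleftrightarrow> E X Y T \<and> 1 \<le> X \<and> 1 \<le> Y" using assms(1) by (auto simp: M_def ok_def)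
  also have "\<dots> \<longleftrightarrow> E X Y T \<and> 0 < s1 * X + s2 * Y" using ge_1_iff[OF assms] by blast
  also have "\<dots> \<longleftrightarrow> (P, q, T) \<in> S"
    using E_iff_F[OF u, of X Y] fw assms(1) by (auto simp: S_def fw_def)
  finally show ?thesis .
qed

text \<open>The root \<open>(b T - sqrt (d T)) / (1 + u T)\<close> on the axis, with rationalised
  numerator: this form survives \<open>u T = - 1\<close>, where the conic is a parabola, and selects
  the positive root when \<open>u T < - 1\<close>.\<close>

definition Pm :: "real \<Rightarrow> real" where "Pm T = 2 * K T / (b T + sqrt (d T))"

lemma Pm_root:
  assumes "ok T" "0 < b T + sqrt (d T)"
  shows "(1 + u T) * Pm T = b T - sqrt (d T)" "F (Pm T) 0 T"
proof -
  define e where "e = sqrt (d T)"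
  have e2: "e\<^sup>2 = (b T)\<^sup>2 - 2 * (1 + u T) * K T" using d_nonneg[OF assms(1)] by (simp add: e_def d_def)
  have e: "0 < b T + e" "Pm T = 2 * K T / (b T + e)" using assms by (auto simp: e_def Pm_def)
  have "(b T + e) * ((1 + u T) * Pm T) = (b T + e) * (b T - e)"
  proof -
    have "(b T + e) * ((1 + u T) * Pm T) = 2 * (1 + u T) * K T" using e by simp
    also have "\<dots> = (b T + e) * (b T - e)" using e2 by algebra
    finally show ?thesis .
  qed
  then show 1: "(1 + u T) * Pm T = b T - sqrt (d T)" using e by (simp add: e_def)
  have K: "K T = Pm T * (b T + e) / 2" using e by simp
  have "(1 + u T) / 2 * (Pm T)\<^sup>2 = Pm T * ((1 + u T) * Pm T) / 2" by (simp add: power2_eq_square)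
  then show "F (Pm T) 0 T" unfolding F_def K 1 by (simp add: e_def field_simps power2_eq_square)
qed

text \<open>The quadratic in \<open>P\<close> on the axis has negative leading coefficient and
  positive constant term \<open>K T\<close>; hence its discriminant exceeds
  \<open>(b T)\<^sup>2\<close>.\<close>

lemma hyp:
  assumes "ok T" "u T < - 1"
  shows "0 < N T" "0 < K T" "(b T)\<^sup>2 < d T" "0 < b T + sqrt (d T)"
proof -
  have "-1 \<le> c1 * c2 - s1 * s2"
    using sum_squares_bound[of c1 "-c2"] sum_squares_bound[of s1 s2] unit by (simp add: power2_eq_square)
  moreover have "0 < s1 * s2" using pos by simp
  ultimately show N: "0 < N T" using assms by (simp add: N_def)
  then show K: "0 < K T" using K_pos assms by simp
  have "2 * (1 + u T) * K T < 0" using K assms by (simp add: mult_neg_pos)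
  then show d: "(b T)\<^sup>2 < d T" by (simp add: d_def)
  have "\<bar>b T\<bar> < sqrt (d T)" by (rule real_less_rsqrt) (use d in simp)
  then show "0 < b T + sqrt (d T)" by linarith
qed

end

text \<open>The roots have opposite signs because \<open>\<alpha> * \<kappa> < 0\<close>. The
  positive one is given in the same rationalised form as \<open>Pm\<close>; with
  \<open>\<kappa> = K T + q\<^sup>2\<close> it describes a whole branch of a hyperbola.\<close>

lemma positive_root_iff:
  fixes P :: real
  assumes "\<alpha> < 0" "0 < \<kappa>"
  shows "0 < P \<and> \<alpha> * P\<^sup>2 - \<beta> * P + \<kappa> = 0 \<longleftrightarrow> P = 2 * \<kappa> / (\<beta> + sqrt (\<beta>\<^sup>2 - 4 * \<alpha> * \<kappa>))"
    and "0 < \<beta> + sqrt (\<beta>\<^sup>2 - 4 * \<alpha> * \<kappa>)"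
proof -
  define e where "e = sqrt (\<beta>\<^sup>2 - 4 * \<alpha> * \<kappa>)"
  have ak: "\<alpha> * \<kappa> < 0" using assms by (simp add: mult_neg_pos)
  then have "0 \<le> \<beta>\<^sup>2 - 4 * \<alpha> * \<kappa>" using zero_le_power2[of \<beta>] by linarith
  then have e2: "e\<^sup>2 = \<beta>\<^sup>2 - 4 * \<alpha> * \<kappa>" unfolding e_def by (rule real_sqrt_pow2)
  have "\<bar>\<beta>\<bar> < e" unfolding e_def by (rule real_less_rsqrt) (use ak in simp)
  then have e: "0 < \<beta> + e" by linarith
  then show "0 < \<beta> + sqrt (\<beta>\<^sup>2 - 4 * \<alpha> * \<kappa>)" by (simp add: e_def)
  have "0 < P \<and> \<alpha> * P\<^sup>2 - \<beta> * P + \<kappa> = 0 \<longleftrightarrow> P = 2 * \<kappa> / (\<beta> + e)"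
  proof
    assume P: "0 < P \<and> \<alpha> * P\<^sup>2 - \<beta> * P + \<kappa> = 0"
    then have "(2 * \<alpha> * P - \<beta>)\<^sup>2 = e\<^sup>2" unfolding e2 by algebra
    then have "2 * \<alpha> * P - \<beta> = e \<or> 2 * \<alpha> * P - \<beta> = - e" by (simp add: power2_eq_iff)
    moreover have "\<alpha> * P < 0" using P assms by (simp add: mult_neg_pos)
    ultimately have "2 * \<alpha> * P - \<beta> = - e" using e by linarith
    then have "2 * \<kappa> = P * (\<beta> + e)" using P by algebra
    then show "P = 2 * \<kappa> / (\<beta> + e)" using e by simp
  next
    assume P: "P = 2 * \<kappa> / (\<beta> + e)"
    then have \<kappa>: "2 * \<kappa> = P * (\<beta> + e)" using e by simp
    have "(\<beta> + e) * (2 * \<alpha> * P) = (\<beta> + e) * (\<beta> - e)" using e2 \<kappa> by algebra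
    then have "2 * \<alpha> * P = \<beta> - e" using e by simp
    then have "\<alpha> * P\<^sup>2 - \<beta> * P + \<kappa> = 0" using \<kappa> by algebra
    then show "0 < P \<and> \<alpha> * P\<^sup>2 - \<beta> * P + \<kappa> = 0" using P e assms by simp
  qed
  then show "0 < P \<and> \<alpha> * P\<^sup>2 - \<beta> * P + \<kappa> = 0 \<longleftrightarrow> P = 2 * \<kappa> / (\<beta> + sqrt (\<beta>\<^sup>2 - 4 * \<alpha> * \<kappa>))"
    by (simp add: e_def)
qed

section \<open>Signs of the coefficients and the curve \<open>q = 0\<close>\<close>

context circle_data
begin

lemma cos_sum_bounds: "- 1 \<le> c0 * c3 - s0 * s3" "- 1 \<le> c1 * c2 - s1 * s2" "c0 * c3 + s0 * s3 \<le> 1"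
    "- 1 < c1 * c2 + s1 * s2"
  using sum_squares_bound[of c1 "-c2"] sum_squares_bound[of s1 s2]
    sum_squares_bound[of c0 "-c3"] sum_squares_bound[of s0 s3] sum_squares_bound[of c0 c3]
    unit mult_pos_pos[OF pos(2,3)] by (simp_all add: power2_eq_square)

text \<open>For points of the unit circle, \<open>(c + c')\<^sup>2 + (s - s')\<^sup>2 = 2 + 2 * (c *
  c' - s * s')\<close>. This says, without angles, that two angles in the open interval from 0 to pi
  add up to pi.\<close>

lemma cos_sum_eq:
  "c0 * c3 - s0 * s3 = - 1 \<longleftrightarrow> c0 + c3 = 0" "c1 * c2 - s1 * s2 = - 1 \<longleftrightarrow> c1 + c2 = 0"
proof -
  have *: "c * c' - s * s' = - 1 \<longleftrightarrow> c + c' = 0"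
    if "c\<^sup>2 + s\<^sup>2 = 1" "c'\<^sup>2 + s'\<^sup>2 = 1" "0 < s" "0 < s'" for c c' s s' :: real
  proof
    assume "c * c' - s * s' = - 1"
    then have "(c + c')\<^sup>2 + (s - s')\<^sup>2 = 0" using that by algebra
    then show "c + c' = 0" by (simp add: sum_power2_eq_zero_iff)
  next
    assume "c + c' = 0"
    then have c': "c' = - c" by simp
    then have "c'\<^sup>2 = c\<^sup>2" by simp
    then have "s\<^sup>2 = s'\<^sup>2" using that(1,2) by linarith
    then have "s = s'" using that(3,4) by (metis less_imp_le power2_eq_iff_nonneg)
    then show "c * c' - s * s' = - 1" using that c' by (simp add: power2_eq_square)
  qed
  show "c0 * c3 - s0 * s3 = - 1 \<longleftrightarrow> c0 + c3 = 0" "c1 * c2 - s1 * s2 = - 1 \<longleftrightarrow> c1 + c2 = 0"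
    using * unit pos by auto
qed

lemma sin_sum_pos:
  assumes "0 < c0 + c3" shows "0 < s0 * c3 + c0 * s3"
proof (cases "0 \<le> c0 \<and> 0 \<le> c3")
  case True
  then have "0 \<le> s0 * c3" "0 \<le> c0 * s3" using pos by auto
  moreover have "0 < s0 * c3 \<or> 0 < c0 * s3" using True assms pos by (auto simp: zero_less_mult_iff)
  ultimately show ?thesis by linarith
next
  case False
  have *: "0 < s * c' + c * s'"
    if "c < 0" "0 < c + c'" "c\<^sup>2 + s\<^sup>2 = 1" "c'\<^sup>2 + s'\<^sup>2 = 1" "0 < s" "0 < s'" for c c' s s' :: real
  proof -
    have "(- c)\<^sup>2 < c'\<^sup>2" using that by (intro power_strict_mono) auto
    then have "s'\<^sup>2 < s\<^sup>2" using that by simp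
    then have "s' < s" using that power2_less_imp_less by fastforce
    have "(- c) * s' < c' * s" using that \<open>s' < s\<close> by (intro mult_strict_mono) auto
    then show ?thesis by (simp add: mult.commute)
  qed
  show ?thesis
    using False *[of c0 c3 s0 s3] *[of c3 c0 s3 s0] assms unit pos by (auto simp: algebra_simps)
qed

text \<open>\<open>s0 * (z * p T) = c3 - c0 * tau T\<close> is affine in \<open>tau T\<close>, which
  ranges between - 1 and \<open>c0 * c3 - s0 * s3\<close>. At these ends its values are
  \<open>c0 + c3\<close> and \<open>s0 * (s0 * c3 + c0 * s3)\<close>, both positive.\<close>

lemma zp_pos:
  assumes "1 \<le> T" "- 1 \<le> tau T" "0 < c0 + c3" shows "0 < z * p T"
proof -
  have eq: "s0 * (z * p T) = c3 - c0 * tau T"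
    using s0_p[of T] zz(1) unfolding u_def by algebra
  have "0 < c3 - c0 * tau T"
  proof (cases "0 \<le> c0")
    case True
    have "s0 * s3 * 1 \<le> s0 * s3 * T" using assms pos by (intro mult_left_mono) auto
    then have "tau T \<le> c0 * c3 - s0 * s3" by (simp add: tau_def)
    then have "c0 * tau T \<le> c0 * (c0 * c3 - s0 * s3)" using True by (rule mult_left_mono)
    moreover have "c3 - c0 * (c0 * c3 - s0 * s3) = s0 * (s0 * c3 + c0 * s3)" using unit by algebra
    moreover have "0 < s0 * (s0 * c3 + c0 * s3)" using sin_sum_pos[OF assms(3)] pos by simp
    ultimately show ?thesis by linarith
  next
    case False
    then have "c0 * tau T \<le> c0 * - 1" using assms by (intro mult_left_mono_neg) auto
    then show ?thesis using assms by simp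
  qed
  then show ?thesis using eq pos by (metis zero_less_mult_pos)
qed

text \<open>Replacing the two angles by their supplements negates \<open>c0\<close> and
  \<open>c3\<close>; this preserves \<open>tau\<close> and negates \<open>p\<close>.\<close>

lemma zp_neg:
  assumes "1 \<le> T" "- 1 \<le> tau T" "c0 + c3 < 0" shows "z * p T < 0"
proof -
  interpret n: circle_data "- c0" s0 c1 s1 c2 s2 "- c3" s3 z
    using unit pos z by unfold_locales auto
  have "n.tau T = tau T" "n.p T = - p T" by (auto simp: n.tau_def tau_def n.p_def p_def algebra_simps)
  then show ?thesis using n.zp_pos[OF assms(1)] assms by simp
qed

text \<open>If \<open>p T = 0\<close>, then \<open>u_p\<close> makes the modulus of
  \<open>u T\<close> at least 1, and \<open>N T = 0\<close> excludes \<open>u T < - 1\<close>. So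
  the conic becomes a double line only over \<open>T = 1\<close>, for \<open>z = 1\<close>, when
  both angle sums are pi.\<close>

lemma degenerate:
  assumes T: "ok T" and "p T = 0" "N T = 0"
  shows "T = 1" "u T = - 1" "z = 1" "c0 + c3 = 0" "c1 + c2 = 0"
proof -
  have "1 \<le> (u T)\<^sup>2" using u_p[of T] s3_T_nonneg[of T] assms by (simp add: ok_def)
  then have "1 \<le> \<bar>u T\<bar>" by (simp add: abs_le_square_iff[of 1, simplified])
  then have "u T \<le> - 1" using u_less_1[OF T] by linarith
  then show u: "u T = - 1" using hyp(1)[OF T] assms(3) by fastforce
  then have "s3\<^sup>2 * (T\<^sup>2 - 1) = 0" using u_p[of T] assms by simp
  then have "T\<^sup>2 = 1" using pos by simp
  then show T1: "T = 1" using T by (auto simp: ok_def power2_eq_1_iff)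
  show z1: "z = 1" using z u tau_less_1[of T] T1 by (auto simp: u_def)
  have "z * (c0 * c3 - s0 * s3 * T) = - 1" using u unfolding u_def tau_def .
  then show "c0 + c3 = 0" using cos_sum_eq(1) unfolding \<open>T = 1\<close> \<open>z = 1\<close> by simp
  have "c1 * c2 - s1 * s2 = - 1" using assms(3) cos_sum_bounds by (auto simp: N_def u)
  then show "c1 + c2 = 0" using cos_sum_eq by simp
qed

definition qq :: "real \<times> real \<times> real \<Rightarrow> real" where "qq x = fst (snd (fw x))"

lemma fw_split: "fw x = (fst (fw x), qq x, snd (snd x))"
  by (simp add: qq_def fw_def case_prod_beta)

lemma M_ok': "x \<in> M \<Longrightarrow> ok (snd (snd x))"
  using M_ok by (metis prod.collapse)

lemma homeomorphism_M: "homeomorphism M (fw ` M) fw bw"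
  by (rule homeomorphism_fw) (use M_ok' u_less_1 in blast)

lemma fw_M_F: assumes "(P, q, T) \<in> fw ` M" shows "ok T" "F P q T" "0 < P"
proof -
  obtain X Y where XY: "(X, Y, T) \<in> M" "fw (X, Y, T) = (P, q, T)"
    using assms by (auto simp: fw_def)
  show "ok T" using M_ok[OF XY(1)] .
  then show "F P q T" using XY E_iff_F[OF u_less_1] by (auto simp: fw_def M_def)
  have "0 < s1 * X" "0 < s2 * Y" using XY pos by (auto simp: M_def)
  then show "0 < P" using XY(2) by (auto simp: fw_def)
qed

text \<open>Every term of \<open>F\<close> other than \<open>- b T * P\<close> is nonnegative and
  \<open>K T\<close> is positive. Consequently, where \<open>b T \<le> 0\<close>, no ellipse or
  parabola contributes points with \<open>P > 0\<close>.\<close>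

lemma b_pos:
  assumes "ok T" "\<not> (p T = 0 \<and> N T = 0)" "F P q T" "0 < P" "- 1 \<le> u T"
  shows "0 < b T"
proof -
  have "0 \<le> (1 + u T) / 2 * P\<^sup>2" using assms by simp
  then have "0 < b T * P" using assms(3) K_pos[OF assms(1,2)] zero_le_power2[of q] unfolding F_def by linarith
  then show ?thesis using assms(4) by (simp add: zero_less_mult_iff)
qed

lemma denom_pos:
  assumes "ok T" "\<not> (p T = 0 \<and> N T = 0)" "F P q T" "0 < P"
  shows "0 < b T + sqrt (d T)"
proof (cases "u T < - 1")
  case True then show ?thesis using hyp assms by blast
next
  case False
  then have "0 < b T" using b_pos assms by simp
  then show ?thesis using d_nonneg[OF assms(1)] by (simp add: add_pos_nonneg)
qed

text \<open>A nonempty conic has its vertex \<open>Pm T\<close> on the axis; in the degenerate case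
  the double line lies in the axis already. This gives equality of the images of a component and its
  curve under the third coordinate.\<close>

lemma q_zero_fibre:
  assumes "x \<in> M" shows "\<exists>y\<in>M. qq y = 0 \<and> snd (snd y) = snd (snd x)"
proof -
  obtain P q T where fx: "fw x = (P, q, T)" by (metis prod.exhaust)
  have T: "T = snd (snd x)" using fx by (metis snd_conv snd_fw(1))
  have m: "(P, q, T) \<in> fw ` M" using assms fx by (metis image_eqI)
  note F = fw_M_F[OF m]
  show ?thesis
  proof (cases "p T = 0 \<and> N T = 0")
    case True
    then have "F P q T \<longleftrightarrow> q = 0"
      using degenerate(2)[OF F(1)] by (simp add: F_def b_def K_def)
    then show ?thesis using F fx T assms by (intro bexI[of _ x]) (auto simp: qq_def)
  next
    case False
    have e: "0 < b T + sqrt (d T)" using denom_pos[OF F(1) False F(2,3)] .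
    have "(Pm T, 0, T) \<in> fw ` M"
      unfolding fw_M_iff[OF F(1) False] using Pm_root[OF F(1) e] F(1) K_pos[OF F(1) False] e
      by (auto simp: S_def Pm_def)
    then obtain y where "y \<in> M" "fw y = (Pm T, 0, T)" by force
    moreover from this have "snd (snd y) = T" by (metis snd_conv snd_fw(1))
    ultimately show ?thesis using T by (intro bexI[of _ y]) (auto simp: qq_def)
  qed
qed

lemma q_zero_fibre_card:
  assumes "\<not> (T = 1 \<and> c0 + c3 = 0 \<and> c1 + c2 = 0)"
  shows "finite {x \<in> M. qq x = 0 \<and> snd (snd x) = T} \<and> card {x \<in> M. qq x = 0 \<and> snd (snd x) = T} \<le> 2"
proof -
  \<comment> \<open>For \<open>u T = - 1\<close> the equation on the axis is linear, with root
    \<open>K T / b T\<close>; otherwise \<open>r1\<close> and \<open>r2\<close> are the two roots of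
    a quadratic.\<close>
  define r1 r2 where "r1 = (if u T = - 1 then K T / b T else (b T + sqrt (d T)) / (1 + u T))"
    and "r2 = (b T - sqrt (d T)) / (1 + u T)"
  have "{x \<in> M. qq x = 0 \<and> snd (snd x) = T} \<subseteq> {bw (r1, 0, T), bw (r2, 0, T)}"
  proof
    fix x assume x: "x \<in> {x \<in> M. qq x = 0 \<and> snd (snd x) = T}"
    define P where "P = fst (fw x)"
    have fx: "fw x = (P, 0, T)" using x fw_split[of x] by (simp add: P_def)
    then have "(P, 0, T) \<in> fw ` M" using x by (metis (mono_tags, lifting) image_eqI mem_Collect_eq)
    note F = fw_M_F[OF this]
    have nd: "\<not> (p T = 0 \<and> N T = 0)" using degenerate[OF F(1)] assms by blast
    have "P = r1 \<or> P = r2"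
    proof (cases "u T = - 1")
      case True
      then have "b T * P = K T" using F(2) by (simp add: F_def)
      then show ?thesis using K_pos[OF F(1) nd] True
        by (cases "b T = 0") (auto simp: r1_def eq_divide_eq mult.commute)
    next
      case False
      have "((1 + u T) * P - b T)\<^sup>2 = (sqrt (d T))\<^sup>2"
        using F(2) d_nonneg[OF F(1)] unfolding F_def d_def by (auto simp: d_def) algebra
      then have "(1 + u T) * P - b T = sqrt (d T) \<or> (1 + u T) * P - b T = - sqrt (d T)"
        unfolding power2_eq_iff .
      then have "(1 + u T) * P = b T + sqrt (d T) \<or> (1 + u T) * P = b T - sqrt (d T)" by linarith
      then show ?thesis using False by (auto simp: r1_def r2_def field_simps)
    qed
    moreover have "x = bw (P, 0, T)" using bw_fw[of x] u_less_1[OF F(1)] fx x by simp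
    ultimately show "x \<in> {bw (r1, 0, T), bw (r2, 0, T)}" by auto
  qed
  moreover have "card {bw (r1, 0, T), bw (r2, 0, T)} \<le> 2" by (simp add: card_insert_if)
  ultimately show ?thesis by (meson card_mono finite.emptyI finite.insertI finite_subset order_trans)
qed

lemma hyperbolic_curve:
  assumes "ok T" "u T < - 1"
  shows "{x \<in> M. qq x = 0 \<and> snd (snd x) = T} = {bw (Pm T, 0, T)}"
proof -
  have nd: "\<not> (p T = 0 \<and> N T = 0)" using hyp(1)[OF assms] by simp
  have d: "(b T)\<^sup>2 - 4 * ((1 + u T) / 2) * K T = d T" by (simp add: d_def)
  have iff: "0 < P \<and> F P 0 T \<longleftrightarrow> P = Pm T" for P
    using positive_root_iff(1)[of "(1 + u T) / 2" "K T" P "b T"] hyp(2)[OF assms] assms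
    unfolding F_def Pm_def d by simp
  have u: "u T < 1" using assms by simp
  show ?thesis
  proof (intro equalityI subsetI)
    fix x assume x: "x \<in> {x \<in> M. qq x = 0 \<and> snd (snd x) = T}"
    define P where "P = fst (fw x)"
    have fx: "fw x = (P, 0, T)" using x fw_split[of x] by (simp add: P_def)
    then have "(P, 0, T) \<in> fw ` M" using x by (metis (mono_tags, lifting) image_eqI mem_Collect_eq)
    then have "P = Pm T" using fw_M_F iff by blast
    then show "x \<in> {bw (Pm T, 0, T)}" using bw_fw[of x] x u fx by simp
  next
    fix x assume "x \<in> {bw (Pm T, 0, T)}"
    then have x: "x = bw (Pm T, 0, T)" by simp
    have "(Pm T, 0, T) \<in> fw ` M" unfolding fw_M_iff[OF assms(1) nd] using iff assms by (auto simp: S_def)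
    then obtain y where y: "y \<in> M" "fw y = (Pm T, 0, T)" by force
    then have "y = x" using bw_fw[of y] x u by (metis snd_conv snd_fw(1))
    then show "x \<in> {x \<in> M. qq x = 0 \<and> snd (snd x) = T}" using y x by (auto simp: qq_def)
  qed
qed

text \<open>The parameter with \<open>tau Ts = - 1\<close>, at which
  \<open>R\<^sub>0 R\<^sub>3\<close> passes from elliptic to hyperbolic.\<close>

definition Ts :: real where "Ts = (1 + c0 * c3) / (s0 * s3)"

lemma s0s3_pos: "0 < s0 * s3" using pos by simp

lemma Ts_ge_1: "1 \<le> Ts"
  using cos_sum_bounds(1) s0s3_pos by (simp add: Ts_def)

lemma tau_Ts: "tau T < - 1 \<longleftrightarrow> Ts < T" "tau T \<le> - 1 \<longleftrightarrow> Ts \<le> T"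
  using s0s3_pos by (simp_all add: Ts_def tau_def field_simps)

section \<open>The union of the conics for \<open>z = 1\<close> is a plane\<close>

lemma u_tau: "z = 1 \<Longrightarrow> u T = tau T"
  unfolding u_def by simp

lemma ok_hyperbolic: assumes "z = 1" "Ts < T" shows "ok T" "u T < - 1"
proof -
  show u: "u T < - 1" using tau_Ts assms(2) by (simp add: u_tau[OF assms(1)])
  then show "ok T" using cos_sum_bounds(2) Ts_ge_1 assms(2) by (simp add: ok_def)
qed

lemma homeomorphism_fwI:
  assumes "fw ` M = A" "homeomorphism A B f g"
    and "\<And>P q T. (P, q, T) \<in> A \<Longrightarrow> \<phi> (f (P, q, T)) = 0 \<longleftrightarrow> q = 0"
  shows "\<exists>f g. homeomorphism M B f g \<and> (\<forall>x\<in>M. \<phi> (f x) = 0 \<longleftrightarrow> qq x = 0)"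
proof (intro exI conjI ballI)
  show "homeomorphism M B (f \<circ> fw) (bw \<circ> g)"
    using homeomorphism_compose[OF homeomorphism_M[unfolded assms(1)] assms(2)] .
  fix x assume "x \<in> M"
  then have "fw x \<in> A" using assms(1) by blast
  then show "\<phi> ((f \<circ> fw) x) = 0 \<longleftrightarrow> qq x = 0"
    using assms(3)[of "fst (fw x)" "qq x" "snd (snd x)"] fw_split[of x] by simp
qed

text \<open>By \<open>b_pos\<close> only hyperbolas occur. Over each \<open>T > Ts\<close> a branch
  is a graph over the \<open>q\<close>-line, since the equation has one positive root for every
  \<open>q\<close>; thus \<open>M\<close> is a graph over an open half-plane in
  \<open>(q, T)\<close>, straightened by a logarithm.\<close>

lemma plane_hyperbolic:
  assumes z: "z = 1" and H: "\<And>T. ok T \<Longrightarrow> - 1 \<le> u T \<Longrightarrow> b T \<le> 0 \<and> \<not> (p T = 0 \<and> N T = 0)"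
  shows "\<exists>f g. homeomorphism M (UNIV :: (real \<times> real) set) f g \<and> (\<forall>x\<in>M. snd (f x) = 0 \<longleftrightarrow> qq x = 0)"
    and "x \<in> M \<Longrightarrow> tau (snd (snd x)) < - 1"
proof -
  have nd: "\<not> (p T = 0 \<and> N T = 0)" if "ok T" for T
    using H[OF that] hyp(1)[OF that] by (cases "u T < - 1") auto
  have lt: "u T < - 1" if "(P, q, T) \<in> fw ` M" for P q T
    using fw_M_F[OF that] b_pos nd H by (metis linorder_not_le)
  {
    fix x assume "x \<in> M"
    then have "(fst (fw x), qq x, snd (snd x)) \<in> fw ` M" using fw_split[of x] by (metis image_eqI)
    from lt[OF this] show "tau (snd (snd x)) < - 1" by (simp add: u_tau[OF z])
  }
  \<comment> \<open>The positive root from \<open>positive_root_iff\<close>, with constant term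
    \<open>K T + q\<^sup>2\<close>.\<close>
  define R where "R = (\<lambda>q T. 2 * (K T + q\<^sup>2) / (b T + sqrt ((b T)\<^sup>2 - 4 * ((1 + u T) / 2) * (K T + q\<^sup>2))))"
  have a: "(1 + u T) / 2 < 0" "0 < K T + q\<^sup>2" "ok T" "u T < 1" if "Ts < T" for q T
    using ok_hyperbolic[OF z that] hyp(2) by (auto simp: add_pos_nonneg)
  have F: "0 < P \<and> F P q T \<longleftrightarrow> P = R q T" if "Ts < T" for P q T
    using positive_root_iff(1)[OF a(1)[OF that] a(2)[OF that], of P "b T" q]
    unfolding F_def R_def by (simp add: add.assoc)
  have A: "fw ` M = {(R q T, q, T) | q T. Ts < T}" (is "_ = ?A")
  proof (intro equalityI subsetI)
    fix x assume x: "x \<in> fw ` M"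
    obtain P q T where PqT: "x = (P, q, T)" by (metis prod.exhaust)
    have "Ts < T" using lt x PqT tau_Ts(1)[of T] by (auto simp: u_tau[OF z])
    moreover have "P = R q T" using F[OF \<open>Ts < T\<close>] fw_M_F[of P q T] x PqT by metis
    ultimately show "x \<in> ?A" using PqT by simp
  next
    fix x assume "x \<in> ?A"
    then obtain q T where x: "x = (R q T, q, T)" and T: "Ts < T" by blast
    show "x \<in> fw ` M" unfolding x fw_M_iff[OF a(3)[OF T] nd[OF a(3)[OF T]]]
      using F[OF T] a(3)[OF T] by (simp add: S_def)
  qed
  have "homeomorphism ?A UNIV (\<lambda>(P, q, T). (ln (T - Ts), q)) (\<lambda>(v, q). (R q (Ts + exp v), q, Ts + exp v))"
  proof (rule homeomorphismI)
    show "continuous_on ?A (\<lambda>(P, q, T). (ln (T - Ts), q))"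
      unfolding case_prod_beta by (intro continuous_intros) auto
    have 1: "u (Ts + exp v) < 1" for v using a(4)[of "Ts + exp v"] by simp
    have 2: "b (Ts + exp v) + sqrt ((b (Ts + exp v))\<^sup>2 - 4 * ((1 + u (Ts + exp v)) / 2) * (K (Ts + exp v) + q\<^sup>2)) \<noteq> 0" for v q
      using positive_root_iff(2)[OF a(1)[of "Ts + exp v"] a(2), of "Ts + exp v" "b (Ts + exp v)" q] by simp
    show "continuous_on UNIV (\<lambda>(v, q). (R q (Ts + exp v), q, Ts + exp v))"
      unfolding case_prod_beta R_def
      by (intro continuous_intros) (use 1 2 in auto)
    show "(\<lambda>(P, q, T). (ln (T - Ts), q)) ` ?A \<subseteq> UNIV" by simp
    show "(\<lambda>(v, q). (R q (Ts + exp v), q, Ts + exp v)) ` UNIV \<subseteq> ?A" by auto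
  qed auto
  from homeomorphism_fwI[OF A this, of snd]
  show "\<exists>f g. homeomorphism M (UNIV :: (real \<times> real) set) f g \<and> (\<forall>x\<in>M. snd (f x) = 0 \<longleftrightarrow> qq x = 0)"
    by simp
qed

text \<open>For \<open>z = 1\<close> the condition \<open>ok\<close> is a lower bound on
  \<open>T\<close>; \<open>Tm\<close> is the larger of 1 and the parameter where
  \<open>u T = c1 * c2 - s1 * s2\<close>. In both alternatives \<open>d\<close> vanishes at
  \<open>Tm\<close>.\<close>

definition Tm :: real where "Tm = max 1 ((c0 * c3 - (c1 * c2 - s1 * s2)) / (s0 * s3))"

lemma ok_Tm: assumes "z = 1" shows "ok T \<longleftrightarrow> Tm \<le> T"
  using s0s3_pos by (auto simp: ok_def Tm_def u_tau[OF assms] tau_def field_simps)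

lemma Tm_vals: assumes "z = 1" shows "d Tm = 0" "- 1 \<le> u Tm"
proof -
  have Tm: "u Tm = c1 * c2 - s1 * s2 \<or> Tm = 1"
    using s0s3_pos by (auto simp: Tm_def u_tau[OF assms] tau_def max_def)
  moreover have "u 1 = c0 * c3 - s0 * s3" by (simp add: u_tau[OF assms] tau_def)
  ultimately show "- 1 \<le> u Tm" using cos_sum_bounds by auto
  have "ok Tm" using ok_Tm[OF assms] by simp
  have "(1 - u Tm) * d Tm = 0"
    unfolding d_eq[OF u_less_1[OF \<open>ok Tm\<close>]] using Tm by (auto simp: N_def)
  then show "d Tm = 0" using u_less_1[OF \<open>ok Tm\<close>] by simp
qed

text \<open>These are the hypotheses of the cone lemma on \<open>\<delta> = sqrt (d T)\<close>. They
  follow from writing \<open>d\<close> as a product of nondecreasing factors, of which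
  \<open>f1 T\<close> and \<open>T - 1\<close> are both at least multiples of \<open>T - Tm\<close>;
  so \<open>d\<close> grows at least quadratically.\<close>

lemma d_growth:
  assumes z: "z = 1"
  shows "Tm \<le> T \<Longrightarrow> T < T' \<Longrightarrow> d T < d T'"
    and "\<exists>k>0. \<forall>T\<ge>Tm. k * (T - Tm) \<le> sqrt (d T)"
proof -
  define f1 f2 f4 where "f1 = (\<lambda>T. c1 * c2 - s1 * s2 - u T)" and "f2 = (\<lambda>T. c1 * c2 + s1 * s2 - u T)"
    and "f4 = (\<lambda>T. (T + 1) / (1 - u T))"
  have u: "u T = c0 * c3 - s0 * s3 * T" for T by (simp add: u_tau[OF z] tau_def)
  have s12: "0 < s1 * s2" using pos by simp
  have T1: "1 \<le> T" "u T < 1" "s0 * s3 * (T - Tm) \<le> f1 T" if "Tm \<le> T" for T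
  proof -
    show "1 \<le> T" "u T < 1" using that ok_Tm[OF z] u_less_1 by (auto simp: ok_def)
    have "0 \<le> f1 Tm" using ok_Tm[OF z, of Tm] by (simp add: ok_def f1_def)
    then show "s0 * s3 * (T - Tm) \<le> f1 T" by (simp add: f1_def u algebra_simps)
  qed
  have d: "d T = (f1 T * (T - 1)) * (2 * s3\<^sup>2 * (f2 T * f4 T))" if "Tm \<le> T" for T
  proof -
    have "(1 - u T) * d T = (1 - u T) * ((f1 T * (T - 1)) * (2 * s3\<^sup>2 * (f2 T * f4 T)))"
      unfolding d_eq[OF T1(2)[OF that]] N_def f4_def f1_def f2_def
      using T1(2)[OF that] by (simp add: power2_eq_square field_simps)
    then show ?thesis using T1(2)[OF that] by simp
  qed
  have f1n: "0 \<le> f1 T" if "Tm \<le> T" for T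
    using ok_Tm[OF z] that by (auto simp: f1_def ok_def)
  have f1m: "f1 T < f1 T'" if "T < T'" for T T'
    using mult_strict_left_mono[OF that s0s3_pos] by (simp add: f1_def u)
  have f2: "f2 T = f1 T + 2 * (s1 * s2)" for T by (simp add: f1_def f2_def)
  \<comment> \<open>After cross-multiplication the difference is \<open>T' - T\<close> times 1 minus
    the cosine of the difference of the angles.\<close>
  have f4: "f4 T \<le> f4 T'" if "Tm \<le> T" "T \<le> T'" for T T'
  proof -
    have "(T + 1) * (1 - u T') \<le> (T' + 1) * (1 - u T)"
    proof -
      have "(T' + 1) * (1 - u T) - (T + 1) * (1 - u T') = (T' - T) * (1 - c0 * c3 - s0 * s3)"
        unfolding u by algebra
      moreover have "0 \<le> (T' - T) * (1 - c0 * c3 - s0 * s3)"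
        using cos_sum_bounds(3) that by (intro mult_nonneg_nonneg) auto
      ultimately show ?thesis by linarith
    qed
    then show ?thesis using T1(2)[of T] T1(2)[of T'] that by (simp add: f4_def frac_le_eq divide_simps)
  qed
  have f4p: "0 < f4 T" if "Tm \<le> T" for T using T1[OF that] by (simp add: f4_def)
  have f2p: "2 * (s1 * s2) \<le> f2 T" if "Tm \<le> T" for T using f1n[OF that] by (simp add: f2)
  have f24: "0 < 2 * s3\<^sup>2 * (f2 T * f4 T)" if "Tm \<le> T" for T
    using f2p[OF that] f4p[OF that] s12 pos
    by (intro mult_pos_pos) (auto intro: less_le_trans[of 0 "2 * (s1 * s2)"])
  show "d T < d T'" if "Tm \<le> T" "T < T'"
  proof -
    have T': "Tm \<le> T'" using that by simp
    have "f1 T * (T - 1) < f1 T' * (T' - 1)"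
      using f1n[OF that(1)] f1m[OF that(2)] that T1(1)[OF that(1)] by (intro mult_strict_mono') auto
    moreover have "f2 T * f4 T \<le> f2 T' * f4 T'"
      using f4[of T T'] f4p[of T] f2p[OF that(1)] f1m[OF that(2)] that s12
      by (intro mult_mono) (auto simp: f2)
    then have "2 * s3\<^sup>2 * (f2 T * f4 T) \<le> 2 * s3\<^sup>2 * (f2 T' * f4 T')" by (intro mult_left_mono) auto
    ultimately show ?thesis unfolding d[OF that(1)] d[OF T']
      using f24[OF that(1)] f1n[OF that(1)] T1(1)[OF that(1)] by (intro mult_less_le_imp_less[of _ _ _ "_ * _"]) simp_all
  qed
  \<comment> \<open>\<open>m\<close> collects the slope \<open>s0 * s3\<close> of \<open>f1\<close>
    and the lower bounds of \<open>f2\<close> and \<open>f4\<close>, so that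
    \<open>m * (T - Tm)\<^sup>2 \<le> d T\<close>.\<close>
  define m where "m = s0 * s3 * (2 * s3\<^sup>2 * (2 * (s1 * s2) * f4 Tm))"
  have m: "0 < m" using s0s3_pos s12 pos f4p[of Tm] by (simp add: m_def)
  show "\<exists>k>0. \<forall>T\<ge>Tm. k * (T - Tm) \<le> sqrt (d T)"
  proof (intro exI conjI allI impI)
    show "0 < sqrt m" using m by simp
    fix T assume T: "Tm \<le> T"
    have "1 \<le> Tm" by (simp add: Tm_def)
    then have "s0 * s3 * (T - Tm) * (T - Tm) \<le> f1 T * (T - 1)"
      using T1(3)[OF T] T f1n[OF T] s0s3_pos by (intro mult_mono) auto
    moreover have "2 * s3\<^sup>2 * (2 * (s1 * s2) * f4 Tm) \<le> 2 * s3\<^sup>2 * (f2 T * f4 T)"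
      using f4[OF order_refl T] f4p[of Tm] f2p[OF T] s12 by (intro mult_left_mono mult_mono) auto
    ultimately have "s0 * s3 * (T - Tm) * (T - Tm) * (2 * s3\<^sup>2 * (2 * (s1 * s2) * f4 Tm)) \<le> d T"
      unfolding d[OF T] by (rule mult_mono) (use f1n[OF T] T1(1)[OF T] pos f4p[of Tm] in \<open>auto intro!: mult_nonneg_nonneg\<close>)
    then have "m * (T - Tm)\<^sup>2 \<le> d T" by (simp add: m_def power2_eq_square algebra_simps)
    then have "sqrt (m * (T - Tm)\<^sup>2) \<le> sqrt (d T)" by simp
    then show "sqrt m * (T - Tm) \<le> sqrt (d T)" using T by (simp add: real_sqrt_mult)
  qed
qed

text \<open>The vertex is a parameter \<open>G\<close> because \<open>Pm\<close> is not usable over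
  \<open>T = 1\<close> when both angle sums are pi. The slope \<open>- (1 + u T) / 2\<close> changes
  from nonpositive for ellipses to positive for hyperbolas, which is the monotonicity that the cone
  lemma expects of \<open>\<nu>\<close>.\<close>

lemma plane_cone:
  assumes z: "z = 1" and G: "continuous_on {Tm..} G"
    and A: "fw ` M = {(P, q, T). Tm \<le> T \<and> G T \<le> P \<and> 0 \<le> sqrt (d T) + - (1 + u T) / 2 * (P - G T) \<and>
      q\<^sup>2 = (P - G T) * (sqrt (d T) + - (1 + u T) / 2 * (P - G T))}"
  shows "\<exists>f g. homeomorphism M (UNIV :: (real \<times> real) set) f g \<and> (\<forall>x\<in>M. snd (f x) = 0 \<longleftrightarrow> qq x = 0)"
proof -
  obtain k where k: "k > 0" "\<And>T. Tm \<le> T \<Longrightarrow> k * (T - Tm) \<le> sqrt (d T)" using d_growth(2)[OF z] by blast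
  have 1: "u T < 1" if "Tm \<le> T" for T using ok_Tm[OF z] that u_less_1 by blast
  have u: "u T = c0 * c3 - s0 * s3 * T" for T by (simp add: u_tau[OF z] tau_def)
  have "\<exists>g. homeomorphism (fw ` M) UNIV
      (\<lambda>(P, q, T). (P - G T - (sqrt (d T) + - (1 + u T) / 2 * (P - G T)), 2 * q)) g"
    unfolding A
  proof (rule cone_homeomorphism[OF G, where ?T0.0 = "max Tm Ts" and k = k])
    show "continuous_on {Tm..} (\<lambda>T. sqrt (d T))" using 1 by (intro continuous_intros) auto
    show "continuous_on {Tm..} (\<lambda>T. - (1 + u T) / 2)" by (intro continuous_intros) auto
    show "- (1 + u T) / 2 \<le> - (1 + u T') / 2" if "T < T'" for T T'
      using mult_left_mono[of T T' "s0 * s3"] s0s3_pos that by (simp add: u)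
    show "- (1 + u Tm) / 2 \<le> 0" using Tm_vals[OF z] by simp
    show "0 \<le> - (1 + u (max Tm Ts)) / 2"
      using tau_Ts(2)[of "max Tm Ts"] by (simp add: u_tau[OF z])
    show "sqrt (d T) < sqrt (d T')" if "Tm \<le> T" "T < T'" for T T' using d_growth(1)[OF z that] by simp
    show "sqrt (d Tm) = 0" using Tm_vals[OF z] by simp
  qed (use k in auto)
  then obtain g where g: "homeomorphism (fw ` M) UNIV
      (\<lambda>(P, q, T). (P - G T - (sqrt (d T) + - (1 + u T) / 2 * (P - G T)), 2 * q)) g" by blast
  show ?thesis by (rule homeomorphism_fwI[OF refl g]) simp
qed

text \<open>With \<open>A = P - Pm T\<close>, the equation \<open>F P q T\<close> becomes \<open>q\<^sup>2 = A * (sqrt (d T) + \<nu> * A)\<close>; the second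
  factor is affine in \<open>A\<close> and positive for \<open>- Pm T < A < 0\<close>, which excludes \<open>0 < P < Pm T\<close>.\<close>

lemma F_cone_iff:
  assumes T: "ok T" and nd: "\<not> (p T = 0 \<and> N T = 0)" and e: "0 < b T + sqrt (d T)"
  defines "B \<equiv> \<lambda>P. sqrt (d T) + - (1 + u T) / 2 * (P - Pm T)"
  shows "0 < P \<and> F P q T \<longleftrightarrow> Pm T \<le> P \<and> 0 \<le> B P \<and> q\<^sup>2 = (P - Pm T) * B P"
proof -
  note r = Pm_root[OF T e]
  have Pm: "0 < Pm T" using K_pos[OF T nd] e by (simp add: Pm_def)
  have W: "(1 + u T) / 2 * P\<^sup>2 - b T * P + K T = - ((P - Pm T) * B P)"
  proof -
    have "(1 + u T) * (Pm T)\<^sup>2 - 2 * b T * Pm T + 2 * K T = 0" using r(2) by (simp add: F_def)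
    then have "(1 + u T) * P\<^sup>2 - 2 * b T * P + 2 * K T =
        - ((P - Pm T) * (2 * sqrt (d T) - (1 + u T) * (P - Pm T)))"
      using r(1) by algebra
    then show ?thesis by (simp add: B_def field_simps)
  qed
  then have F: "F P q T \<longleftrightarrow> q\<^sup>2 = (P - Pm T) * B P" by (auto simp: F_def)
  show ?thesis
  proof
    assume PF: "0 < P \<and> F P q T"
    have "Pm T \<le> P"
    proof (rule ccontr)
      assume "\<not> ?thesis"
      then have lt: "P < Pm T" by simp
      \<comment> \<open>Affine interpolation between \<open>P = 0\<close>, where \<open>B\<close> is
        \<open>(b T + sqrt (d T)) / 2\<close>, and \<open>P = Pm T\<close>, where \<open>B\<close>
        is \<open>sqrt (d T)\<close>.\<close>
      have "Pm T * B P = sqrt (d T) * P + (b T + sqrt (d T)) / 2 * (Pm T - P)"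
      proof -
        have "Pm T * (2 * sqrt (d T) - (1 + u T) * (P - Pm T)) =
            2 * (sqrt (d T) * P) + (b T + sqrt (d T)) * (Pm T - P)"
          using r(1) by algebra
        then show ?thesis by (simp add: B_def field_simps)
      qed
      moreover have "0 \<le> sqrt (d T) * P" using d_nonneg[OF T] PF by simp
      moreover have "0 < (b T + sqrt (d T)) / 2 * (Pm T - P)" using e lt by simp
      ultimately have "0 < Pm T * B P" by linarith
      then have "0 < B P" using Pm by (simp add: zero_less_mult_iff)
      then have "(P - Pm T) * B P < 0" using lt by (simp add: mult_neg_pos)
      then show False using PF F zero_le_power2[of q] by simp
    qed
    moreover have "0 \<le> B P"
    proof (cases "P = Pm T")
      case True then show ?thesis using d_nonneg[OF T] by (simp add: B_def)
    next
      case False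
      then have "0 < P - Pm T" using \<open>Pm T \<le> P\<close> by simp
      moreover have "0 \<le> (P - Pm T) * B P" using PF F by (metis zero_le_power2)
      ultimately show ?thesis by (simp add: zero_le_mult_iff)
    qed
    ultimately show "Pm T \<le> P \<and> 0 \<le> B P \<and> q\<^sup>2 = (P - Pm T) * B P" using PF F by blast
  qed (use F Pm in auto)
qed

text \<open>Since \<open>b T\<close> is positive up to the parabola, the denominator of
  \<open>Pm\<close> stays positive throughout and the vertex moves continuously while ellipses open
  into a parabola and then into hyperbolas. It exists for every \<open>T \<ge> Tm\<close>, whence
  the second claim.\<close>

lemma plane_mixed:
  assumes z: "z = 1" and H: "\<And>T. ok T \<Longrightarrow> - 1 \<le> u T \<Longrightarrow> 0 < b T \<and> \<not> (p T = 0 \<and> N T = 0)"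
  shows "\<exists>f g. homeomorphism M (UNIV :: (real \<times> real) set) f g \<and> (\<forall>x\<in>M. snd (f x) = 0 \<longleftrightarrow> qq x = 0)"
    and "Tm \<le> T \<Longrightarrow> \<exists>x\<in>M. snd (snd x) = T"
proof -
  have nd: "\<not> (p T = 0 \<and> N T = 0)" if "ok T" for T
    using H[OF that] hyp(1)[OF that] by (cases "u T < - 1") auto
  have e: "0 < b T + sqrt (d T)" if "ok T" for T
    using H[OF that] hyp(4)[OF that] d_nonneg[OF that] by (cases "u T < - 1") (auto simp: add_pos_nonneg)
  have fwM: "(P, q, T) \<in> fw ` M \<longleftrightarrow> ok T \<and> 0 < P \<and> F P q T" for P q T
  proof (cases "ok T")
    case True then show ?thesis using fw_M_iff[OF True nd[OF True]] by (simp add: S_def)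
  qed (use fw_M_F in blast)
  show "\<exists>f g. homeomorphism M (UNIV :: (real \<times> real) set) f g \<and> (\<forall>x\<in>M. snd (f x) = 0 \<longleftrightarrow> qq x = 0)"
  proof (rule plane_cone[OF z, where G = Pm])
    show "continuous_on {Tm..} Pm"
      unfolding Pm_def using e u_less_1 ok_Tm[OF z] by (intro continuous_intros) (auto simp: less_imp_neq[symmetric])
    show "fw ` M = {(P, q, T). Tm \<le> T \<and> Pm T \<le> P \<and> 0 \<le> sqrt (d T) + - (1 + u T) / 2 * (P - Pm T) \<and>
      q\<^sup>2 = (P - Pm T) * (sqrt (d T) + - (1 + u T) / 2 * (P - Pm T))}"
      (is "_ = ?A")
    proof (intro set_eqI)
      fix x :: "real \<times> real \<times> real"
      obtain P q T where x: "x = (P, q, T)" by (metis prod.exhaust)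
      show "x \<in> fw ` M \<longleftrightarrow> x \<in> ?A"
        unfolding x fwM using F_cone_iff[OF _ nd e, of T P q] ok_Tm[OF z, of T] by auto
    qed
  qed
  assume "Tm \<le> T"
  then have T: "ok T" using ok_Tm[OF z] by simp
  have "(Pm T, 0, T) \<in> fw ` M"
    unfolding fwM using T Pm_root[OF T e[OF T]] K_pos[OF T nd[OF T]] e[OF T] by (simp add: Pm_def)
  then obtain x where "x \<in> M" "fw x = (Pm T, 0, T)" by force
  then show "\<exists>x\<in>M. snd (snd x) = T" by (metis snd_conv snd_fw(1))
qed


text \<open>Over \<open>T = 1\<close> the conic is the double line \<open>X = Y\<close>, of which
  \<open>M\<close> contains the half-line \<open>X \<ge> 1\<close>. Over \<open>T > 1\<close> it is
  the branch \<open>q\<^sup>2 = \<epsilon> T / 2 * (P\<^sup>2 - (G T)\<^sup>2)\<close>, which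
  flattens to that half-line. The third claim describes the half-line by a continuous
  parameter.\<close>

lemma plane_identity:
  assumes z: "z = 1" and H: "c0 + c3 = 0" "c1 + c2 = 0"
  shows "\<exists>f g. homeomorphism M (UNIV :: (real \<times> real) set) f g \<and> (\<forall>x\<in>M. snd (f x) = 0 \<longleftrightarrow> qq x = 0)"
    and "x \<in> M \<Longrightarrow> tau (snd (snd x)) \<le> - 1"
    and "\<exists>G. continuous_on {0..} G \<and> {x \<in> M. qq x = 0 \<and> snd (snd x) = 1} = G ` {0..} \<and>
           (\<forall>r\<ge>0. s1 * fst (G r) = s1 + r)"
proof -
  have c: "c3 = - c0" "c2 = - c1" using H by auto
  have "c3\<^sup>2 = c0\<^sup>2" "c2\<^sup>2 = c1\<^sup>2" using c by auto
  then have "s3\<^sup>2 = s0\<^sup>2" "s2\<^sup>2 = s1\<^sup>2" using unit by linarith+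
  then have s: "s3 = s0" "s2 = s1" using pos by (auto simp: power2_eq_iff)
  define \<epsilon> where "\<epsilon> = (\<lambda>T. s0\<^sup>2 * (T - 1))"
  have u: "u T = - 1 - \<epsilon> T" for T
  proof -
    have "u T = c0 * c3 - s0 * s3 * T" by (simp add: u_tau[OF z] tau_def)
    also have "\<dots> = - 1 - \<epsilon> T"
      using unit(1) by (simp add: c s \<epsilon>_def power2_eq_square algebra_simps)
    finally show ?thesis .
  qed
  have p: "p T = s0 * c0 * (T - 1)" for T
  proof -
    have "p T = s0 * c3 + c0 * s3 * T" unfolding p_def by (subst z) simp
    also have "\<dots> = s0 * c0 * (T - 1)" by (simp add: c s algebra_simps)
    finally show ?thesis .
  qed
  have Tm1: "Tm = 1"
  proof -
    have "c0 * c3 - (c1 * c2 - s1 * s2) = s0 * s3"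
      using unit(1,2) by (simp add: c s power2_eq_square)
    then show ?thesis using s0s3_pos by (simp add: Tm_def)
  qed
  have ok: "ok T \<longleftrightarrow> 1 \<le> T" for T using ok_Tm[OF z] Tm1 by simp
  have \<epsilon>0: "0 \<le> \<epsilon> T" if "1 \<le> T" for T using that by (simp add: \<epsilon>_def)
  {
    fix x assume "x \<in> M"
    then have "1 \<le> snd (snd x)" using M_ok' ok by blast
    then show "tau (snd (snd x)) \<le> - 1" using u \<epsilon>0 by (simp add: u_tau[OF z, symmetric])
  }
  \<comment> \<open>Over \<open>T = 1\<close> both \<open>K\<close> and \<open>d\<close> vanish,
    together with \<open>\<epsilon>\<close>, and the quotient defining \<open>Pm\<close> is 0 / 0.
    Here \<open>K T = \<epsilon> T * J T / 2\<close> with \<open>J\<close> positive, and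
    \<open>sqrt (J T)\<close> continues the vertex to \<open>T = 1\<close>.\<close>
  define J where "J = (\<lambda>T. 2 * (c0\<^sup>2 * (T - 1) * (1 - 2 * c1\<^sup>2 / (2 + \<epsilon> T)) + 2 * s1\<^sup>2 + \<epsilon> T))"
  have b: "b T = 0" for T using H by (simp add: b_def)
  have K: "K T = \<epsilon> T * J T / 2" if "1 \<le> T" for T
  proof -
    have "N T = \<epsilon> T * (2 * s1\<^sup>2 + \<epsilon> T)"
    proof -
      have "c1 * c2 - s1 * s2 = - 1" "c1 * c2 + s1 * s2 = 2 * s1\<^sup>2 - 1"
        using unit(2) by (simp_all add: c s power2_eq_square algebra_simps)
      then show ?thesis unfolding N_def u by algebra
    qed
    moreover have "(p T)\<^sup>2 = \<epsilon> T * (c0\<^sup>2 * (T - 1))" by (simp add: p \<epsilon>_def power2_eq_square)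
    moreover have "(c2 - c1)\<^sup>2 / (2 * (1 - u T)) = 2 * c1\<^sup>2 / (2 + \<epsilon> T)"
    proof -
      have 1: "1 - u T = 2 + \<epsilon> T" "(c2 - c1)\<^sup>2 = 4 * c1\<^sup>2" by (simp_all add: u c(2) power2_eq_square)
      show ?thesis unfolding 1 using \<epsilon>0[OF that] by (simp add: divide_simps)
    qed
    ultimately have "K T = \<epsilon> T * (c0\<^sup>2 * (T - 1)) * (1 - 2 * c1\<^sup>2 / (2 + \<epsilon> T)) + \<epsilon> T * (2 * s1\<^sup>2 + \<epsilon> T)"
      by (simp only: K_alt)
    then have "2 * K T = \<epsilon> T * J T" unfolding J_def by algebra
    then show ?thesis by simp
  qed
  have J: "4 * s1\<^sup>2 \<le> J T" "0 < J T" if "1 \<le> T" for T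
  proof -
    have "c1\<^sup>2 \<le> 1" using unit(2) by (metis add_le_cancel_left le_add_same_cancel1 zero_le_power2)
    then have "2 * c1\<^sup>2 / (2 + \<epsilon> T) \<le> 1" using \<epsilon>0[OF that] by simp
    then have "0 \<le> c0\<^sup>2 * (T - 1) * (1 - 2 * c1\<^sup>2 / (2 + \<epsilon> T))" using that by simp
    then show "4 * s1\<^sup>2 \<le> J T" using \<epsilon>0[OF that] by (simp add: J_def)
    moreover have "0 < s1\<^sup>2" using pos by simp
    ultimately show "0 < J T" by linarith
  qed
  define G where "G = (\<lambda>T. sqrt (J T))"
  have G2: "(G T)\<^sup>2 = J T" "0 < G T" if "1 \<le> T" for T using J[OF that] by (auto simp: G_def)
  have d: "sqrt (d T) = \<epsilon> T * G T" if "1 \<le> T" for T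
  proof -
    have "d T = (\<epsilon> T * G T)\<^sup>2"
      using G2[OF that] by (simp add: d_def b u K[OF that] power_mult_distrib power2_eq_square algebra_simps)
    then show ?thesis using \<epsilon>0[OF that] G2[OF that] by simp
  qed
  have J1: "J 1 = (2 * s1)\<^sup>2" by (simp add: J_def \<epsilon>_def power_mult_distrib)
  \<comment> \<open>This is the value of \<open>P\<close> at \<open>X = Y = 1\<close>, so the cone
    includes the end of the half-line and nothing beyond it.\<close>
  have G1: "G 1 = 2 * s1" unfolding G_def J1 by (rule real_sqrt_unique) (use pos in auto)
  have F: "F P q T \<longleftrightarrow> q\<^sup>2 = (P - G T) * (sqrt (d T) + - (1 + u T) / 2 * (P - G T))"
    "sqrt (d T) + - (1 + u T) / 2 * (P - G T) = \<epsilon> T / 2 * (P + G T)" if "1 \<le> T" for P q T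
  proof -
    show *: "sqrt (d T) + - (1 + u T) / 2 * (P - G T) = \<epsilon> T / 2 * (P + G T)"
      unfolding d[OF that] u by (simp add: field_simps)
    have "F P q T \<longleftrightarrow> q\<^sup>2 = \<epsilon> T / 2 * (P\<^sup>2 - (G T)\<^sup>2)"
      unfolding F_def b u K[OF that] G2[OF that] by (auto simp: algebra_simps)
    then show "F P q T \<longleftrightarrow> q\<^sup>2 = (P - G T) * (sqrt (d T) + - (1 + u T) / 2 * (P - G T))"
      unfolding * by (simp add: power2_eq_square algebra_simps)
  qed
  have u1: "u 1 = - 1" by (simp add: u \<epsilon>_def)
  have p1: "p 1 = 0" by (simp add: p)
  have N1: "N 1 = 0" using cos_sum_eq(2) H(2) by (simp add: N_def u1)
  have M1: "(X, Y, 1) \<in> M \<longleftrightarrow> X = Y \<and> 1 \<le> X" for X Y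
  proof -
    have "E X Y 1 \<longleftrightarrow> (s1 * X)\<^sup>2 + (s2 * Y)\<^sup>2 - 2 * (s1 * X) * (s2 * Y) = 0"
      unfolding E_def u1 p1 N1 by simp
    also have "\<dots> \<longleftrightarrow> (s1 * (X - Y))\<^sup>2 = 0"
      unfolding s(2) by (simp add: power2_eq_square algebra_simps)
    also have "\<dots> \<longleftrightarrow> X = Y" using pos by simp
    finally show ?thesis using ok[of 1] by (auto simp: M_def ok_def)
  qed
  have fw1: "fw (X, Y, 1) = (s1 * (X + Y), w 1 * (s1 * (X - Y)), 1)" for X Y
  proof -
    have "fw (X, Y, 1) = (s1 * X + s2 * Y, w 1 * (s1 * X - s2 * Y), 1)"
      unfolding fw_def sh_def split p1 by simp
    then show ?thesis by (simp only: s(2) distrib_left right_diff_distrib)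
  qed
  have fwM: "(P, q, T) \<in> fw ` M \<longleftrightarrow> 1 \<le> T \<and> G T \<le> P \<and> F P q T" for P q T
  proof (cases "T = 1")
    case True
    have "(P, q, 1) \<in> fw ` M \<longleftrightarrow> q = 0 \<and> 2 * s1 \<le> P"
    proof
      assume "(P, q, 1) \<in> fw ` M"
      then obtain X Y where XY: "(X, Y, 1) \<in> M" "fw (X, Y, 1) = (P, q, 1)" by (auto simp: fw_def)
      then show "q = 0 \<and> 2 * s1 \<le> P" using pos M1 by (auto simp: fw1)
    next
      assume "q = 0 \<and> 2 * s1 \<le> P"
      then have "(P / (2 * s1), P / (2 * s1), 1) \<in> M" "fw (P / (2 * s1), P / (2 * s1), 1) = (P, q, 1)"
        using pos M1 by (auto simp: fw1)
      then show "(P, q, 1) \<in> fw ` M" by (metis image_eqI)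
    qed
    moreover have "F P q 1 \<longleftrightarrow> q = 0" using K[of 1] by (simp add: F_def u1 b \<epsilon>_def)
    ultimately show ?thesis using True G1 by auto
  next
    case False
    show ?thesis
    proof (cases "1 \<le> T")
      case True
      have \<epsilon>p: "0 < \<epsilon> T" using True False pos by (simp add: \<epsilon>_def)
      have "\<not> (p T = 0 \<and> N T = 0)" using degenerate(1)[of T] ok True False by blast
      then have "(P, q, T) \<in> fw ` M \<longleftrightarrow> 0 < P \<and> F P q T"
        using fw_M_iff[of T P q] ok True by (simp add: S_def)
      also have "\<dots> \<longleftrightarrow> G T \<le> P \<and> F P q T"
      proof -
        have "G T \<le> P" if "0 < P" "F P q T"
        proof -
          have "q\<^sup>2 = (P - G T) * (\<epsilon> T / 2 * (P + G T))" using F[OF True] that by metis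
          then have "0 \<le> (P - G T) * (\<epsilon> T / 2 * (P + G T))" by (metis zero_le_power2)
          moreover have "0 < \<epsilon> T / 2 * (P + G T)" using \<epsilon>p that G2[OF True] by simp
          ultimately show ?thesis by (simp add: zero_le_mult_iff)
        qed
        then show ?thesis using G2[OF True] by auto
      qed
      finally show ?thesis using True by simp
    qed (use fw_M_F(1) ok in blast)
  qed
  show "\<exists>f g. homeomorphism M (UNIV :: (real \<times> real) set) f g \<and> (\<forall>x\<in>M. snd (f x) = 0 \<longleftrightarrow> qq x = 0)"
  proof (rule plane_cone[OF z, where G = G])
    have "2 + \<epsilon> T \<noteq> 0" if "1 \<le> T" for T using \<epsilon>0[OF that] by simp
    moreover have "continuous_on {1..} \<epsilon>" unfolding \<epsilon>_def by (intro continuous_intros)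
    ultimately show "continuous_on {Tm..} G" unfolding G_def J_def Tm1 by (intro continuous_intros) auto
    show "fw ` M = {(P, q, T). Tm \<le> T \<and> G T \<le> P \<and> 0 \<le> sqrt (d T) + - (1 + u T) / 2 * (P - G T) \<and>
      q\<^sup>2 = (P - G T) * (sqrt (d T) + - (1 + u T) / 2 * (P - G T))}" (is "_ = ?A")
    proof (intro set_eqI)
      fix x :: "real \<times> real \<times> real"
      obtain P q T where x: "x = (P, q, T)" by (metis prod.exhaust)
      have "0 \<le> \<epsilon> T / 2 * (P + G T)" if "1 \<le> T" "G T \<le> P"
        using that \<epsilon>0[OF that(1)] G2[OF that(1)] by (intro mult_nonneg_nonneg) auto
      then show "x \<in> fw ` M \<longleftrightarrow> x \<in> ?A"
        unfolding x fwM Tm1 using F[of T P] by auto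
    qed
  qed
  have L: "{x \<in> M. qq x = 0 \<and> snd (snd x) = 1} = (\<lambda>r. (1 + r / s1, 1 + r / s1, 1 :: real)) ` {0..}"
  proof (intro equalityI subsetI)
    fix x :: "real \<times> real \<times> real" assume "x \<in> {x \<in> M. qq x = 0 \<and> snd (snd x) = 1}"
    then obtain X Y where x: "x = (X, Y, 1)" "(X, Y, 1) \<in> M" by (metis (mono_tags) mem_Collect_eq prod.collapse)
    then have "Y = X" "1 \<le> X" using M1 by auto
    then show "x \<in> (\<lambda>r. (1 + r / s1, 1 + r / s1, 1)) ` {0..}"
      using pos x by (intro image_eqI[of _ _ "s1 * (X - 1)"]) (auto simp: field_simps)
  next
    fix x :: "real \<times> real \<times> real" assume "x \<in> (\<lambda>r. (1 + r / s1, 1 + r / s1, 1)) ` {0..}"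
    then show "x \<in> {x \<in> M. qq x = 0 \<and> snd (snd x) = 1}"
      using pos M1 by (auto simp: qq_def fw1)
  qed
  show "\<exists>G. continuous_on {0..} G \<and> {x \<in> M. qq x = 0 \<and> snd (snd x) = 1} = G ` {0..} \<and>
           (\<forall>r\<ge>0. s1 * fst (G r) = s1 + r)"
    using pos by (intro exI[of _ "\<lambda>r. (1 + r / s1, 1 + r / s1, 1)"] conjI L)
      (auto intro!: continuous_intros simp: field_simps)
qed

section \<open>The union of the conics for \<open>z = - 1\<close> is a sphere, a point or
  empty\<close>

definition T1 :: real where "T1 = (c0 * c3 + (c1 * c2 - s1 * s2)) / (s0 * s3)"

text \<open>For \<open>z = - 1\<close> the function \<open>u\<close> increases with
  \<open>T\<close>, so the trace condition bounds \<open>T\<close> from above.\<close>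

lemma ok_T1: assumes "z = - 1" shows "ok T \<longleftrightarrow> 1 \<le> T \<and> T \<le> T1"
proof -
  have "u T = - tau T" unfolding u_def by (subst assms) simp
  then show ?thesis using s0s3_pos by (auto simp: ok_def T1_def tau_def field_simps)
qed

text \<open>Here \<open>u = - tau\<close>, and both lie strictly between - 1 and 1. A point of
  \<open>M\<close> forces \<open>b T > 0\<close>, and since \<open>- p T\<close> has the sign of
  \<open>c0 + c3\<close>, the sign of \<open>b T\<close> is that of the product.\<close>

lemma compact_nonempty:
  assumes z: "z = - 1" and "M \<noteq> {}"
  shows "1 \<le> T1" "0 < (c0 + c3) * (c1 + c2)"
proof -
  obtain P q T where m: "(P, q, T) \<in> fw ` M" using assms(2) by (metis equals0I image_is_empty prod.exhaust)
  note F = fw_M_F[OF m]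
  show "1 \<le> T1" using ok_T1[OF z] F(1) by auto
  have nd: "\<not> (p T = 0 \<and> N T = 0)" using degenerate(3)[OF F(1)] z by auto
  have u: "u T = - tau T" unfolding u_def by (subst z) simp
  have T: "1 \<le> T" using F(1) by (simp add: ok_def)
  have tau: "- 1 < tau T" "tau T < 1" using u u_less_1[OF F(1)] tau_less_1[OF T] by auto
  have b: "0 < b T" using b_pos[OF F(1) nd F(2,3)] u tau by simp
  have zp: "z * p T = - p T" by (subst z) simp
  have "0 < (z * p T) * (c1 + c2)" using b by (simp add: b_def zp)
  moreover have "c0 + c3 \<noteq> 0"
  proof
    assume "c0 + c3 = 0"
    then have "c0 * c3 - s0 * s3 = - 1" using cos_sum_eq by simp
    moreover have "s0 * s3 * 1 \<le> s0 * s3 * T" using T s0s3_pos by (intro mult_left_mono) auto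
    ultimately have "tau T \<le> - 1" by (simp add: tau_def)
    then show False using tau by simp
  qed
  ultimately show "0 < (c0 + c3) * (c1 + c2)"
    using zp_pos[OF T] zp_neg[OF T] tau
    by (smt (verit) mult_neg_neg mult_pos_pos zero_less_mult_iff)
qed

text \<open>The conics over \<open>1 \<le> T \<le> T1\<close> are ellipses that shrink to points at
  both ends. Rescaling their axes makes them circles with squared radius
  \<open>(T - 1) * (T1 - T)\<close>, the horizontal sections of the sphere whose vertical diameter
  runs from 1 to \<open>T1\<close>. For \<open>T1 = 1\<close> its radius is 0.\<close>

lemma sphere_compact:
  assumes z: "z = - 1" and H: "1 \<le> T1" "0 < (c0 + c3) * (c1 + c2)"
  shows "\<exists>f g. homeomorphism M (sphere (0 :: real, 0 :: real, (1 + T1) / 2) ((T1 - 1) / 2)) f g \<and>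
      (\<forall>x\<in>M. fst (snd (f x)) = 0 \<longleftrightarrow> qq x = 0)"
    and "x \<in> M \<Longrightarrow> \<bar>tau (snd (snd x))\<bar> < 1"
proof -
  have u: "u T = - tau T" for T unfolding u_def by (subst z) simp
  have tau: "- 1 < u T" "u T < 1" if "ok T" for T
    using that u u_less_1[OF that] tau_less_1[of T] by (auto simp: ok_def)
  {
    fix x assume "x \<in> M"
    then show "\<bar>tau (snd (snd x))\<bar> < 1" using tau[OF M_ok'[OF \<open>x \<in> M\<close>]] u[of "snd (snd x)"] by simp
  }
  have nd: "\<not> (p T = 0 \<and> N T = 0)" if "ok T" for T using degenerate(2)[OF that] tau[OF that] by auto
  have b: "0 < b T" if T: "ok T" for T
  proof -
    have zp: "z * p T = - p T" by (subst z) simp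
    have "1 \<le> T" "- 1 \<le> tau T" using T tau[OF T] u by (auto simp: ok_def)
    then have "0 < (z * p T) * (c1 + c2)"
      using H(2) zp_pos zp_neg by (auto simp: zero_less_mult_iff)
    then show ?thesis by (simp add: b_def zp)
  qed
  have P: "0 < P" if T: "ok T" and "F P q T" for P q T
  proof (rule ccontr)
    assume "\<not> 0 < P"
    then have "b T * P \<le> 0" using b[OF T] by (simp add: mult_nonneg_nonpos)
    moreover have "0 \<le> (1 + u T) / 2 * P\<^sup>2" using tau[OF T] by simp
    ultimately show False
      using K_pos[OF T nd[OF T]] zero_le_power2[of q] that(2) unfolding F_def by linarith
  qed
  have A: "(Q, q, T) \<in> fw ` M \<longleftrightarrow> ok T \<and> F Q q T" for Q q T
    using fw_M_F[of Q q T] fw_M_iff[of T Q q] nd P by (auto simp: S_def)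
  \<comment> \<open>The quotient of \<open>d T\<close> by
    \<open>2 * (1 + u T) * (T - 1) * (T1 - T)\<close>, obtained by cancelling in
    \<open>d_eq\<close>; it is positive on the whole closed interval.\<close>
  define k where "k = (\<lambda>T. s0 * s3 * (c1 * c2 + s1 * s2 - u T) * s3\<^sup>2 * (T + 1) / ((1 - u T) * (1 + u T)))"
  have f2: "0 < c1 * c2 + s1 * s2 - u T" if "ok T" for T
    using that mult_pos_pos[OF pos(2,3)] by (simp add: ok_def)
  have k: "0 < k T" if "ok T" for T
    unfolding k_def using tau[OF that] f2[OF that] pos that by (auto simp: ok_def intro!: mult_pos_pos divide_pos_pos)
  have d: "d T = 2 * (1 + u T) * ((T - 1) * (T1 - T) * k T)" if "ok T" for T
  proof -
    have "c1 * c2 - s1 * s2 - u T = s0 * s3 * (T1 - T)"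
    proof -
      have "s0 * s3 * T1 = c0 * c3 + (c1 * c2 - s1 * s2)" using pos by (simp add: T1_def)
      then show ?thesis by (simp add: u tau_def algebra_simps)
    qed
    then have "(1 - u T) * d T = 2 * (s0 * s3 * (T1 - T) * (c1 * c2 + s1 * s2 - u T)) * (s3\<^sup>2 * (T\<^sup>2 - 1))"
      unfolding d_eq[OF tau(2)[OF that]] N_def by simp
    also have "\<dots> = (1 - u T) * (2 * (1 + u T) * ((T - 1) * (T1 - T) * k T))"
    proof -
      have "(1 - u T) * (1 + u T) * k T = s0 * s3 * (c1 * c2 + s1 * s2 - u T) * s3\<^sup>2 * (T + 1)"
        using tau[OF that] by (simp add: k_def)
      then show ?thesis by algebra
    qed
    finally show ?thesis using tau[OF that] by simp
  qed
  define \<alpha> where "\<alpha> = (\<lambda>T. sqrt ((1 + u T) / 2))"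
  define \<beta> where "\<beta> = (\<lambda>T. b T / (1 + u T))"
  have \<alpha>: "0 < \<alpha> T" "(\<alpha> T)\<^sup>2 = (1 + u T) / 2" if "ok T" for T using tau[OF that] by (auto simp: \<alpha>_def)
  have sk: "0 < sqrt (k T)" "(sqrt (k T))\<^sup>2 = k T" if "ok T" for T using k[OF that] by auto
  have F: "F Q q T \<longleftrightarrow> (\<alpha> T * (Q - \<beta> T) / sqrt (k T))\<^sup>2 + (q / sqrt (k T))\<^sup>2 = (T - 1) * (T1 - T)"
    if T: "ok T" for Q q T
  proof -
    have 1: "1 + u T \<noteq> 0" "k T \<noteq> 0" using tau[OF T] k[OF T] by auto
    have "2 * (1 + u T) * ((1 + u T) / 2 * Q\<^sup>2 - b T * Q + K T + q\<^sup>2) =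
        ((1 + u T) * Q - b T)\<^sup>2 + 2 * (1 + u T) * q\<^sup>2 - d T"
      unfolding d_def by (simp add: power2_eq_square field_simps)
    also have "(1 + u T) * Q - b T = (1 + u T) * (Q - \<beta> T)" using 1 by (simp add: \<beta>_def field_simps)
    also have "((1 + u T) * (Q - \<beta> T))\<^sup>2 + 2 * (1 + u T) * q\<^sup>2 - d T =
       2 * (1 + u T) * ((1 + u T) / 2 * (Q - \<beta> T)\<^sup>2 + q\<^sup>2 - (T - 1) * (T1 - T) * k T)"
      unfolding d[OF T] by (simp add: power2_eq_square field_simps)
    finally have "(1 + u T) / 2 * Q\<^sup>2 - b T * Q + K T + q\<^sup>2 =
        (1 + u T) / 2 * (Q - \<beta> T)\<^sup>2 + q\<^sup>2 - (T - 1) * (T1 - T) * k T"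
      using 1 by simp
    then have "F Q q T \<longleftrightarrow> (1 + u T) / 2 * (Q - \<beta> T)\<^sup>2 + q\<^sup>2 - (T - 1) * (T1 - T) * k T = 0"
      by (simp only: F_def)
    also have "\<dots> \<longleftrightarrow> ((1 + u T) / 2 * (Q - \<beta> T)\<^sup>2 + q\<^sup>2) / k T = (T - 1) * (T1 - T)"
      using 1 by (simp add: field_simps)
    also have "((1 + u T) / 2 * (Q - \<beta> T)\<^sup>2 + q\<^sup>2) / k T =
        (\<alpha> T * (Q - \<beta> T) / sqrt (k T))\<^sup>2 + (q / sqrt (k T))\<^sup>2"
      unfolding power_divide power_mult_distrib \<alpha>(2)[OF T] sk(2)[OF T] by (simp add: add_divide_distrib)
    finally show ?thesis .
  qed
  have sph: "(x, y, T) \<in> sphere (0, 0, (1 + T1) / 2) ((T1 - 1) / 2) \<longleftrightarrow> x\<^sup>2 + y\<^sup>2 = (T - 1) * (T1 - T)"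
    for x y T
  proof -
    have "(x, y, T) \<in> sphere (0, 0, (1 + T1) / 2) ((T1 - 1) / 2) \<longleftrightarrow>
        sqrt (x\<^sup>2 + (y\<^sup>2 + ((1 + T1) / 2 - T)\<^sup>2)) = (T1 - 1) / 2"
      by (simp add: dist_Pair_Pair dist_real_def)
    also have "\<dots> \<longleftrightarrow> x\<^sup>2 + (y\<^sup>2 + ((1 + T1) / 2 - T)\<^sup>2) = ((T1 - 1) / 2)\<^sup>2"
    proof -
      have "(T1 - 1) / 2 = sqrt (((T1 - 1) / 2)\<^sup>2)" using H(1) by simp
      then show ?thesis by (metis real_sqrt_eq_iff)
    qed
    also have "\<dots> \<longleftrightarrow> x\<^sup>2 + y\<^sup>2 = (T - 1) * (T1 - T)"
    proof -
      have "((1 + T1) / 2 - T)\<^sup>2 = ((T1 - 1) / 2)\<^sup>2 - (T - 1) * (T1 - T)"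
        by (simp add: power2_eq_square field_simps)
      then show ?thesis by linarith
    qed
    finally show ?thesis .
  qed
  have okS: "ok T" if "x\<^sup>2 + y\<^sup>2 = (T - 1) * (T1 - T)" for x y T
  proof -
    have "0 \<le> (T - 1) * (T1 - T)" using that by (metis sum_power2_ge_zero)
    then show ?thesis using H(1) unfolding ok_T1[OF z] by (auto simp: zero_le_mult_iff)
  qed
  let ?S = "sphere (0 :: real, 0 :: real, (1 + T1) / 2) ((T1 - 1) / 2)"
  define f where "f = (\<lambda>(Q, q, T). (\<alpha> T * (Q - \<beta> T) / sqrt (k T), q / sqrt (k T), T))"
  define g where "g = (\<lambda>(x, y, T). (sqrt (k T) * x / \<alpha> T + \<beta> T, sqrt (k T) * y, T))"
  have cont: "continuous_on B (\<lambda>x. \<alpha> (h x))" "continuous_on B (\<lambda>x. \<beta> (h x))" "continuous_on B (\<lambda>x. k (h x))"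
    if "continuous_on B h" "\<And>x. x \<in> B \<Longrightarrow> ok (h x)" for B :: "(real \<times> real \<times> real) set" and h
    unfolding \<alpha>_def \<beta>_def k_def using that(2) tau
    by (force intro!: continuous_intros that(1))+
  have "homeomorphism (fw ` M) ?S f g"
  proof (rule homeomorphismI)
    have 1: "ok (snd (snd x))" if "x \<in> fw ` M" for x using A that by (metis prod.collapse)
    have 2: "ok (snd (snd x))" if "x \<in> ?S" for x using sph okS that by (metis prod.collapse)
    show "continuous_on (fw ` M) f" unfolding f_def case_prod_beta
      using 1 k by (intro continuous_intros cont) (auto simp: less_imp_neq[symmetric] dest!: 1)
    show "continuous_on ?S g" unfolding g_def case_prod_beta
      using 2 \<alpha> by (intro continuous_intros cont) (auto simp: less_imp_neq[symmetric] dest!: 2)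
    show "f ` (fw ` M) \<subseteq> ?S"
    proof
      fix y assume "y \<in> f ` (fw ` M)"
      then obtain Q q T where x: "(Q, q, T) \<in> fw ` M" "y = f (Q, q, T)" by force
      then have "ok T" "F Q q T" using A by auto
      then show "y \<in> ?S" using F unfolding x(2) f_def split sph by metis
    qed
    show "g ` ?S \<subseteq> fw ` M"
    proof
      fix y assume "y \<in> g ` ?S"
      then obtain a v T where x: "(a, v, T) \<in> ?S" "y = g (a, v, T)" by force
      then have eq: "a\<^sup>2 + v\<^sup>2 = (T - 1) * (T1 - T)" using sph by blast
      note T = okS[OF eq]
      have "\<alpha> T * (sqrt (k T) * a / \<alpha> T + \<beta> T - \<beta> T) / sqrt (k T) = a" "sqrt (k T) * v / sqrt (k T) = v"
        using \<alpha>[OF T] sk[OF T] by (auto simp: field_simps)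
      then show "y \<in> fw ` M" unfolding x(2) g_def split A using F[OF T] T eq by simp
    qed
    show "g (f x) = x" if "x \<in> fw ` M" for x
      using \<alpha>[OF 1[OF that]] sk[OF 1[OF that]] by (cases x) (auto simp: f_def g_def field_simps)
    show "f (g x) = x" if "x \<in> ?S" for x
      using \<alpha>[OF 2[OF that]] sk[OF 2[OF that]] by (cases x) (auto simp: f_def g_def field_simps)
  qed
  show "\<exists>f g. homeomorphism M ?S f g \<and> (\<forall>x\<in>M. fst (snd (f x)) = 0 \<longleftrightarrow> qq x = 0)"
  proof (rule homeomorphism_fwI[where \<phi> = "\<lambda>x. fst (snd x)", OF refl])
    show "homeomorphism (fw ` M) ?S f g" by fact
    fix P q T assume "(P, q, T) \<in> fw ` M"
    then have "k T \<noteq> 0" using A k by fastforce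
    then show "fst (snd (f (P, q, T))) = 0 \<longleftrightarrow> q = 0" by (simp add: f_def)
  qed
qed

end

section \<open>Hermitian planes and rotations\<close>

context hermitian_plane
begin

lemma form_add_right: "h w (u + v) = h w u + h w v"
  unfolding hermitian[of w "u + v"] hermitian[of w u] hermitian[of w v] form_add_left by simp

lemma form_scale_right: "h w (k *\<^sub>V u) = cnj k * h w u"
  unfolding hermitian[of w "k *\<^sub>V u"] hermitian[of w u] form_scale_left by simp

lemma form_zero [simp]: "h 0 v = 0" "h v 0 = 0"
  using form_scale_left[of 0 0 v] form_scale_right[of v 0 0] by simp_all

lemma form_minus_left: "h (- u) w = - h u w"
  using form_add_left[of u "- u" w] by (simp add: eq_neg_iff_add_eq_0 add.commute)

lemma form_self_real: "h u u = of_real (Re (h u u))"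
  using hermitian[of u u] by (simp add: complex_eq_iff)

text \<open>A vector outside the span of \<open>e\<close> and \<open>f\<close> would produce three
  independent vectors in dimension 2. Pairing with \<open>e\<close> and \<open>f\<close> then
  recovers the coefficients, the sign coming from \<open>h f f = - 1\<close>.\<close>

lemma orthonormal_expansion:
  assumes "h e e = 1" "h f f = - 1" "h e f = 0"
  shows "v = h v e *\<^sub>V e + (- h v f) *\<^sub>V f"
proof -
  have fe: "h f e = 0" using hermitian[of e f] assms(3) by simp
  have coeff: "x = h w e \<and> y = - h w f" if "w = x *\<^sub>V e + y *\<^sub>V f" for w x y
    using that by (simp add: form_add_left form_scale_left assms fe)
  obtain B where B0: "B \<subseteq> UNIV" and B: "independent B" "UNIV \<subseteq> span B" "card B = dim UNIV"
    by (rule basis_exists[of UNIV])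
  have finB: "card B = 2" "finite B" using B(3) dimension by (simp_all add: card_ge_0_finite)
  have "v \<in> span {e, f}"
  proof (rule ccontr)
    assume v: "v \<notin> span {e, f}"
    have "f \<noteq> 0" using assms by auto
    moreover have "e \<notin> span {f}"
    proof
      assume "e \<in> span {f}"
      then obtain k where "e = k *\<^sub>V f" by (auto simp: span_singleton)
      then have "h e e = k * h f e" by (metis form_scale_left)
      then show False using assms fe by simp
    qed
    ultimately have ind: "independent {e, f}"
      by (simp add: independent_insert span_empty)
    then have "independent {v, e, f}" unfolding independent_insert[of v "{e, f}"] using v by simp
    then have "card {v, e, f} \<le> card B"
      using independent_span_bound[OF finB(2)] B(2) by blast
    moreover have "e \<noteq> f" using assms by auto
    moreover have "v \<noteq> e" "v \<noteq> f" using v span_base by auto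
    ultimately show False using finB by simp
  qed
  then obtain x where "v - x *\<^sub>V e \<in> span {f}" unfolding span_breakdown_eq ..
  then obtain y where "v - x *\<^sub>V e = y *\<^sub>V f" unfolding span_singleton by blast
  then have v: "v = x *\<^sub>V e + y *\<^sub>V f" by (simp add: diff_eq_eq add.commute)
  show ?thesis using coeff[OF v] v by simp
qed

lemma exists_orthonormal: obtains e f where "h e e = 1" "h f f = - 1" "h e f = 0"
proof -
  obtain e f where ef: "h e f = 0" "Re (h e e) > 0" "Re (h f f) < 0" using signature by blast
  define r s where "r = sqrt (Re (h e e))" and "s = sqrt (- Re (h f f))"
  define e' f' where "e' = of_real (1 / r) *\<^sub>V e" and "f' = of_real (1 / s) *\<^sub>V f"
  have "r > 0" "s > 0" "r * r = Re (h e e)" "s * s = - Re (h f f)" using ef by (auto simp: r_def s_def)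
  moreover from this have "h e e = of_real (r * r)" "h f f = of_real (- (s * s))"
    using form_self_real[of e] form_self_real[of f] by simp_all
  ultimately have "h e' e' = 1" "h f' f' = - 1" "h e' f' = 0"
    using ef by (auto simp: e'_def f'_def form_scale_left form_scale_right)
  then show ?thesis by (rule that)
qed

lemma nondegenerate: assumes "\<And>v. h u v = 0" shows "u = 0"
proof -
  obtain e f where "h e e = 1" "h f f = - 1" "h e f = 0" by (rule exists_orthonormal)
  from orthonormal_expansion[OF this, of u] show ?thesis using assms by simp
qed

lemma in_span_singleton: "v \<in> span {u} \<longleftrightarrow> (\<exists>k. v = k *\<^sub>V u)"
  by (auto simp: span_singleton)

lemma span_scale_eq: "k \<noteq> 0 \<Longrightarrow> span {k *\<^sub>V u} = span {u}"
  by (auto simp: in_span_singleton) (metis scale_scale nonzero_eq_divide_eq)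

lemma rep_span: assumes "u \<noteq> 0" obtains k where "k \<noteq> 0" "rep (span {u}) = k *\<^sub>V u"
proof -
  have "rep (span {u}) \<in> span {u} \<and> rep (span {u}) \<noteq> 0"
    unfolding rep_def by (rule someI[of _ u]) (use assms span_base in auto)
  then show ?thesis using that in_span_singleton by (metis scale_zero_left)
qed

lemma ta_span:
  assumes "u \<noteq> 0" "v \<noteq> 0"
  shows "ta (span {u}) (span {v}) = Re (h u v * h v u / (h u u * h v v))"
proof -
  obtain k where k: "k \<noteq> 0" "rep (span {u}) = k *\<^sub>V u" using rep_span[OF assms(1)] .
  obtain l where l: "l \<noteq> 0" "rep (span {v}) = l *\<^sub>V v" using rep_span[OF assms(2)] .
  define m where "m = (k * cnj k) * (l * cnj l)"
  have m: "m \<noteq> 0" using k(1) l(1) by (simp add: m_def)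
  have "h (k *\<^sub>V u) (l *\<^sub>V v) * h (l *\<^sub>V v) (k *\<^sub>V u) = m * (h u v * h v u)"
    "h (k *\<^sub>V u) (k *\<^sub>V u) * h (l *\<^sub>V v) (l *\<^sub>V v) = m * (h u u * h v v)"
    by (simp_all only: form_scale_left form_scale_right m_def ac_simps)
  then show ?thesis unfolding ta_def k(2) l(2) using m by simp
qed

lemma rot_span:
  assumes "u \<noteq> 0"
  shows "rot (span {u}) k v = ((cnj k - k) * (h v u / h u u)) *\<^sub>V u + k *\<^sub>V v"
proof -
  obtain l where l: "l \<noteq> 0" "rep (span {u}) = l *\<^sub>V u" using rep_span[OF assms] .
  have "(cnj k - k) * (h v (l *\<^sub>V u) / h (l *\<^sub>V u) (l *\<^sub>V u)) * l = (cnj k - k) * (h v u / h u u)"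
    unfolding form_scale_left form_scale_right using l(1) by simp
  then show ?thesis unfolding rot_def l(2) scale_scale by simp
qed

lemma BV_nonzero: "Re (h v v) > 0 \<Longrightarrow> v \<noteq> 0"
  by auto

lemma unitaryD:
  assumes "unitary f"
  shows "f (u + v) = f u + f v" "f (k *\<^sub>V u) = k *\<^sub>V f u" "h (f u) (f v) = h u v"
  using assms by (auto simp: unitary_def Vector_Spaces.linear_iff)

lemma unitaryI:
  assumes "\<And>u v. f (u + v) = f u + f v" "\<And>k u. f (k *\<^sub>V u) = k *\<^sub>V f u" "\<And>u v. h (f u) (f v) = h u v"
  shows "unitary f"
  using assms vector_space_axioms by (auto simp: unitary_def Vector_Spaces.linear_iff)

lemma unitary_eq_0: assumes "unitary f" shows "f v = 0 \<longleftrightarrow> v = 0"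
proof
  assume "f v = 0"
  then have "h v u = 0" for u using unitaryD(3)[OF assms, of v u] by simp
  then show "v = 0" by (rule nondegenerate)
next
  assume "v = 0" then show "f v = 0" using unitaryD(2)[OF assms, of 0 0] by simp
qed

lemma unitary_span: assumes "unitary f" shows "f ` span {v} = span {f v}"
  by (auto simp: in_span_singleton unitaryD[OF assms])
    (metis imageI in_span_singleton unitaryD(2)[OF assms])

lemma unitary_comp: "unitary f \<Longrightarrow> unitary g \<Longrightarrow> unitary (f \<circ> g)"
  by (rule unitaryI) (simp_all add: unitaryD)

lemma unitary_id: "unitary id"
  by (rule unitaryI) simp_all

lemma unitary_BV: assumes "unitary f" "p \<in> BV" shows "f ` p \<in> BV"
proof -
  obtain v where v: "p = span {v}" "Re (h v v) > 0" using assms(2) by (auto simp: BV_def)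
  then show ?thesis unfolding BV_def using unitary_span[OF assms(1)] unitaryD(3)[OF assms(1)] by auto
qed

lemma unitary_ta: assumes "unitary f" "p \<in> BV" "q \<in> BV" shows "ta (f ` p) (f ` q) = ta p q"
proof -
  obtain u where u: "p = span {u}" "Re (h u u) > 0" using assms(2) by (auto simp: BV_def)
  obtain v where v: "q = span {v}" "Re (h v v) > 0" using assms(3) by (auto simp: BV_def)
  show ?thesis using u v BV_nonzero unitary_eq_0[OF assms(1)]
    by (simp add: unitary_span[OF assms(1)] ta_span unitaryD(3)[OF assms(1)])
qed

lemma unitary_rot: assumes "unitary f" "p \<in> BV" shows "rot (f ` p) k (f v) = f (rot p k v)"
proof -
  obtain u where u: "p = span {u}" "Re (h u u) > 0" using assms(2) by (auto simp: BV_def)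
  then have "u \<noteq> 0" using BV_nonzero by auto
  then show ?thesis using u unitary_eq_0[OF assms(1)]
    by (simp add: unitary_span[OF assms(1)] rot_span unitaryD[OF assms(1)])
qed

text \<open>The images of an orthonormal basis are orthonormal, so expanding in them and mapping
  back to the basis inverts \<open>f\<close>.\<close>

lemma unitary_inverse:
  assumes "unitary f" obtains g where "unitary g" "\<And>v. g (f v) = v" "\<And>v. f (g v) = v"
proof -
  obtain a b where ab: "h a a = 1" "h b b = - 1" "h a b = 0" by (rule exists_orthonormal)
  define g where "g v = h v (f a) *\<^sub>V a + (- h v (f b)) *\<^sub>V b" for v
  have fg: "f (g v) = v" for v
  proof -
    have "f (g v) = h v (f a) *\<^sub>V f a + (- h v (f b)) *\<^sub>V f b"
      unfolding g_def by (simp only: unitaryD[OF assms])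
    also have "\<dots> = v"
      by (rule orthonormal_expansion[symmetric]) (simp_all add: unitaryD[OF assms] ab)
    finally show ?thesis .
  qed
  have gf: "g (f v) = v" for v
    unfolding g_def unitaryD(3)[OF assms] using orthonormal_expansion[OF ab] by simp
  have "unitary g"
  proof (rule unitaryI)
    show "h (g u) (g v) = h u v" for u v using unitaryD(3)[OF assms, of "g u" "g v"] by (simp add: fg)
    show "g (u + v) = g u + g v" for u v
      by (simp add: g_def form_add_left scale_left_distrib algebra_simps)
    show "g (k *\<^sub>V u) = k *\<^sub>V g u" for k u
      by (simp add: g_def form_scale_left scale_right_diff_distrib)
  qed
  then show ?thesis using that gf fg by blast
qed

lemma rot_unitary:
  assumes "p \<in> BV" "cmod k = 1" shows "unitary (rot p k)"
proof -
  obtain u where u: "p = span {u}" "Re (h u u) > 0" using assms(1) by (auto simp: BV_def)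
  then have u0: "u \<noteq> 0" using BV_nonzero by auto
  define r where "r = h u u"
  have r: "r \<noteq> 0" "cnj r = r" using u hermitian[of u u] by (auto simp: r_def)
  have k: "k * cnj k = 1" using assms(2) by (simp add: complex_norm_square[symmetric] )
  show ?thesis
  proof (rule unitaryI)
    fix v w
    have w: "cnj (h w u) = h u w" by (metis hermitian)
    define x y where "x = h v u / r" and "y = h u w / r"
    have x: "h v u = x * r" "h u w = y * r" using r by (auto simp: x_def y_def)
    have "cnj (h w u / r) = y" by (simp add: y_def w r)
    then have 1: "cnj ((cnj k - k) * (h w u / r)) = (k - cnj k) * y"
      by (simp only: complex_cnj_mult complex_cnj_diff complex_cnj_cnj)
    have "h (rot p k v) (rot p k w) = (cnj k - k) * x * ((k - cnj k) * y * r + cnj k * (y * r)) +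
        k * ((k - cnj k) * y * (x * r) + cnj k * h v w)"
      unfolding u(1) rot_span[OF u0] form_add_left form_add_right form_scale_left form_scale_right
      unfolding r_def[symmetric] 1 x(2) unfolding x_def[symmetric] unfolding x(1) by (simp add: algebra_simps)
    also have "\<dots> = h v w" using k by algebra
    finally show "h (rot p k v) (rot p k w) = h v w" .
  next
    show "rot p k (v + w) = rot p k v + rot p k w" for v w
      unfolding u(1) rot_span[OF u0] form_add_left add_divide_distrib distrib_left scale_left_distrib
        scale_right_distrib by simp
    show "rot p k (l *\<^sub>V v) = l *\<^sub>V rot p k v" for l v
      unfolding u(1) rot_span[OF u0] form_scale_left scale_right_distrib scale_scale by (simp add: ac_simps)
  qed
qed

lemma rot_fixes: assumes "p \<in> BV" "cmod k = 1" shows "rot p k ` p = p"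
proof -
  obtain u where u: "p = span {u}" "Re (h u u) > 0" using assms(1) by (auto simp: BV_def)
  then have u0: "u \<noteq> 0" "h u u \<noteq> 0" using BV_nonzero by auto
  have "rot p k u = cnj k *\<^sub>V u"
    using u0 by (simp add: u(1) rot_span scale_left_distrib[symmetric])
  then show ?thesis
    using u(1) unitary_span[OF rot_unitary[OF assms], of u] span_scale_eq[of "cnj k" u] assms(2) by fastforce
qed

lemma rot_inverse: assumes "p \<in> BV" "cmod k = 1" shows "rot p (cnj k) (rot p k v) = v"
proof -
  obtain u where u: "p = span {u}" "Re (h u u) > 0" using assms(1) by (auto simp: BV_def)
  then have u0: "u \<noteq> 0" "h u u \<noteq> 0" using BV_nonzero by auto
  have k: "k * cnj k = 1" "cnj k * k = 1" using assms(2) by (simp_all add: complex_norm_square[symmetric] mult.commute)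
  have "rot p (cnj k) (rot p k v) =
      (((k - cnj k) * (((cnj k - k) * (h v u / h u u)) * h u u + k * h v u) / h u u) + cnj k * ((cnj k - k) * (h v u / h u u))) *\<^sub>V u + (cnj k * k) *\<^sub>V v"
    using u0 by (simp add: u(1) rot_span form_add_left form_scale_left scale_right_distrib scale_left_distrib)
  also have "((k - cnj k) * (((cnj k - k) * (h v u / h u u)) * h u u + k * h v u) / h u u) + cnj k * ((cnj k - k) * (h v u / h u u)) = 0"
    using u0(2) by (simp add: field_simps)
  finally show ?thesis by (simp add: k)
qed

lemma inv_rot: assumes "p \<in> BV" "cmod k = 1" shows "inv (rot p k) = rot p (cnj k)"
  by (rule inv_unique_comp) (use rot_inverse[OF assms] rot_inverse[of p "cnj k"] assms in \<open>auto simp: fun_eq_iff\<close>)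

definition act :: "('v \<Rightarrow> 'v) \<Rightarrow> (nat \<Rightarrow> 'v set) \<Rightarrow> nat \<Rightarrow> 'v set" where
  "act f c = (\<lambda>j\<in>{..3}. f ` c j)"

lemma orbit_act: "orbit c = {act f c | f. unitary f}"
  by (simp add: orbit_def act_def)

lemma act_act: "act f (act g c) = act (f \<circ> g) c"
  by (auto simp: act_def fun_eq_iff image_comp)

lemma orbit_self: "c \<in> {..3} \<rightarrow>\<^sub>E BV \<Longrightarrow> c \<in> orbit c"
proof -
  assume "c \<in> {..3} \<rightarrow>\<^sub>E BV"
  then have "c = act id c" by (auto simp: act_def fun_eq_iff PiE_def extensional_def)
  then show ?thesis using unitary_id by (auto simp: orbit_act)
qed

lemma orbit_eq: assumes "unitary f" shows "orbit (act f c) = orbit c"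
proof -
  obtain g where g: "unitary g" "\<And>v. g (f v) = v" "\<And>v. f (g v) = v"
    using unitary_inverse[OF assms] by blast
  have "act k (act f c) \<in> orbit c" if "unitary k" for k
    using unitary_comp[OF that assms] by (auto simp: act_act orbit_act)
  moreover have "act k c \<in> orbit (act f c)" if "unitary k" for k
  proof -
    have "act k c = act (k \<circ> g) (act f c)"
      by (simp add: act_act act_def fun_eq_iff g(2) image_comp comp_def)
    then show ?thesis using unitary_comp[OF that g(1)] by (auto simp: orbit_act)
  qed
  ultimately show ?thesis by (auto simp: orbit_act[of "act f c"] orbit_act[of c])
qed

lemma act_PiE: "unitary f \<Longrightarrow> c \<in> {..3} \<rightarrow>\<^sub>E BV \<Longrightarrow> act f c \<in> {..3} \<rightarrow>\<^sub>E BV"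
  by (auto simp: act_def intro!: unitary_BV)

end

section \<open>Pairs encoding matrices in SU(1,1)\<close>

text \<open>A pair \<open>(\<alpha>, \<beta>)\<close> encodes the matrix with rows \<open>(\<alpha>, \<beta>)\<close> and \<open>(cnj \<beta>, cnj \<alpha>)\<close>.\<close>

definition sm :: "complex \<times> complex \<Rightarrow> complex \<times> complex \<Rightarrow> complex \<times> complex" where
  "sm A B = (fst A * fst B + snd A * cnj (snd B), fst A * snd B + snd A * cnj (fst B))"
definition si :: "complex \<times> complex \<Rightarrow> complex \<times> complex" where
  "si A = (cnj (fst A), - snd A)"
definition nrm :: "complex \<times> complex \<Rightarrow> bool" where
  "nrm A \<longleftrightarrow> (cmod (fst A))\<^sup>2 - (cmod (snd A))\<^sup>2 = 1"

lemma nrm_complex: "nrm A \<longleftrightarrow> fst A * cnj (fst A) - snd A * cnj (snd A) = 1"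
proof -
  have "fst A * cnj (fst A) - snd A * cnj (snd A) = of_real ((cmod (fst A))\<^sup>2 - (cmod (snd A))\<^sup>2)"
    unfolding of_real_diff complex_norm_square ..
  then show ?thesis unfolding nrm_def by (metis of_real_eq_1_iff)
qed

lemma sm_assoc: "sm (sm A B) C = sm A (sm B C)"
  by (simp add: sm_def algebra_simps)

lemma sm_one [simp]: "sm (1, 0) A = A" "sm A (1, 0) = A"
  by (simp_all add: sm_def)

lemma sm_si: assumes "nrm A" shows "sm (si A) A = (1, 0)" "sm A (si A) = (1, 0)"
  using assms by (simp_all add: sm_def si_def nrm_complex algebra_simps)

lemma sm_cancel [simp]:
  assumes "nrm A" shows "sm (si A) (sm A B) = B" "sm A (sm (si A) B) = B"
  by (simp_all add: sm_assoc[symmetric] sm_si[OF assms])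

lemma si_sm: "si (sm A B) = sm (si B) (si A)"
  by (simp add: sm_def si_def algebra_simps)

lemma nrm_si [simp]: "nrm (si A) \<longleftrightarrow> nrm A" by (simp add: nrm_def si_def)

lemma nrm_sm: assumes "nrm A" "nrm B" shows "nrm (sm A B)"
  using assms unfolding nrm_complex sm_def by simp algebra

lemma sm_central: "sm (of_real r, 0) A = sm A (of_real r, 0)"
  by (simp add: sm_def mult.commute)

lemma sm_central_left: "sm A (sm (of_real r, 0) B) = sm (of_real r, 0) (sm A B)"
  by (metis sm_assoc sm_central)

lemma fst_sm_commute: "Re (fst (sm A B)) = Re (fst (sm B A))"
  by (simp add: sm_def)

text \<open>A point of the hyperbolic plane is encoded by the horizontal part \<open>n\<close> of
  the corresponding point of the hyperboloid. Its height \<open>ht n\<close> is the hyperbolic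
  cosine of the distance to the origin, and \<open>rq a n\<close> is the matrix of the rotation
  about it with \<open>k = cis a\<close>.\<close>

definition ht :: "complex \<Rightarrow> real" where "ht n = sqrt (1 + (cmod n)\<^sup>2)"
definition rq :: "real \<Rightarrow> complex \<Rightarrow> complex \<times> complex" where
  "rq a n = (Complex (cos a) (- (ht n * sin a)), \<i> * cnj n * sin a)"
text \<open>For \<open>y = ht n\<close> this is the hyperbolic cosine of the distance between the
  point \<open>n\<close> and the image of the origin under \<open>A\<close>. The height is a
  separate argument because the reconstruction below has to consider \<open>y = - ht n\<close> as
  well.\<close>

definition Yg :: "complex \<times> complex \<Rightarrow> real \<Rightarrow> complex \<Rightarrow> real" where
  "Yg A y n = y * ((cmod (fst A))\<^sup>2 + (cmod (snd A))\<^sup>2) - 2 * Re (fst A * snd A * n)"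

lemma ht_sq: "(ht n)\<^sup>2 = 1 + (cmod n)\<^sup>2" by (simp add: ht_def)
lemma ht_ge_1: "1 \<le> ht n" by (simp add: ht_def)
lemma ht_pos: "0 < ht n" using ht_ge_1[of n] by linarith
lemma ht_0 [simp]: "ht 0 = 1" by (simp add: ht_def)
lemma cmod_less_ht: "cmod n < ht n"
  unfolding ht_def by (rule real_less_rsqrt) simp
lemma ht_unit: "cmod \<zeta> = 1 \<Longrightarrow> ht (\<zeta> * n) = ht n" by (simp add: ht_def norm_mult)

lemma nrm_rq: "nrm (rq a n)"
proof -
  have "(cos a)\<^sup>2 + (ht n)\<^sup>2 * (sin a)\<^sup>2 - (cmod n)\<^sup>2 * (sin a)\<^sup>2 = 1"
    unfolding ht_sq using sin_cos_squared_add2[of a] by algebra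
  then show ?thesis
    by (simp add: nrm_def rq_def cmod_power2 norm_mult power_mult_distrib)
qed

lemma rq_0: "rq a 0 = (cis (- a), 0)"
  by (simp add: rq_def complex_eq_iff)

lemma cmod_sq: "(cmod w)\<^sup>2 = (Re w)\<^sup>2 + (Im w)\<^sup>2" by (simp add: cmod_power2)

text \<open>Conjugating a rotation by \<open>A\<close> moves its centre by the inverse of
  \<open>A\<close>; \<open>Yg\<close> is the height of the new centre, and the cosine is preserved
  with the trace.\<close>

lemma fst_conj:
  assumes "nrm A"
  shows "fst (sm (si A) (sm (Complex c (- (y * s)), \<i> * cnj n * of_real s) A)) = Complex c (- (s * Yg A y n))"
proof -
  have 1: "(Re (fst A))\<^sup>2 + (Im (fst A))\<^sup>2 - (Re (snd A))\<^sup>2 - (Im (snd A))\<^sup>2 = 1"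
    using assms by (simp add: nrm_def cmod_sq)
  show ?thesis unfolding complex_eq_iff
  proof
    show "Re (fst (sm (si A) (sm (Complex c (- (y * s)), \<i> * cnj n * of_real s) A))) = Re (Complex c (- (s * Yg A y n)))"
      using 1 unfolding sm_def si_def by simp algebra
    show "Im (fst (sm (si A) (sm (Complex c (- (y * s)), \<i> * cnj n * of_real s) A))) = Im (Complex c (- (s * Yg A y n)))"
      unfolding sm_def si_def Yg_def cmod_sq by simp algebra
  qed
qed

lemma Yg_bounds: assumes "0 \<le> y" "cmod n \<le> y" shows "0 \<le> Yg A y n"
proof -
  have "Re (fst A * snd A * n) \<le> cmod (fst A) * cmod (snd A) * cmod n"
    using complex_Re_le_cmod[of "fst A * snd A * n"] by (simp add: norm_mult)
  also have "\<dots> \<le> cmod (fst A) * cmod (snd A) * y" using assms by (intro mult_left_mono) auto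
  finally have "2 * Re (fst A * snd A * n) \<le> 2 * (cmod (fst A) * cmod (snd A) * y)" by linarith
  also have "\<dots> = y * (2 * cmod (fst A) * cmod (snd A))" by simp
  also have "\<dots> \<le> y * ((cmod (fst A))\<^sup>2 + (cmod (snd A))\<^sup>2)"
    using assms sum_squares_bound[of "cmod (fst A)" "cmod (snd A)"] by (intro mult_left_mono) auto
  finally show ?thesis by (simp add: Yg_def)
qed

lemma ht_prod_bound: "Re (n * m) \<le> ht n * ht m - 1"
proof -
  have "Re (n * m) \<le> cmod n * cmod m" using complex_Re_le_cmod[of "n * m"] by (simp add: norm_mult)
  moreover have "cmod n * cmod m + 1 \<le> ht n * ht m"
  proof -
    have "2 * (cmod n * cmod m) \<le> (cmod n)\<^sup>2 + (cmod m)\<^sup>2" using sum_squares_bound[of "cmod n" "cmod m"] by simp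
    then have "(cmod n * cmod m + 1)\<^sup>2 \<le> (1 + (cmod n)\<^sup>2) * (1 + (cmod m)\<^sup>2)"
      by (simp add: power2_eq_square algebra_simps)
    then have "cmod n * cmod m + 1 \<le> sqrt ((1 + (cmod n)\<^sup>2) * (1 + (cmod m)\<^sup>2))" by (rule real_le_rsqrt)
    then show ?thesis by (simp add: ht_def real_sqrt_mult)
  qed
  ultimately show ?thesis by linarith
qed

section \<open>The lifted relation and its solutions with the first centre at the origin\<close>

definition rel :: "(nat \<Rightarrow> real) \<Rightarrow> real \<Rightarrow> (nat \<Rightarrow> complex) \<Rightarrow> bool" where
  "rel a z n \<longleftrightarrow> sm (rq (a 3) (n 3)) (sm (rq (a 2) (n 2)) (sm (rq (a 1) (n 1)) (rq (a 0) (n 0)))) = (of_real z, 0)"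

lemma rel_iff:
  "rel a z n \<longleftrightarrow> rq (a 2) (n 2) = sm (of_real z, 0) (si (sm (rq (a 1) (n 1)) (sm (rq (a 0) (n 0)) (rq (a 3) (n 3)))))"
proof -
  let ?q = "\<lambda>j. rq (a j) (n j)"
  note q = nrm_rq
  have "rel a z n \<longleftrightarrow> ?q 2 = sm (si (?q 3)) (sm (of_real z, 0) (sm (si (?q 0)) (si (?q 1))))"
  proof
    assume "rel a z n"
    then have "sm (si (?q 3)) (sm (sm (?q 3) (sm (?q 2) (sm (?q 1) (?q 0)))) (sm (si (?q 0)) (si (?q 1)))) =
       sm (si (?q 3)) (sm (of_real z, 0) (sm (si (?q 0)) (si (?q 1))))" by (simp add: rel_def)
    then show "?q 2 = sm (si (?q 3)) (sm (of_real z, 0) (sm (si (?q 0)) (si (?q 1))))"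
      by (simp add: sm_assoc q sm_si)
  next
    assume "?q 2 = sm (si (?q 3)) (sm (of_real z, 0) (sm (si (?q 0)) (si (?q 1))))"
    then show "rel a z n"
      by (simp add: rel_def sm_assoc q sm_si)
  qed
  also have "sm (si (?q 3)) (sm (of_real z, 0) (sm (si (?q 0)) (si (?q 1)))) =
      sm (of_real z, 0) (si (sm (?q 1) (sm (?q 0) (?q 3))))"
    by (simp add: si_sm sm_assoc sm_central_left)
  finally show ?thesis .
qed

text \<open>Conjugating by \<open>R\<^sub>1\<close> isolates the coordinates: the first entry on the
  left involves \<open>n\<^sub>2\<close> only through the second coordinate, and for
  \<open>n 0 = 0\<close> the first entry on the right involves phases only through the product of
  \<open>n 1\<close> and \<open>cnj (n 3)\<close>.\<close>

lemma rel_conj: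
  assumes "rel a z n"
  shows "sm (si (rq (a 1) (n 1))) (sm (rq (a 2) (n 2)) (rq (a 1) (n 1))) =
    sm (of_real z, 0) (si (sm (rq (a 0) (n 0)) (sm (rq (a 3) (n 3)) (rq (a 1) (n 1)))))"
  using assms unfolding rel_iff
  by (simp add: si_sm sm_assoc nrm_rq sm_si sm_central_left)

declare One_nat_def [simp del]

lemma Re_fst_scaled_inverse: "Re (fst (sm (of_real r, 0) (si A))) = r * Re (fst A)"
  by (simp add: sm_def si_def)

locale angle_data =
  fixes a :: "nat \<Rightarrow> real"
  assumes angles: "\<And>j. j \<le> 3 \<Longrightarrow> 0 < a j \<and> a j < pi"
begin

lemma sin_pos: "j \<le> 3 \<Longrightarrow> 0 < sin (a j)"
  using angles sin_gt_zero by blast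

lemma circle_data:
  assumes "z = 1 \<or> z = - 1"
  shows "circle_data (cos (a 0)) (sin (a 0)) (cos (a 1)) (sin (a 1)) (cos (a 2)) (sin (a 2)) (cos (a 3)) (sin (a 3)) z"
  using sin_pos assms by unfold_locales auto

definition Mz :: "real \<Rightarrow> (real \<times> real \<times> real) set" where
  "Mz z = circle_data.M (cos (a 0)) (sin (a 0)) (cos (a 1)) (sin (a 1)) (cos (a 2)) (sin (a 2)) (cos (a 3)) (sin (a 3)) z"

definition Y2 :: "(nat \<Rightarrow> complex) \<Rightarrow> real" where
  "Y2 n = Yg (rq (a 1) (n 1)) (ht (n 2)) (n 2)"

text \<open>For a solution of the relation this is \<open>sin (a 1) * sin (a 3)\<close> times
  \<open>n 1 * cnj (n 3)\<close>. As the squared modulus of \<open>n\<close> is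
  \<open>(ht n)\<^sup>2 - 1\<close>, taking moduli gives the equation \<open>E\<close>.\<close>

definition W :: "real \<Rightarrow> real \<Rightarrow> real \<Rightarrow> real \<Rightarrow> complex" where
  "W z X Y T = of_real z * cis (a 0) * Complex (cos (a 2)) (sin (a 2) * Y) -
     Complex (cos (a 3)) (- (T * sin (a 3))) * Complex (cos (a 1)) (- (X * sin (a 1)))"

lemma W_norm:
  assumes z: "z = 1 \<or> z = - 1"
  shows "(cmod (W z X Y T))\<^sup>2 = (sin (a 1) * sin (a 3))\<^sup>2 * (X\<^sup>2 - 1) * (T\<^sup>2 - 1) \<longleftrightarrow>
    circle_data.E (cos (a 0)) (sin (a 0)) (cos (a 1)) (sin (a 1)) (cos (a 2)) (sin (a 2)) (cos (a 3)) (sin (a 3)) z X Y T"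
proof -
  interpret cd: circle_data "cos (a 0)" "sin (a 0)" "cos (a 1)" "sin (a 1)" "cos (a 2)" "sin (a 2)" "cos (a 3)" "sin (a 3)" z
    by (rule circle_data[OF z])
  define c0 s0 c1 s1 c2 s2 c3 s3 where defs: "c0 = cos (a 0)" "s0 = sin (a 0)" "c1 = cos (a 1)" "s1 = sin (a 1)"
    "c2 = cos (a 2)" "s2 = sin (a 2)" "c3 = cos (a 3)" "s3 = sin (a 3)"
  have u: "c0\<^sup>2 + s0\<^sup>2 = 1" "c1\<^sup>2 + s1\<^sup>2 = 1" "c2\<^sup>2 + s2\<^sup>2 = 1" "c3\<^sup>2 + s3\<^sup>2 = 1" by (simp_all add: defs)
  have zz: "z\<^sup>2 = 1" using z by auto
  have Re: "Re (W z X Y T) = z * (c0 * c2 - s0 * (s2 * Y)) - (c3 * c1 - T * s3 * (X * s1))"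
    by (simp add: W_def defs algebra_simps)
  have Im: "Im (W z X Y T) = z * (c0 * (s2 * Y) + s0 * c2) + (c3 * (X * s1) + T * s3 * c1)"
    by (simp add: W_def defs algebra_simps)
  have E: "cd.E X Y T \<longleftrightarrow> (s1 * X)\<^sup>2 + (s2 * Y)\<^sup>2 + 2 * (z * (c0 * c3 - s0 * s3 * T)) * (s1 * X) * (s2 * Y)
     + 2 * (z * (s0 * c3 + c0 * s3 * T)) * (c1 * (s2 * Y) + c2 * (s1 * X)) + (z * (s0 * c3 + c0 * s3 * T))\<^sup>2 +
     (c1 * c2 - s1 * s2 - z * (c0 * c3 - s0 * s3 * T)) * (c1 * c2 + s1 * s2 - z * (c0 * c3 - s0 * s3 * T)) = 0"
    unfolding cd.E_def cd.N_def cd.u_def cd.p_def cd.tau_def defs ..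
  have "(Re (W z X Y T))\<^sup>2 + (Im (W z X Y T))\<^sup>2 - (s1 * s3)\<^sup>2 * (X\<^sup>2 - 1) * (T\<^sup>2 - 1) =
    (s1 * X)\<^sup>2 + (s2 * Y)\<^sup>2 + 2 * (z * (c0 * c3 - s0 * s3 * T)) * (s1 * X) * (s2 * Y)
     + 2 * (z * (s0 * c3 + c0 * s3 * T)) * (c1 * (s2 * Y) + c2 * (s1 * X)) + (z * (s0 * c3 + c0 * s3 * T))\<^sup>2 +
     (c1 * c2 - s1 * s2 - z * (c0 * c3 - s0 * s3 * T)) * (c1 * c2 + s1 * s2 - z * (c0 * c3 - s0 * s3 * T))"
    unfolding Re Im using u zz by algebra
  then have "cd.E X Y T \<longleftrightarrow> (Re (W z X Y T))\<^sup>2 + (Im (W z X Y T))\<^sup>2 - (s1 * s3)\<^sup>2 * (X\<^sup>2 - 1) * (T\<^sup>2 - 1) = 0"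
    unfolding E by (simp only:)
  then show ?thesis unfolding cmod_sq defs by auto
qed

text \<open>Comparison of the first entries in \<open>rel_conj\<close>, solved for the off-diagonal
  product after multiplication by \<open>cis (a 0)\<close>; the factors \<open>z\<close> on both
  sides combine because \<open>z * z = 1\<close>.\<close>

lemma rel_product:
  assumes "rel a z n" "n 0 = 0" "z = 1 \<or> z = - 1"
  shows "of_real (sin (a 1) * sin (a 3)) * (n 1 * cnj (n 3)) = W z (ht (n 1)) (Y2 n) (ht (n 3))"
proof -
  have "fst (sm (si (rq (a 1) (n 1))) (sm (rq (a 2) (n 2)) (rq (a 1) (n 1)))) =
      Complex (cos (a 2)) (- (sin (a 2) * Y2 n))"
    unfolding Y2_def rq_def[of "a 2"] by (rule fst_conj[OF nrm_rq])
  then have "Complex (cos (a 2)) (- (sin (a 2) * Y2 n)) =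
      of_real z * cnj (fst (sm (rq (a 0) (n 0)) (sm (rq (a 3) (n 3)) (rq (a 1) (n 1)))))"
    unfolding rel_conj[OF assms(1)] by (simp add: sm_def si_def)
  then have "of_real z * cnj (Complex (cos (a 2)) (- (sin (a 2) * Y2 n))) =
      (of_real z * of_real z) * fst (sm (rq (a 0) (n 0)) (sm (rq (a 3) (n 3)) (rq (a 1) (n 1))))"
    by simp
  also have "of_real z * of_real z = (1 :: complex)" using assms(3) by auto
  finally have "of_real z * Complex (cos (a 2)) (sin (a 2) * Y2 n) =
      cis (- a 0) * (fst (rq (a 3) (n 3)) * fst (rq (a 1) (n 1)) + snd (rq (a 3) (n 3)) * cnj (snd (rq (a 1) (n 1))))"
    by (simp add: assms(2) rq_0 sm_def complex_cnj[symmetric] complex_eq_iff del: cis.simps)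
  then have "cis (a 0) * (of_real z * Complex (cos (a 2)) (sin (a 2) * Y2 n)) =
      (cis (a 0) * cis (- a 0)) * (fst (rq (a 3) (n 3)) * fst (rq (a 1) (n 1)) + snd (rq (a 3) (n 3)) * cnj (snd (rq (a 1) (n 1))))"
    by (simp only: mult.assoc)
  then show ?thesis
    by (simp add: cis_mult W_def rq_def algebra_simps)
qed

text \<open>The sum of the squared moduli of the entries is the height of
  \<open>2 * fst A * snd A\<close>, so \<open>Yg\<close> has the form bounded in
  \<open>ht_prod_bound\<close>.\<close>

lemma Yg_ge_1: assumes "nrm A" shows "1 \<le> Yg A (ht n) n"
proof -
  let ?m = "2 * (fst A * snd A)"
  have "(ht ?m)\<^sup>2 = ((cmod (fst A))\<^sup>2 + (cmod (snd A))\<^sup>2)\<^sup>2"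
    using assms unfolding ht_sq nrm_def norm_mult by simp algebra
  then have "ht ?m = (cmod (fst A))\<^sup>2 + (cmod (snd A))\<^sup>2"
    using ht_pos[of ?m] by (simp add: power2_eq_iff_nonneg)
  then show ?thesis using ht_prod_bound[of n ?m] by (simp add: Yg_def algebra_simps)
qed

lemma rel_trace:
  assumes "rel a z n" "n 0 = 0" "z = 1 \<or> z = - 1"
  shows "z * (cos (a 0) * cos (a 3) - sin (a 0) * sin (a 3) * ht (n 3)) =
    cos (a 1) * cos (a 2) - sin (a 1) * sin (a 2) * (ht (n 1) * ht (n 2) - Re (n 1 * cnj (n 2)))"
proof -
  let ?q = "\<lambda>j. rq (a j) (n j)"
  have "sm (?q 2) (?q 1) = sm (of_real z, 0) (si (sm (?q 0) (?q 3)))"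
    using assms(1) unfolding rel_iff
    by (simp add: si_sm sm_assoc nrm_rq sm_si sm_central_left)
  then have "Re (fst (sm (?q 2) (?q 1))) = z * Re (fst (sm (?q 0) (?q 3)))"
    by (simp add: sm_def si_def)
  then show ?thesis using assms(2)
    by (simp add: sm_def rq_def algebra_simps)
qed

lemma rel_Mz:
  assumes "rel a z n" "n 0 = 0" and z: "z = 1 \<or> z = - 1"
  shows "(ht (n 1), Y2 n, ht (n 3)) \<in> Mz z"
proof -
  interpret cd: circle_data "cos (a 0)" "sin (a 0)" "cos (a 1)" "sin (a 1)" "cos (a 2)" "sin (a 2)" "cos (a 3)" "sin (a 3)" z
    by (rule circle_data[OF z])
  have "(cmod (W z (ht (n 1)) (Y2 n) (ht (n 3))))\<^sup>2 =
      (sin (a 1) * sin (a 3))\<^sup>2 * ((ht (n 1))\<^sup>2 - 1) * ((ht (n 3))\<^sup>2 - 1)"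
    unfolding rel_product[OF assms, symmetric] ht_sq norm_mult norm_of_real by (simp add: power_mult_distrib)
  then have E: "cd.E (ht (n 1)) (Y2 n) (ht (n 3))" using W_norm[OF z] by blast
  have "1 \<le> ht (n 1) * ht (n 2) - Re (n 1 * cnj (n 2))"
    using ht_prod_bound[of "n 1" "cnj (n 2)"] by (simp add: ht_def)
  then have "sin (a 1) * sin (a 2) * 1 \<le> sin (a 1) * sin (a 2) * (ht (n 1) * ht (n 2) - Re (n 1 * cnj (n 2)))"
    using sin_pos[of 1] sin_pos[of 2] by (intro mult_left_mono) auto
  then have "cd.u (ht (n 3)) \<le> cos (a 1) * cos (a 2) - sin (a 1) * sin (a 2)"
    using rel_trace[OF assms] unfolding cd.u_def cd.tau_def by linarith
  then show ?thesis using E ht_ge_1 Yg_ge_1[OF nrm_rq] by (simp add: Mz_def cd.M_def Y2_def)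
qed

text \<open>The phases of \<open>n\<^sub>1\<close> and \<open>n\<^sub>3\<close> are chosen to match
  \<open>W\<close>, and \<open>R\<^sub>2\<close> is defined by the relation. It remains to see that
  this matrix is a rotation with the prescribed angle: its trace is right, and
  \<open>Y \<ge> 1\<close> fixes its sense.\<close>

lemma Mz_rel:
  assumes m: "(X, Y, T) \<in> Mz z" and z: "z = 1 \<or> z = - 1"
  shows "\<exists>n. n 0 = 0 \<and> rel a z n \<and> ht (n 1) = X \<and> Y2 n = Y \<and> ht (n 3) = T"
proof -
  interpret cd: circle_data "cos (a 0)" "sin (a 0)" "cos (a 1)" "sin (a 1)" "cos (a 2)" "sin (a 2)" "cos (a 3)" "sin (a 3)" z
    by (rule circle_data[OF z])
  have XYT: "1 \<le> X" "1 \<le> Y" "1 \<le> T" "cd.E X Y T" using m by (auto simp: Mz_def cd.M_def)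
  note s = sin_pos[of 1, simplified] sin_pos[of 2, simplified] sin_pos[of 3, simplified]
  define \<kappa> where "\<kappa> = W z X Y T / of_real (sin (a 1) * sin (a 3))"
  have sq: "0 \<le> X\<^sup>2 - 1" "0 \<le> T\<^sup>2 - 1" using one_le_power[of X 2] one_le_power[of T 2] XYT by auto
  have \<kappa>: "(cmod \<kappa>)\<^sup>2 = (X\<^sup>2 - 1) * (T\<^sup>2 - 1)"
    using W_norm[OF z, of X Y T] XYT(4) s
    by (simp add: \<kappa>_def norm_divide norm_mult power_divide power_mult_distrib)
  \<comment> \<open>The moduli of \<open>n1\<close> and \<open>n3\<close> are prescribed, and by
    \<open>E\<close> their product is the modulus of \<open>\<kappa>\<close>. If
    \<open>X = 1\<close>, then \<open>n1\<close> and \<open>\<kappa>\<close> vanish and the phase of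
    \<open>n3\<close> is free.\<close>
  obtain n1 n3 where n13: "ht n1 = X" "ht n3 = T" "n1 * cnj n3 = \<kappa>"
  proof (cases "X = 1")
    case True
    then have "\<kappa> = 0" using \<kappa> by simp
    moreover have "ht (of_real (sqrt (T\<^sup>2 - 1))) = T" using sq XYT by (simp add: ht_def)
    ultimately show ?thesis using True that[of 0 "of_real (sqrt (T\<^sup>2 - 1))"] by simp
  next
    case False
    define r where "r = sqrt (X\<^sup>2 - 1)"
    have "X\<^sup>2 \<noteq> 1" using False XYT by (auto simp: power2_eq_1_iff)
    then have r: "0 < r" "r\<^sup>2 = X\<^sup>2 - 1" using sq by (auto simp: r_def)
    have "ht (of_real r) = X" using r XYT by (simp add: ht_def)
    moreover have "ht (cnj (\<kappa> / of_real r)) = T"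
    proof -
      have "(cmod (cnj (\<kappa> / of_real r)))\<^sup>2 = T\<^sup>2 - 1"
        using \<kappa> r(1) unfolding r(2)[symmetric] by (simp add: norm_divide power_divide)
      then show ?thesis using XYT by (simp add: ht_def)
    qed
    ultimately show ?thesis using that[of "of_real r" "cnj (\<kappa> / of_real r)"] r by simp
  qed
  let ?q0 = "rq (a 0) 0" and ?q1 = "rq (a 1) n1" and ?q3 = "rq (a 3) n3"
  define q2 where "q2 = sm (of_real z, 0) (si (sm ?q1 (sm ?q0 ?q3)))"
  have "nrm q2" unfolding q2_def using z by (intro nrm_sm) (auto simp: nrm_def[of "(_, 0)"] nrm_sm nrm_rq)
  have fst3: "fst (sm ?q0 (sm ?q3 ?q1)) = of_real z * Complex (cos (a 2)) (sin (a 2) * Y)"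
  proof -
    have "of_real (sin (a 1) * sin (a 3)) * (n1 * cnj n3) = W z X Y T"
      unfolding n13 \<kappa>_def using s by simp
    moreover have "snd ?q3 * cnj (snd ?q1) = of_real (sin (a 1) * sin (a 3)) * (n1 * cnj n3)"
      by (simp add: rq_def algebra_simps)
    ultimately have "snd ?q3 * cnj (snd ?q1) = W z X Y T" by simp
    moreover have "fst ?q3 * fst ?q1 =
        Complex (cos (a 3)) (- (T * sin (a 3))) * Complex (cos (a 1)) (- (X * sin (a 1)))"
      by (simp add: rq_def n13(1,2))
    ultimately have "fst ?q3 * fst ?q1 + snd ?q3 * cnj (snd ?q1) = of_real z * cis (a 0) * Complex (cos (a 2)) (sin (a 2) * Y)"
      by (simp only: W_def) simp
    then have "fst (sm ?q0 (sm ?q3 ?q1)) = cis (- a 0) * (of_real z * cis (a 0) * Complex (cos (a 2)) (sin (a 2) * Y))"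
      by (simp add: sm_def rq_0 del: cis.simps)
    also have "\<dots> = (cis (- a 0) * cis (a 0)) * (of_real z * Complex (cos (a 2)) (sin (a 2) * Y))"
      by (simp only: ac_simps)
    finally show ?thesis by (simp add: cis_mult)
  qed
  have zz: "z * z = 1" using z by auto
  have Req2: "Re (fst q2) = cos (a 2)"
  proof -
    have "Re (fst q2) = z * Re (fst (sm ?q1 (sm ?q0 ?q3)))"
      unfolding q2_def by (rule Re_fst_scaled_inverse)
    also have "Re (fst (sm ?q1 (sm ?q0 ?q3))) = Re (fst (sm ?q0 (sm ?q3 ?q1)))"
      by (metis fst_sm_commute sm_assoc)
    finally show ?thesis unfolding fst3 using zz by (simp add: mult.assoc[symmetric])
  qed
  define n2 where "n2 = cnj (snd q2 / (\<i> * sin (a 2)))"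
  have snd2: "snd q2 = \<i> * cnj n2 * sin (a 2)" using s by (simp add: n2_def)
  define y where "y = - Im (fst q2) / sin (a 2)"
  have fst2: "fst q2 = Complex (cos (a 2)) (- (y * sin (a 2)))"
    using Req2 s by (simp add: y_def complex_eq_iff)
  have "y\<^sup>2 * (sin (a 2))\<^sup>2 = (1 + (cmod n2)\<^sup>2) * (sin (a 2))\<^sup>2"
  proof -
    have "(cos (a 2))\<^sup>2 + (y * sin (a 2))\<^sup>2 - (cmod n2 * sin (a 2))\<^sup>2 = 1"
      using \<open>nrm q2\<close> s by (simp add: nrm_def fst2 snd2 cmod_sq[of "Complex _ _"] norm_mult)
    then show ?thesis using sin_cos_squared_add2[of "a 2"] by algebra
  qed
  then have "y\<^sup>2 = (ht n2)\<^sup>2" using s by (simp add: ht_sq)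
  then have y: "y = ht n2 \<or> y = - ht n2" by (simp add: power2_eq_iff)
  have conj: "sm (si ?q1) (sm q2 ?q1) = sm (of_real z, 0) (si (sm ?q0 (sm ?q3 ?q1)))"
    unfolding q2_def by (simp add: si_sm sm_assoc nrm_rq sm_si sm_central_left)
  have "q2 = (Complex (cos (a 2)) (- (y * sin (a 2))), \<i> * cnj n2 * sin (a 2))"
    using fst2 snd2 by (simp add: prod_eq_iff)
  then have "Complex (cos (a 2)) (- (sin (a 2) * Yg ?q1 y n2)) = fst (sm (si ?q1) (sm q2 ?q1))"
    using fst_conj[OF nrm_rq] by metis
  also have "\<dots> = of_real z * cnj (fst (sm ?q0 (sm ?q3 ?q1)))"
    unfolding conj by (simp add: sm_def si_def)
  also have "\<dots> = (of_real z * of_real z) * cnj (Complex (cos (a 2)) (sin (a 2) * Y))"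
    unfolding fst3 by simp
  also have "of_real z * of_real z = (1 :: complex)" using z by auto
  finally have Y: "Yg ?q1 y n2 = Y" using s by (simp add: complex_eq_iff)
  \<comment> \<open>The negative sign would mean a rotation with \<open>- a 2\<close> about the
    point \<open>- n2\<close>; it would make the second coordinate at most 0.\<close>
  have "y = ht n2"
  proof (rule ccontr)
    assume "y \<noteq> ht n2"
    then have "y = - ht n2" using y by simp
    then have "Yg ?q1 y n2 = - Yg ?q1 (ht n2) (- n2)" by (simp add: Yg_def)
    moreover have "0 \<le> Yg ?q1 (ht n2) (- n2)"
      using Yg_bounds[of "ht n2" "- n2" ?q1] ht_pos[of n2] cmod_less_ht[of n2] by simp
    ultimately show False using Y XYT by simp
  qed
  define n where "n = (\<lambda>j :: nat. if j = 0 then 0 else if j = 1 then n1 else if j = 2 then n2 else n3)"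
  have n: "n 0 = 0" "n 1 = n1" "n 2 = n2" "n 3 = n3" by (simp_all add: n_def)
  have "q2 = rq (a 2) n2" using fst2 snd2 \<open>y = ht n2\<close> by (simp add: rq_def prod_eq_iff)
  then have "rel a z n" unfolding rel_iff n q2_def by simp
  then show ?thesis using n n13 Y \<open>y = ht n2\<close> by (intro exI[of _ n]) (simp add: Y2_def)
qed

text \<open>Conjugation by the rotation about the origin that multiplies every \<open>n\<close> by
  the unit number \<open>\<zeta>\<close>.\<close>

definition rt :: "complex \<Rightarrow> complex \<times> complex \<Rightarrow> complex \<times> complex" where
  "rt \<zeta> A = (fst A, cnj \<zeta> * snd A)"

lemma rt_sm: assumes "cmod \<zeta> = 1" shows "rt \<zeta> (sm A B) = sm (rt \<zeta> A) (rt \<zeta> B)"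
proof -
  have "cnj \<zeta> * \<zeta> = 1" using assms by (simp add: complex_norm_square[symmetric] mult.commute)
  then show ?thesis by (simp add: rt_def sm_def algebra_simps)
qed

lemma rt_rq: "cmod \<zeta> = 1 \<Longrightarrow> rt \<zeta> (rq b n) = rq b (\<zeta> * n)"
  by (simp add: rt_def rq_def ht_unit ac_simps)

text \<open>The heights fix the moduli of \<open>n 1\<close> and \<open>n 3\<close>, and
  \<open>rel_product\<close> fixes their relative phase. So they agree up to a common phase, and the
  relation propagates it to \<open>n 2\<close>.\<close>

lemma rel_unique:
  assumes r: "rel a z n" "rel a z m" and 0: "n 0 = 0" "m 0 = 0" and z: "z = 1 \<or> z = - 1"
    and eq: "ht (m 1) = ht (n 1)" "Y2 m = Y2 n" "ht (m 3) = ht (n 3)"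
  shows "\<exists>\<zeta>. cmod \<zeta> = 1 \<and> (\<forall>j\<le>3. m j = \<zeta> * n j)"
proof -
  note s = sin_pos[of 1, simplified] sin_pos[of 2, simplified] sin_pos[of 3, simplified]
  have pr: "n 1 * cnj (n 3) = m 1 * cnj (m 3)"
  proof -
    have "complex_of_real (sin (a 1) * sin (a 3)) * (n 1 * cnj (n 3)) = of_real (sin (a 1) * sin (a 3)) * (m 1 * cnj (m 3))"
      using rel_product[OF r(1) 0(1) z] rel_product[OF r(2) 0(2) z] eq by simp
    moreover have "complex_of_real (sin (a 1) * sin (a 3)) \<noteq> 0" using s by simp
    ultimately show ?thesis by (metis mult_left_cancel)
  qed
  have cm: "cmod (m 1) = cmod (n 1)" "cmod (m 3) = cmod (n 3)"
    using eq by (simp_all add: ht_def)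
  obtain \<zeta> where \<zeta>: "cmod \<zeta> = 1" "m 1 = \<zeta> * n 1" "m 3 = \<zeta> * n 3"
  \<comment> \<open>If \<open>n 1\<close> vanishes, the phase must be read off from
    \<open>n 3\<close>; if both vanish, 1 serves.\<close>
  proof (cases "n 1 = 0")
    case True
    show ?thesis
    proof (cases "n 3 = 0")
      case n3: True
      show ?thesis using that[of 1] True n3 cm by simp
    next
      case False
      show ?thesis using that[of "m 3 / n 3"] True False cm by (simp add: norm_divide)
    qed
  next
    case False
    define \<zeta> where "\<zeta> = m 1 / n 1"
    have \<zeta>: "cmod \<zeta> = 1" "m 1 = \<zeta> * n 1" using False cm by (simp_all add: \<zeta>_def norm_divide)
    have "\<zeta> * cnj \<zeta> = 1" using \<zeta>(1) by (simp add: complex_norm_square[symmetric])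
    moreover have "cnj (n 3) = \<zeta> * cnj (m 3)" using pr False \<zeta>(2) by simp
    then have "n 3 = cnj \<zeta> * m 3" by (metis complex_cnj_cnj complex_cnj_mult)
    ultimately have "m 3 = \<zeta> * n 3" by (simp add: mult.assoc[symmetric])
    then show ?thesis using that \<zeta> by blast
  qed
  have "rt \<zeta> (rq (a 2) (n 2)) = sm (of_real z, 0) (si (sm (rq (a 1) (m 1)) (sm (rq (a 0) (m 0)) (rq (a 3) (m 3)))))"
  proof -
    have "rt \<zeta> (si A) = si (rt \<zeta> A)" for A by (simp add: rt_def si_def)
    moreover have "rt \<zeta> (of_real z, 0) = (of_real z, 0)" by (simp add: rt_def)
    ultimately show ?thesis
      using r(1) unfolding rel_iff by (simp add: rt_sm[OF \<zeta>(1)] rt_rq[OF \<zeta>(1)] \<zeta> 0)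
  qed
  also have "\<dots> = rq (a 2) (m 2)" using r(2) unfolding rel_iff by simp
  finally have "rq (a 2) (\<zeta> * n 2) = rq (a 2) (m 2)" using rt_rq[OF \<zeta>(1)] by simp
  then have "cnj (\<zeta> * n 2) = cnj (m 2)" using s by (simp add: rq_def)
  then have "m 2 = \<zeta> * n 2" by (simp only: complex_cnj_cancel_iff)
  then have "m j = \<zeta> * n j" if "j \<le> 3" for j
  proof -
    have "j = 0 \<or> j = 1 \<or> j = 2 \<or> j = 3" using that by auto
    then show ?thesis using \<zeta> 0 \<open>m 2 = \<zeta> * n 2\<close> by auto
  qed
  then show ?thesis using \<zeta>(1) by blast
qed

end

section \<open>Coordinates on the hyperbolic plane in an orthonormal basis\<close>

locale hermitian_basis = hermitian_plane scl h for scl :: "complex \<Rightarrow> 'v::ab_group_add \<Rightarrow> 'v" (infixr \<open>*\<^sub>V\<close> 75) and h +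
  fixes e f :: 'v
  assumes onb: "h e e = 1" "h f f = - 1" "h e f = 0"
begin

definition vec :: "complex \<Rightarrow> complex \<Rightarrow> 'v" where "vec x y = x *\<^sub>V e + y *\<^sub>V f"

lemma h_fe: "h f e = 0" using hermitian[of f e] onb by simp

lemma h_vec: "h (vec x y) (vec x' y') = x * cnj x' - y * cnj y'"
  by (simp add: vec_def form_add_left form_add_right form_scale_left form_scale_right onb h_fe)

lemma h_vec_ef: "h (vec x y) e = x" "h (vec x y) f = - y"
  by (simp_all add: vec_def form_add_left form_scale_left onb h_fe)

lemma vec_expansion: "v = vec (h v e) (- h v f)"
  unfolding vec_def by (rule orthonormal_expansion[OF onb])

lemma vec_cases: obtains x y where "v = vec x y"
  using vec_expansion by blast

lemma vec_inject [simp]: "vec x y = vec x' y' \<longleftrightarrow> x = x' \<and> y = y'"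
  by (metis h_vec_ef minus_minus)

lemma vec_add: "vec x y + vec x' y' = vec (x + x') (y + y')"
  by (simp add: vec_def scale_left_distrib ac_simps)

lemma vec_scale: "k *\<^sub>V vec x y = vec (k * x) (k * y)"
  by (simp add: vec_def scale_right_distrib)

lemma vec_0: "vec 0 0 = 0" by (simp add: vec_def)

text \<open>The quotient \<open>n / (1 + ht n)\<close> of the coordinates is the stereographic
  projection of the hyperboloid point to the unit disc.\<close>

definition pv :: "complex \<Rightarrow> 'v" where "pv n = vec (of_real (1 + ht n)) n"
definition pt :: "complex \<Rightarrow> 'v set" where "pt n = span {pv n}"

lemma h_pv: "h (pv n) (pv m) = of_real ((1 + ht n) * (1 + ht m)) - n * cnj m"
  by (simp add: pv_def h_vec)

lemma h_pv_self: "h (pv n) (pv n) = of_real (2 * (1 + ht n))"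
proof -
  have "(1 + ht n) * (1 + ht n) - (cmod n)\<^sup>2 = 2 * (1 + ht n)"
    using ht_sq[of n] by (simp add: power2_eq_square algebra_simps)
  then show ?thesis unfolding h_pv complex_norm_square[symmetric] of_real_diff[symmetric] by simp
qed

lemma pv_nonzero: "pv n \<noteq> 0"
proof
  assume "pv n = 0"
  then have "2 * (1 + ht n) = 0" using h_pv_self[of n] by (metis form_zero(1) of_real_eq_0_iff)
  then show False using ht_pos[of n] by simp
qed

lemma pt_BV: "pt n \<in> BV"
  unfolding BV_def pt_def using h_pv_self[of n] ht_pos[of n] by auto

lemma BV_pt: assumes "c \<in> BV" obtains n where "c = pt n"
proof -
  obtain v where v: "c = span {v}" "Re (h v v) > 0" using assms by (auto simp: BV_def)
  obtain x y where xy: "v = vec x y" by (rule vec_cases)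
  have pos: "(cmod y)\<^sup>2 < (cmod x)\<^sup>2"
    using v(2) unfolding xy h_vec complex_norm_square[symmetric] of_real_diff[symmetric] by simp
  then have x: "x \<noteq> 0" by auto
  define w where "w = y / x"
  define r where "r = (cmod w)\<^sup>2"
  have r: "0 \<le> r" "r < 1" using pos x by (simp_all add: r_def w_def norm_divide power_divide)
  \<comment> \<open>The inverse of the stereographic projection, applied to the disc coordinate
    \<open>w\<close>.\<close>
  define n where "n = of_real (2 / (1 - r)) * w"
  have "(cmod n)\<^sup>2 = (2 / (1 - r))\<^sup>2 * r"
    unfolding n_def norm_mult norm_of_real power_mult_distrib power2_abs r_def ..
  then have "1 + (cmod n)\<^sup>2 = ((1 + r) / (1 - r))\<^sup>2"
    using r by (simp add: power2_eq_square divide_simps) (simp add: algebra_simps)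
  then have ht: "ht n = (1 + r) / (1 - r)" unfolding ht_def using r by simp
  have 1: "1 + ht n = 2 / (1 - r)" using r unfolding ht by (simp add: field_simps)
  define q where "q = complex_of_real (2 / (1 - r))"
  have a: "complex_of_real (1 + ht n) = q / x * x" using x unfolding 1 q_def by simp
  have b: "n = q / x * y" unfolding n_def q_def w_def by simp
  have "pv n = (q / x) *\<^sub>V v"
    unfolding pv_def xy vec_scale vec_inject using a b by blast
  moreover have "q / x \<noteq> 0" using x r by (simp add: q_def)
  ultimately have "pt n = c" unfolding pt_def v by (metis span_scale_eq)
  then show ?thesis using that by blast
qed

text \<open>First coordinates are positive reals, so proportional representatives differ by a
  positive real factor \<open>r\<close>. It multiplies \<open>1 + ht\<close> by \<open>r\<close>,
  while the self-product, which is linear in \<open>1 + ht\<close>, is multiplied by the square of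
  \<open>r\<close>; hence \<open>r = 1\<close>.\<close>

lemma pt_inj: assumes "pt n = pt m" shows "n = m"
proof -
  have "pv n \<in> span {pv m}" using assms span_base unfolding pt_def by blast
  then obtain k where k: "pv n = k *\<^sub>V pv m" by (auto simp: in_span_singleton)
  then have 1: "of_real (1 + ht n) = k * of_real (1 + ht m)" "n = k * m"
    unfolding pv_def vec_scale vec_inject by blast+
  define r where "r = (1 + ht n) / (1 + ht m)"
  have "complex_of_real (1 + ht m) \<noteq> 0" using ht_pos[of m] unfolding of_real_eq_0_iff by linarith
  then have "k = of_real (1 + ht n) / of_real (1 + ht m)" unfolding 1(1) by simp
  then have kr: "k = of_real r" by (simp only: r_def of_real_divide)
  have r: "1 + ht n = r * (1 + ht m)" "0 < r" using ht_pos[of m] ht_pos[of n] by (simp_all add: r_def)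
  have "2 * (1 + ht n) = r * r * (2 * (1 + ht m))"
  proof -
    have "complex_of_real (2 * (1 + ht n)) = h (pv n) (pv n)" by (simp only: h_pv_self)
    also have "\<dots> = k * (cnj k * h (pv m) (pv m))" unfolding k form_scale_left form_scale_right by (rule mult.left_commute)
    also have "\<dots> = of_real (r * r * (2 * (1 + ht m)))" unfolding h_pv_self kr by simp
    finally show ?thesis by (simp only: of_real_eq_iff)
  qed
  then have "r * (1 + ht m) * (r - 1) = 0" using r(1) by algebra
  moreover have "r * (1 + ht m) \<noteq> 0" using r(2) ht_pos[of m] by simp
  ultimately have "r = 1" by simp
  then show ?thesis using 1 kr by simp
qed

definition un :: "'v set \<Rightarrow> complex" where "un c = (THE n. c = pt n)"

lemma un_pt [simp]: "un (pt n) = n"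
  unfolding un_def by (rule the_equality) (auto dest: pt_inj)

lemma pt_un [simp]: "c \<in> BV \<Longrightarrow> pt (un c) = c"
  by (erule BV_pt) simp

text \<open>Twice the value minus 1 is the Lorentz product of the two hyperboloid points; this is
  why \<open>2 * t - 1\<close> is the convenient form of the coordinates.\<close>

lemma ta_pt: "ta (pt n) (pt m) = (1 + ht n * ht m - Re (n * cnj m)) / 2"
proof -
  define A where "A = (1 + ht n) * (1 + ht m)"
  have A: "0 < A" using ht_pos[of n] ht_pos[of m] by (simp add: A_def)
  have "ta (pt n) (pt m) = Re ((of_real A - n * cnj m) * (of_real A - m * cnj n) / of_real (4 * A))"
    unfolding pt_def ta_span[OF pv_nonzero pv_nonzero] h_pv_self h_pv by (simp add: A_def algebra_simps)
  also have "\<dots> = Re ((of_real A - n * cnj m) * (of_real A - m * cnj n)) / (4 * A)"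
    by (rule Re_divide_of_real)
  also have "Re ((of_real A - n * cnj m) * (of_real A - m * cnj n)) = A\<^sup>2 - 2 * A * Re (n * cnj m) + (cmod n)\<^sup>2 * (cmod m)\<^sup>2"
    unfolding cmod_sq by simp algebra
  also have "(cmod n)\<^sup>2 * (cmod m)\<^sup>2 = A * ((ht n - 1) * (ht m - 1))"
    using ht_sq[of n] ht_sq[of m] unfolding A_def by algebra
  also have "(A\<^sup>2 - 2 * A * Re (n * cnj m) + A * ((ht n - 1) * (ht m - 1))) / (4 * A) =
      (A - 2 * Re (n * cnj m) + (ht n - 1) * (ht m - 1)) / 4"
    using A by (simp add: power2_eq_square field_simps)
  also have "\<dots> = (1 + ht n * ht m - Re (n * cnj m)) / 2" by (simp add: A_def field_simps)
  finally show ?thesis .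
qed

definition mat :: "complex \<times> complex \<Rightarrow> 'v \<Rightarrow> 'v" where
  "mat A v = vec (fst A * h v e - snd A * h v f) (cnj (snd A) * h v e - cnj (fst A) * h v f)"

lemma mat_vec: "mat A (vec x y) = vec (fst A * x + snd A * y) (cnj (snd A) * x + cnj (fst A) * y)"
  by (simp add: mat_def h_vec_ef)

lemma mat_sm: "mat A \<circ> mat B = mat (sm A B)"
proof
  fix v obtain x y where "v = vec x y" by (rule vec_cases)
  then show "(mat A \<circ> mat B) v = mat (sm A B) v"
    by (simp add: mat_vec sm_def algebra_simps)
qed

lemma unitary_mat: assumes "nrm A" shows "unitary (mat A)"
proof (rule unitaryI)
  fix u v :: 'v and k
  obtain x y where u: "u = vec x y" by (rule vec_cases)
  obtain x' y' where v: "v = vec x' y'" by (rule vec_cases)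
  show "mat A (u + v) = mat A u + mat A v" by (simp add: u v vec_add mat_vec algebra_simps)
  show "mat A (k *\<^sub>V u) = k *\<^sub>V mat A u" by (simp add: u vec_scale mat_vec algebra_simps)
  show "h (mat A u) (mat A v) = h u v"
    using assms unfolding nrm_complex u v mat_vec h_vec by simp algebra
qed

text \<open>A scalar matrix of determinant 1 in this group is 1 or - 1; this is the origin of the
  two values of \<open>z\<close>.\<close>

lemma trivial_mat: assumes "nrm A"
  shows "trivial_in_PU (mat A) \<longleftrightarrow> A = (of_real 1, 0) \<or> A = (of_real (- 1), 0)"
proof
  assume "trivial_in_PU (mat A)"
  then obtain z where z: "\<And>v. mat A v = z *\<^sub>V v" by (auto simp: trivial_in_PU_def)
  have 1: "fst A = z" "snd A = 0" using z[of "vec 1 0"] by (simp_all add: mat_vec vec_scale)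
  have 2: "cnj (fst A) = z" using z[of "vec 0 1"] by (simp add: mat_vec vec_scale)
  have "z * z = 1" using assms unfolding nrm_complex 2 by (simp add: 1)
  then have "z = 1 \<or> z = - 1" by (simp add: square_eq_1_iff)
  then show "A = (of_real 1, 0) \<or> A = (of_real (- 1), 0)" using 1 by (auto simp: prod_eq_iff)
next
  assume A: "A = (of_real 1, 0) \<or> A = (of_real (- 1), 0)"
  have "mat A v = fst A *\<^sub>V v" for v
  proof -
    obtain x y where "v = vec x y" by (rule vec_cases)
    then show ?thesis using A by (auto simp: mat_vec vec_scale)
  qed
  then show "trivial_in_PU (mat A)" using A unfolding trivial_in_PU_def by (intro exI[of _ "fst A"]) auto
qed

lemma rot_pt: "rot (pt n) (cis b) = mat (rq b n)"
proof
  fix v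
  obtain x y where v: "v = vec x y" by (rule vec_cases)
  define r where "r = 1 + ht n"
  have r: "r \<noteq> 0" "n * cnj n = of_real (r * (r - 2))"
    using ht_pos[of n] ht_sq[of n] unfolding complex_norm_square[symmetric]
    by (simp_all add: r_def power2_eq_square algebra_simps)
  have k: "cnj (cis b) - cis b = - 2 * \<i> * of_real (sin b)" by (simp add: complex_eq_iff)
  have hv: "h v (pv n) = x * of_real r - y * cnj n" by (simp add: v pv_def h_vec r_def)
  define g where "g = - \<i> * of_real (sin b) * (x * of_real r - y * cnj n) / of_real r"
  have "rot (pt n) (cis b) v = g *\<^sub>V pv n + cis b *\<^sub>V v"
    unfolding pt_def rot_span[OF pv_nonzero] k hv h_pv_self r_def[symmetric] g_def
    using r(1) by (simp add: field_simps)
  also have "\<dots> = vec (g * of_real r + cis b * x) (g * n + cis b * y)"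
    by (simp add: v pv_def vec_scale vec_add r_def)
  also have "\<dots> = mat (rq b n) v"
  proof -
    have gr: "g * of_real r = - \<i> * of_real (sin b) * (x * of_real r - y * cnj n)" using r(1) by (simp add: g_def)
    then have 1: "g * of_real r + cis b * x = fst (rq b n) * x + snd (rq b n) * y"
      by (simp add: rq_def r_def complex_eq_iff) (simp add: algebra_simps)
    have "of_real r * (g * n) = of_real r * (- \<i> * of_real (sin b) * (x * n - y * of_real (r - 2)))"
    proof -
      have "of_real r * (g * n) = - \<i> * of_real (sin b) * (x * of_real r * n - y * (n * cnj n))"
        using gr by algebra
      then show ?thesis unfolding r(2) by (simp add: algebra_simps)
    qed
    then have "g * n = - \<i> * of_real (sin b) * (x * n - y * of_real (r - 2))"
      using r(1) by (metis mult_left_cancel of_real_eq_0_iff)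
    then have 2: "g * n + cis b * y = cnj (snd (rq b n)) * x + cnj (fst (rq b n)) * y"
      by (simp add: rq_def r_def complex_eq_iff) (simp add: algebra_simps)
    show ?thesis unfolding v mat_vec 1 2 ..
  qed
  finally show "rot (pt n) (cis b) v = mat (rq b n) v" .
qed

text \<open>Identifies the second coordinate of a hexagon normalised at the origin with the height
  computed in \<open>fst_conj\<close>.\<close>

lemma rot_pt_0:
  "2 * ta (pt m) (rot (pt n) (cis b) ` pt 0) - 1 = Yg (rq b n) (ht m) m"
proof -
  let ?A = "rq b n"
  define r where "r = 1 + ht m"
  have r: "0 < r" "(cmod m)\<^sup>2 = r * (r - 2)" using ht_pos[of m] ht_sq[of m] by (simp_all add: r_def power2_eq_square algebra_simps)
  have e: "pt 0 = span {vec 1 0}"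
    using span_scale_eq[of 2 "vec 1 0"] by (simp add: pt_def pv_def vec_scale)
  have "rot (pt n) (cis b) ` pt 0 = span {vec (fst ?A) (cnj (snd ?A))}"
    unfolding rot_pt e unitary_span[OF unitary_mat[OF nrm_rq]] mat_vec by simp
  moreover have h1: "h (vec (fst ?A) (cnj (snd ?A))) (vec (fst ?A) (cnj (snd ?A))) = 1"
    using nrm_rq[of b n] unfolding nrm_complex h_vec by (simp add: mult.commute)
  then have "vec (fst ?A) (cnj (snd ?A)) \<noteq> 0" using form_zero by fastforce
  ultimately have "ta (pt m) (rot (pt n) (cis b) ` pt 0) =
      Re ((of_real r * cnj (fst ?A) - m * snd ?A) * (fst ?A * of_real r - cnj (snd ?A) * cnj m) / of_real (2 * r))"
    unfolding pt_def[of m] using ta_span[OF pv_nonzero] h1 h_pv_self[of m]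
    by (simp add: h_vec pv_def r_def)
  also have "\<dots> = Re ((of_real r * cnj (fst ?A) - m * snd ?A) * (fst ?A * of_real r - cnj (snd ?A) * cnj m)) / (2 * r)"
    by (rule Re_divide_of_real)
  also have "Re ((of_real r * cnj (fst ?A) - m * snd ?A) * (fst ?A * of_real r - cnj (snd ?A) * cnj m)) =
      r\<^sup>2 * (cmod (fst ?A))\<^sup>2 - 2 * r * Re (fst ?A * snd ?A * m) + (cmod m)\<^sup>2 * (cmod (snd ?A))\<^sup>2"
    unfolding cmod_sq by simp algebra
  also have "\<dots> / (2 * r) = (r * (cmod (fst ?A))\<^sup>2 - 2 * Re (fst ?A * snd ?A * m) + (r - 2) * (cmod (snd ?A))\<^sup>2) / 2"
    unfolding r(2) using r(1) by (simp add: power2_eq_square field_simps)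
  finally show ?thesis using nrm_rq[of b n] unfolding nrm_def Yg_def r_def by (simp add: algebra_simps)
qed

text \<open>The boost along the geodesic from the point to the origin; \<open>r\<close> normalises
  the determinant, since \<open>(1 + ht n)\<^sup>2\<close> minus the squared modulus of
  \<open>n\<close> is \<open>2 * (1 + ht n)\<close>.\<close>

lemma to_origin: obtains A where "nrm A" "mat A ` pt n = pt 0"
proof -
  define r where "r = sqrt (2 * (1 + ht n))"
  have r: "0 < r" "r\<^sup>2 = 2 * (1 + ht n)" using ht_pos[of n] by (simp_all add: r_def)
  define A where "A = (complex_of_real ((1 + ht n) / r), - cnj n / of_real r)"
  have "(cmod (fst A))\<^sup>2 - (cmod (snd A))\<^sup>2 = ((1 + ht n)\<^sup>2 - (cmod n)\<^sup>2) / r\<^sup>2"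
    unfolding A_def fst_conv snd_conv norm_of_real norm_divide norm_minus_cancel power2_abs power_divide
    by (simp add: diff_divide_distrib)
  also have "\<dots> = 1"
    unfolding r(2) using ht_sq[of n] ht_pos[of n] by (simp add: power2_eq_square algebra_simps)
  finally have nA: "nrm A" by (simp add: nrm_def)
  have "mat A (pv n) = vec (fst A * of_real (1 + ht n) + snd A * n) 0"
    by (simp add: pv_def mat_vec A_def algebra_simps add_divide_distrib)
  also have "\<dots> = ((fst A * of_real (1 + ht n) + snd A * n) / 2) *\<^sub>V pv 0"
    by (simp add: pv_def vec_scale)
  finally have eq: "mat A (pv n) = ((fst A * of_real (1 + ht n) + snd A * n) / 2) *\<^sub>V pv 0" .
  moreover have "mat A (pv n) \<noteq> 0" using unitary_eq_0[OF unitary_mat[OF nA]] pv_nonzero by simp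
  ultimately have "span {mat A (pv n)} = span {pv 0}" by (metis span_scale_eq scale_zero_left)
  then have "mat A ` pt n = pt 0" unfolding pt_def unitary_span[OF unitary_mat[OF nA]] .
  then show ?thesis using that nA by blast
qed

lemma rotate_unit:
  assumes "cmod \<zeta> = 1" obtains F where "unitary F" "\<And>n. F ` pt n = pt (\<zeta> * n)"
proof -
  define g where "g v = vec (h v e) (\<zeta> * - h v f)" for v
  have g: "g (vec x y) = vec x (\<zeta> * y)" for x y by (simp add: g_def h_vec_ef)
  have \<zeta>: "\<zeta> * cnj \<zeta> = 1" using assms by (simp add: complex_norm_square[symmetric])
  have u: "unitary g"
  proof (rule unitaryI)
    fix u v :: 'v and k
    obtain x y where u: "u = vec x y" by (rule vec_cases)
    obtain x' y' where v: "v = vec x' y'" by (rule vec_cases)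
    show "g (u + v) = g u + g v" by (simp add: u v vec_add g algebra_simps)
    show "g (k *\<^sub>V u) = k *\<^sub>V g u" by (simp add: u vec_scale g algebra_simps)
    show "h (g u) (g v) = h u v" unfolding u v g h_vec using \<zeta> by simp
  qed
  have "g ` pt n = pt (\<zeta> * n)" for n
    unfolding pt_def unitary_span[OF u] by (simp add: pv_def g ht_unit[OF assms])
  then show ?thesis using that u by blast
qed

end

section \<open>The topology of the hyperbolic plane\<close>

lemma continuous_on_ht [continuous_intros]: "continuous_on A g \<Longrightarrow> continuous_on A (\<lambda>x. ht (g x))"
  unfolding ht_def by (intro continuous_intros)

text \<open>The disc coordinate and its inverse. Euclidean distances in the disc are easily bounded
  by \<open>ta\<close>, which transfers the metric topology to coordinates.\<close>

definition wd :: "complex \<Rightarrow> complex" where "wd n = n / of_real (1 + ht n)"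
definition nd :: "complex \<Rightarrow> complex" where "nd w = 2 * w / of_real (1 - (cmod w)\<^sup>2)"

lemma wd_sq: "(1 + ht n) * (cmod (wd n))\<^sup>2 = ht n - 1"
proof -
  have "(cmod (wd n))\<^sup>2 = (cmod n)\<^sup>2 / (1 + ht n)\<^sup>2"
    unfolding wd_def norm_divide norm_of_real power_divide power2_abs ..
  also have "(cmod n)\<^sup>2 = (ht n - 1) * (1 + ht n)" using ht_sq[of n] by algebra
  finally show ?thesis using ht_pos[of n] by (simp add: power2_eq_square)
qed

lemma wd_less: "(cmod (wd n))\<^sup>2 < 1"
proof -
  have "(1 + ht n) * (cmod (wd n))\<^sup>2 < (1 + ht n) * 1" using wd_sq[of n] by simp
  then show ?thesis using ht_pos[of n] by simp
qed

lemma nd_wd: "nd (wd n) = n"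
proof -
  have "(1 + ht n) * (1 - (cmod (wd n))\<^sup>2) = 2" using wd_sq[of n] by (simp add: algebra_simps)
  then have 1: "1 - (cmod (wd n))\<^sup>2 = 2 / (1 + ht n)" using ht_pos[of n] by (simp add: field_simps)
  define r where "r = complex_of_real (1 + ht n)"
  have r: "r \<noteq> 0" using ht_pos[of n] unfolding r_def of_real_eq_0_iff by linarith
  show ?thesis unfolding nd_def 1 of_real_divide r_def[symmetric]
    unfolding wd_def r_def[symmetric] using r by simp
qed

context hermitian_basis
begin

text \<open>In fact \<open>4 * (ta - 1)\<close> equals \<open>(1 + ht n) * (1 + ht m)\<close> times
  the squared Euclidean distance of the disc coordinates, and each of the two factors is at least
  2.\<close>

lemma ta_wd: "(cmod (wd n - wd m))\<^sup>2 \<le> ta (pt n) (pt m) - 1"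
proof -
  let ?A = "(1 + ht n) * (1 + ht m)"
  have "(cmod (wd n - wd m))\<^sup>2 = (cmod (wd n))\<^sup>2 + (cmod (wd m))\<^sup>2 - 2 * Re (wd n * cnj (wd m))"
    unfolding cmod_sq by simp algebra
  moreover have "?A * Re (wd n * cnj (wd m)) = Re (n * cnj m)"
  proof -
    have "wd n * cnj (wd m) = n * cnj m / of_real ?A" by (simp add: wd_def)
    then have "Re (wd n * cnj (wd m)) = Re (n * cnj m) / ?A" by (metis Re_divide_of_real)
    then show ?thesis using ht_pos[of n] ht_pos[of m] by simp
  qed
  ultimately have eq: "?A * (cmod (wd n - wd m))\<^sup>2 = 4 * (ta (pt n) (pt m) - 1)"
    using wd_sq[of n] wd_sq[of m] unfolding ta_pt by algebra
  have "4 * (cmod (wd n - wd m))\<^sup>2 \<le> ?A * (cmod (wd n - wd m))\<^sup>2"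
    using mult_mono[of 2 "1 + ht n" 2 "1 + ht m"] ht_ge_1[of n] ht_ge_1[of m]
    by (intro mult_right_mono) auto
  then show ?thesis unfolding eq by simp
qed

lemma ta_ge_1: "1 \<le> ta (pt n) (pt m)"
  using ta_wd[of n m] zero_le_power2[of "cmod (wd n - wd m)"] by linarith

lemma cosh_hdist: "cosh (hdist (pt n) (pt m) / 2) = sqrt (ta (pt n) (pt m))"
    "cosh (hdist (pt n) (pt m)) = 2 * ta (pt n) (pt m) - 1" "0 \<le> hdist (pt n) (pt m)"
proof -
  have d: "hdist (pt n) (pt m) = 2 * arcosh (sqrt (ta (pt n) (pt m)))" by (simp add: hdist_def pt_BV)
  then show 1: "cosh (hdist (pt n) (pt m) / 2) = sqrt (ta (pt n) (pt m))"
    using ta_ge_1[of n m] by simp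
  show "cosh (hdist (pt n) (pt m)) = 2 * ta (pt n) (pt m) - 1"
    using cosh_double_cosh[of "hdist (pt n) (pt m) / 2"] 1 ta_ge_1[of n m] by simp
  show "0 \<le> hdist (pt n) (pt m)" unfolding d using ta_ge_1[of n m] by simp
qed

lemma hdist_unitary: "unitary g \<Longrightarrow> p \<in> BV \<Longrightarrow> q \<in> BV \<Longrightarrow> hdist (g ` p) (g ` q) = hdist p q"
  by (simp add: hdist_def unitary_BV unitary_ta)

text \<open>With the middle point at the origin, the hyperbolic sines of the two distances are the
  moduli of \<open>n\<close> and \<open>m\<close>; so the addition formula for \<open>cosh\<close>
  bounds the Lorentz product.\<close>

lemma hdist_triangle_0: "hdist (pt n) (pt m) \<le> hdist (pt n) (pt 0) + hdist (pt 0) (pt m)"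
proof -
  define x y where "x = hdist (pt n) (pt 0)" and "y = hdist (pt 0) (pt m)"
  have x: "cosh x = ht n" "0 \<le> x" and y: "cosh y = ht m" "0 \<le> y"
    using cosh_hdist(2,3)[of n 0] cosh_hdist(2,3)[of 0 m] by (simp_all add: x_def y_def ta_pt add_divide_distrib)
  have "(sinh x)\<^sup>2 = (cmod n)\<^sup>2" "(sinh y)\<^sup>2 = (cmod m)\<^sup>2"
    using cosh_square_eq[of x] cosh_square_eq[of y] ht_sq[of n] ht_sq[of m] x y by simp_all
  then have "sinh x = cmod n" "sinh y = cmod m" using x y by (simp_all add: power2_eq_iff_nonneg)
  then have "cosh (x + y) = ht n * ht m + cmod n * cmod m" by (simp add: cosh_add x y)
  moreover have "cosh (hdist (pt n) (pt m)) = ht n * ht m - Re (n * cnj m)"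
    unfolding cosh_hdist ta_pt by (simp add: field_simps)
  moreover have "- Re (n * cnj m) \<le> cmod n * cmod m"
    using complex_Re_le_cmod[of "- (n * cnj m)"] by (simp add: norm_mult)
  ultimately have "cosh (hdist (pt n) (pt m)) \<le> cosh (x + y)" by linarith
  then show ?thesis using cosh_hdist(3)[of n m] x y unfolding x_def[symmetric] y_def[symmetric]
    by (simp add: cosh_real_nonneg_le_iff)
qed

lemma Metric_space_BV: "Metric_space BV hdist"
proof
  have sym: "ta p q = ta q p" for p q by (simp add: ta_def mult.commute)
  show nn: "0 \<le> hdist p q" for p q
    by (cases "p \<in> BV \<and> q \<in> BV") (metis BV_pt cosh_hdist(3), auto simp: hdist_def)
  show "hdist p q = hdist q p" for p q by (auto simp: hdist_def sym[of p q])
  fix p q r assume pq: "p \<in> BV" "q \<in> BV"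
  obtain n where n: "p = pt n" using BV_pt pq by blast
  obtain m where m: "q = pt m" using BV_pt pq by blast
  show "hdist p q = 0 \<longleftrightarrow> p = q"
  proof
    assume "hdist p q = 0"
    then have "ta (pt n) (pt m) = 1" using cosh_hdist(2)[of n m] by (simp add: n m)
    then have "wd n = wd m" using ta_wd[of n m] by simp
    then show "p = q" unfolding n m by (metis nd_wd)
  next
    assume "p = q"
    then have "n = m" using pt_inj n m by blast
    have "(ht m)\<^sup>2 - (cmod m)\<^sup>2 = 1" using ht_sq[of m] by simp
    then have "ta (pt m) (pt m) = 1"
      unfolding ta_pt cmod_sq by (simp add: power2_eq_square)
    then show "hdist p q = 0" by (simp add: hdist_def n m \<open>n = m\<close> pt_BV)
  qed
  assume "r \<in> BV"
  then obtain k where k: "r = pt k" using BV_pt by blast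
  \<comment> \<open>The general triangle inequality reduces to the previous one by moving the middle
    point to the origin.\<close>
  obtain A where A: "nrm A" "mat A ` pt m = pt 0" by (rule to_origin)
  note U = unitary_mat[OF A(1)]
  obtain n' where n': "mat A ` pt n = pt n'" using BV_pt unitary_BV[OF U pt_BV] by metis
  obtain k' where k': "mat A ` pt k = pt k'" using BV_pt unitary_BV[OF U pt_BV] by metis
  show "hdist p r \<le> hdist p q + hdist q r"
    using hdist_triangle_0[of n' k'] unfolding n'[symmetric] k'[symmetric] A(2)[symmetric]
    by (simp add: hdist_unitary[OF U] pt_BV n m k)
qed

text \<open>The metric topology is the topology of the coordinate \<open>n\<close>: the distance is
  continuous in \<open>n\<close>, and conversely a small distance means close disc coordinates, from
  which \<open>n\<close> depends continuously.\<close>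

lemma openin_BV: "openin BV_topology U \<longleftrightarrow> U \<subseteq> BV \<and> open {n. pt n \<in> U}"
proof -
  interpret m: Metric_space BV hdist by (rule Metric_space_BV)
  have "(\<forall>x. x \<in> U \<longrightarrow> (\<exists>r>0. m.mball x r \<subseteq> U)) \<longleftrightarrow> open {n. pt n \<in> U}" if U: "U \<subseteq> BV"
  proof
    assume H: "\<forall>x. x \<in> U \<longrightarrow> (\<exists>r>0. m.mball x r \<subseteq> U)"
    show "open {n. pt n \<in> U}"
    proof (subst open_subopen, intro ballI)
      fix n assume "n \<in> {n. pt n \<in> U}"
      then obtain r where r: "0 < r" "m.mball (pt n) r \<subseteq> U" using H by blast
      let ?T = "{k. hdist (pt n) (pt k) < r}"
      have "continuous_on UNIV (\<lambda>k. hdist (pt n) (pt k))"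
      proof -
        have "continuous_on UNIV (\<lambda>k. ta (pt n) (pt k))"
          unfolding ta_pt by (intro continuous_intros) auto
        then have "continuous_on UNIV (\<lambda>k. sqrt (ta (pt n) (pt k)))" by (rule continuous_on_real_sqrt)
        then have "continuous_on UNIV (\<lambda>k. arcosh (sqrt (ta (pt n) (pt k))))"
          by (rule continuous_on_compose2[OF continuous_on_arcosh[OF order_refl]]) (use ta_ge_1 in auto)
        then have "continuous_on UNIV (\<lambda>k. 2 * arcosh (sqrt (ta (pt n) (pt k))))"
          by (rule continuous_on_mult_left)
        then show ?thesis by (simp add: hdist_def pt_BV)
      qed
      then have "open ?T" by (intro open_Collect_less continuous_intros)
      moreover have "n \<in> ?T" using r m.mdist_zero[OF pt_BV] by simp
      moreover have "?T \<subseteq> {n. pt n \<in> U}" using r(2) pt_BV by (auto simp: m.mball_def)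
      ultimately show "\<exists>T. open T \<and> n \<in> T \<and> T \<subseteq> {n. pt n \<in> U}" by blast
    qed
  next
    assume H: "open {n. pt n \<in> U}"
    show "\<forall>x. x \<in> U \<longrightarrow> (\<exists>r>0. m.mball x r \<subseteq> U)"
    proof (intro allI impI)
      fix x assume "x \<in> U"
      then obtain n where n: "x = pt n" using U BV_pt by blast
      then have "n \<in> {n. pt n \<in> U}" using \<open>x \<in> U\<close> by simp
      then obtain \<epsilon> where \<epsilon>: "0 < \<epsilon>" "\<And>k. dist k n < \<epsilon> \<Longrightarrow> pt k \<in> U"
        using H unfolding open_dist by blast
      have "isCont nd (wd n)"
      proof -
        have "1 - (cmod (wd n))\<^sup>2 \<noteq> 0" using wd_less[of n] by simp
        then have "complex_of_real (1 - (cmod (wd n))\<^sup>2) \<noteq> 0" unfolding of_real_eq_0_iff .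
        then show ?thesis unfolding nd_def[abs_def] by (intro continuous_intros)
      qed
      then obtain \<delta> where \<delta>: "0 < \<delta>" "\<And>w. dist w (wd n) < \<delta> \<Longrightarrow> dist (nd w) (nd (wd n)) < \<epsilon>"
        using \<epsilon>(1) unfolding continuous_at_eps_delta by blast
      \<comment> \<open>Chosen so that distance less than \<open>r\<close> means
        \<open>ta < 1 + \<delta>\<^sup>2\<close>, hence disc coordinates closer than
        \<open>\<delta>\<close> by \<open>ta_wd\<close>.\<close>
      define r where "r = 2 * arcosh (sqrt (1 + \<delta>\<^sup>2))"
      have 1: "1 < sqrt (1 + \<delta>\<^sup>2)" using \<delta>(1) by simp
      have cr: "cosh (r / 2) = sqrt (1 + \<delta>\<^sup>2)" unfolding r_def using 1 by simp
      have "0 < r" unfolding r_def using arcosh_real_gt_1_iff[of "sqrt (1 + \<delta>\<^sup>2)"] 1 by simp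
      moreover have "m.mball x r \<subseteq> U"
      proof
        fix y assume "y \<in> m.mball x r"
        then have y: "y \<in> BV" "hdist x y < r" by (auto simp: m.mball_def)
        obtain k where k: "y = pt k" using BV_pt y by blast
        have "cosh (hdist x y / 2) < cosh (r / 2)"
        proof (rule iffD2[OF cosh_real_nonneg_less_iff])
          have "0 \<le> hdist x y" by (rule m.nonneg)
          then show "0 \<le> hdist x y / 2" "0 \<le> r / 2" "hdist x y / 2 < r / 2" using y(2) by linarith+
        qed
        then have "ta (pt n) (pt k) < 1 + \<delta>\<^sup>2" unfolding cr n k cosh_hdist by simp
        then have "(cmod (wd n - wd k))\<^sup>2 < \<delta>\<^sup>2" using ta_wd[of n k] by simp
        then have "cmod (wd n - wd k) < \<delta>" using \<delta>(1) by (simp add: power_less_imp_less_base)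
        then have "dist (nd (wd k)) (nd (wd n)) < \<epsilon>" using \<delta>(2)[of "wd k"] by (simp add: dist_norm norm_minus_commute)
        then show "y \<in> U" using \<epsilon>(2) by (simp add: nd_wd k)
      qed
      ultimately show "\<exists>r>0. m.mball x r \<subseteq> U" by blast
    qed
  qed
  then show ?thesis unfolding BV_topology_def m.openin_mtopology by blast
qed

lemma topspace_BV [simp]: "topspace BV_topology = BV"
  unfolding BV_topology_def using Metric_space.topspace_mtopology[OF Metric_space_BV] .

lemma continuous_un: "continuous_map BV_topology euclidean un"
proof -
  have "openin BV_topology {p \<in> BV. un p \<in> U}" if "open U" for U
  proof -
    have "{n. pt n \<in> {p \<in> BV. un p \<in> U}} = U" using pt_BV by auto
    then show ?thesis using that by (simp add: openin_BV)
  qed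
  then show ?thesis by (auto simp: continuous_map_def)
qed

lemma continuous_pt: "continuous_map euclidean BV_topology pt"
  using pt_BV by (auto simp: continuous_map_def openin_BV)

end

section \<open>The space of hexagons of the first type\<close>

context circle_data
begin

text \<open>While \<open>- 1 \<le> u T\<close>, the sign of \<open>p T\<close> is that of
  \<open>c0 + c3\<close>, so \<open>b T = - p T * (c1 + c2)\<close> is not positive. If
  \<open>c0 + c3 = 0\<close>, this range consists of \<open>T = 1\<close> alone, where
  \<open>p\<close> vanishes.\<close>

lemma same_sign_hyperbolic:
  assumes z: "z = 1" and H: "0 \<le> (c0 + c3) * (c1 + c2)" "\<not> (c0 + c3 = 0 \<and> c1 + c2 = 0)"
    and T: "ok T" "- 1 \<le> u T"
  shows "b T \<le> 0 \<and> \<not> (p T = 0 \<and> N T = 0)"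
proof
  show "\<not> (p T = 0 \<and> N T = 0)" using degenerate(4,5)[OF T(1)] H(2) by blast
  have T1: "1 \<le> T" using T by (simp add: ok_def)
  have tau: "- 1 \<le> tau T" using T(2) u_tau[OF z] by simp
  have zp: "z * p T = p T" by (subst z) simp
  consider "0 < c0 + c3" | "c0 + c3 < 0" | "c0 + c3 = 0" by linarith
  then have "0 \<le> p T * (c1 + c2)"
  proof cases
    case 1
    then have "0 < p T" using zp_pos[OF T1 tau] zp by simp
    then show ?thesis using H(1) 1 by (simp add: zero_le_mult_iff)
  next
    case 2
    then have "p T < 0" using zp_neg[OF T1 tau] zp by simp
    then show ?thesis using H(1) 2 by (simp add: zero_le_mult_iff)
  next
    case 3
    have "c0 * c3 - s0 * s3 = - 1" using cos_sum_eq(1) 3 by simp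
    then have "tau T = - 1 - s0 * s3 * (T - 1)" by (simp add: tau_def algebra_simps)
    moreover have "0 \<le> s0 * s3 * (T - 1)" using T1 s0s3_pos by simp
    ultimately have "s0 * s3 * (T - 1) = 0" using tau by linarith
    then have "T = 1" "tau T = - 1" using s0s3_pos tau \<open>tau T = _\<close> by auto
    then have "(p T)\<^sup>2 = 0" using tau_p[of T] by simp
    then show ?thesis by simp
  qed
  then show "b T \<le> 0" by (simp add: b_def)
qed

lemma opposite_sign_mixed:
  assumes z: "z = 1" and H: "(c0 + c3) * (c1 + c2) < 0" and T: "ok T" "- 1 \<le> u T"
  shows "0 < b T \<and> \<not> (p T = 0 \<and> N T = 0)"
proof
  show "\<not> (p T = 0 \<and> N T = 0)" using degenerate(4)[OF T(1)] H by auto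
  have T1: "1 \<le> T" using T by (simp add: ok_def)
  have tau: "- 1 \<le> tau T" using T(2) u_tau[OF z] by simp
  have zp: "z * p T = p T" by (subst z) simp
  have "p T * (c1 + c2) < 0"
    using H zp_pos[OF T1 tau] zp_neg[OF T1 tau] unfolding zp by (auto simp: mult_less_0_iff)
  then show "0 < b T" by (simp add: b_def)
qed

end

context angle_data
begin

text \<open>If \<open>Mz (- 1)\<close> is nonempty, the two cosine sums have the same sign; then
  half the trace is below - 1 on \<open>Mz 1\<close> and between - 1 and 1 on
  \<open>Mz (- 1)\<close>.\<close>

lemma Mz_disjoint: "x \<in> Mz 1 \<Longrightarrow> x \<in> Mz (- 1) \<Longrightarrow> False"
proof -
  assume 1: "x \<in> Mz 1" and 2: "x \<in> Mz (- 1)"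
  interpret p: circle_data "cos (a 0)" "sin (a 0)" "cos (a 1)" "sin (a 1)" "cos (a 2)" "sin (a 2)" "cos (a 3)" "sin (a 3)" 1
    by (rule circle_data) simp
  interpret m: circle_data "cos (a 0)" "sin (a 0)" "cos (a 1)" "sin (a 1)" "cos (a 2)" "sin (a 2)" "cos (a 3)" "sin (a 3)" "- 1"
    by (rule circle_data) simp
  have xm: "x \<in> m.M" and xp: "x \<in> p.M" using 1 2 by (simp_all add: Mz_def)
  then have c: "1 \<le> m.T1" "0 < (cos (a 0) + cos (a 3)) * (cos (a 1) + cos (a 2))"
    using m.compact_nonempty by auto
  have "\<bar>m.tau (snd (snd x))\<bar> < 1" using m.sphere_compact(2)[OF _ c xm] by simp
  moreover have "m.tau (snd (snd x)) < - 1"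
    using p.plane_hyperbolic(2)[OF _ p.same_sign_hyperbolic xp] c by force
  ultimately show False by simp
qed

end

locale hexagons = hermitian_basis scl h e f + angle_data a
  for scl :: "complex \<Rightarrow> 'v::ab_group_add \<Rightarrow> 'v" (infixr \<open>*\<^sub>V\<close> 75) and h e f and a :: "nat \<Rightarrow> real"
begin

definition pts :: "(nat \<Rightarrow> complex) \<Rightarrow> nat \<Rightarrow> 'v set" where
  "pts n = (\<lambda>j\<in>{..3}. pt (n j))"

lemma pts_PiE: "pts n \<in> {..3} \<rightarrow>\<^sub>E BV"
  using pt_BV by (auto simp: pts_def)

lemma PiE_pts: assumes "c \<in> {..3} \<rightarrow>\<^sub>E BV" shows "c = pts (\<lambda>j. un (c j))"
  using assms by (auto simp: pts_def fun_eq_iff PiE_def extensional_def Pi_def)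

lemma R_pts: "j \<le> 3 \<Longrightarrow> R a (pts n) j = mat (rq (a j) (n j))"
  by (simp add: R_def pts_def rot_pt)

lemma quadruple_iff: "pts n \<in> quadruples First_Type a \<longleftrightarrow> rel a 1 n \<or> rel a (- 1) n"
proof -
  have "R a (pts n) 3 \<circ> R a (pts n) 2 \<circ> R a (pts n) 1 \<circ> R a (pts n) 0 =
      mat (sm (rq (a 3) (n 3)) (sm (rq (a 2) (n 2)) (sm (rq (a 1) (n 1)) (rq (a 0) (n 0)))))"
    by (simp add: R_pts mat_sm sm_assoc)
  then show ?thesis using pts_PiE[of n]
    by (simp add: quadruples_def trivial_mat nrm_sm nrm_rq rel_def)
qed

lemma quadruples_pts: assumes "c \<in> quadruples First_Type a"
  obtains n where "c = pts n" "rel a 1 n \<or> rel a (- 1) n"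
proof -
  have "c = pts (\<lambda>j. un (c j))" using PiE_pts assms by (auto simp: quadruples_def)
  then show ?thesis using that quadruple_iff assms by metis
qed

lemma act_R: assumes "unitary g" "c \<in> {..3} \<rightarrow>\<^sub>E BV" "j \<le> 3" shows "R a (act g c) j (g v) = g (R a c j v)"
  using assms unitary_rot[OF assms(1), of "c j"] by (auto simp: R_def act_def)

lemma quadruples_act: assumes "unitary g" "c \<in> quadruples First_Type a" shows "act g c \<in> quadruples First_Type a"
proof -
  have c: "c \<in> {..3} \<rightarrow>\<^sub>E BV" using assms(2) by (simp add: quadruples_def)
  obtain k where k: "unitary k" "\<And>v. k (g v) = v" "\<And>v. g (k v) = v"
    using unitary_inverse[OF assms(1)] by blast
  obtain z where z: "cmod z = 1" "\<And>v. (R a c 3 \<circ> R a c 2 \<circ> R a c 1 \<circ> R a c 0) v = z *\<^sub>V v"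
    using assms(2) by (auto simp: quadruples_def trivial_in_PU_def)
  have "(R a (act g c) 3 \<circ> R a (act g c) 2 \<circ> R a (act g c) 1 \<circ> R a (act g c) 0) v = z *\<^sub>V v" for v
  proof -
    have "(R a (act g c) 3 \<circ> R a (act g c) 2 \<circ> R a (act g c) 1 \<circ> R a (act g c) 0) (g (k v)) =
        g ((R a c 3 \<circ> R a c 2 \<circ> R a c 1 \<circ> R a c 0) (k v))"
      by (simp add: act_R[OF assms(1) c])
    also have "\<dots> = z *\<^sub>V g (k v)" unfolding z(2) unitaryD(2)[OF assms(1)] ..
    finally show ?thesis by (simp add: k)
  qed
  then show ?thesis using act_PiE[OF assms(1) c] z(1) by (auto simp: quadruples_def trivial_in_PU_def)
qed

text \<open>A rotation about \<open>c\<^sub>j\<close> preserves distances to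
  \<open>c\<^sub>j\<close>, so the first two coordinates can be measured at the vertex before the
  rotation.\<close>

definition tc :: "(nat \<Rightarrow> 'v set) \<Rightarrow> real \<times> real \<times> real" where
  "tc c = (2 * ta (c 1) (c 0) - 1, 2 * ta (c 2) (R a c 1 ` c 0) - 1, 2 * ta (c 3) (c 0) - 1)"

lemma R_unitary: "c \<in> {..3} \<rightarrow>\<^sub>E BV \<Longrightarrow> j \<le> 3 \<Longrightarrow> unitary (R a c j)"
  by (auto simp: R_def intro!: rot_unitary)

lemma R_fixes: "c \<in> {..3} \<rightarrow>\<^sub>E BV \<Longrightarrow> j \<le> 3 \<Longrightarrow> R a c j ` c j = c j"
  unfolding R_def by (rule rot_fixes) auto

lemma BV_c: "c \<in> {..3} \<rightarrow>\<^sub>E BV \<Longrightarrow> j \<le> 3 \<Longrightarrow> c j \<in> BV"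
  by auto

lemma tc_vertex:
  assumes c: "c \<in> {..3} \<rightarrow>\<^sub>E BV"
  shows "tc c = (2 * ta (c 1) (vertex First_Type a c 1) - 1, 2 * ta (c 2) (vertex First_Type a c 2) - 1,
    2 * ta (c 3) (vertex First_Type a c 3) - 1)"
proof -
  note u = R_unitary[OF c] and fx = R_fixes[OF c] and B = BV_c[OF c]
  have "ta (R a c 1 ` c 1) (R a c 1 ` c 0) = ta (c 1) (c 0)"
    by (rule unitary_ta) (simp_all add: u B)
  moreover have "ta (R a c 2 ` c 2) (R a c 2 ` R a c 1 ` c 0) = ta (c 2) (R a c 1 ` c 0)"
    by (rule unitary_ta) (simp_all add: u B unitary_BV)
  ultimately show ?thesis
    by (simp add: tc_def vertex_def rotate_point_def fx)
qed

lemma tc_act: assumes g: "unitary g" and c: "c \<in> {..3} \<rightarrow>\<^sub>E BV" shows "tc (act g c) = tc c"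
proof -
  have "R a (act g c) 1 ` (g ` c 0) = g ` (R a c 1 ` c 0)"
    using act_R[OF g c, of 1] by (auto simp: image_comp)
  moreover have "act g c j = g ` c j" if "j \<le> 3" for j using that by (simp add: act_def)
  ultimately show ?thesis
    by (simp add: tc_def unitary_ta[OF g] BV_c[OF c] unitary_BV R_unitary[OF c])
qed

lemma tc_pts: assumes "n 0 = 0" shows "tc (pts n) = (ht (n 1), Y2 n, ht (n 3))"
  using rot_pt_0[of "n 2" "n 1" "a 1"] assms
  by (simp add: tc_def R_def Y2_def) (simp add: pts_def ta_pt add_divide_distrib)

text \<open>Moving \<open>c\<^sub>0\<close> to the origin leaves only the rotations about the origin
  as freedom, which \<open>rel_unique\<close> accounts for.\<close>

lemma normalise:
  assumes c: "c \<in> quadruples First_Type a"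
  obtains n z where "n 0 = 0" "pts n \<in> quadruples First_Type a" "orbit (pts n) = orbit c"
    "z = 1 \<or> z = - 1" "rel a z n" "tc c = (ht (n 1), Y2 n, ht (n 3))"
proof -
  have B: "c \<in> {..3} \<rightarrow>\<^sub>E BV" using c by (simp add: quadruples_def)
  obtain A where A: "nrm A" "mat A ` pt (un (c 0)) = pt 0" by (rule to_origin)
  note U = unitary_mat[OF A(1)]
  have q: "act (mat A) c \<in> quadruples First_Type a" by (rule quadruples_act[OF U c])
  then obtain n where n: "act (mat A) c = pts n" "rel a 1 n \<or> rel a (- 1) n" by (rule quadruples_pts)
  have "pt (n 0) = act (mat A) c 0" unfolding n by (simp add: pts_def)
  also have "\<dots> = pt 0" using A(2) BV_c[OF B, of 0] by (simp add: act_def)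
  finally have 0: "n 0 = 0" by (rule pt_inj)
  have "orbit (pts n) = orbit c" using orbit_eq[OF U, of c] n by simp
  moreover have "tc c = (ht (n 1), Y2 n, ht (n 3))" using tc_act[OF U B] tc_pts[of n, OF 0] n by simp
  ultimately show ?thesis using that[of n 1] that[of n "- 1"] 0 q n by metis
qed

definition H :: "(nat \<Rightarrow> 'v set) set \<Rightarrow> real \<times> real \<times> real" where
  "H P = (2 * t First_Type a 1 P - 1, 2 * t First_Type a 2 P - 1, 2 * t First_Type a 3 P - 1)"

lemma H_orbit: assumes "c \<in> {..3} \<rightarrow>\<^sub>E BV" shows "H (orbit c) = tc c"
proof -
  define c' where "c' = (SOME c'. c' \<in> orbit c)"
  have "c' \<in> orbit c" unfolding c'_def
    by (rule someI[of "\<lambda>x. x \<in> orbit c", OF orbit_self[OF assms]])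
  then obtain g where g: "unitary g" "c' = act g c" by (auto simp: orbit_act)
  have "H (orbit c) = tc c'"
    unfolding H_def t_def Let_def c'_def[symmetric] using tc_vertex[of c'] act_PiE[OF g(1) assms] g(2) by simp
  then show ?thesis using tc_act[OF g(1) assms] g(2) by simp
qed

end

lemma istopology_quotient:
  "istopology (\<lambda>U. U \<subseteq> q ` topspace X \<and> openin X {x \<in> topspace X. q x \<in> U})"
proof -
  have "{x \<in> topspace X. q x \<in> S \<inter> T} = {x \<in> topspace X. q x \<in> S} \<inter> {x \<in> topspace X. q x \<in> T}" for S T
    by auto
  moreover have "{x \<in> topspace X. q x \<in> \<Union> \<K>} = (\<Union>K\<in>\<K>. {x \<in> topspace X. q x \<in> K})" for \<K> by auto
  ultimately show ?thesis unfolding istopology_def by (auto simp del: mem_Collect_eq intro!: openin_Int openin_Union) 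
qed

lemma openin_quotient:
  "openin (quotient_topology X q) U \<longleftrightarrow> U \<subseteq> q ` topspace X \<and> openin X {x \<in> topspace X. q x \<in> U}"
  unfolding quotient_topology_def topology_inverse'[OF istopology_quotient] ..

lemma topspace_quotient [simp]: "topspace (quotient_topology X q) = q ` topspace X"
proof -
  have "{x \<in> topspace X. q x \<in> q ` topspace X} = topspace X" by auto
  then have "openin (quotient_topology X q) (q ` topspace X)" unfolding openin_quotient by simp
  then show ?thesis by (intro equalityI openin_subset) (auto simp: topspace_def openin_quotient)
qed

lemma closedin_quotient:
  "closedin (quotient_topology X q) U \<longleftrightarrow> U \<subseteq> q ` topspace X \<and> closedin X {x \<in> topspace X. q x \<in> U}"
proof -
  have "{x \<in> topspace X. q x \<in> q ` topspace X - U} = topspace X - {x \<in> topspace X. q x \<in> U}" by auto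
  then show ?thesis by (auto simp: closedin_def openin_quotient)
qed

text \<open>Needed for properness: it bounds \<open>n\<^sub>2\<close> by the second coordinate and
  \<open>n\<^sub>1\<close>. If \<open>k\<close> and \<open>l\<close> are the moduli of the entries
  of \<open>A\<close>, then \<open>Yg A y n \<ge> y * (k - l)\<^sup>2\<close>, and
  \<open>k\<^sup>2 - l\<^sup>2 = 1\<close> makes \<open>(k + l)\<^sup>2\<close> the reciprocal
  factor.\<close>

lemma Yg_growth:
  assumes A: "nrm A" and n: "cmod n \<le> y"
  shows "y \<le> Yg A y n * (2 + 4 * (cmod (snd A))\<^sup>2)"
proof -
  define k l where "k = cmod (fst A)" and "l = cmod (snd A)"
  have kl: "k\<^sup>2 - l\<^sup>2 = 1" using A by (simp add: nrm_def k_def l_def)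
  have y: "0 \<le> y" using n norm_ge_zero order_trans by blast
  have "Re (fst A * snd A * n) \<le> k * l * cmod n"
    using complex_Re_le_cmod[of "fst A * snd A * n"] by (simp add: norm_mult k_def l_def)
  also have "\<dots> \<le> k * l * y" using n by (intro mult_left_mono) (auto simp: k_def l_def)
  finally have "y * (k\<^sup>2 + l\<^sup>2) - 2 * (k * l * y) \<le> Yg A y n" unfolding Yg_def k_def l_def by linarith
  also have "y * (k\<^sup>2 + l\<^sup>2) - 2 * (k * l * y) = y * (k - l)\<^sup>2" by algebra
  finally have "y * (k - l)\<^sup>2 * (k + l)\<^sup>2 \<le> Yg A y n * (k + l)\<^sup>2" by (intro mult_right_mono) auto
  also have "y * (k - l)\<^sup>2 * (k + l)\<^sup>2 = y" using kl by algebra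
  also have "Yg A y n * (k + l)\<^sup>2 \<le> Yg A y n * (2 + 4 * l\<^sup>2)"
  proof (rule mult_left_mono)
    have "(k + l)\<^sup>2 \<le> 2 * k\<^sup>2 + 2 * l\<^sup>2"
      using zero_le_power2[of "k - l"] by (simp add: power2_sum power2_diff)
    then show "(k + l)\<^sup>2 \<le> 2 + 4 * l\<^sup>2" using kl by linarith
    show "0 \<le> Yg A y n" by (rule Yg_bounds[OF y n])
  qed
  finally show ?thesis by (simp add: l_def)
qed

lemma continuous_map_Pair_euclidean:
  assumes "continuous_map X euclidean f" "continuous_map X euclidean g"
  shows "continuous_map X euclidean (\<lambda>x. (f x, g x))"
proof -
  have "openin X {x \<in> topspace X. (f x, g x) \<in> U}" if U: "open U" for U
  proof (subst openin_subopen, intro ballI)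
    fix x assume "x \<in> {x \<in> topspace X. (f x, g x) \<in> U}"
    then have x: "x \<in> topspace X" "(f x, g x) \<in> U" by auto
    obtain A B where AB: "open A" "open B" "(f x, g x) \<in> A \<times> B" "A \<times> B \<subseteq> U"
      using open_prod_elim[OF U x(2)] by blast
    have "openin X {x \<in> topspace X. f x \<in> A}" "openin X {x \<in> topspace X. g x \<in> B}"
      using assms AB by (simp_all add: continuous_map_def)
    then have "openin X ({x \<in> topspace X. f x \<in> A} \<inter> {x \<in> topspace X. g x \<in> B})" by (rule openin_Int)
    then show "\<exists>T. openin X T \<and> x \<in> T \<and> T \<subseteq> {x \<in> topspace X. (f x, g x) \<in> U}"
      using x AB(3)
      by (intro exI[of _ "{x \<in> topspace X. f x \<in> A} \<inter> {x \<in> topspace X. g x \<in> B}"] conjI)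
        (auto intro: subsetD[OF AB(4)])
  qed
  then show ?thesis by (simp add: continuous_map_def)
qed

lemma continuous_on_rq [continuous_intros]:
  "continuous_on A g \<Longrightarrow> continuous_on A (\<lambda>x. rq b (g x))"
  unfolding rq_def Complex_eq by (intro continuous_intros)

context hexagons
begin

abbreviation "Q \<equiv> quadruples First_Type a"
abbreviation "TQ \<equiv> subtopology (product_topology (\<lambda>_. BV_topology) {..3 :: nat}) Q"

lemma topspace_TQ: "topspace TQ = Q"
  by (auto simp: quadruples_def)

lemma continuous_tc: "continuous_map TQ euclidean tc"
proof -
  \<comment> \<open>\<open>F\<close> is \<open>tc\<close> in coordinates, for an arbitrary first
    centre: \<open>x\<close>, \<open>y\<close> are the coordinates of the image of
    \<open>pv n0\<close> under \<open>R\<^sub>1\<close>, and \<open>k\<close> is the product of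
    \<open>pv n2\<close> with that image.\<close>
  define F where "F = (\<lambda>(n0, n1, n2, n3).
     let A = rq (a 1) n1; x = fst A * of_real (1 + ht n0) + snd A * n0; y = cnj (snd A) * of_real (1 + ht n0) + cnj (fst A) * n0;
         k = of_real (1 + ht n2) * cnj x - n2 * cnj y
     in (ht n1 * ht n0 - Re (n1 * cnj n0), 2 * ((cmod k)\<^sup>2 / (4 * (1 + ht n2) * (1 + ht n0))) - 1, ht n3 * ht n0 - Re (n3 * cnj n0)))"
  define U where "U = (\<lambda>c :: nat \<Rightarrow> 'v set. (un (c 0), un (c 1), un (c 2), un (c 3)))"
  have "4 * (1 + ht n) * (1 + ht m) \<noteq> 0" for n m
    using mult_pos_pos[of "1 + ht n" "1 + ht m"] ht_pos[of n] ht_pos[of m] by auto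
  then have "continuous_on UNIV F"
    unfolding F_def case_prod_beta Let_def
    by (intro continuous_intros ballI)
  moreover have "continuous_map TQ euclidean U"
  proof -
    have "continuous_map TQ euclidean (\<lambda>c. un (c j))" if "j \<le> 3" for j
    proof -
      have "continuous_map TQ BV_topology (\<lambda>c. c j)"
        by (intro continuous_map_from_subtopology continuous_map_product_projection) (use that in auto)
      from continuous_map_compose[OF this continuous_un] show ?thesis by (simp add: comp_def)
    qed
    then show ?thesis unfolding U_def by (intro continuous_map_Pair_euclidean) simp_all
  qed
  ultimately have "continuous_map TQ euclidean (F \<circ> U)" by (intro continuous_map_compose) auto
  moreover have "(F \<circ> U) c = tc c" if "c \<in> topspace TQ" for c
  proof -
    have cB: "c \<in> {..3} \<rightarrow>\<^sub>E BV" using that unfolding topspace_TQ by (simp add: quadruples_def)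
    define n where "n = (\<lambda>j. un (c j))"
    have c: "c = pts n" using PiE_pts[OF cB] by (simp add: n_def)
    define A where "A = rq (a 1) (n 1)"
    define x y k where "x = fst A * of_real (1 + ht (n 0)) + snd A * n 0"
      and "y = cnj (snd A) * of_real (1 + ht (n 0)) + cnj (fst A) * n 0"
      and "k = of_real (1 + ht (n 2)) * cnj x - n 2 * cnj y"
    have v: "mat A (pv (n 0)) = vec x y" by (simp add: pv_def mat_vec x_def y_def)
    have uA: "unitary (mat A)" unfolding A_def by (rule unitary_mat[OF nrm_rq])
    have R: "R a c 1 ` c 0 = span {vec x y}"
      unfolding c R_pts[of 1, simplified] A_def[symmetric]
      by (simp add: pts_def pt_def unitary_span[OF uA] v)
    have nz: "vec x y \<noteq> 0" unfolding v[symmetric] unitary_eq_0[OF uA] by (rule pv_nonzero)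
    have hv: "h (vec x y) (vec x y) = of_real (2 * (1 + ht (n 0)))"
      unfolding v[symmetric] unitaryD(3)[OF uA] by (rule h_pv_self)
    have hk: "h (pv (n 2)) (vec x y) = k" unfolding pv_def h_vec k_def ..
    then have hk': "h (vec x y) (pv (n 2)) = cnj k" using hermitian[of "vec x y" "pv (n 2)"] by simp
    have "ta (c 2) (R a c 1 ` c 0) = Re (k * cnj k / (of_real (2 * (1 + ht (n 2))) * of_real (2 * (1 + ht (n 0)))))"
      unfolding R using ta_span[OF pv_nonzero nz, of "n 2"] by (simp add: c pts_def pt_def hk hk' hv h_pv_self)
    also have "\<dots> = (cmod k)\<^sup>2 / (4 * (1 + ht (n 2)) * (1 + ht (n 0)))"
      unfolding complex_norm_square[symmetric] of_real_mult[symmetric] of_real_divide[symmetric] Re_complex_of_real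
      by (simp add: algebra_simps)
    finally have "ta (c 2) (R a c 1 ` c 0) = (cmod k)\<^sup>2 / (4 * (1 + ht (n 2)) * (1 + ht (n 0)))" .
    moreover have "2 * ta (c 1) (c 0) - 1 = ht (n 1) * ht (n 0) - Re (n 1 * cnj (n 0))"
      "2 * ta (c 3) (c 0) - 1 = ht (n 3) * ht (n 0) - Re (n 3 * cnj (n 0))"
      by (simp_all add: c pts_def ta_pt field_simps)
    moreover have "U c = (n 0, n 1, n 2, n 3)" by (simp add: U_def n_def)
    ultimately show ?thesis
      by (simp only: tc_def F_def comp_apply split Let_def A_def x_def y_def k_def)
  qed
  ultimately show ?thesis by (rule continuous_map_eq)
qed

lemma continuous_map_pts:
  "continuous_map euclidean (product_topology (\<lambda>_. BV_topology) {..3})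
     (\<lambda>(n1, n2, n3). pts (\<lambda>j. if j = 0 then 0 else if j = 1 then n1 else if j = 2 then n2 else n3))"
  unfolding continuous_map_componentwise
proof (intro conjI ballI)
  show "(\<lambda>(n1, n2, n3). pts (\<lambda>j. if j = 0 then 0 else if j = 1 then n1 else if j = 2 then n2 else n3)) `
      topspace euclidean \<subseteq> extensional {..3}"
    by (auto simp: pts_def)
  fix k :: nat assume k: "k \<in> {..3}"
  define g where "g = (\<lambda>(n1, n2, n3). if k = 0 then 0 else if k = 1 then n1 else if k = 2 then n2 else (n3 :: complex))"
  have "continuous_on UNIV g"
    unfolding g_def case_prod_beta
    by (cases "k = 0"; cases "k = 1"; cases "k = 2") (simp_all add: continuous_on_fst continuous_on_snd continuous_on_id)
  then have "continuous_map euclidean BV_topology (pt \<circ> g)"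
    by (intro continuous_map_compose[OF _ continuous_pt]) simp
  moreover have "(\<lambda>x. (case x of (n1, n2, n3) \<Rightarrow> pts (\<lambda>j. if j = 0 then 0 else if j = 1 then n1 else if j = 2 then n2 else n3)) k) = pt \<circ> g"
    using k by (auto simp: fun_eq_iff pts_def g_def)
  ultimately show "continuous_map euclidean BV_topology
      (\<lambda>x. (case x of (n1, n2, n3) \<Rightarrow> pts (\<lambda>j. if j = 0 then 0 else if j = 1 then n1 else if j = 2 then n2 else n3)) k)"
    by simp
qed

text \<open>Closedness replaces continuity of the inverse. A closed set of orbits is represented by
  a closed set of triples \<open>(n\<^sub>1, n\<^sub>2, n\<^sub>3)\<close> with
  \<open>n\<^sub>0 = 0\<close>, and on such triples the coordinates form a proper map.\<close>

lemma homeomorphic_map_H: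
  "homeomorphic_map (hexagon_space First_Type a) (top_of_set (Mz 1 \<union> Mz (- 1))) H"
proof (rule bijective_closed_imp_homeomorphic_map)
  let ?X = "hexagon_space First_Type a" and ?M = "Mz 1 \<union> Mz (- 1)"
  have X: "?X = quotient_topology TQ orbit" by (simp add: hexagon_space_def)
  have tX: "topspace ?X = orbit ` Q" unfolding X topspace_quotient topspace_TQ ..
  have QB: "c \<in> {..3} \<rightarrow>\<^sub>E BV" if "c \<in> Q" for c using that by (simp add: quadruples_def)
  have HM: "tc c \<in> ?M" if cQ: "c \<in> Q" for c
  proof -
    obtain n z where n: "n 0 = 0" "pts n \<in> Q" "orbit (pts n) = orbit c" "z = 1 \<or> z = - 1" "rel a z n" "tc c = (ht (n 1), Y2 n, ht (n 3))"
      by (rule normalise[OF cQ])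
    then show ?thesis using rel_Mz[OF n(5,1,4)] by auto
  qed
  define q3 where "q3 = (\<lambda>(n1, n2, n3) j :: nat. if j = 0 then 0 else if j = 1 then n1 else if j = 2 then n2 else (n3 :: complex))"
  have q3: "q3 x 0 = 0" "q3 x 1 = fst x" "q3 x 2 = fst (snd x)" "q3 x 3 = snd (snd x)" for x
    by (simp_all add: q3_def case_prod_beta)
  have pts_cong: "pts n = pts m" if "\<And>j. j \<le> 3 \<Longrightarrow> n j = m j" for n m
    using that by (auto simp: pts_def fun_eq_iff)
  have q3_pts: "pts n = pts (q3 (n 1, n 2, n 3))" if "n 0 = 0" for n
  proof (rule pts_cong)
    fix j :: nat assume "j \<le> 3"
    then have "j = 0 \<or> j = 1 \<or> j = 2 \<or> j = 3" by auto
    then show "n j = q3 (n 1, n 2, n 3) j" using that q3 by auto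
  qed
  show img: "H ` topspace ?X = topspace (top_of_set ?M)"
  proof (intro equalityI subsetI)
    fix x assume "x \<in> H ` topspace ?X"
    then obtain c where "c \<in> Q" "x = H (orbit c)" unfolding tX by blast
    then show "x \<in> topspace (top_of_set ?M)" using H_orbit[OF QB] HM by simp
  next
    fix x assume "x \<in> topspace (top_of_set ?M)"
    then obtain z where z: "z = 1 \<or> z = - 1" "x \<in> Mz z" by auto
    obtain X Y T where x: "x = (X, Y, T)" by (metis prod.exhaust)
    obtain n where n: "n 0 = 0" "rel a z n" "(ht (n 1), Y2 n, ht (n 3)) = x"
      using Mz_rel[OF z(2)[unfolded x] z(1)] unfolding x by blast
    have "pts n \<in> Q" using n(2) z(1) quadruple_iff by blast
    moreover have "H (orbit (pts n)) = x" using H_orbit[OF pts_PiE] tc_pts[of n, OF n(1)] n(3) by simp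
    ultimately show "x \<in> H ` topspace ?X" unfolding tX by blast
  qed
  show "inj_on H (topspace ?X)"
  proof (rule inj_onI)
    fix P P' assume "P \<in> topspace ?X" "P' \<in> topspace ?X" and eq: "H P = H P'"
    then obtain c c' where c: "c \<in> Q" "P = orbit c" "c' \<in> Q" "P' = orbit c'" unfolding tX by blast
    obtain n z where n: "n 0 = 0" "pts n \<in> Q" "orbit (pts n) = orbit c" "z = 1 \<or> z = - 1" "rel a z n" "tc c = (ht (n 1), Y2 n, ht (n 3))"
      by (rule normalise[OF c(1)])
    obtain m y where m: "m 0 = 0" "pts m \<in> Q" "orbit (pts m) = orbit c'" "y = 1 \<or> y = - 1" "rel a y m" "tc c' = (ht (m 1), Y2 m, ht (m 3))"
      by (rule normalise[OF c(3)])
    have teq: "tc c = tc c'" using eq H_orbit QB c by simp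
    have "tc c \<in> Mz z" "tc c \<in> Mz y" using rel_Mz[OF n(5,1,4)] rel_Mz[OF m(5,1,4)] n(6) m(6) teq by simp_all
    then have "y = z" using Mz_disjoint n(4) m(4) by metis
    then obtain \<zeta> where \<zeta>: "cmod \<zeta> = 1" "\<And>j. j \<le> 3 \<Longrightarrow> m j = \<zeta> * n j"
      using rel_unique[of z n m] n m teq by auto
    obtain g where g: "unitary g" "\<And>k. g ` pt k = pt (\<zeta> * k)" using rotate_unit[OF \<zeta>(1)] by blast
    have "pts m = act g (pts n)" using \<zeta>(2) g(2) by (auto simp: pts_def act_def fun_eq_iff)
    then show "P = P'" using orbit_eq[OF g(1), of "pts n"] n(3) m(3) c by simp
  qed
  show "continuous_map ?X (top_of_set ?M) H"
  proof -
    have "openin ?X {P \<in> topspace ?X. H P \<in> U}" if "open U" for U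
    proof -
      have "{c \<in> topspace TQ. orbit c \<in> {P \<in> topspace ?X. H P \<in> U}} = {c \<in> topspace TQ. tc c \<in> U}"
        unfolding topspace_TQ tX using H_orbit[OF QB] by auto
      moreover have "openin TQ {c \<in> topspace TQ. tc c \<in> U}"
        using continuous_tc that by (simp add: continuous_map_def)
      ultimately show ?thesis unfolding X openin_quotient by (simp add: X topspace_TQ)
    qed
    then have "continuous_map ?X euclidean H" by (simp add: continuous_map_def)
    then show ?thesis using img by (auto simp: continuous_map_in_subtopology)
  qed
  show "closed_map ?X (top_of_set ?M) H"
    unfolding closed_map_def
  proof (intro allI impI)
    fix C assume C: "closedin ?X C"
    define D where "D = {c \<in> Q. orbit c \<in> C}"
    have D: "closedin TQ D" "C = orbit ` D"
      using C unfolding X closedin_quotient topspace_TQ D_def by auto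
    \<comment> \<open>The slice of normalised quadruples; it is closed, being given by matrix
      equations, and it meets every orbit.\<close>
    define A where "A = {x. rel a 1 (q3 x) \<or> rel a (- 1) (q3 x)}"
    have AQ: "x \<in> A \<longleftrightarrow> pts (q3 x) \<in> Q" for x by (simp add: A_def quadruple_iff)
    have contq: "continuous_on UNIV (\<lambda>x. q3 x j)" for j
      unfolding q3_def case_prod_beta
      by (cases "j = 0"; cases "j = 1"; cases "j = 2") (simp_all add: continuous_on_fst continuous_on_snd continuous_on_id)
    have "closed {x. rel a z (q3 x)}" for z
      unfolding rel_def sm_def
      by (intro closed_Collect_eq continuous_intros contq)
    then have "closed A" unfolding A_def by (simp add: closed_Collect_disj)
    have cpq: "continuous_map euclidean (product_topology (\<lambda>_. BV_topology) {..3}) (\<lambda>x. pts (q3 x))"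
      using continuous_map_pts unfolding q3_def case_prod_beta .
    then have "continuous_map (top_of_set A) TQ (\<lambda>x. pts (q3 x))"
      using AQ by (auto simp: continuous_map_in_subtopology intro: continuous_map_from_subtopology)
    then have "closedin (top_of_set A) {x \<in> topspace (top_of_set A). pts (q3 x) \<in> D}"
      using D(1) closedin_continuous_map_preimage by blast
    then have clB: "closed {x \<in> A. pts (q3 x) \<in> D}"
      using \<open>closed A\<close> by (simp add: closedin_closed_eq)
    define B where "B = {x \<in> A. pts (q3 x) \<in> D}"
    define F where "F = (\<lambda>x. (ht (q3 x 1), Y2 (q3 x), ht (q3 x 3)))"
    have "H ` C = F ` B"
    proof (intro equalityI subsetI)
      fix y assume "y \<in> H ` C"
      then obtain P where P: "P \<in> C" "y = H P" by blast
      then obtain c where "c \<in> D" "P = orbit c" using D(2) by blast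
      with P have c: "c \<in> Q" "orbit c \<in> C" "y = H (orbit c)" unfolding D_def by simp_all
      obtain n z where n: "n 0 = 0" "pts n \<in> Q" "orbit (pts n) = orbit c" "z = 1 \<or> z = - 1" "rel a z n" "tc c = (ht (n 1), Y2 n, ht (n 3))"
        by (rule normalise[OF c(1)])
      have "y = tc c" using c H_orbit[OF QB] by simp
      moreover have "F (n 1, n 2, n 3) = tc c" unfolding n(6) F_def Y2_def q3 fst_conv snd_conv ..
      moreover have "(n 1, n 2, n 3) \<in> B"
        using n(2,3) c(2) unfolding q3_pts[of n, OF n(1)] B_def D_def AQ by simp
      ultimately show "y \<in> F ` B" by (metis image_eqI)
    next
      fix y assume "y \<in> F ` B"
      then obtain x where x: "x \<in> B" "y = F x" by blast
      then have "y = H (orbit (pts (q3 x)))"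
        unfolding H_orbit[OF pts_PiE] tc_pts[of "q3 x", OF q3(1)] F_def by simp
      moreover have "orbit (pts (q3 x)) \<in> C" using x(1) unfolding B_def D_def by simp
      ultimately show "y \<in> H ` C" by (rule image_eqI)
    qed
    moreover have "closed (F ` B)"
    proof (rule closed_image_proper)
      show "closed B" using clB by (simp add: B_def)
      show "continuous_on B F"
        unfolding F_def Y2_def Yg_def
        by (rule continuous_on_subset[of UNIV]) (intro continuous_intros contq, simp)
      fix V :: "(real \<times> real \<times> real) set" assume "bounded V"
      then obtain r where r: "\<And>v. v \<in> V \<Longrightarrow> norm v \<le> r" by (auto simp: bounded_iff)
      \<comment> \<open>The first and third coordinates bound \<open>n\<^sub>1\<close> and
        \<open>n\<^sub>3\<close> directly; the middle radius comes from \<open>Yg_growth\<close>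
        with the off-diagonal entry bounded by \<open>r\<close>.\<close>
      have "{x \<in> B. F x \<in> V} \<subseteq> cball 0 r \<times> (cball 0 (r * (2 + 4 * r\<^sup>2)) \<times> cball 0 r)"
      proof
        fix x assume "x \<in> {x \<in> B. F x \<in> V}"
        then have "norm (F x) \<le> r" using r by blast
        moreover have "norm (fst (F x)) \<le> norm (F x)" "norm (snd (F x)) \<le> norm (F x)"
          by (metis norm_fst_le prod.collapse, metis norm_snd_le prod.collapse)
        moreover have "norm (fst (snd (F x))) \<le> norm (snd (F x))" "norm (snd (snd (F x))) \<le> norm (snd (F x))"
          by (metis norm_fst_le prod.collapse, metis norm_snd_le prod.collapse)
        ultimately have b: "ht (q3 x 1) \<le> r" "Y2 (q3 x) \<le> r" "ht (q3 x 3) \<le> r"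
          by (auto simp: F_def)
        have n13: "cmod (q3 x 1) \<le> r" "cmod (q3 x 3) \<le> r"
          using b cmod_less_ht[of "q3 x 1"] cmod_less_ht[of "q3 x 3"] by linarith+
        have "cmod (snd (rq (a 1) (q3 x 1))) \<le> r"
        proof -
          have "cmod (snd (rq (a 1) (q3 x 1))) = cmod (q3 x 1) * \<bar>sin (a 1)\<bar>"
            by (simp add: rq_def norm_mult)
          also have "\<dots> \<le> cmod (q3 x 1) * 1" by (intro mult_left_mono) auto
          finally show ?thesis using n13 by simp
        qed
        then have sq: "(cmod (snd (rq (a 1) (q3 x 1))))\<^sup>2 \<le> r\<^sup>2" by (rule power_mono) simp
        have "Y2 (q3 x) * (2 + 4 * (cmod (snd (rq (a 1) (q3 x 1))))\<^sup>2) \<le> r * (2 + 4 * r\<^sup>2)"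
        proof (rule mult_mono)
          show "0 \<le> r" using b(1) ht_pos[of "q3 x 1"] by linarith
        qed (use b(2) sq in auto)
        then have "ht (q3 x 2) \<le> r * (2 + 4 * r\<^sup>2)"
          using Yg_growth[OF nrm_rq less_imp_le[OF cmod_less_ht[of "q3 x 2"]]] unfolding Y2_def by (rule order_trans[rotated])
        then have "cmod (q3 x 2) \<le> r * (2 + 4 * r\<^sup>2)" using cmod_less_ht[of "q3 x 2"] by linarith
        then show "x \<in> cball 0 r \<times> (cball 0 (r * (2 + 4 * r\<^sup>2)) \<times> cball 0 r)"
          using n13 by (simp add: q3 mem_Times_iff)
      qed
      then show "bounded {x \<in> B. F x \<in> V}"
        by (rule bounded_subset[rotated]) (intro bounded_Times bounded_cball)
    qed
    ultimately have "closed (H ` C)" by simp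
    moreover have "H ` C \<subseteq> ?M" using img C closedin_subset by fastforce
    ultimately show "closedin (top_of_set ?M) (H ` C)" by (rule closed_subset[rotated])
  qed
qed

end

section \<open>Kinds of isometries and the second type\<close>

context hermitian_basis
begin

lemma mat_fixed_iff:
  assumes "nrm A" "v \<noteq> 0" shows "mat A ` span {v} = span {v} \<longleftrightarrow> (\<exists>k. mat A v = k *\<^sub>V v)"
  unfolding unitary_span[OF unitary_mat[OF assms(1)]]
proof
  assume "span {mat A v} = span {v}"
  then have "mat A v \<in> span {v}" using span_base[of "mat A v" "{mat A v}"] by simp
  then show "\<exists>k. mat A v = k *\<^sub>V v" by (simp only: in_span_singleton)
next
  assume "\<exists>k. mat A v = k *\<^sub>V v"
  then obtain k where k: "mat A v = k *\<^sub>V v" ..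
  then have "k \<noteq> 0" using unitary_eq_0[OF unitary_mat[OF assms(1)], of v] assms(2) by auto
  then show "span {mat A v} = span {v}" unfolding k by (rule span_scale_eq)
qed

lemma nrm_Re_Im: "nrm A \<longleftrightarrow> (Im (fst A))\<^sup>2 - (cmod (snd A))\<^sup>2 = 1 - (Re (fst A))\<^sup>2"
  unfolding nrm_def cmod_sq[of "fst A"] by auto

lemma elliptic_mat:
  assumes A: "nrm A" and tr: "(Re (fst A))\<^sup>2 < 1" shows "elliptic (mat A)"
proof -
  define \<tau> \<mu> where "\<tau> = Re (fst A)" and "\<mu> = Im (fst A)"
  have m: "\<mu>\<^sup>2 - (cmod (snd A))\<^sup>2 = 1 - \<tau>\<^sup>2" using A unfolding nrm_Re_Im \<tau>_def \<mu>_def .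
  have \<tau>: "\<tau>\<^sup>2 < 1" using tr by (simp add: \<tau>_def)
  have \<mu>: "\<mu> \<noteq> 0"
  proof
    assume "\<mu> = 0"
    then show False using m \<tau> zero_le_power2[of "cmod (snd A)"] by simp
  qed
  \<comment> \<open>The eigenvalues are
    \<open>\<tau> \<plusminus> i * sqrt (1 - \<tau>\<^sup>2)\<close>. The sign of
    \<open>\<mu>\<close> selects the one whose eigenvector is positive: its self-product is
    \<open>2 * \<kappa>\<^sup>2 + 2 * \<kappa> * \<mu>\<close>.\<close>
  define \<kappa> where "\<kappa> = sgn \<mu> * sqrt (1 - \<tau>\<^sup>2)"
  have \<kappa>2: "\<kappa>\<^sup>2 = 1 - \<tau>\<^sup>2" using \<tau> \<mu> by (simp add: \<kappa>_def power_mult_distrib sgn_if)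
  have \<kappa>\<mu>: "0 < \<kappa> * \<mu>"
  proof -
    have "\<kappa> * \<mu> = \<bar>\<mu>\<bar> * sqrt (1 - \<tau>\<^sup>2)" by (simp add: \<kappa>_def sgn_if)
    then show ?thesis using \<mu> \<tau> by simp
  qed
  define l where "l = Complex \<tau> \<kappa>"
  have l: "l * l - 2 * of_real \<tau> * l + 1 = 0"
    using \<kappa>2 by (simp add: l_def complex_eq_iff power2_eq_square)
  have al: "fst A + cnj (fst A) = 2 * of_real \<tau>" by (simp add: \<tau>_def complex_eq_iff)
  have nA: "fst A * cnj (fst A) - snd A * cnj (snd A) = 1" using A by (simp add: nrm_complex)
  \<comment> \<open>The second row of the eigenvector equation holds identically for this choice;
    the first row is the characteristic equation.\<close>
  define v where "v = vec (l - cnj (fst A)) (cnj (snd A))"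
  have "mat A v = l *\<^sub>V v"
    unfolding v_def mat_vec vec_scale vec_inject
  proof
    show "fst A * (l - cnj (fst A)) + snd A * cnj (snd A) = l * (l - cnj (fst A))"
      using l al nA by algebra
    show "cnj (snd A) * (l - cnj (fst A)) + cnj (fst A) * cnj (snd A) = l * cnj (snd A)" by algebra
  qed
  moreover have hv: "Re (h v v) > 0"
  proof -
    have "Re (h v v) = (cmod (l - cnj (fst A)))\<^sup>2 - (cmod (snd A))\<^sup>2"
    proof -
      have "h v v = of_real ((cmod (l - cnj (fst A)))\<^sup>2 - (cmod (snd A))\<^sup>2)"
        unfolding v_def h_vec of_real_diff complex_norm_square by (simp add: mult.commute)
      then show ?thesis by (simp only: Re_complex_of_real)
    qed
    also have "(cmod (l - cnj (fst A)))\<^sup>2 = (\<kappa> + \<mu>)\<^sup>2"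
      unfolding cmod_sq by (simp add: l_def \<tau>_def \<mu>_def)
    finally have "Re (h v v) = 2 * \<kappa>\<^sup>2 + 2 * (\<kappa> * \<mu>)" using m \<kappa>2 by (simp add: power2_sum)
    then show ?thesis using \<kappa>\<mu> zero_le_power2[of \<kappa>] by linarith
  qed
  moreover have "v \<noteq> 0" using BV_nonzero[OF hv] .
  ultimately have "mat A ` span {v} = span {v}" "span {v} \<in> BV"
    using mat_fixed_iff[OF A] by (auto simp: BV_def)
  moreover have "\<not> trivial_in_PU (mat A)" using \<mu> unfolding trivial_mat[OF A] \<mu>_def by auto
  ultimately show ?thesis unfolding elliptic_def by blast
qed

text \<open>The ratio of the coordinates of a fixed point satisfies a quadratic equation. For half
  trace of modulus at least 1, completing the square shows that this ratio has modulus 1 unless the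
  off-diagonal entry vanishes, which leaves only scalar matrices.\<close>

lemma no_fixed_positive:
  assumes A: "nrm A" and tr: "1 \<le> (Re (fst A))\<^sup>2" and nt: "\<not> trivial_in_PU (mat A)" and c: "c \<in> BV"
  shows "mat A ` c \<noteq> c"
proof
  assume fx: "mat A ` c = c"
  obtain v where v: "c = span {v}" "Re (h v v) > 0" using c by (auto simp: BV_def)
  obtain x y where xy: "v = vec x y" by (rule vec_cases)
  have lt: "(cmod y)\<^sup>2 < (cmod x)\<^sup>2"
    using v(2) unfolding xy h_vec complex_norm_square[symmetric] of_real_diff[symmetric] by simp
  obtain k where k: "mat A v = k *\<^sub>V v" using fx mat_fixed_iff[OF A BV_nonzero[OF v(2)]] v(1) by auto
  define \<tau> \<mu> where "\<tau> = Re (fst A)" and "\<mu> = Im (fst A)"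
  have m: "\<mu>\<^sup>2 - (cmod (snd A))\<^sup>2 = 1 - \<tau>\<^sup>2" using A unfolding nrm_Re_Im \<tau>_def \<mu>_def .
  define \<rho> where "\<rho> = sqrt (\<tau>\<^sup>2 - 1)"
  have \<rho>: "\<rho>\<^sup>2 = \<tau>\<^sup>2 - 1" using tr by (simp add: \<rho>_def \<tau>_def)
  have e: "fst A * x + snd A * y = k * x" "cnj (snd A) * x + cnj (fst A) * y = k * y"
    using k unfolding xy mat_vec vec_scale vec_inject by blast+
  have al: "fst A - cnj (fst A) = 2 * \<i> * of_real \<mu>" by (simp add: \<mu>_def complex_eq_iff)
  have bb: "snd A * cnj (snd A) = of_real (\<mu>\<^sup>2 + \<rho>\<^sup>2)"
  proof -
    have "(cmod (snd A))\<^sup>2 = \<mu>\<^sup>2 + \<rho>\<^sup>2" using m \<rho> by simp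
    then show ?thesis by (simp only: complex_norm_square[symmetric])
  qed
  have "snd A * y * y + (fst A - cnj (fst A)) * x * y - cnj (snd A) * x * x = 0"
    using e by algebra
  then have "(snd A * y + \<i> * of_real \<mu> * x)\<^sup>2 = (of_real \<rho> * x)\<^sup>2"
  proof -
    have "(snd A * y + \<i> * of_real \<mu> * x)\<^sup>2 - (of_real \<rho> * x)\<^sup>2 =
        snd A * (snd A * y * y + (2 * \<i> * of_real \<mu>) * x * y - cnj (snd A) * x * x) +
        x * x * (snd A * cnj (snd A) - of_real (\<mu>\<^sup>2 + \<rho>\<^sup>2))"
      by (simp add: power2_eq_square algebra_simps)
    then show ?thesis using \<open>_ = 0\<close> unfolding al bb by simp
  qed
  then have "snd A * y + \<i> * of_real \<mu> * x = of_real \<rho> * x \<or> snd A * y + \<i> * of_real \<mu> * x = - (of_real \<rho> * x)"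
    by (simp only: power2_eq_iff)
  then have "snd A * y = Complex \<rho> (- \<mu>) * x \<or> snd A * y = Complex (- \<rho>) (- \<mu>) * x"
    by (auto simp: Complex_eq algebra_simps eq_diff_eq diff_eq_eq add_eq_0_iff)
  then have "(cmod (snd A))\<^sup>2 * (cmod y)\<^sup>2 = (\<rho>\<^sup>2 + \<mu>\<^sup>2) * (cmod x)\<^sup>2"
  proof
    assume "snd A * y = Complex \<rho> (- \<mu>) * x"
    then have "(cmod (snd A * y))\<^sup>2 = (cmod (Complex \<rho> (- \<mu>) * x))\<^sup>2" by simp
    then show ?thesis unfolding norm_mult power_mult_distrib cmod_sq[of "Complex _ _"] by simp
  next
    assume "snd A * y = Complex (- \<rho>) (- \<mu>) * x"
    then have "(cmod (snd A * y))\<^sup>2 = (cmod (Complex (- \<rho>) (- \<mu>) * x))\<^sup>2" by simp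
    then show ?thesis unfolding norm_mult power_mult_distrib cmod_sq[of "Complex _ _"] by simp
  qed
  moreover have b2: "(cmod (snd A))\<^sup>2 = \<rho>\<^sup>2 + \<mu>\<^sup>2" using m \<rho> by simp
  ultimately have "(cmod (snd A))\<^sup>2 = 0" using lt by auto
  then have 0: "snd A = 0" "\<rho>\<^sup>2 + \<mu>\<^sup>2 = 0" using b2 by simp_all
  then have "\<rho> = 0" "\<mu> = 0" by (simp_all add: sum_power2_eq_zero_iff)
  then have "\<tau>\<^sup>2 = 1" using \<rho> by simp
  then have "\<tau> = 1 \<or> \<tau> = - 1" by (simp add: power2_eq_1_iff)
  then have "A = (of_real 1, 0) \<or> A = (of_real (- 1), 0)"
    using 0(1) \<open>\<mu> = 0\<close> unfolding \<tau>_def \<mu>_def prod_eq_iff complex_eq_iff by auto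
  then show False using nt trivial_mat[OF A] by blast
qed

text \<open>Isotropic lines are spanned by \<open>(1, \<zeta>)\<close> with \<open>\<zeta>\<close>
  of modulus 1. There the conjugate of \<open>\<zeta>\<close> is its inverse, and the quadratic
  fixed-point equation is \<open>\<zeta>\<close> times a purely imaginary number: one real linear
  condition.\<close>

lemma fixed_absolute:
  assumes A: "nrm A"
  shows "{c \<in> absolute. mat A ` c = c} =
     (\<lambda>\<zeta>. span {vec 1 \<zeta>}) ` {\<zeta>. cmod \<zeta> = 1 \<and> Im (snd A * \<zeta>) = - Im (fst A)}"
    "inj (\<lambda>\<zeta>. span {vec 1 \<zeta>})"
proof -
  show "inj (\<lambda>\<zeta>. span {vec 1 \<zeta>})"
  proof (rule injI)
    fix \<zeta> \<xi> assume "span {vec 1 \<zeta>} = span {vec 1 \<xi>}"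
    then have "vec 1 \<zeta> \<in> span {vec 1 \<xi>}" using span_base[of "vec 1 \<zeta>" "{vec 1 \<zeta>}"] by simp
    then show "\<zeta> = \<xi>" by (auto simp: in_span_singleton vec_scale)
  qed
  have nz: "vec 1 \<zeta> \<noteq> 0" for \<zeta> unfolding vec_0[symmetric] by simp
  have fix_iff: "mat A ` span {vec 1 \<zeta>} = span {vec 1 \<zeta>} \<longleftrightarrow> Im (snd A * \<zeta>) = - Im (fst A)" if \<zeta>: "cmod \<zeta> = 1" for \<zeta>
  proof -
    have "mat A ` span {vec 1 \<zeta>} = span {vec 1 \<zeta>} \<longleftrightarrow> cnj (snd A) + cnj (fst A) * \<zeta> = (fst A + snd A * \<zeta>) * \<zeta>"
      unfolding mat_fixed_iff[OF A nz] mat_vec vec_scale vec_inject by auto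
    also have "\<dots> \<longleftrightarrow> \<zeta> * (snd A * \<zeta> - cnj (snd A * \<zeta>) + (fst A - cnj (fst A))) = 0"
    proof -
      have "\<zeta> * cnj \<zeta> = 1" using \<zeta> by (simp add: complex_norm_square[symmetric])
      then have "\<zeta> * (snd A * \<zeta> - cnj (snd A * \<zeta>) + (fst A - cnj (fst A))) =
          (fst A + snd A * \<zeta>) * \<zeta> - (cnj (snd A) + cnj (fst A) * \<zeta>)"
        unfolding complex_cnj_mult by algebra
      then show ?thesis by auto
    qed
    also have "\<dots> \<longleftrightarrow> snd A * \<zeta> - cnj (snd A * \<zeta>) + (fst A - cnj (fst A)) = 0" using \<zeta> by auto
    also have "\<dots> \<longleftrightarrow> Im (snd A * \<zeta>) = - Im (fst A)"
    proof -
      have "w - cnj w + (v - cnj v) = 0 \<longleftrightarrow> Im w = - Im v" for w v by (auto simp: complex_eq_iff)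
      then show ?thesis .
    qed
    finally show ?thesis .
  qed
  have "c \<in> absolute \<longleftrightarrow> (\<exists>\<zeta>. cmod \<zeta> = 1 \<and> c = span {vec 1 \<zeta>})" for c
  proof
    assume "c \<in> absolute"
    then obtain v where v: "c = span {v}" "v \<noteq> 0" "h v v = 0" by (auto simp: absolute_def)
    obtain x y where xy: "v = vec x y" by (rule vec_cases)
    have "of_real ((cmod x)\<^sup>2 - (cmod y)\<^sup>2) = h v v" unfolding xy h_vec of_real_diff complex_norm_square ..
    then have eq: "(cmod x)\<^sup>2 = (cmod y)\<^sup>2" using v(3) by (metis eq_iff_diff_eq_0 of_real_eq_0_iff)
    have x: "x \<noteq> 0"
    proof
      assume "x = 0"
      then have "v = 0" using eq unfolding xy vec_0[symmetric] by simp
      then show False using v by simp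
    qed
    have "cmod y = cmod x" using eq by (simp add: power2_eq_iff_nonneg)
    then have "cmod (y / x) = 1" using x by (simp add: norm_divide)
    moreover have "c = span {vec 1 (y / x)}"
      using span_scale_eq[OF x, of "vec 1 (y / x)"] x by (simp add: v(1) xy vec_scale)
    ultimately show "\<exists>\<zeta>. cmod \<zeta> = 1 \<and> c = span {vec 1 \<zeta>}" by blast
  next
    assume "\<exists>\<zeta>. cmod \<zeta> = 1 \<and> c = span {vec 1 \<zeta>}"
    then obtain \<zeta> where z: "cmod \<zeta> = 1" "c = span {vec 1 \<zeta>}" by blast
    have "\<zeta> * cnj \<zeta> = 1" using z(1) by (simp add: complex_norm_square[symmetric])
    then have "h (vec 1 \<zeta>) (vec 1 \<zeta>) = 0" unfolding h_vec by simp
    then show "c \<in> absolute" unfolding absolute_def z(2) using nz by blast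
  qed
  note abs_iff = this
  define g where "g = (\<lambda>\<zeta>. span {vec 1 \<zeta>})"
  have gs: "span {vec 1 \<zeta>} = g \<zeta>" for \<zeta> by (simp add: g_def)
  have idx: "{\<zeta>. cmod \<zeta> = 1 \<and> mat A ` g \<zeta> = g \<zeta>} = {\<zeta>. cmod \<zeta> = 1 \<and> Im (snd A * \<zeta>) = - Im (fst A)}"
    unfolding gs[symmetric] by (rule Collect_cong) (rule conj_cong[OF refl fix_iff])
  have "c \<in> {c \<in> absolute. mat A ` c = c} \<longleftrightarrow> c \<in> g ` {\<zeta>. cmod \<zeta> = 1 \<and> mat A ` g \<zeta> = g \<zeta>}" for c
    unfolding mem_Collect_eq abs_iff gs image_iff bex_simps by blast
  then show "{c \<in> absolute. mat A ` c = c} =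
     (\<lambda>\<zeta>. span {vec 1 \<zeta>}) ` {\<zeta>. cmod \<zeta> = 1 \<and> Im (snd A * \<zeta>) = - Im (fst A)}"
    unfolding idx[symmetric] g_def[symmetric] by (intro set_eqI)
qed

text \<open>Multiplication by \<open>snd A\<close> carries the unit circle to the circle of squared
  radius \<open>\<rho>\<^sup>2 + \<mu>\<^sup>2\<close>, and the condition becomes a horizontal line
  at height \<open>- \<mu>\<close>. They meet where the real part is \<open>\<rho>\<close> or
  \<open>- \<rho>\<close>.\<close>

lemma card_fixed_absolute:
  assumes A: "nrm A" and b: "snd A \<noteq> 0" and tr: "1 \<le> (Re (fst A))\<^sup>2"
  shows "card {c \<in> absolute. mat A ` c = c} = (if (Re (fst A))\<^sup>2 = 1 then 1 else 2)"
proof -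
  define \<tau> \<mu> where "\<tau> = Re (fst A)" and "\<mu> = Im (fst A)"
  have m: "\<mu>\<^sup>2 - (cmod (snd A))\<^sup>2 = 1 - \<tau>\<^sup>2" using A unfolding nrm_Re_Im \<tau>_def \<mu>_def .
  define \<rho> where "\<rho> = sqrt (\<tau>\<^sup>2 - 1)"
  have \<rho>: "\<rho>\<^sup>2 = \<tau>\<^sup>2 - 1" using tr by (simp add: \<rho>_def \<tau>_def)
  have "{\<zeta>. cmod \<zeta> = 1 \<and> Im (snd A * \<zeta>) = - \<mu>} = {Complex \<rho> (- \<mu>) / snd A, Complex (- \<rho>) (- \<mu>) / snd A}"
  proof -
    have "cmod \<zeta> = 1 \<and> Im (snd A * \<zeta>) = - \<mu> \<longleftrightarrow> snd A * \<zeta> = Complex \<rho> (- \<mu>) \<or> snd A * \<zeta> = Complex (- \<rho>) (- \<mu>)" for \<zeta>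
    proof -
      have "cmod \<zeta> = 1 \<longleftrightarrow> (cmod \<zeta>)\<^sup>2 = 1"
        by (metis norm_ge_zero one_power2 power2_eq_iff_nonneg zero_le_one)
      also have "\<dots> \<longleftrightarrow> (cmod (snd A))\<^sup>2 * (cmod \<zeta>)\<^sup>2 = (cmod (snd A))\<^sup>2" using b by simp
      also have "(cmod (snd A))\<^sup>2 * (cmod \<zeta>)\<^sup>2 = (Re (snd A * \<zeta>))\<^sup>2 + (Im (snd A * \<zeta>))\<^sup>2"
        by (simp only: cmod_sq[symmetric] norm_mult power_mult_distrib)
      also have "(cmod (snd A))\<^sup>2 = \<rho>\<^sup>2 + \<mu>\<^sup>2" using m \<rho> by simp
      finally have 1: "cmod \<zeta> = 1 \<longleftrightarrow> (Re (snd A * \<zeta>))\<^sup>2 + (Im (snd A * \<zeta>))\<^sup>2 = \<rho>\<^sup>2 + \<mu>\<^sup>2" .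
      have "(Re w)\<^sup>2 + (Im w)\<^sup>2 = \<rho>\<^sup>2 + \<mu>\<^sup>2 \<and> Im w = - \<mu> \<longleftrightarrow> w = Complex \<rho> (- \<mu>) \<or> w = Complex (- \<rho>) (- \<mu>)" for w
        unfolding complex_eq_iff by (auto simp: power2_eq_iff)
      then show ?thesis unfolding 1 .
    qed
    moreover have "snd A * \<zeta> = v \<longleftrightarrow> \<zeta> = v / snd A" for \<zeta> v
      using b by (simp add: nonzero_eq_divide_eq mult.commute)
    ultimately show ?thesis by (simp only: insert_compr empty_iff Collect_conj_eq) auto
  qed
  then have "card {c \<in> absolute. mat A ` c = c} = card {Complex \<rho> (- \<mu>) / snd A, Complex (- \<rho>) (- \<mu>) / snd A}"
    unfolding fixed_absolute(1)[OF A] \<mu>_def[symmetric]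
    using card_image[OF inj_on_subset[OF fixed_absolute(2)[OF A] subset_UNIV]] by metis
  also have "\<dots> = (if \<rho> = 0 then 1 else 2)" using b by (auto simp: card_insert_if)
  also have "\<rho> = 0 \<longleftrightarrow> (Re (fst A))\<^sup>2 = 1" by (simp add: \<rho>_def \<tau>_def)
  finally show ?thesis .
qed

lemma not_trivial_snd: assumes A: "nrm A" and "1 \<le> (Re (fst A))\<^sup>2" "\<not> trivial_in_PU (mat A)" shows "snd A \<noteq> 0"
proof
  assume 0: "snd A = 0"
  then have 1: "(Im (fst A))\<^sup>2 = 1 - (Re (fst A))\<^sup>2" using A unfolding nrm_Re_Im by simp
  then have "(Im (fst A))\<^sup>2 = 0" using assms(2) zero_le_power2[of "Im (fst A)"] by linarith
  then have "Im (fst A) = 0" "(Re (fst A))\<^sup>2 = 1" using 1 by simp_all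
  then have "A = (of_real 1, 0) \<or> A = (of_real (- 1), 0)"
    using 0 unfolding prod_eq_iff complex_eq_iff by (auto simp: power2_eq_1_iff)
  then show False using assms(3) trivial_mat[OF A] by blast
qed

lemma hyperbolic_mat:
  assumes A: "nrm A" and tr: "1 < (Re (fst A))\<^sup>2" shows "hyperbolic (mat A)"
proof -
  have nt: "\<not> trivial_in_PU (mat A)" using tr trivial_mat[OF A] by auto
  show ?thesis unfolding hyperbolic_def
    using no_fixed_positive[OF A _ nt] card_fixed_absolute[OF A not_trivial_snd[OF A _ nt]] tr by auto
qed

lemma parabolic_mat:
  assumes A: "nrm A" and tr: "(Re (fst A))\<^sup>2 = 1" and nt: "\<not> trivial_in_PU (mat A)" shows "parabolic (mat A)"
  unfolding parabolic_def
  using no_fixed_positive[OF A _ nt] card_fixed_absolute[OF A not_trivial_snd[OF A _ nt]] tr by auto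

end

context hermitian_plane
begin

lemma elliptic_not_hyperbolic: "elliptic g \<Longrightarrow> \<not> hyperbolic g"
  by (auto simp: elliptic_def hyperbolic_def)

lemma parabolic_not_hyperbolic: "parabolic g \<Longrightarrow> \<not> hyperbolic g"
  by (auto simp: parabolic_def hyperbolic_def)

lemma trivial_not_hyperbolic: assumes "trivial_in_PU g" shows "\<not> hyperbolic g"
proof -
  obtain z where z: "cmod z = 1" "\<And>v. g v = z *\<^sub>V v" using assms by (auto simp: trivial_in_PU_def)
  obtain v where v: "h v v = 1" using exists_orthonormal by metis
  have z0: "z \<noteq> 0" using z by auto
  have "g ` span {v} = span {v}"
  proof (intro equalityI subsetI)
    fix w assume "w \<in> g ` span {v}" then show "w \<in> span {v}" using z(2) span_scale by auto
  next
    fix w assume "w \<in> span {v}"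
    then have "(1 / z) *\<^sub>V w \<in> span {v}" by (rule span_scale)
    moreover have "w = g ((1 / z) *\<^sub>V w)" using z0 by (simp add: z)
    ultimately show "w \<in> g ` span {v}" by (rule rev_image_eqI)
  qed
  moreover have "span {v} \<in> BV" using v by (auto simp: BV_def)
  ultimately show ?thesis unfolding hyperbolic_def by blast
qed

end

context hexagons
begin

text \<open>\<open>\<tau>\<close> is half the trace and decides the kind, except at - 1, where the
  map may be parabolic or trivial; there the angles decide.\<close>

lemma R03_kind:
  fixes c
  assumes c: "c \<in> {..3} \<rightarrow>\<^sub>E BV"
  defines "g \<equiv> R a c 0 \<circ> R a c 3"
    and "\<tau> \<equiv> cos (a 0) * cos (a 3) - sin (a 0) * sin (a 3) * (2 * ta (c 3) (c 0) - 1)"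
  shows "\<tau>\<^sup>2 < 1 \<Longrightarrow> elliptic g" "1 < \<tau>\<^sup>2 \<Longrightarrow> hyperbolic g"
    "\<tau> = - 1 \<Longrightarrow> cos (a 0) + cos (a 3) \<noteq> 0 \<Longrightarrow> parabolic g"
    "\<tau> = - 1 \<Longrightarrow> cos (a 0) + cos (a 3) = 0 \<Longrightarrow> trivial_in_PU g"
proof -
  define n where "n = (\<lambda>j. un (c j))"
  have cn: "c = pts n" using PiE_pts[OF c] by (simp add: n_def)
  define A where "A = sm (rq (a 0) (n 0)) (rq (a 3) (n 3))"
  have nA: "nrm A" unfolding A_def by (intro nrm_sm nrm_rq)
  have g: "g = mat A" unfolding g_def cn by (simp add: R_pts mat_sm A_def)
  have ta: "2 * ta (c 3) (c 0) - 1 = ht (n 3) * ht (n 0) - Re (n 3 * cnj (n 0))"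
    by (simp add: cn pts_def ta_pt add_divide_distrib diff_divide_distrib)
  have tr: "Re (fst A) = \<tau>" unfolding \<tau>_def ta by (simp add: A_def sm_def rq_def algebra_simps)
  show "\<tau>\<^sup>2 < 1 \<Longrightarrow> elliptic g" unfolding g using elliptic_mat[OF nA] tr by simp
  show "1 < \<tau>\<^sup>2 \<Longrightarrow> hyperbolic g" unfolding g using hyperbolic_mat[OF nA] tr by simp
  note s = sin_pos[of 0, simplified] sin_pos[of 3, simplified]
  {
    assume 1: "\<tau> = - 1" and ne: "cos (a 0) + cos (a 3) \<noteq> 0"
    have "\<not> trivial_in_PU (mat A)"
    proof
      assume "trivial_in_PU (mat A)"
      then have "A = (of_real (- 1), 0)" using trivial_mat[OF nA] tr 1 by auto
      \<comment> \<open>Were the product - 1, \<open>R\<^sub>3\<close> would be minus the inverse of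
        \<open>R\<^sub>0\<close>; the real parts of the first entries give opposite cosines.\<close>
      then have "sm (si (rq (a 0) (n 0))) A = sm (si (rq (a 0) (n 0))) (of_real (- 1), 0)" by simp
      then have "rq (a 3) (n 3) = sm (si (rq (a 0) (n 0))) (of_real (- 1), 0)"
        unfolding A_def by (simp add: nrm_rq)
      then have "Re (fst (rq (a 3) (n 3))) = - Re (fst (rq (a 0) (n 0)))" by (simp add: sm_def si_def)
      then show False using ne by (simp add: rq_def)
    qed
    then show "parabolic g" unfolding g using parabolic_mat[OF nA] tr 1 by simp
  }
  {
    assume 1: "\<tau> = - 1" and eq: "cos (a 0) + cos (a 3) = 0"
    have c3: "cos (a 3) = - cos (a 0)" using eq by simp
    have "(sin (a 3))\<^sup>2 = (sin (a 0))\<^sup>2" using c3 by (simp add: sin_squared_eq)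
    then have s3: "sin (a 3) = sin (a 0)" using s by (simp add: power2_eq_iff_nonneg)
    \<comment> \<open>Supplementary angles have equal sines, and then half trace - 1 says that the
      two centres coincide.\<close>
    have "sin (a 0) * sin (a 0) * (2 * ta (c 3) (c 0) - 1) = 1 - cos (a 0) * cos (a 0)"
      using 1 unfolding \<tau>_def c3 s3 by simp
    also have "\<dots> = sin (a 0) * sin (a 0)"
      using sin_cos_squared_add[of "a 0"] unfolding power2_eq_square by linarith
    finally have "ta (c 3) (c 0) = 1" using s by simp
    then have "wd (n 3) = wd (n 0)" using ta_wd[of "n 3" "n 0"] by (simp add: cn pts_def)
    then have n3: "n 3 = n 0" by (metis nd_wd)
    have "rq (a 3) (n 3) = sm (of_real (- 1), 0) (si (rq (a 0) (n 0)))"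
      unfolding n3 by (simp add: rq_def sm_def si_def c3 s3 complex_eq_iff)
    then have "A = (of_real (- 1), 0)"
      unfolding A_def by (simp only: sm_central_left sm_si[OF nrm_rq] sm_one)
    then show "trivial_in_PU g" unfolding g trivial_mat[OF nA] by blast
  }
qed

end

context hermitian_plane
begin

text \<open>Conjugating the complex structure turns rotations into their inverses and thus exchanges the two
  types of hexagons.\<close>

lemma hermitian_plane_conj: "hermitian_plane (\<lambda>k. scl (cnj k)) (\<lambda>u v. h v u)"
proof -
  interpret c: vector_space "\<lambda>k. scl (cnj k)"
    by unfold_locales (simp_all add: scale_right_distrib scale_left_distrib)
  \<comment> \<open>The subspaces are the same for both complex structures, hence so are spans,
    independence and dimension.\<close>
  have sub: "c.subspace S \<longleftrightarrow> subspace S" for S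
    unfolding c.subspace_def subspace_def by (metis complex_cnj_cnj)
  have span: "c.span S = span S" for S
    by (intro equalityI c.span_minimal span_minimal)
      (simp_all add: sub[symmetric] c.span_superset span_superset, simp_all add: sub)
  have dep: "c.dependent = dependent" by (intro ext) (simp only: c.dependent_def dependent_def span)
  have "c.dim UNIV = dim UNIV" unfolding c.dim_def dim_def span dep ..
  then show ?thesis
  proof unfold_locales
    show "c.dim UNIV = 2" if "c.dim UNIV = dim UNIV" using that dimension by simp
    show "h w (u + v) = h w u + h w v" for u v w by (rule form_add_right)
    show "h w (scl (cnj k) u) = k * h w u" for k u w by (simp add: form_scale_right)
    show "h u v = cnj (h v u)" for u v by (rule hermitian)
    show "\<exists>e f. h f e = 0 \<and> 0 < Re (h e e) \<and> Re (h f f) < 0"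
    proof -
      obtain e f where ef: "h e f = 0" "Re (h e e) > 0" "Re (h f f) < 0" using signature by blast
      have "h f e = 0" using hermitian[of f e] ef by simp
      then show ?thesis using ef by blast
    qed
  qed
qed

text \<open>Points, unitary maps, metric and orbits do not change with the structure, while
  \<open>rot p k\<close> becomes \<open>rot p (cnj k)\<close>. So each \<open>R\<^sub>j\<close>
  becomes its inverse, and the product of the first type becomes the inverse of the product of the
  second type.\<close>

lemma conj_transfer:
  shows "hermitian_plane.hexagon_space (\<lambda>k. scl (cnj k)) (\<lambda>u v. h v u) First_Type a = hexagon_space Second_Type a"
    and "P \<in> topspace (hexagon_space Second_Type a) \<Longrightarrow>
      hermitian_plane.t (\<lambda>k. scl (cnj k)) (\<lambda>u v. h v u) First_Type a j P = t Second_Type a j P"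
proof -
  interpret c: hermitian_plane "\<lambda>k. scl (cnj k)" "\<lambda>u v. h v u" by (rule hermitian_plane_conj)
  have span1: "c.span {v} = span {v}" for v
    unfolding c.span_singleton span_singleton by (auto simp: image_iff) (metis complex_cnj_cnj)+
  have BV: "c.BV = BV" unfolding c.BV_def BV_def span1 by (rule refl)
  have ta: "c.ta p q = ta p q" for p q unfolding c.ta_def ta_def by (simp add: mult.commute)
  have hd: "c.hdist = hdist" unfolding c.hdist_def[abs_def] hdist_def[abs_def] BV ta by (rule refl)
  have top: "c.BV_topology = BV_topology" unfolding c.BV_topology_def BV_topology_def BV hd by (rule refl)
  have herm: "cnj (h u v) = h v u" for u v using hermitian[of u v] by simp
  have rot: "c.rot p k v = rot p (cnj k) v" for p k v
    unfolding c.rot_def rot_def by (simp add: herm)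
  have uni: "c.unitary g \<longleftrightarrow> unitary g" for g
  proof -
    have "Vector_Spaces.linear (\<lambda>k. scl (cnj k)) (\<lambda>k. scl (cnj k)) g \<longleftrightarrow> Vector_Spaces.linear scl scl g"
      unfolding Vector_Spaces.linear_iff using vector_space_axioms c.vector_space_axioms
      by (metis complex_cnj_cnj)
    then show ?thesis unfolding c.unitary_def unitary_def by auto
  qed
  have triv: "c.trivial_in_PU g \<longleftrightarrow> trivial_in_PU g" for g
    unfolding c.trivial_in_PU_def trivial_in_PU_def by (metis complex_cnj_cnj complex_mod_cnj)
  have orbit: "c.orbit = orbit" unfolding c.orbit_def[abs_def] orbit_def[abs_def] uni by (rule refl)
  have R: "c.R a q j v = rot (q j) (cnj (cis (a j))) v" for q j v by (simp add: c.R_def rot)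
  have RR: "c.R a q j (R a q j v) = v" "R a q j (c.R a q j v) = v" if "q \<in> {..3} \<rightarrow>\<^sub>E BV" "j \<le> 3" for q j v
    using rot_inverse[of "q j" "cis (a j)" v] rot_inverse[of "q j" "cnj (cis (a j))" v] that
    by (auto simp: R R_def)
  have trivial_inverse: "trivial_in_PU G"
    if F: "trivial_in_PU F" and GF: "\<And>v. G (F v) = v" "\<And>v. F (G v) = v" for F G :: "'v \<Rightarrow> 'v"
  proof -
    obtain z where z: "cmod z = 1" "\<And>v. F v = scl z v" using F by (auto simp: trivial_in_PU_def)
    then have z0: "cnj z * z = 1" by (simp add: complex_norm_square[symmetric] mult.commute)
    have "G v = scl (cnj z) v" for v
    proof -
      have "scl (cnj z) v = scl (cnj z) (scl z (G v))" using GF(2)[of v] z(2) by simp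
      then show ?thesis by (simp add: z0)
    qed
    then show ?thesis unfolding trivial_in_PU_def using z(1) by (intro exI[of _ "cnj z"]) simp
  qed
  have quad: "c.quadruples First_Type a = quadruples Second_Type a"
  proof -
    have "trivial_in_PU (c.R a q 3 \<circ> c.R a q 2 \<circ> c.R a q 1 \<circ> c.R a q 0) \<longleftrightarrow>
        trivial_in_PU (R a q 0 \<circ> R a q 1 \<circ> R a q 2 \<circ> R a q 3)" if q: "q \<in> {..3} \<rightarrow>\<^sub>E BV" for q
    proof -
      let ?F = "R a q 0 \<circ> R a q 1 \<circ> R a q 2 \<circ> R a q 3" and ?G = "c.R a q 3 \<circ> c.R a q 2 \<circ> c.R a q 1 \<circ> c.R a q 0"
      have "?G (?F v) = v" "?F (?G v) = v" for v by (simp_all add: RR[OF q])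
      then show ?thesis using trivial_inverse[of ?F ?G] trivial_inverse[of ?G ?F] by blast
    qed
    then show ?thesis unfolding c.quadruples_def quadruples_def BV triv by auto
  qed
  show space: "c.hexagon_space First_Type a = hexagon_space Second_Type a"
    unfolding c.hexagon_space_def hexagon_space_def quad orbit top by (rule refl)
  assume P: "P \<in> topspace (hexagon_space Second_Type a)"
  then obtain q where q: "q \<in> {..3} \<rightarrow>\<^sub>E BV" "P = orbit q"
    unfolding hexagon_space_def topspace_quotient by (auto simp: quadruples_def)
  define q' where "q' = (SOME q'. q' \<in> P)"
  have "q' \<in> P" unfolding q'_def q(2)
    by (rule someI[of "\<lambda>x. x \<in> orbit q", OF orbit_self[OF q(1)]])
  then have q': "q' \<in> {..3} \<rightarrow>\<^sub>E BV" unfolding q(2) orbit_act using act_PiE[OF _ q(1)] by blast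
  have rp: "c.rotate_point First_Type a q' j p = rotate_point Second_Type a q' j p" if "j \<le> 3" for j p
  proof -
    have "inv (R a q' j) = rot (q' j) (cnj (cis (a j)))" unfolding R_def
      by (rule inv_rot) (use q' that in auto)
    then show ?thesis by (simp add: c.rotate_point_def rotate_point_def R[abs_def])
  qed
  then show "c.t First_Type a j P = t Second_Type a j P"
    unfolding c.t_def t_def q'_def[symmetric] Let_def ta c.vertex_def vertex_def by simp
qed

end

section \<open>Topological and smooth curves\<close>

text \<open>A class of expressions closed under differentiation, large enough for \<open>Pm\<close>
  and \<open>sh\<close>; membership gives smoothness without computing higher derivatives. The side
  conditions concern \<open>I\<close> only.\<close>

inductive_set smooth_terms :: "real set \<Rightarrow> (real \<Rightarrow> real) set" for I where
  const: "(\<lambda>x. c) \<in> smooth_terms I"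
| ident: "(\<lambda>x. x) \<in> smooth_terms I"
| add: "g \<in> smooth_terms I \<Longrightarrow> k \<in> smooth_terms I \<Longrightarrow> (\<lambda>x. g x + k x) \<in> smooth_terms I"
| mult: "g \<in> smooth_terms I \<Longrightarrow> k \<in> smooth_terms I \<Longrightarrow> (\<lambda>x. g x * k x) \<in> smooth_terms I"
| inverse: "g \<in> smooth_terms I \<Longrightarrow> (\<And>x. x \<in> I \<Longrightarrow> g x \<noteq> 0) \<Longrightarrow> (\<lambda>x. inverse (g x)) \<in> smooth_terms I"
| sqrt: "g \<in> smooth_terms I \<Longrightarrow> (\<And>x. x \<in> I \<Longrightarrow> 0 < g x) \<Longrightarrow> (\<lambda>x. sqrt (g x)) \<in> smooth_terms I"

lemma smooth_terms_minus: "g \<in> smooth_terms I \<Longrightarrow> (\<lambda>x. - g x) \<in> smooth_terms I"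
  using smooth_terms.mult[OF smooth_terms.const[of "- 1"], of g I] by simp

lemma smooth_terms_diff: "g \<in> smooth_terms I \<Longrightarrow> k \<in> smooth_terms I \<Longrightarrow> (\<lambda>x. g x - k x) \<in> smooth_terms I"
  using smooth_terms.add[OF _ smooth_terms_minus, of g I k] by simp

lemma smooth_terms_divide:
  "g \<in> smooth_terms I \<Longrightarrow> k \<in> smooth_terms I \<Longrightarrow> (\<And>x. x \<in> I \<Longrightarrow> k x \<noteq> 0) \<Longrightarrow> (\<lambda>x. g x / k x) \<in> smooth_terms I"
  unfolding divide_inverse by (intro smooth_terms.mult smooth_terms.inverse)

lemma smooth_terms_power: "g \<in> smooth_terms I \<Longrightarrow> (\<lambda>x. (g x)\<^sup>2) \<in> smooth_terms I"
  unfolding power2_eq_square by (rule smooth_terms.mult)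

lemmas smooth_terms_intros = smooth_terms_minus smooth_terms_diff smooth_terms_divide smooth_terms_power
  smooth_terms.const smooth_terms.ident smooth_terms.add smooth_terms.mult smooth_terms.sqrt

lemma smooth_terms_deriv:
  assumes "g \<in> smooth_terms I"
  shows "\<exists>g'\<in>smooth_terms I. \<forall>x\<in>I. (g has_real_derivative g' x) (at x)"
  using assms
proof induction
  case (const c)
  show ?case by (intro bexI[OF _ smooth_terms.const[of 0]] ballI) auto
next
  case ident
  show ?case by (intro bexI[OF _ smooth_terms.const[of 1]] ballI) auto
next
  case (add g k)
  then obtain g' k' where "g' \<in> smooth_terms I" "k' \<in> smooth_terms I"
    "\<And>x. x \<in> I \<Longrightarrow> (g has_real_derivative g' x) (at x)" "\<And>x. x \<in> I \<Longrightarrow> (k has_real_derivative k' x) (at x)"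
    by auto
  then show ?case by (intro bexI[OF _ smooth_terms.add[of g' I k']] ballI DERIV_add)
next
  case (mult g k)
  then obtain g' k' where *: "g' \<in> smooth_terms I" "k' \<in> smooth_terms I"
    "\<And>x. x \<in> I \<Longrightarrow> (g has_real_derivative g' x) (at x)" "\<And>x. x \<in> I \<Longrightarrow> (k has_real_derivative k' x) (at x)"
    by auto
  then have "(\<lambda>x. g' x * k x + k' x * g x) \<in> smooth_terms I" using mult by (intro smooth_terms.intros)
  then show ?case by (rule bexI[rotated]) (intro ballI DERIV_mult *)
next
  case (inverse g)
  then obtain g' where *: "g' \<in> smooth_terms I" "\<And>x. x \<in> I \<Longrightarrow> (g has_real_derivative g' x) (at x)" by auto
  then have "(\<lambda>x. - (inverse (g x) * g' x * inverse (g x))) \<in> smooth_terms I"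
    using inverse by (intro smooth_terms_minus smooth_terms.intros)
  then show ?case by (rule bexI[rotated]) (intro ballI DERIV_inverse' * inverse)
next
  case (sqrt g)
  then obtain g' where *: "g' \<in> smooth_terms I" "\<And>x. x \<in> I \<Longrightarrow> (g has_real_derivative g' x) (at x)" by auto
  have "(\<lambda>x. inverse (sqrt (g x)) / 2 * g' x) \<in> smooth_terms I"
    unfolding divide_inverse using sqrt *(1) by (intro smooth_terms.intros) force+
  then show ?case
    by (rule bexI[rotated]) (intro ballI DERIV_chain2[OF DERIV_real_sqrt] * sqrt)
qed

text \<open>Each iterated derivative agrees on \<open>I\<close> with a member of the class; openness
  of \<open>I\<close> carries the agreement over to the next derivative.\<close>

lemma smooth_terms_smooth:
  assumes I: "open I" and g: "g \<in> smooth_terms I"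
  shows "smooth_real_on I g"
proof -
  have "\<exists>k\<in>smooth_terms I. \<forall>x\<in>I. (deriv ^^ n) g x = k x" for n
  proof (induction n)
    case 0 show ?case using g by auto
  next
    case (Suc n)
    then obtain k where k: "k \<in> smooth_terms I" "\<And>x. x \<in> I \<Longrightarrow> (deriv ^^ n) g x = k x" by auto
    obtain k' where k': "k' \<in> smooth_terms I" "\<And>x. x \<in> I \<Longrightarrow> (k has_real_derivative k' x) (at x)"
      using smooth_terms_deriv[OF k(1)] by auto
    have "(deriv ^^ Suc n) g x = k' x" if "x \<in> I" for x
    proof -
      have "((deriv ^^ n) g has_real_derivative k' x) (at x)"
        by (rule has_field_derivative_transform_within_open[OF k'(2)[OF that] I that]) (simp add: k(2))
      then show ?thesis by (simp add: DERIV_imp_deriv)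
    qed
    then show ?case using k'(1) by blast
  qed
  then have "\<exists>k. \<forall>x\<in>I. ((deriv ^^ n) g has_real_derivative k x) (at x)" for n
  proof -
    obtain k where k: "k \<in> smooth_terms I" "\<And>x. x \<in> I \<Longrightarrow> (deriv ^^ n) g x = k x"
      using \<open>\<And>n. \<exists>k\<in>smooth_terms I. \<forall>x\<in>I. (deriv ^^ n) g x = k x\<close>[of n] by blast
    obtain k' where k': "\<And>x. x \<in> I \<Longrightarrow> (k has_real_derivative k' x) (at x)"
      using smooth_terms_deriv[OF k(1)] by auto
    have "((deriv ^^ n) g has_real_derivative k' x) (at x)" if "x \<in> I" for x
      by (rule has_field_derivative_transform_within_open[OF k'[OF that] I that]) (simp add: k(2))
    then show ?thesis by blast
  qed
  then show ?thesis unfolding smooth_real_on_def field_differentiable_def by blast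
qed

text \<open>For the curve, whose coordinates are known to be smooth terms only on the interval of
  hyperbolic parameters.\<close>

lemma smooth_real_on_cong:
  assumes "open I" "smooth_real_on I g" "\<And>x. x \<in> I \<Longrightarrow> g x = k x" shows "smooth_real_on I k"
proof -
  have eq: "(deriv ^^ n) g x = (deriv ^^ n) k x" if "x \<in> I" for n x
    using that
  proof (induction n arbitrary: x)
    case (Suc n)
    have "eventually (\<lambda>y. (deriv ^^ n) g y = (deriv ^^ n) k y) (nhds x)"
      using eventually_nhds_in_open[OF assms(1) Suc.prems] by eventually_elim (rule Suc.IH)
    then show ?case by (simp add: deriv_cong_ev)
  qed (simp add: assms(3))
  show ?thesis unfolding smooth_real_on_def
  proof (intro allI ballI)
    fix n s assume s: "s \<in> I"
    have "(deriv ^^ n) g field_differentiable at s" using assms(2) s by (auto simp: smooth_real_on_def)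
    then obtain D where "((deriv ^^ n) g has_field_derivative D) (at s)" unfolding field_differentiable_def ..
    then have "((deriv ^^ n) k has_field_derivative D) (at s)"
      by (rule has_field_derivative_transform_within_open[OF _ assms(1) s]) (rule eq)
    then show "(deriv ^^ n) k field_differentiable at s" unfolding field_differentiable_def ..
  qed
qed

lemma two_components:
  assumes U: "openin Y U" "connectedin Y U" "U \<noteq> {}" and V: "openin Y V" "connectedin Y V" "V \<noteq> {}"
    and UV: "U \<inter> V = {}" "U \<union> V = topspace Y"
  shows "connected_components_of Y = {U, V} \<and> U \<noteq> V"
proof -
  have clo: "closedin Y U" "closedin Y V"
    using U(1) V(1) UV openin_subset by (auto simp: closedin_def intro: back_subst[of "openin Y"])
  have comp: "connected_component_of_set Y x = A"
    if "openin Y A" "closedin Y A" "connectedin Y A" "x \<in> A" for x A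
  proof
    show "A \<subseteq> connected_component_of_set Y x" using that(3,4) connected_component_of_maximal by metis
    have "connectedin Y (connected_component_of_set Y x)" by (rule connectedin_connected_component_of)
    then have "connected_component_of_set Y x \<subseteq> A \<or> disjnt (connected_component_of_set Y x) A"
      using that(1,2) connectedin_clopen_cases by metis
    moreover have "x \<in> connected_component_of_set Y x"
      using that openin_subset by (auto simp: connected_component_of_refl)
    ultimately show "connected_component_of_set Y x \<subseteq> A" using that(4) by (auto simp: disjnt_iff)
  qed
  have "connected_component_of_set Y ` topspace Y = {U, V}"
  proof -
    have "connected_component_of_set Y ` U = {U}" using comp[OF U(1) clo(1) U(2)] U(3) by auto
    moreover have "connected_component_of_set Y ` V = {V}" using comp[OF V(1) clo(2) V(2)] V(3) by auto
    ultimately show ?thesis unfolding UV(2)[symmetric] image_Un by auto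
  qed
  then show ?thesis using UV(1) U(3) by (auto simp: connected_components_of_def)
qed

lemma card_components_homeomorphic:
  assumes "homeomorphic_map X Y g" shows "card (connected_components_of Y) = card (connected_components_of X)"
proof -
  have "inj_on ((`) g) (connected_components_of X)"
  proof (rule inj_onI)
    fix A B assume AB: "A \<in> connected_components_of X" "B \<in> connected_components_of X" "g ` A = g ` B"
    then show "A = B"
      using inj_on_image_eq_iff[OF homeomorphic_imp_injective_map[OF assms]
        connected_components_of_subset[OF AB(1)] connected_components_of_subset[OF AB(2)]] by blast
  qed
  then show ?thesis by (simp add: homeomorphic_map_connected_components_of[OF assms] card_image)
qed

lemma homeomorphic_real2: "(UNIV :: (real \<times> real) set) homeomorphic (UNIV :: (real^2) set)"
  unfolding homeomorphic_UNIV_UNIV by simp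

lemma homeomorphism_imp_homeomorphic_map:
  "homeomorphism S T g k \<Longrightarrow> homeomorphic_map (top_of_set S) (top_of_set T) g"
  unfolding homeomorphic_map_maps homeomorphic_maps_def homeomorphism_def
  by (intro exI[of _ k]) (auto simp: continuous_map_in_subtopology)

lemma homeomorphic_imp_homeomorphic_space:
  "S homeomorphic T \<Longrightarrow> top_of_set S homeomorphic_space top_of_set T"
  unfolding homeomorphic_def by (metis homeomorphism_imp_homeomorphic_map homeomorphic_map_imp_homeomorphic_space)

lemma is_planeI: "homeomorphic_map X (euclidean :: (real \<times> real) topology) g \<Longrightarrow> is_plane X"
  using homeomorphic_imp_homeomorphic_space[OF homeomorphic_real2]
  by (metis homeomorphic_map_imp_homeomorphic_space homeomorphic_space_trans subtopology_UNIV)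

lemma plane_not_sphere: "is_plane X \<Longrightarrow> \<not> is_sphere X"
proof
  assume "is_plane X" "is_sphere X"
  then have "(euclidean :: (real^2) topology) homeomorphic_space top_of_set (sphere (0 :: real^3) 1)"
    by (meson homeomorphic_space_sym homeomorphic_space_trans)
  then have "compact_space (euclidean :: (real^2) topology)"
    using homeomorphic_compact_space by (metis compact_sphere compact_space_subtopology compactin_euclidean_iff)
  then show False using not_compact_UNIV[where ?'a = "real^2"] by (simp add: compact_space_def)
qed

lemma plane_curve:
  assumes g: "homeomorphic_map (subtopology X C) (euclidean :: (real \<times> real) topology) g"
    and C: "C \<subseteq> topspace X" and L: "L = {P \<in> C. snd (g P) = 0}"
  shows "card (connected_components_of (subtopology X (C - L))) = 2" "is_line (subtopology X L)"
proof -
  have tC: "topspace (subtopology X C) = C" using C by auto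
  have im: "g ` C = UNIV" using homeomorphic_imp_surjective_map[OF g] tC by simp
  have restrict: "homeomorphic_map (subtopology X {P \<in> C. \<phi> (g P)}) (top_of_set {x. \<phi> x}) g" for \<phi>
  proof -
    have "homeomorphic_map (subtopology (subtopology X C) {P \<in> C. \<phi> (g P)}) (subtopology euclidean {x. \<phi> x}) g"
    proof (rule homeomorphic_map_subtopologies[OF g])
      have "g ` (C \<inter> {P \<in> C. \<phi> (g P)}) = g ` C \<inter> {x. \<phi> x}" by auto
      then show "g ` (topspace (subtopology X C) \<inter> {P \<in> C. \<phi> (g P)}) = topspace euclidean \<inter> {x. \<phi> x}"
        unfolding tC im by simp
    qed
    moreover have "C \<inter> {P \<in> C. \<phi> (g P)} = {P \<in> C. \<phi> (g P)}" by auto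
    ultimately show ?thesis by (simp add: subtopology_subtopology)
  qed
  have CL: "C - L = {P \<in> C. snd (g P) \<noteq> 0}" using L by auto
  let ?Y = "top_of_set {x :: real \<times> real. snd x \<noteq> 0}"
  have "connected_components_of ?Y = {{x. snd x > 0}, {x. snd x < 0}} \<and> {x :: real \<times> real. snd x > 0} \<noteq> {x. snd x < 0}"
  proof (rule two_components)
    have conv: "convex {x :: real \<times> real. snd x > 0}" "convex {x :: real \<times> real. snd x < 0}"
      using convex_halfspace_gt[of 0 "(0 :: real, 1 :: real)"] convex_halfspace_lt[of "(0 :: real, 1 :: real)" 0]
      by (simp_all add: inner_prod_def)
    have op: "open {x :: real \<times> real. snd x > 0}" "open {x :: real \<times> real. snd x < 0}"
      by (intro open_Collect_less continuous_intros)+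
    show "openin ?Y {x. snd x > 0}" "openin ?Y {x. snd x < 0}"
      using op by (auto intro!: open_openin_trans[OF _ _] open_subset)
    show "connectedin ?Y {x. snd x > 0}" "connectedin ?Y {x. snd x < 0}"
      using conv convex_connected by (auto simp: connectedin_subtopology)
    have "(0, 1) \<in> {x :: real \<times> real. snd x > 0}" "(0, - 1) \<in> {x :: real \<times> real. snd x < 0}" by auto
    then show "{x :: real \<times> real. snd x > 0} \<noteq> {}" "{x :: real \<times> real. snd x < 0} \<noteq> {}" by blast+
  qed auto
  then have "card (connected_components_of ?Y) = 2" by simp
  then show "card (connected_components_of (subtopology X (C - L))) = 2"
    using card_components_homeomorphic[OF restrict[of "\<lambda>x. snd x \<noteq> 0"]] CL by simp
  have "homeomorphism {x :: real \<times> real. snd x = 0} (UNIV :: real set) fst (\<lambda>r. (r, 0))"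
    by (rule homeomorphismI) (auto intro!: continuous_intros)
  then have "top_of_set {x :: real \<times> real. snd x = 0} homeomorphic_space (euclidean :: real topology)"
    using homeomorphic_map_imp_homeomorphic_space[OF homeomorphism_imp_homeomorphic_map] by fastforce
  then show "is_line (subtopology X L)"
    using homeomorphic_map_imp_homeomorphic_space[OF restrict[of "\<lambda>x. snd x = 0"]] homeomorphic_space_trans L by metis
qed

lemma sphere_curve:
  fixes s r :: real
  defines "\<Sigma> \<equiv> sphere (0 :: real, 0 :: real, s) r"
  assumes r: "0 < r" and g: "homeomorphic_map (subtopology X C) (top_of_set \<Sigma>) g"
    and C: "C \<subseteq> topspace X" and L: "L = {P \<in> C. fst (snd (g P)) = 0}"
  shows "card (connected_components_of (subtopology X (C - L))) = 2" "is_circle (subtopology X L)" "is_sphere (subtopology X C)"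
proof -
  have tC: "topspace (subtopology X C) = C" using C by auto
  have im: "g ` C = \<Sigma>" using homeomorphic_imp_surjective_map[OF g] tC by simp
  have restrict: "homeomorphic_map (subtopology X {P \<in> C. \<phi> (g P)}) (top_of_set {x \<in> \<Sigma>. \<phi> x}) g" for \<phi>
  proof -
    have "homeomorphic_map (subtopology (subtopology X C) {P \<in> C. \<phi> (g P)}) (subtopology (top_of_set \<Sigma>) {x \<in> \<Sigma>. \<phi> x}) g"
    proof (rule homeomorphic_map_subtopologies[OF g])
      have "g ` (C \<inter> {P \<in> C. \<phi> (g P)}) = g ` C \<inter> {x \<in> g ` C. \<phi> x}" by auto
      then show "g ` (topspace (subtopology X C) \<inter> {P \<in> C. \<phi> (g P)}) = topspace (top_of_set \<Sigma>) \<inter> {x \<in> \<Sigma>. \<phi> x}"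
        unfolding tC im by simp
    qed
    moreover have "C \<inter> {P \<in> C. \<phi> (g P)} = {P \<in> C. \<phi> (g P)}" "\<Sigma> \<inter> {x \<in> \<Sigma>. \<phi> x} = {x \<in> \<Sigma>. \<phi> x}" by auto
    ultimately show ?thesis by (simp add: subtopology_subtopology)
  qed
  have mem: "(x, y, v) \<in> \<Sigma> \<longleftrightarrow> x\<^sup>2 + y\<^sup>2 + (s - v)\<^sup>2 = r\<^sup>2" for x y v
  proof -
    have "(x, y, v) \<in> \<Sigma> \<longleftrightarrow> sqrt (x\<^sup>2 + (y\<^sup>2 + (s - v)\<^sup>2)) = sqrt (r\<^sup>2)"
      using r by (simp add: \<Sigma>_def dist_Pair_Pair dist_real_def)
    also have "\<dots> \<longleftrightarrow> x\<^sup>2 + y\<^sup>2 + (s - v)\<^sup>2 = r\<^sup>2" unfolding real_sqrt_eq_iff by (simp add: add.assoc)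
    finally show ?thesis .
  qed
  have CL: "C - L = {P \<in> C. fst (snd (g P)) \<noteq> 0}" using L by auto
  let ?Y = "top_of_set {x \<in> \<Sigma>. fst (snd x) \<noteq> 0}"
  let ?U = "{x \<in> \<Sigma>. fst (snd x) > 0}" and ?V = "{x \<in> \<Sigma>. fst (snd x) < 0}"
  have half: "connected {x \<in> \<Sigma>. 0 < \<sigma> * fst (snd x)}" if \<sigma>: "\<sigma> = 1 \<or> \<sigma> = - 1" for \<sigma> :: real
  proof -
    \<comment> \<open>The open hemisphere on the side of \<open>\<sigma>\<close> is the graph of a
      square root over an open disc, hence connected.\<close>
    define k where "k = (\<lambda>(x :: real, v). (x, \<sigma> * sqrt (r\<^sup>2 - x\<^sup>2 - (s - v)\<^sup>2), v))"
    have ball: "(x, v) \<in> ball (0, s) r \<longleftrightarrow> x\<^sup>2 + (s - v)\<^sup>2 < r\<^sup>2" for x v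
    proof -
      have "(x, v) \<in> ball (0, s) r \<longleftrightarrow> sqrt (x\<^sup>2 + (s - v)\<^sup>2) < sqrt (r\<^sup>2)"
        using r by (simp add: dist_Pair_Pair dist_real_def)
      then show ?thesis unfolding real_sqrt_less_iff .
    qed
    have ss: "\<sigma> * \<sigma> = 1" "\<sigma>\<^sup>2 = 1" using \<sigma> by auto
    have "{x \<in> \<Sigma>. 0 < \<sigma> * fst (snd x)} = k ` ball (0, s) r"
    proof (intro equalityI subsetI)
      fix p assume p: "p \<in> {x \<in> \<Sigma>. 0 < \<sigma> * fst (snd x)}"
      obtain x y v where xyv: "p = (x, y, v)" by (metis prod.exhaust)
      have 1: "x\<^sup>2 + y\<^sup>2 + (s - v)\<^sup>2 = r\<^sup>2" "0 < \<sigma> * y" using p by (auto simp: xyv mem)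
      have "(\<sigma> * y)\<^sup>2 = r\<^sup>2 - x\<^sup>2 - (s - v)\<^sup>2" using 1(1) ss by (simp add: power_mult_distrib)
      then have "sqrt (r\<^sup>2 - x\<^sup>2 - (s - v)\<^sup>2) = \<sigma> * y" using 1(2) by (intro real_sqrt_unique) auto
      then have "p = k (x, v)" using ss by (simp add: k_def xyv mult.assoc[symmetric])
      moreover have "0 < y\<^sup>2" using 1(2) by auto
      then have "(x, v) \<in> ball (0, s) r" unfolding ball using 1(1) by linarith
      ultimately show "p \<in> k ` ball (0, s) r" by blast
    next
      fix p assume "p \<in> k ` ball (0, s) r"
      then obtain x v where xv: "(x, v) \<in> ball (0, s) r" "p = k (x, v)" by force
      then have 1: "0 < r\<^sup>2 - x\<^sup>2 - (s - v)\<^sup>2" using ball by simp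
      then show "p \<in> {x \<in> \<Sigma>. 0 < \<sigma> * fst (snd x)}"
        by (simp add: xv(2) k_def mem power_mult_distrib ss mult.assoc[symmetric])
    qed
    moreover have "connected (k ` ball (0, s) r)"
      unfolding k_def case_prod_beta
      by (intro connected_continuous_image continuous_intros convex_connected convex_ball)
    ultimately show ?thesis by simp
  qed
  have "connected_components_of ?Y = {?U, ?V} \<and> ?U \<noteq> ?V"
  proof (rule two_components)
    have op: "open {x :: real \<times> real \<times> real. fst (snd x) > 0}" "open {x :: real \<times> real \<times> real. fst (snd x) < 0}"
      by (intro open_Collect_less continuous_intros)+
    show "openin ?Y ?U" "openin ?Y ?V"
      using op by (auto simp: openin_open)
    show "connectedin ?Y ?U" "connectedin ?Y ?V"
      using half[of 1] half[of "- 1"] by (auto simp: connectedin_subtopology)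
    have "(0, r, s) \<in> ?U" "(0, - r, s) \<in> ?V" using r by (auto simp: mem)
    then show "?U \<noteq> {}" "?V \<noteq> {}" by blast+
  qed auto
  then have "card (connected_components_of ?Y) = 2" by simp
  then show "card (connected_components_of (subtopology X (C - L))) = 2"
    using card_components_homeomorphic[OF restrict[of "\<lambda>x. fst (snd x) \<noteq> 0"]] CL by simp
  have "homeomorphism {x \<in> \<Sigma>. fst (snd x) = 0} (sphere (0, s) r) (\<lambda>(x, y, v). (x, v)) (\<lambda>(x, v). (x, 0, v))"
  proof -
    have "(x, v) \<in> sphere (0, s) r \<longleftrightarrow> x\<^sup>2 + (s - v)\<^sup>2 = r\<^sup>2" for x v
    proof -
      have "(x, v) \<in> sphere (0, s) r \<longleftrightarrow> sqrt (x\<^sup>2 + (s - v)\<^sup>2) = sqrt (r\<^sup>2)"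
        using r by (simp add: dist_Pair_Pair dist_real_def)
      then show ?thesis by (simp only: real_sqrt_eq_iff)
    qed
    then show ?thesis
      by (intro homeomorphismI) (auto simp: mem case_prod_beta simp del: mem_sphere intro!: continuous_intros)
  qed
  then have 1: "{x \<in> \<Sigma>. fst (snd x) = 0} homeomorphic sphere (0 :: real, s) r"
    unfolding homeomorphic_def by (intro exI)
  have 2: "sphere (0 :: real, s) r homeomorphic sphere (0 :: real^2) 1"
    by (rule homeomorphic_spheres_gen) (use r in auto)
  have "top_of_set {x \<in> \<Sigma>. fst (snd x) = 0} homeomorphic_space top_of_set (sphere (0 :: real^2) 1)"
    by (rule homeomorphic_imp_homeomorphic_space[OF homeomorphic_trans[OF 1 2]])
  then show "is_circle (subtopology X L)"
    unfolding L by (rule homeomorphic_space_trans[OF homeomorphic_map_imp_homeomorphic_space[OF restrict[of "\<lambda>x. fst (snd x) = 0"]]])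
  have "\<Sigma> homeomorphic sphere (0 :: real^3) 1"
    unfolding \<Sigma>_def by (rule homeomorphic_spheres_gen) (use r in auto)
  then have "top_of_set \<Sigma> homeomorphic_space top_of_set (sphere (0 :: real^3) 1)"
    by (rule homeomorphic_imp_homeomorphic_space)
  then show "is_sphere (subtopology X C)"
    by (rule homeomorphic_space_trans[OF homeomorphic_map_imp_homeomorphic_space[OF g]])
qed

section \<open>The pieces of the space of hexagons\<close>

context circle_data
begin

lemma smooth_terms_coefficients:
  assumes T: "(\<lambda>x. T x) \<in> smooth_terms I"
  shows "(\<lambda>x. u (T x)) \<in> smooth_terms I" "(\<lambda>x. p (T x)) \<in> smooth_terms I" "(\<lambda>x. N (T x)) \<in> smooth_terms I"
    "(\<lambda>x. b (T x)) \<in> smooth_terms I"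
proof -
  show u: "(\<lambda>x. u (T x)) \<in> smooth_terms I" and p: "(\<lambda>x. p (T x)) \<in> smooth_terms I"
    unfolding u_def tau_def p_def by (intro smooth_terms_intros T)+
  show "(\<lambda>x. N (T x)) \<in> smooth_terms I" unfolding N_def by (intro smooth_terms_intros u)
  show "(\<lambda>x. b (T x)) \<in> smooth_terms I" unfolding b_def by (intro smooth_terms_intros p)
qed

text \<open>For \<open>u T < - 1\<close> the discriminant exceeds \<open>(b T)\<^sup>2\<close>, so
  the square root in \<open>Pm\<close> is smooth and its denominator is positive.\<close>

lemma smooth_terms_curve:
  assumes T: "(\<lambda>x. T x) \<in> smooth_terms I" and H: "\<And>x. x \<in> I \<Longrightarrow> ok (T x) \<and> u (T x) < - 1"
  shows "(\<lambda>x. Pm (T x)) \<in> smooth_terms I" "(\<lambda>x. sh (T x)) \<in> smooth_terms I"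
proof -
  note c = smooth_terms_coefficients[OF T]
  have nz: "1 - u (T x) \<noteq> 0" "2 * (1 - u (T x)) \<noteq> 0" if "x \<in> I" for x using H[OF that] by auto
  show "(\<lambda>x. sh (T x)) \<in> smooth_terms I"
    unfolding sh_def by (intro smooth_terms_intros c nz)
  have K: "(\<lambda>x. K (T x)) \<in> smooth_terms I"
    unfolding K_def by (intro smooth_terms_intros c nz)
  have d: "(\<lambda>x. d (T x)) \<in> smooth_terms I"
    unfolding d_def by (intro smooth_terms_intros c K)
  have dpos: "0 < d (T x)" if "x \<in> I" for x
    using hyp(3)[of "T x"] H[OF that] zero_le_power2[of "b (T x)"] by linarith
  have den: "b (T x) + sqrt (d (T x)) \<noteq> 0" if "x \<in> I" for x
    using hyp(4)[of "T x"] H[OF that] by simp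
  show "(\<lambda>x. Pm (T x)) \<in> smooth_terms I"
    unfolding Pm_def by (intro smooth_terms_intros c K d dpos den)
qed

text \<open>Leaves room for elliptic parameters between the start \<open>Tm\<close> and the
  parabolic value \<open>Ts\<close>.\<close>

lemma Tm_less_Ts: "c0 + c3 \<noteq> 0 \<Longrightarrow> c1 + c2 \<noteq> 0 \<Longrightarrow> Tm < Ts"
  using cos_sum_eq cos_sum_bounds(1,2) s0s3_pos by (auto simp: Tm_def Ts_def divide_strict_right_mono)

text \<open>The sign of \<open>(c0 + c3) * (c1 + c2)\<close> decides how the plane arises: as a
  cone, as the cone with a double line, or as a graph over hyperbolic parameters.\<close>

lemma plane:
  assumes z: "z = 1"
  shows "\<exists>f g. homeomorphism M (UNIV :: (real \<times> real) set) f g \<and> (\<forall>x\<in>M. snd (f x) = 0 \<longleftrightarrow> qq x = 0)"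
proof -
  consider "(c0 + c3) * (c1 + c2) < 0" | "c0 + c3 = 0" "c1 + c2 = 0" |
    "0 \<le> (c0 + c3) * (c1 + c2)" "\<not> (c0 + c3 = 0 \<and> c1 + c2 = 0)" by linarith
  then show ?thesis
  proof cases
    case 1 show ?thesis by (rule plane_mixed(1)[OF z opposite_sign_mixed[OF z 1]])
  next
    case 2 show ?thesis by (rule plane_identity(1)[OF z 2])
  next
    case 3 show ?thesis by (rule plane_hyperbolic(1)[OF z same_sign_hyperbolic[OF z 3]])
  qed
qed

end

context hexagons
begin

definition Ht :: "hexagon_type \<Rightarrow> (nat \<Rightarrow> 'v set) set \<Rightarrow> real \<times> real \<times> real" where
  "Ht ty P = (2 * t ty a 1 P - 1, 2 * t ty a 2 P - 1, 2 * t ty a 3 P - 1)"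

lemma homeomorphic_map_Ht:
  "homeomorphic_map (hexagon_space ty a) (top_of_set (Mz 1 \<union> Mz (- 1))) (Ht ty)"
proof (cases ty)
  case First_Type
  then show ?thesis using homeomorphic_map_H unfolding H_def[abs_def] Ht_def[abs_def] by simp
next
  case Second_Type
  interpret c: hermitian_plane "\<lambda>k. scl (cnj k)" "\<lambda>u v. h v u" by (rule hermitian_plane_conj)
  interpret c: hexagons "\<lambda>k. scl (cnj k)" "\<lambda>u v. h v u" e f a
    by unfold_locales (simp_all add: onb h_fe)
  have "homeomorphic_map (hexagon_space Second_Type a) (top_of_set (Mz 1 \<union> Mz (- 1))) c.H"
    using c.homeomorphic_map_H unfolding conj_transfer(1) .
  then have "homeomorphic_map (hexagon_space Second_Type a) (top_of_set (Mz 1 \<union> Mz (- 1))) (Ht Second_Type)"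
    by (rule homeomorphic_map_eq) (simp add: c.H_def Ht_def conj_transfer(2))
  then show ?thesis using Second_Type by simp
qed

definition tau3 :: "real \<Rightarrow> real" where
  "tau3 T = cos (a 0) * cos (a 3) - sin (a 0) * sin (a 3) * T"

text \<open>Both types have \<open>t\<^sub>3 = ta c\<^sub>3 c\<^sub>0\<close>, because the third
  vertex is \<open>c\<^sub>0\<close>, and the same map \<open>R\<^sub>0 R\<^sub>3\<close>; so the
  trace criterion applies to either type directly.\<close>

lemma kinds:
  assumes P: "P \<in> topspace (hexagon_space ty a)"
  defines "\<tau> \<equiv> tau3 (snd (snd (Ht ty P)))"
  shows "\<tau>\<^sup>2 < 1 \<Longrightarrow> elliptic (R03 a P)" "\<tau> < - 1 \<Longrightarrow> hyperbolic (R03 a P)"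
    "\<tau> = - 1 \<Longrightarrow> cos (a 0) + cos (a 3) \<noteq> 0 \<Longrightarrow> parabolic (R03 a P)"
    "\<tau> = - 1 \<Longrightarrow> cos (a 0) + cos (a 3) = 0 \<Longrightarrow> trivial_in_PU (R03 a P)"
proof -
  obtain q where q: "q \<in> {..3} \<rightarrow>\<^sub>E BV" "P = orbit q"
    using P unfolding hexagon_space_def topspace_quotient by (auto simp: quadruples_def)
  define c where "c = (SOME c. c \<in> P)"
  have "c \<in> P" unfolding c_def q(2)
    by (rule someI[of "\<lambda>x. x \<in> orbit q", OF orbit_self[OF q(1)]])
  then have c: "c \<in> {..3} \<rightarrow>\<^sub>E BV" unfolding q(2) orbit_act using act_PiE[OF _ q(1)] by blast
  have R: "R03 a P = R a c 0 \<circ> R a c 3" unfolding R03_def c_def[symmetric] Let_def ..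
  have "t ty a 3 P = ta (c 3) (c 0)" unfolding t_def c_def[symmetric] Let_def by (simp add: vertex_def)
  then have \<tau>: "\<tau> = cos (a 0) * cos (a 3) - sin (a 0) * sin (a 3) * (2 * ta (c 3) (c 0) - 1)"
    unfolding \<tau>_def tau3_def Ht_def snd_conv by simp
  note k = R03_kind[OF c, folded \<tau> R]
  show "\<tau>\<^sup>2 < 1 \<Longrightarrow> elliptic (R03 a P)" "\<tau> = - 1 \<Longrightarrow> cos (a 0) + cos (a 3) \<noteq> 0 \<Longrightarrow> parabolic (R03 a P)"
    "\<tau> = - 1 \<Longrightarrow> cos (a 0) + cos (a 3) = 0 \<Longrightarrow> trivial_in_PU (R03 a P)"
    by (rule k(1), assumption) (rule k(3), assumption, assumption, rule k(4), assumption, assumption)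
  assume "\<tau> < - 1"
  then have "1 < \<tau>\<^sup>2" using power_strict_mono[of 1 "- \<tau>" 2] by simp
  then show "hyperbolic (R03 a P)" by (rule k(2))
qed

sublocale p: circle_data "cos (a 0)" "sin (a 0)" "cos (a 1)" "sin (a 1)" "cos (a 2)" "sin (a 2)" "cos (a 3)" "sin (a 3)" 1
  by (rule circle_data) simp
sublocale m: circle_data "cos (a 0)" "sin (a 0)" "cos (a 1)" "sin (a 1)" "cos (a 2)" "sin (a 2)" "cos (a 3)" "sin (a 3)" "- 1"
  by (rule circle_data) simp

lemma Mz_pm: "Mz 1 = p.M" "Mz (- 1) = m.M"
  by (simp_all add: Mz_def)

lemma tau3_pm: "p.tau = tau3" "p.u = tau3" "m.tau = tau3"
  by (auto simp: fun_eq_iff p.tau_def p.u_def tau3_def)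

definition qz :: "real \<Rightarrow> real \<times> real \<times> real \<Rightarrow> real" where
  "qz z = circle_data.qq (cos (a 0)) (sin (a 0)) (cos (a 1)) (sin (a 1)) (cos (a 2)) (sin (a 2)) (cos (a 3)) (sin (a 3)) z"

lemma qz_pm: "qz 1 = p.qq" "qz (- 1) = m.qq"
  by (simp_all add: qz_def)

abbreviation "XX ty \<equiv> hexagon_space ty a"

text \<open>The sign \<open>z\<close> of the lifted relation is read off from the coordinates, which
  is unambiguous because \<open>Mz 1\<close> and \<open>Mz (- 1)\<close> are disjoint.\<close>

definition piece :: "hexagon_type \<Rightarrow> real \<Rightarrow> (nat \<Rightarrow> 'v set) set set" where
  "piece ty z = {P \<in> topspace (XX ty). Ht ty P \<in> Mz z}"
definition curve :: "hexagon_type \<Rightarrow> real \<Rightarrow> (nat \<Rightarrow> 'v set) set set" where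
  "curve ty z = {P \<in> piece ty z. qz z (Ht ty P) = 0}"

lemma Ht_image: "Ht ty ` topspace (XX ty) = Mz 1 \<union> Mz (- 1)"
  using homeomorphic_imp_surjective_map[OF homeomorphic_map_Ht] by simp

lemma Ht_inj: "inj_on (Ht ty) (topspace (XX ty))"
  by (rule homeomorphic_imp_injective_map[OF homeomorphic_map_Ht])

lemma Ht_piece_image: "z = 1 \<or> z = - 1 \<Longrightarrow> Ht ty ` piece ty z = Mz z"
proof (intro equalityI subsetI)
  fix x assume z: "z = 1 \<or> z = - 1" and x: "x \<in> Mz z"
  have "x \<in> Ht ty ` topspace (XX ty)" unfolding Ht_image using z x by auto
  then obtain P where "P \<in> topspace (XX ty)" "x = Ht ty P" by (rule imageE)
  then show "x \<in> Ht ty ` piece ty z" using x by (simp add: piece_def)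
qed (auto simp: piece_def)

lemma homeomorphic_map_piece:
  assumes z: "z = 1 \<or> z = - 1"
  shows "homeomorphic_map (subtopology (XX ty) (piece ty z)) (top_of_set (Mz z)) (Ht ty)"
proof -
  have "homeomorphic_map (subtopology (XX ty) (piece ty z)) (subtopology (top_of_set (Mz 1 \<union> Mz (- 1))) (Mz z)) (Ht ty)"
  proof (rule homeomorphic_map_subtopologies[OF homeomorphic_map_Ht])
    have "topspace (XX ty) \<inter> piece ty z = piece ty z" by (auto simp: piece_def)
    then show "Ht ty ` (topspace (XX ty) \<inter> piece ty z) = topspace (top_of_set (Mz 1 \<union> Mz (- 1))) \<inter> Mz z"
      using Ht_piece_image[OF z] z by auto
  qed
  moreover have "(Mz 1 \<union> Mz (- 1)) \<inter> Mz z = Mz z" using z by auto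
  ultimately show ?thesis by (simp add: subtopology_subtopology)
qed

lemma topspace_XX: "topspace (XX ty) = piece ty 1 \<union> piece ty (- 1)"
proof (intro equalityI subsetI)
  fix P assume P: "P \<in> topspace (XX ty)"
  then have "Ht ty P \<in> Ht ty ` topspace (XX ty)" by (rule imageI)
  then show "P \<in> piece ty 1 \<union> piece ty (- 1)" unfolding Ht_image using P by (simp add: piece_def)
qed (auto simp: piece_def)

lemma t3_Ht: "t ty a 3 P = (snd (snd (Ht ty P)) + 1) / 2"
  by (simp add: Ht_def)

lemma curve_image: assumes z: "z = 1 \<or> z = - 1" shows "t ty a 3 ` piece ty z = t ty a 3 ` curve ty z"
proof (intro equalityI subsetI)
  interpret cd: circle_data "cos (a 0)" "sin (a 0)" "cos (a 1)" "sin (a 1)" "cos (a 2)" "sin (a 2)" "cos (a 3)" "sin (a 3)" z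
    by (rule circle_data[OF z])
  fix s assume "s \<in> t ty a 3 ` piece ty z"
  then obtain P where P: "P \<in> piece ty z" "s = t ty a 3 P" by blast
  then have "Ht ty P \<in> cd.M" by (simp add: piece_def Mz_def)
  then obtain y where y: "y \<in> cd.M" "cd.qq y = 0" "snd (snd y) = snd (snd (Ht ty P))"
    using cd.q_zero_fibre by metis
  then obtain Q where Q: "Q \<in> piece ty z" "Ht ty Q = y" using Ht_piece_image[OF z, of ty] unfolding Mz_def by (metis imageE)
  then have "Q \<in> curve ty z" using y by (simp add: curve_def qz_def)
  moreover have "t ty a 3 Q = s" using y Q P by (simp add: t3_Ht)
  ultimately show "s \<in> t ty a 3 ` curve ty z" by blast
next
  fix s assume "s \<in> t ty a 3 ` curve ty z"
  then show "s \<in> t ty a 3 ` piece ty z" by (auto simp: curve_def)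
qed

lemma curve_fibre_card:
  assumes z: "z = 1 \<or> z = - 1" and s: "\<not> (s = 1 \<and> cos (a 0) + cos (a 3) = 0 \<and> cos (a 1) + cos (a 2) = 0)"
  shows "finite {P \<in> curve ty z. t ty a 3 P = s} \<and> card {P \<in> curve ty z. t ty a 3 P = s} \<le> 2"
proof -
  interpret cd: circle_data "cos (a 0)" "sin (a 0)" "cos (a 1)" "sin (a 1)" "cos (a 2)" "sin (a 2)" "cos (a 3)" "sin (a 3)" z
    by (rule circle_data[OF z])
  let ?A = "{P \<in> curve ty z. t ty a 3 P = s}" and ?B = "{x \<in> cd.M. cd.qq x = 0 \<and> snd (snd x) = 2 * s - 1}"
  have B: "finite ?B" "card ?B \<le> 2" using cd.q_zero_fibre_card[of "2 * s - 1"] s by auto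
  have inj: "inj_on (Ht ty) ?A"
    by (rule inj_on_subset[OF Ht_inj]) (auto simp: curve_def piece_def)
  have sub: "Ht ty ` ?A \<subseteq> ?B" by (auto simp: curve_def piece_def Mz_def qz_def t3_Ht)
  show ?thesis using inj_on_finite[OF inj sub B(1)] card_inj_on_le[OF inj sub B(1)] B(2) by auto
qed

lemma plane_piece:
  shows "is_plane (subtopology (XX ty) (piece ty 1))"
    "card (connected_components_of (subtopology (XX ty) (piece ty 1 - curve ty 1))) = 2"
    "is_line (subtopology (XX ty) (curve ty 1))"
proof -
  obtain g k where g: "homeomorphism (Mz 1) (UNIV :: (real \<times> real) set) g k" "\<And>x. x \<in> Mz 1 \<Longrightarrow> snd (g x) = 0 \<longleftrightarrow> qz 1 x = 0"
    using p.plane[OF refl] unfolding Mz_pm qz_pm by auto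
  have "homeomorphic_map (top_of_set (Mz 1)) euclidean g"
    using homeomorphism_imp_homeomorphic_map[OF g(1)] by simp
  with homeomorphic_map_piece[of 1 ty]
  have c: "homeomorphic_map (subtopology (XX ty) (piece ty 1)) (euclidean :: (real \<times> real) topology) (g \<circ> Ht ty)"
    by (intro homeomorphic_map_compose) auto
  show "is_plane (subtopology (XX ty) (piece ty 1))" by (rule is_planeI[OF c])
  have sub: "piece ty 1 \<subseteq> topspace (XX ty)" by (auto simp: piece_def)
  have L: "curve ty 1 = {P \<in> piece ty 1. snd ((g \<circ> Ht ty) P) = 0}"
    unfolding curve_def by (rule Collect_cong, rule conj_cong[OF refl]) (simp add: piece_def g(2))
  show "card (connected_components_of (subtopology (XX ty) (piece ty 1 - curve ty 1))) = 2"
    "is_line (subtopology (XX ty) (curve ty 1))"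
    using plane_curve[OF c sub L] by blast+
qed

text \<open>The condition for \<open>Mz (- 1)\<close> to be nonempty.\<close>

definition compact_case :: bool where
  "compact_case \<longleftrightarrow> 1 \<le> m.T1 \<and> 0 < (cos (a 0) + cos (a 3)) * (cos (a 1) + cos (a 2))"

text \<open>The piece is a copy of a round sphere of radius \<open>(m.T1 - 1) / 2\<close>; radius 0
  gives the single point.\<close>

lemma sphere_piece:
  assumes cc: compact_case
  shows "m.T1 \<noteq> 1 \<Longrightarrow> is_sphere (subtopology (XX ty) (piece ty (- 1)))"
    "m.T1 \<noteq> 1 \<Longrightarrow> card (connected_components_of (subtopology (XX ty) (piece ty (- 1) - curve ty (- 1)))) = 2"
    "m.T1 \<noteq> 1 \<Longrightarrow> is_circle (subtopology (XX ty) (curve ty (- 1)))"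
    "m.T1 = 1 \<Longrightarrow> \<exists>Q. piece ty (- 1) = {Q}"
    "connected (Mz (- 1))" "Mz (- 1) \<noteq> {}"
proof -
  let ?c = "(1 + m.T1) / 2" and ?r = "(m.T1 - 1) / 2"
  have T1: "1 \<le> m.T1" using cc by (simp add: compact_case_def)
  obtain g k where g: "homeomorphism (Mz (- 1)) (sphere (0 :: real, 0 :: real, ?c) ?r) g k"
      "\<And>x. x \<in> Mz (- 1) \<Longrightarrow> fst (snd (g x)) = 0 \<longleftrightarrow> qz (- 1) x = 0"
    using m.sphere_compact(1)[OF refl] cc unfolding Mz_pm qz_pm compact_case_def by auto
  have gm: "homeomorphic_map (top_of_set (Mz (- 1))) (top_of_set (sphere (0, 0, ?c) ?r)) g"
    by (rule homeomorphism_imp_homeomorphic_map[OF g(1)])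
  have c: "homeomorphic_map (subtopology (XX ty) (piece ty (- 1))) (top_of_set (sphere (0, 0, ?c) ?r)) (g \<circ> Ht ty)"
    by (rule homeomorphic_map_compose[OF homeomorphic_map_piece gm]) simp
  have sub: "piece ty (- 1) \<subseteq> topspace (XX ty)" by (auto simp: piece_def)
  have L: "curve ty (- 1) = {P \<in> piece ty (- 1). fst (snd ((g \<circ> Ht ty) P)) = 0}"
    unfolding curve_def by (rule Collect_cong, rule conj_cong[OF refl]) (simp add: piece_def g(2))
  {
    assume "m.T1 \<noteq> 1"
    then have r: "0 < ?r" using T1 by simp
    note sphere_curve[OF r c sub L]
  }
  then show "m.T1 \<noteq> 1 \<Longrightarrow> is_sphere (subtopology (XX ty) (piece ty (- 1)))"
    "m.T1 \<noteq> 1 \<Longrightarrow> card (connected_components_of (subtopology (XX ty) (piece ty (- 1) - curve ty (- 1)))) = 2"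
    "m.T1 \<noteq> 1 \<Longrightarrow> is_circle (subtopology (XX ty) (curve ty (- 1)))" by blast+
  have "(0, 0, m.T1) \<in> sphere (0 :: real, 0 :: real, ?c) ?r"
  proof -
    have "\<bar>?c - m.T1\<bar> = ?r" using T1 by (simp add: abs_if field_simps)
    then show ?thesis by (simp add: dist_Pair_Pair dist_real_def)
  qed
  then have ne: "sphere (0 :: real, 0 :: real, ?c) ?r \<noteq> {}" by blast
  have kim: "Mz (- 1) = k ` sphere (0, 0, ?c) ?r" using g(1) by (simp add: homeomorphism_def)
  then show "Mz (- 1) \<noteq> {}" using ne by simp
  have "connected (sphere (0 :: real, 0 :: real, ?c) ?r)" by (rule connected_sphere) simp
  then show "connected (Mz (- 1))"
    unfolding kim by (intro connected_continuous_image homeomorphism_cont2[OF g(1)])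
  assume "m.T1 = 1"
  then have "Mz (- 1) = {k (0, 0, 1)}" unfolding kim by simp
  then have "Ht ty ` piece ty (- 1) = {k (0, 0, 1)}" using Ht_piece_image[of "- 1" ty] by simp
  moreover have "inj_on (Ht ty) (piece ty (- 1))" by (rule inj_on_subset[OF Ht_inj sub])
  ultimately have "card (piece ty (- 1)) = 1" using card_image by fastforce
  then obtain Q where "piece ty (- 1) = {Q}" by (rule card_1_singletonE)
  then show "\<exists>Q. piece ty (- 1) = {Q}" by (rule exI)
qed

lemma not_compact_case: "\<not> compact_case \<Longrightarrow> Mz (- 1) = {}"
  using m.compact_nonempty unfolding compact_case_def Mz_pm by blast

lemma compact_case_tau:
  assumes cc: compact_case
  shows "x \<in> Mz 1 \<Longrightarrow> tau3 (snd (snd x)) < - 1" "x \<in> Mz (- 1) \<Longrightarrow> \<bar>tau3 (snd (snd x))\<bar> < 1"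
proof -
  have H: "0 \<le> (cos (a 0) + cos (a 3)) * (cos (a 1) + cos (a 2))"
    "\<not> (cos (a 0) + cos (a 3) = 0 \<and> cos (a 1) + cos (a 2) = 0)" using cc by (auto simp: compact_case_def)
  show "x \<in> Mz 1 \<Longrightarrow> tau3 (snd (snd x)) < - 1"
    using p.plane_hyperbolic(2)[OF refl p.same_sign_hyperbolic[OF refl H]] unfolding Mz_pm tau3_pm .
  show "x \<in> Mz (- 1) \<Longrightarrow> \<bar>tau3 (snd (snd x))\<bar> < 1"
    using m.sphere_compact(2)[OF refl] cc unfolding Mz_pm tau3_pm compact_case_def by blast
qed

lemma connected_plane: "connected (Mz 1)" "Mz 1 \<noteq> {}"
proof -
  obtain g k where g: "homeomorphism (Mz 1) (UNIV :: (real \<times> real) set) g k"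
    using p.plane[OF refl] unfolding Mz_pm by auto
  then have kim: "Mz 1 = range k" by (simp add: homeomorphism_def)
  show "connected (Mz 1)"
    unfolding kim by (intro connected_continuous_image homeomorphism_cont2[OF g] connected_UNIV)
  show "Mz 1 \<noteq> {}" unfolding kim by simp
qed

lemma connectedin_piece:
  assumes z: "z = 1 \<or> z = - 1" and "connected (Mz z)" shows "connectedin (XX ty) (piece ty z)"
proof -
  have "connected_space (top_of_set (Mz z))" using assms(2) connectedin_iff_connected[of "Mz z"] unfolding connectedin_def by simp
  then have "connected_space (subtopology (XX ty) (piece ty z))"
    using homeomorphic_connected_space homeomorphic_map_imp_homeomorphic_space[OF homeomorphic_map_piece[OF z]] by blast
  then show ?thesis unfolding connectedin_def by (auto simp: piece_def)
qed

lemma continuous_Ht: "continuous_map (XX ty) euclidean (Ht ty)"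
  using homeomorphic_imp_continuous_map[OF homeomorphic_map_Ht] by (simp add: continuous_map_in_subtopology)

lemma openin_Ht: assumes "open U" shows "openin (XX ty) {P \<in> topspace (XX ty). Ht ty P \<in> U}"
  using continuous_Ht assms by (simp add: continuous_map_def)

text \<open>The open conditions \<open>tau3 < - 1\<close> and \<open>tau3 > - 1\<close> separate the
  two pieces, so each is open.\<close>

lemma components_compact:
  assumes cc: compact_case
  shows "connected_components_of (XX ty) = {piece ty (- 1), piece ty 1}" "piece ty (- 1) \<noteq> piece ty 1"
proof -
  have ne: "piece ty 1 \<noteq> {}" "piece ty (- 1) \<noteq> {}"
    using Ht_piece_image[of 1 ty] Ht_piece_image[of "- 1" ty] connected_plane(2) sphere_piece(6)[OF cc] by auto
  have U: "piece ty 1 = {P \<in> topspace (XX ty). Ht ty P \<in> {x. tau3 (snd (snd x)) < - 1}}"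
    "piece ty (- 1) = {P \<in> topspace (XX ty). Ht ty P \<in> {x. - 1 < tau3 (snd (snd x))}}"
  proof -
    have "Ht ty P \<in> Mz 1 \<or> Ht ty P \<in> Mz (- 1)" if "P \<in> topspace (XX ty)" for P
      using imageI[OF that, of "Ht ty"] unfolding Ht_image by simp
    moreover have "Ht ty P \<in> Mz 1 \<Longrightarrow> tau3 (snd (snd (Ht ty P))) < - 1"
      "Ht ty P \<in> Mz (- 1) \<Longrightarrow> - 1 < tau3 (snd (snd (Ht ty P)))" for P
      using compact_case_tau[OF cc, of "Ht ty P"] by linarith+
    ultimately show "piece ty 1 = {P \<in> topspace (XX ty). Ht ty P \<in> {x. tau3 (snd (snd x)) < - 1}}"
      "piece ty (- 1) = {P \<in> topspace (XX ty). Ht ty P \<in> {x. - 1 < tau3 (snd (snd x))}}"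
      unfolding piece_def by (safe; force)+
  qed
  have op: "open {x :: real \<times> real \<times> real. tau3 (snd (snd x)) < - 1}" "open {x :: real \<times> real \<times> real. - 1 < tau3 (snd (snd x))}"
    unfolding tau3_def by (intro open_Collect_less continuous_intros)+
  have o1: "openin (XX ty) (piece ty 1)" unfolding U(1) by (rule openin_Ht[OF op(1)])
  have o2: "openin (XX ty) (piece ty (- 1))" unfolding U(2) by (rule openin_Ht[OF op(2)])
  have "piece ty (- 1) \<inter> piece ty 1 = {}"
  proof (rule equals0I)
    fix P assume "P \<in> piece ty (- 1) \<inter> piece ty 1"
    then have "Ht ty P \<in> Mz 1 \<inter> Mz (- 1)" unfolding piece_def by simp
    then show False using Mz_disjoint[of "Ht ty P"] by simp
  qed
  then have "connected_components_of (XX ty) = {piece ty (- 1), piece ty 1} \<and> piece ty (- 1) \<noteq> piece ty 1"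
    using two_components[OF o2 connectedin_piece[OF _ sphere_piece(5)[OF cc]] ne(2) o1 connectedin_piece[OF _ connected_plane(1)] ne(1)]
      topspace_XX[of ty] by auto
  then show "connected_components_of (XX ty) = {piece ty (- 1), piece ty 1}" "piece ty (- 1) \<noteq> piece ty 1" by blast+
qed

lemma components_noncompact:
  assumes cc: "\<not> compact_case"
  shows "connected_components_of (XX ty) = {piece ty 1}"
proof -
  have "topspace (XX ty) = piece ty 1"
    using topspace_XX[of ty] not_compact_case[OF cc] by (auto simp: piece_def)
  moreover have "connectedin (XX ty) (piece ty 1)" by (rule connectedin_piece[OF _ connected_plane(1)]) simp
  moreover have "piece ty 1 \<noteq> {}" using Ht_piece_image[of 1 ty] connected_plane(2) by auto
  ultimately show ?thesis unfolding connected_components_of_eq_singleton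
    by (metis connectedin_topspace topspace_discrete_topology)
qed

text \<open>Over every \<open>T > Ts\<close> the curve has exactly one point, given by the explicit
  formula \<open>\<rho>\<close>. Hence a single chart, with inverse \<open>t\<^sub>3\<close>, covers
  all its hyperbolic points.\<close>

lemma curve_smooth:
  assumes P: "P \<in> curve ty 1" and hyp: "tau3 (snd (snd (Ht ty P))) < - 1"
  shows "smooth_by_t3_at ty a (curve ty 1) P"
proof -
  obtain G where G: "homeomorphic_maps (XX ty) (top_of_set (Mz 1 \<union> Mz (- 1))) (Ht ty) G"
    using homeomorphic_map_Ht homeomorphic_map_maps by blast
  have GH: "G (Ht ty Q) = Q" if "Q \<in> topspace (XX ty)" for Q using G that by (simp add: homeomorphic_maps_def)
  have HG: "Ht ty (G x) = x" if "x \<in> Mz 1 \<union> Mz (- 1)" for x using G that by (simp add: homeomorphic_maps_def)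
  have Gc: "continuous_map (top_of_set (Mz 1 \<union> Mz (- 1))) (XX ty) G" using G by (simp add: homeomorphic_maps_def)
  \<comment> \<open>The parameter of the chart is \<open>s = t\<^sub>3\<close>, while the conics are
    indexed by \<open>T = 2 * s - 1\<close>.\<close>
  define I where "I = {s. p.Ts < 2 * s - 1}"
  define \<rho> where "\<rho> s = p.bw (p.Pm (2 * s - 1), 0, 2 * s - 1)" for s
  define \<gamma> where "\<gamma> s = G (\<rho> s)" for s
  have I: "p.ok (2 * s - 1)" "p.u (2 * s - 1) < - 1" if "s \<in> I" for s
    using p.ok_hyperbolic[OF refl, of "2 * s - 1"] that by (simp_all add: I_def)
  have set: "{x \<in> p.M. p.qq x = 0 \<and> snd (snd x) = 2 * s - 1} = {\<rho> s}" if "s \<in> I" for s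
    unfolding \<rho>_def by (rule p.hyperbolic_curve[OF I[OF that]])
  have \<rho>: "\<rho> s \<in> Mz 1" "qz 1 (\<rho> s) = 0" "snd (snd (\<rho> s)) = 2 * s - 1" if "s \<in> I" for s
    using set[OF that] unfolding Mz_pm qz_pm by blast+
  have uniq: "\<rho> s = x" if "s \<in> I" "x \<in> Mz 1" "qz 1 x = 0" "snd (snd x) = 2 * s - 1" for s x
  proof -
    have "x \<in> {x \<in> p.M. p.qq x = 0 \<and> snd (snd x) = 2 * s - 1}"
      using that(2-) unfolding Mz_pm qz_pm by simp
    then show ?thesis unfolding set[OF that(1)] by simp
  qed
  have H\<gamma>: "Ht ty (\<gamma> s) = \<rho> s" if "s \<in> I" for s
    unfolding \<gamma>_def by (rule HG) (use \<rho>[OF that] in simp)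
  have \<gamma>X: "\<gamma> s \<in> topspace (XX ty)" if "s \<in> I" for s
    using continuous_map_image_subset_topspace[OF Gc] \<rho>(1)[OF that] by (auto simp: \<gamma>_def)
  have \<gamma>L: "\<gamma> s \<in> curve ty 1" if "s \<in> I" for s
    using \<gamma>X[OF that] H\<gamma>[OF that] \<rho>[OF that] by (simp add: curve_def piece_def)
  have t\<gamma>: "t ty a 3 (\<gamma> s) = s" if "s \<in> I" for s
    using H\<gamma>[OF that] \<rho>(3)[OF that] by (simp add: t3_Ht)
  have on_curve: "t ty a 3 Q \<in> I \<and> \<gamma> (t ty a 3 Q) = Q" if Q: "Q \<in> curve ty 1" "p.Ts < snd (snd (Ht ty Q))" for Q
  proof -
    have I': "t ty a 3 Q \<in> I" using Q(2) by (simp add: I_def t3_Ht add_divide_distrib)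
    have "\<rho> (t ty a 3 Q) = Ht ty Q"
      by (rule uniq[OF I']) (use Q(1) in \<open>auto simp: curve_def piece_def t3_Ht add_divide_distrib\<close>)
    then show ?thesis using I' GH[of Q] Q(1) by (simp add: \<gamma>_def curve_def piece_def)
  qed
  have PT: "p.Ts < snd (snd (Ht ty P))" using hyp p.tau_Ts(1) unfolding tau3_pm by blast
  note P' = on_curve[OF P PT]
  have img: "\<gamma> ` I = curve ty 1 \<inter> {Q \<in> topspace (XX ty). Ht ty Q \<in> {x. p.Ts < snd (snd x)}}"
  proof (intro equalityI subsetI)
    fix Q assume "Q \<in> \<gamma> ` I"
    then obtain s where s: "Q = \<gamma> s" "s \<in> I" by (rule imageE)
    show "Q \<in> curve ty 1 \<inter> {Q \<in> topspace (XX ty). Ht ty Q \<in> {x. p.Ts < snd (snd x)}}"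
      unfolding s(1) using s(2) \<gamma>L[OF s(2)] \<gamma>X[OF s(2)] \<rho>(3)[OF s(2)] by (simp add: I_def H\<gamma>[OF s(2)])
  next
    fix Q assume "Q \<in> curve ty 1 \<inter> {Q \<in> topspace (XX ty). Ht ty Q \<in> {x. p.Ts < snd (snd x)}}"
    then have "Q \<in> curve ty 1" "p.Ts < snd (snd (Ht ty Q))" by simp_all
    note Q = on_curve[OF this]
    show "Q \<in> \<gamma> ` I" using imageI[OF conjunct1[OF Q], of \<gamma>] unfolding conjunct2[OF Q] .
  qed
  have oI: "open I" unfolding I_def by (intro open_Collect_less continuous_intros)
  have st: "(\<lambda>s. 2 * s - 1) \<in> smooth_terms I" by (intro smooth_terms_intros)
  have sm: "(\<lambda>s. p.Pm (2 * s - 1)) \<in> smooth_terms I" "(\<lambda>s. p.sh (2 * s - 1)) \<in> smooth_terms I"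
    using p.smooth_terms_curve[OF st] I by blast+
  have \<rho>1: "fst (\<rho> s) = (p.Pm (2 * s - 1) - p.sh (2 * s - 1)) / (2 * sin (a 1))"
    and \<rho>2: "fst (snd (\<rho> s)) = (p.Pm (2 * s - 1) + p.sh (2 * s - 1)) / (2 * sin (a 2))" for s
    by (simp_all add: \<rho>_def p.bw_def)
  have nz: "2 * sin (a 1) \<noteq> 0" "2 * sin (a 2) \<noteq> 0" using sin_pos[of 1] sin_pos[of 2] by auto
  have s1: "(\<lambda>s. fst (\<rho> s)) \<in> smooth_terms I" "(\<lambda>s. fst (snd (\<rho> s))) \<in> smooth_terms I"
    unfolding \<rho>1 \<rho>2 by (intro smooth_terms_intros sm nz)+
  have cont: "continuous_on I \<rho>"
  proof -
    have c1: "continuous_on I g" if "g \<in> smooth_terms I" for g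
      using smooth_terms_deriv[OF that] DERIV_isCont continuous_at_imp_continuous_on by metis
    have "\<rho> s = (fst (\<rho> s), fst (snd (\<rho> s)), 2 * s - 1)" for s by (simp add: \<rho>_def p.bw_def)
    then have e: "\<rho> = (\<lambda>s. (fst (\<rho> s), fst (snd (\<rho> s)), 2 * s - 1))" by (rule ext)
    show ?thesis by (subst e) (rule continuous_on_Pair[OF c1[OF s1(1)] continuous_on_Pair[OF c1[OF s1(2)] c1[OF st]]])
  qed
  have "homeomorphic_maps (top_of_set I) (subtopology (XX ty) (\<gamma> ` I)) \<gamma> (t ty a 3)"
  proof -
    have "continuous_map (top_of_set I) (top_of_set (Mz 1 \<union> Mz (- 1))) \<rho>"
      using cont \<rho>(1) by (auto simp: continuous_map_in_subtopology)
    then have "continuous_map (top_of_set I) (XX ty) (G \<circ> \<rho>)" by (rule continuous_map_compose[OF _ Gc])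
    then have "continuous_map (top_of_set I) (subtopology (XX ty) (\<gamma> ` I)) \<gamma>"
      by (auto simp: continuous_map_in_subtopology \<gamma>_def[abs_def] o_def)
    moreover have "continuous_map (XX ty) euclidean ((\<lambda>x. (snd (snd x) + 1) / 2) \<circ> Ht ty)"
      by (rule continuous_map_compose[OF continuous_Ht]) (auto intro!: continuous_intros)
    then have "continuous_map (XX ty) euclidean (t ty a 3)" by (simp add: o_def t3_Ht[abs_def])
    then have "continuous_map (subtopology (XX ty) (\<gamma> ` I)) (top_of_set I) (t ty a 3)"
      using t\<gamma> by (auto simp: continuous_map_in_subtopology intro: continuous_map_from_subtopology)
    ultimately show ?thesis using t\<gamma> by (auto simp: homeomorphic_maps_def)
  qed
  then have hm: "homeomorphic_map (top_of_set I) (subtopology (XX ty) (\<gamma> ` I)) \<gamma>"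
    using homeomorphic_map_maps by blast
  have op: "openin (subtopology (XX ty) (curve ty 1)) (\<gamma> ` I)"
    unfolding img by (intro openin_subtopology_Int2 openin_Ht open_Collect_less continuous_intros)
  have sm3: "smooth_real_on I (\<lambda>s. t ty a j (\<gamma> s))" if "j \<in> {1, 2, 3}" for j
  proof -
    define k where "k = (if j = 1 then (\<lambda>s. (fst (\<rho> s) + 1) / 2) else if j = 2 then (\<lambda>s. (fst (snd (\<rho> s)) + 1) / 2) else (\<lambda>s. s))"
    have "k \<in> smooth_terms I" unfolding k_def using s1 by (auto intro!: smooth_terms_intros)
    then have "smooth_real_on I k" by (rule smooth_terms_smooth[OF oI])
    moreover have "k s = t ty a j (\<gamma> s)" if "s \<in> I" for s
      using \<open>j \<in> {1, 2, 3}\<close> H\<gamma>[OF that, symmetric] t\<gamma>[OF that] by (auto simp: k_def Ht_def)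
    ultimately show ?thesis by (rule smooth_real_on_cong[OF oI])
  qed
  have "is_interval I" unfolding I_def is_interval_1 by auto
  then show ?thesis unfolding smooth_by_t3_at_def
    using oI P' op hm t\<gamma> sm3 by (intro exI[of _ I] exI[of _ \<gamma>] conjI ballI) auto
qed

end

section \<open>The components\<close>

lemma cos_add_cos_sign:
  fixes x y :: real
  assumes "0 < x" "x < pi" "0 < y" "y < pi"
  shows "0 < cos x + cos y \<longleftrightarrow> x + y < pi" "cos x + cos y < 0 \<longleftrightarrow> pi < x + y" "cos x + cos y = 0 \<longleftrightarrow> x + y = pi"
proof -
  have c: "cos (pi - y) = - cos y" by simp
  have 1: "cos (pi - y) < cos x \<longleftrightarrow> x < pi - y" "cos x < cos (pi - y) \<longleftrightarrow> pi - y < x"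
    using cos_mono_less_eq[of "pi - y" x] cos_mono_less_eq[of x "pi - y"] assms by auto
  show l: "0 < cos x + cos y \<longleftrightarrow> x + y < pi" using 1(1) unfolding c by linarith
  show g: "cos x + cos y < 0 \<longleftrightarrow> pi < x + y" using 1(2) unfolding c by linarith
  show "cos x + cos y = 0 \<longleftrightarrow> x + y = pi" using l g by linarith
qed

context angle_data
begin

lemma angle_signs:
  "0 < cos (a 0) + cos (a 3) \<longleftrightarrow> a 0 + a 3 < pi" "cos (a 0) + cos (a 3) < 0 \<longleftrightarrow> pi < a 0 + a 3"
  "cos (a 0) + cos (a 3) = 0 \<longleftrightarrow> a 0 + a 3 = pi"
  "0 < cos (a 1) + cos (a 2) \<longleftrightarrow> a 1 + a 2 < pi" "cos (a 1) + cos (a 2) < 0 \<longleftrightarrow> pi < a 1 + a 2"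
  "cos (a 1) + cos (a 2) = 0 \<longleftrightarrow> a 1 + a 2 = pi"
  using cos_add_cos_sign[of "a 0" "a 3"] cos_add_cos_sign[of "a 1" "a 2"] angles[of 0] angles[of 1] angles[of 2] angles[of 3]
  by simp_all

lemma angle_sum: "(\<Sum>j\<le>3. a j) = a 0 + a 3 + (a 1 + a 2)"
proof -
  have "{..3 :: nat} = {0, 1, 2, 3}" by auto
  then show ?thesis by simp
qed

end

context hexagons
begin

text \<open>Let \<open>x\<close> and \<open>y\<close> be the two angle sums.
  \<open>m.T1 \<ge> 1\<close> means \<open>cos x + cos y \<ge> 0\<close>, and the product condition
  puts \<open>x\<close> and \<open>y\<close> on the same side of pi. Below pi this gives
  \<open>x + y \<le> pi\<close>; above pi, reflection in pi gives
  \<open>x + y \<ge> 3 * pi\<close>.\<close>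

lemma compact_case_iff:
  "compact_case \<longleftrightarrow> (\<Sum>j\<le>3. a j) \<le> pi \<or> 3 * pi \<le> (\<Sum>j\<le>3. a j)"
  "compact_case \<Longrightarrow> m.T1 = 1 \<longleftrightarrow> (\<Sum>j\<le>3. a j) = pi \<or> (\<Sum>j\<le>3. a j) = 3 * pi"
proof -
  define x y where "x = a 0 + a 3" and "y = a 1 + a 2"
  have xy: "0 < x" "x < 2 * pi" "0 < y" "y < 2 * pi"
    using angles[of 0] angles[of 1] angles[of 2] angles[of 3] by (simp_all add: x_def y_def)
  have sum: "(\<Sum>j\<le>3. a j) = x + y" unfolding angle_sum x_def y_def ..
  have sp: "0 < sin (a 0) * sin (a 3)" using sin_pos[of 0] sin_pos[of 3] by simp
  have T1: "m.T1 = (cos x + cos y + sin (a 0) * sin (a 3)) / (sin (a 0) * sin (a 3))"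
    unfolding m.T1_def x_def y_def cos_add by simp
  have T: "1 \<le> m.T1 \<longleftrightarrow> 0 \<le> cos x + cos y" "m.T1 = 1 \<longleftrightarrow> cos x + cos y = 0"
    unfolding T1 using sp by (auto simp: field_simps)
  have sgn: "0 < (cos (a 0) + cos (a 3)) * (cos (a 1) + cos (a 2)) \<longleftrightarrow> (x < pi \<and> y < pi) \<or> (pi < x \<and> pi < y)"
    unfolding zero_less_mult_iff angle_signs x_def y_def by blast
  have low: "(0 \<le> cos x + cos y \<longleftrightarrow> x + y \<le> pi) \<and> (cos x + cos y = 0 \<longleftrightarrow> x + y = pi)" if "x < pi" "y < pi"
    using cos_add_cos_sign[OF xy(1) that(1) xy(3) that(2)] by linarith
  have high: "(0 \<le> cos x + cos y \<longleftrightarrow> 3 * pi \<le> x + y) \<and> (cos x + cos y = 0 \<longleftrightarrow> x + y = 3 * pi)" if "pi < x" "pi < y"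
  proof -
    have "cos (2 * pi - x) = cos x" "cos (2 * pi - y) = cos y" by (simp_all add: cos_diff)
    then show ?thesis using cos_add_cos_sign[of "2 * pi - x" "2 * pi - y"] xy that by auto
  qed
  show "compact_case \<longleftrightarrow> (\<Sum>j\<le>3. a j) \<le> pi \<or> 3 * pi \<le> (\<Sum>j\<le>3. a j)"
    unfolding compact_case_def sgn T(1) sum
  proof
    assume "0 \<le> cos x + cos y \<and> (x < pi \<and> y < pi \<or> pi < x \<and> pi < y)"
    then show "x + y \<le> pi \<or> 3 * pi \<le> x + y" using low high by blast
  next
    assume "x + y \<le> pi \<or> 3 * pi \<le> x + y"
    then show "0 \<le> cos x + cos y \<and> (x < pi \<and> y < pi \<or> pi < x \<and> pi < y)"
    proof
      assume *: "x + y \<le> pi"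
      then have "x < pi" "y < pi" using xy by linarith+
      then show ?thesis using low * by blast
    next
      assume *: "3 * pi \<le> x + y"
      then have "pi < x" "pi < y" using xy by linarith+
      then show ?thesis using high * by blast
    qed
  qed
  assume "compact_case"
  then have "(x < pi \<and> y < pi) \<or> (pi < x \<and> pi < y)" unfolding compact_case_def sgn by blast
  then show "m.T1 = 1 \<longleftrightarrow> (\<Sum>j\<le>3. a j) = pi \<or> (\<Sum>j\<le>3. a j) = 3 * pi"
    unfolding T(2) sum
  proof
    assume *: "x < pi \<and> y < pi"
    then have "x + y \<noteq> 3 * pi" using pi_gt_zero by linarith
    then show "cos x + cos y = 0 \<longleftrightarrow> x + y = pi \<or> x + y = 3 * pi" using low * by blast
  next
    assume *: "pi < x \<and> pi < y"
    then have "x + y \<noteq> pi" using pi_gt_zero by linarith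
    then show "cos x + cos y = 0 \<longleftrightarrow> x + y = pi \<or> x + y = 3 * pi" using high * by blast
  qed
qed

lemma piece_topspace: "P \<in> piece ty z \<Longrightarrow> P \<in> topspace (XX ty)" "P \<in> piece ty z \<Longrightarrow> Ht ty P \<in> Mz z"
  by (simp_all add: piece_def)

lemma compact_piece_kinds:
  assumes cc: compact_case
  shows "P \<in> piece ty (- 1) \<Longrightarrow> elliptic (R03 a P)" "P \<in> piece ty 1 \<Longrightarrow> hyperbolic (R03 a P)"
  using kinds(1)[OF piece_topspace(1)] compact_case_tau(2)[OF cc piece_topspace(2)]
    kinds(2)[OF piece_topspace(1)] compact_case_tau(1)[OF cc piece_topspace(2)]
  by (simp_all add: abs_square_less_1)

lemma piece_hyperbolic:
  assumes H: "0 \<le> (cos (a 0) + cos (a 3)) * (cos (a 1) + cos (a 2))"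
    "\<not> (cos (a 0) + cos (a 3) = 0 \<and> cos (a 1) + cos (a 2) = 0)" and P: "P \<in> piece ty 1"
  shows "hyperbolic (R03 a P)"
proof (rule kinds(2)[OF piece_topspace(1)[OF P]])
  have "x \<in> Mz 1 \<Longrightarrow> tau3 (snd (snd x)) < - 1" for x
    using p.plane_hyperbolic(2)[OF refl p.same_sign_hyperbolic[OF refl H]] unfolding Mz_pm tau3_pm .
  from this[OF piece_topspace(2)[OF P]] show "tau3 (snd (snd (Ht ty P))) < - 1" .
qed

lemma piece_identity:
  assumes H: "cos (a 0) + cos (a 3) = 0" "cos (a 1) + cos (a 2) = 0" and P: "P \<in> piece ty 1"
  shows "hyperbolic (R03 a P) \<or> trivial_in_PU (R03 a P)"
proof -
  have "Ht ty P \<in> p.M" using piece_topspace(2)[OF P] unfolding Mz_pm .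
  from p.plane_identity(2)[OF refl H this] have "tau3 (snd (snd (Ht ty P))) \<le> - 1" unfolding tau3_pm .
  then show ?thesis using kinds(2,4)[OF piece_topspace(1)[OF P]] H(1) by linarith
qed

text \<open>Every \<open>T \<ge> Tm\<close> is attained and \<open>Tm < Ts\<close>; the values
  \<open>Tm\<close>, \<open>Ts\<close> and \<open>Ts + 1\<close> realise the three kinds.\<close>

lemma piece_mixed:
  assumes H: "(cos (a 0) + cos (a 3)) * (cos (a 1) + cos (a 2)) < 0"
  shows "\<exists>P\<in>piece ty 1. elliptic (R03 a P)" "\<exists>P\<in>piece ty 1. parabolic (R03 a P)" "\<exists>P\<in>piece ty 1. hyperbolic (R03 a P)"
proof -
  have nz: "cos (a 0) + cos (a 3) \<noteq> 0" "cos (a 1) + cos (a 2) \<noteq> 0" using H by auto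
  note lt = p.Tm_less_Ts[OF nz]
  have ex: "\<exists>P\<in>piece ty 1. snd (snd (Ht ty P)) = T" if T: "p.Tm \<le> T" for T
  proof -
    obtain x where x: "x \<in> p.M" "snd (snd x) = T"
      using p.plane_mixed(2)[OF refl p.opposite_sign_mixed[OF refl H] T] by blast
    then have "x \<in> Ht ty ` piece ty 1" using Ht_piece_image[of 1 ty] unfolding Mz_pm by simp
    then show ?thesis using x(2) by blast
  qed
  note tt = p.tau_Ts[unfolded tau3_pm]
  obtain P where P: "P \<in> piece ty 1" "snd (snd (Ht ty P)) = p.Tm" using ex[of p.Tm] by blast
  have "1 \<le> p.Tm" by (simp add: p.Tm_def)
  then have "tau3 p.Tm < 1" using p.tau_less_1 unfolding tau3_pm by simp
  moreover have "- 1 < tau3 p.Tm" using tt(2)[of p.Tm] lt by simp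
  ultimately have "(tau3 p.Tm)\<^sup>2 < 1" by (simp add: abs_square_less_1)
  then show "\<exists>P\<in>piece ty 1. elliptic (R03 a P)" using P kinds(1)[OF piece_topspace(1)[OF P(1)]] by auto
  obtain P' where P': "P' \<in> piece ty 1" "snd (snd (Ht ty P')) = p.Ts" using ex[of p.Ts] lt by auto
  have "tau3 p.Ts = - 1" using tt[of p.Ts] by simp
  then show "\<exists>P\<in>piece ty 1. parabolic (R03 a P)" using P' kinds(3)[OF piece_topspace(1)[OF P'(1)]] nz(1) by auto
  obtain P'' where P'': "P'' \<in> piece ty 1" "snd (snd (Ht ty P'')) = p.Ts + 1" using ex[of "p.Ts + 1"] lt by auto
  have "tau3 (p.Ts + 1) < - 1" using tt(1)[of "p.Ts + 1"] by simp
  then show "\<exists>P\<in>piece ty 1. hyperbolic (R03 a P)" using P'' kinds(2)[OF piece_topspace(1)[OF P''(1)]] by auto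
qed

text \<open>Half the trace is always below 1. If it is at least - 1, the map is elliptic, parabolic
  or trivial, and each of these excludes hyperbolic.\<close>

lemma hyperbolic_tau:
  assumes P: "P \<in> piece ty z" and z: "z = 1 \<or> z = - 1" and hyp: "hyperbolic (R03 a P)"
  shows "tau3 (snd (snd (Ht ty P))) < - 1"
proof (rule ccontr)
  assume n: "\<not> ?thesis"
  interpret cd: circle_data "cos (a 0)" "sin (a 0)" "cos (a 1)" "sin (a 1)" "cos (a 2)" "sin (a 2)" "cos (a 3)" "sin (a 3)" z
    by (rule circle_data[OF z])
  have "Ht ty P \<in> cd.M" using piece_topspace(2)[OF P] by (simp add: Mz_def)
  then have "1 \<le> snd (snd (Ht ty P))" using cd.M_ok' by (simp add: cd.ok_def)
  then have lt: "tau3 (snd (snd (Ht ty P))) < 1" using p.tau_less_1 unfolding tau3_pm by simp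
  note k = kinds[OF piece_topspace(1)[OF P]]
  show False
  proof (cases "tau3 (snd (snd (Ht ty P))) = - 1")
    case True
    then show False
      using k(3,4) hyp parabolic_not_hyperbolic trivial_not_hyperbolic by blast
  next
    case False
    then have "(tau3 (snd (snd (Ht ty P))))\<^sup>2 < 1" using n lt by (simp add: abs_square_less_1)
    then show False using k(1) hyp elliptic_not_hyperbolic by blast
  qed
qed

text \<open>The fibre is the half-line \<open>X = Y \<ge> 1\<close>; the first coordinate supplies
  the continuous inverse of its parameterization.\<close>

lemma curve_ray:
  assumes H: "cos (a 0) + cos (a 3) = 0" "cos (a 1) + cos (a 2) = 0"
  shows "is_ray (subtopology (XX ty) {P \<in> curve ty 1. t ty a 3 P = 1})"
proof -
  let ?A = "{P \<in> curve ty 1. t ty a 3 P = 1}" and ?B = "{x \<in> p.M. p.qq x = 0 \<and> snd (snd x) = 1}"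
  obtain G where G: "continuous_on {0..} G" "?B = G ` {0..}" "\<And>r. 0 \<le> r \<Longrightarrow> sin (a 1) * fst (G r) = sin (a 1) + r"
    using p.plane_identity(3)[OF refl H] by blast
  have "homeomorphism {0..} (G ` {0..}) G (\<lambda>x. sin (a 1) * fst x - sin (a 1))"
    by (rule homeomorphismI) (use G in \<open>auto intro!: continuous_intros\<close>)
  then have "top_of_set {0 :: real..} homeomorphic_space top_of_set ?B"
    unfolding G(2) by (metis homeomorphism_imp_homeomorphic_map homeomorphic_map_imp_homeomorphic_space)
  moreover have "homeomorphic_map (subtopology (XX ty) ?A) (top_of_set ?B) (Ht ty)"
  proof -
    have img: "Ht ty ` ?A = ?B"
    proof (intro equalityI subsetI)
      fix x assume "x \<in> Ht ty ` ?A"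
      then show "x \<in> ?B" unfolding curve_def piece_def Mz_pm qz_pm by (auto simp: t3_Ht)
    next
      fix x assume x: "x \<in> ?B"
      then have "x \<in> Ht ty ` piece ty 1" using Ht_piece_image[of 1 ty] unfolding Mz_pm by simp
      then obtain P where P: "x = Ht ty P" "P \<in> piece ty 1" by (rule imageE)
      then have "P \<in> ?A" using x by (simp add: curve_def qz_pm t3_Ht)
      then show "x \<in> Ht ty ` ?A" unfolding P(1) by (rule imageI)
    qed
    have sub: "topspace (XX ty) \<inter> ?A = ?A" by (auto simp: curve_def piece_def)
    have subB: "?B \<subseteq> Mz 1 \<union> Mz (- 1)" unfolding Mz_pm by blast
    have "homeomorphic_map (subtopology (XX ty) ?A) (subtopology (top_of_set (Mz 1 \<union> Mz (- 1))) ?B) (Ht ty)"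
      by (rule homeomorphic_map_subtopologies[OF homeomorphic_map_Ht]) (use sub img subB in \<open>simp add: Int_absorb1\<close>)
    then show ?thesis using subB by (simp add: subtopology_subtopology Int_absorb1)
  qed
  ultimately show ?thesis
    by (meson homeomorphic_map_imp_homeomorphic_space homeomorphic_space_sym homeomorphic_space_trans)
qed

end

lemma sphere_not_plane: "is_sphere X \<Longrightarrow> \<not> is_plane X"
  using plane_not_sphere by blast

theorem proposition4p5p2:
  fixes scl :: "complex \<Rightarrow> 'v::ab_group_add \<Rightarrow> 'v"
    and h :: "'v \<Rightarrow> 'v \<Rightarrow> complex"
    and a :: "nat \<Rightarrow> real"
    and ty :: hexagon_type
  defines "X \<equiv> hermitian_plane.hexagon_space scl h ty a"
    and "t3 \<equiv> hermitian_plane.t scl h ty a 3"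
    and "R03 \<equiv> hermitian_plane.R03 scl h a"
    and "elliptic \<equiv> hermitian_plane.elliptic scl h"
    and "parabolic \<equiv> hermitian_plane.parabolic scl h"
    and "hyperbolic \<equiv> hermitian_plane.hyperbolic scl h"
    and "identity \<equiv> hermitian_plane.trivial_in_PU scl"
  assumes V: "hermitian_plane scl h"
    and angles: "\<And>j. j \<le> 3 \<Longrightarrow> 0 < a j \<and> a j < pi"
  shows
    "((\<Sum>j\<le>3. a j) < pi \<or> 3 * pi < (\<Sum>j\<le>3. a j) \<longrightarrow>
        (\<exists>C D. C \<noteq> D \<and> connected_components_of X = {C, D} \<and>
           is_sphere (subtopology X C) \<and> (\<forall>P\<in>C. elliptic (R03 P)) \<and>
           is_plane (subtopology X D) \<and> (\<forall>P\<in>D. hyperbolic (R03 P)))) \<and>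
     ((\<Sum>j\<le>3. a j) = pi \<or> (\<Sum>j\<le>3. a j) = 3 * pi \<longrightarrow>
        (\<exists>Q D. {Q} \<noteq> D \<and> connected_components_of X = {{Q}, D} \<and>
           hermitian_plane.degenerate_t3 scl h ty a Q \<and> elliptic (R03 Q) \<and>
           is_plane (subtopology X D) \<and> (\<forall>P\<in>D. hyperbolic (R03 P)))) \<and>
     (a 0 + a 3 < pi \<and> pi < a 1 + a 2 \<or> a 1 + a 2 < pi \<and> pi < a 0 + a 3 \<longrightarrow>
        (\<exists>C. connected_components_of X = {C} \<and> is_plane (subtopology X C) \<and>
           (\<exists>P\<in>C. elliptic (R03 P)) \<and> (\<exists>P\<in>C. parabolic (R03 P)) \<and>
           (\<exists>P\<in>C. hyperbolic (R03 P)))) \<and>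
     (a 0 + a 3 = pi \<and> a 1 + a 2 = pi \<longrightarrow>
        (\<exists>C. connected_components_of X = {C} \<and> is_plane (subtopology X C) \<and>
           (\<forall>P\<in>C. hyperbolic (R03 P) \<or> identity (R03 P)))) \<and>
     (pi < (\<Sum>j\<le>3. a j) \<and> a 0 + a 3 < pi \<and> a 1 + a 2 < pi \<or>
      (\<Sum>j\<le>3. a j) < 3 * pi \<and> pi < a 0 + a 3 \<and> pi < a 1 + a 2 \<or>
      a 0 + a 3 = pi \<and> a 1 + a 2 \<noteq> pi \<or>
      a 1 + a 2 = pi \<and> a 0 + a 3 \<noteq> pi \<longrightarrow>
        (\<exists>C. connected_components_of X = {C} \<and> is_plane (subtopology X C) \<and>
           (\<forall>P\<in>C. hyperbolic (R03 P)))) \<and>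
     (\<forall>C \<in> connected_components_of X. \<not> is_singleton C \<longrightarrow>
        (\<exists>L \<subseteq> C.
           card (connected_components_of (subtopology X (C - L))) = 2 \<and>
           t3 ` C = t3 ` L \<and>
           (if a 0 + a 3 = pi \<and> a 1 + a 2 = pi
            then is_ray (subtopology X {P \<in> L. t3 P = 1}) \<and>
                 (\<forall>s. s \<noteq> 1 \<longrightarrow> finite {P \<in> L. t3 P = s} \<and> card {P \<in> L. t3 P = s} \<le> 2)
            else (\<forall>s. finite {P \<in> L. t3 P = s} \<and> card {P \<in> L. t3 P = s} \<le> 2)) \<and>
           (is_sphere (subtopology X C) \<longrightarrow> is_circle (subtopology X L)) \<and>
           (is_plane (subtopology X C) \<longrightarrow> is_line (subtopology X L)) \<and>
           (\<forall>P\<in>L. hyperbolic (R03 P) \<longrightarrow>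
              hermitian_plane.smooth_by_t3_at scl h ty a L P)))"
proof -
  interpret V: hermitian_plane scl h by (rule V)
  obtain e f where ef: "h e e = 1" "h f f = - 1" "h e f = 0" by (rule V.exists_orthonormal)
  interpret H: hexagons scl h e f a
    by unfold_locales (use ef angles in auto)
  note defs = X_def t3_def R03_def elliptic_def parabolic_def hyperbolic_def identity_def
  have signs: "0 < (cos (a 0) + cos (a 3)) * (cos (a 1) + cos (a 2)) \<longleftrightarrow>
      a 0 + a 3 < pi \<and> a 1 + a 2 < pi \<or> pi < a 0 + a 3 \<and> pi < a 1 + a 2"
    "(cos (a 0) + cos (a 3)) * (cos (a 1) + cos (a 2)) < 0 \<longleftrightarrow>
      pi < a 0 + a 3 \<and> a 1 + a 2 < pi \<or> a 0 + a 3 < pi \<and> pi < a 1 + a 2"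
    unfolding zero_less_mult_iff mult_less_0_iff H.angle_signs by blast+
  have d_iff: "cos (a 0) + cos (a 3) = 0 \<and> cos (a 1) + cos (a 2) = 0 \<longleftrightarrow> a 0 + a 3 = pi \<and> a 1 + a 2 = pi"
    unfolding H.angle_signs ..
  have cc_pos: "0 < (cos (a 0) + cos (a 3)) * (cos (a 1) + cos (a 2))" if "H.compact_case"
    using that by (simp add: H.compact_case_def)
  show ?thesis
    unfolding defs
  proof (intro conjI impI ballI)
    assume A: "(\<Sum>j\<le>3. a j) < pi \<or> 3 * pi < (\<Sum>j\<le>3. a j)"
    then have cc: H.compact_case unfolding H.compact_case_iff(1) by linarith
    have "H.m.T1 \<noteq> 1" unfolding H.compact_case_iff(2)[OF cc] using A pi_gt_zero by linarith
    from H.sphere_piece(1)[OF cc this] H.components_compact[OF cc] H.compact_piece_kinds[OF cc] H.plane_piece(1)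
    show "\<exists>C D. C \<noteq> D \<and> connected_components_of (V.hexagon_space ty a) = {C, D} \<and>
           is_sphere (subtopology (V.hexagon_space ty a) C) \<and> (\<forall>P\<in>C. V.elliptic (V.R03 a P)) \<and>
           is_plane (subtopology (V.hexagon_space ty a) D) \<and> (\<forall>P\<in>D. V.hyperbolic (V.R03 a P))"
      by (intro exI[of _ "H.piece ty (- 1)"] exI[of _ "H.piece ty 1"] conjI ballI) simp_all
  next
    assume A: "(\<Sum>j\<le>3. a j) = pi \<or> (\<Sum>j\<le>3. a j) = 3 * pi"
    then have cc: H.compact_case unfolding H.compact_case_iff(1) by linarith
    have "H.m.T1 = 1" unfolding H.compact_case_iff(2)[OF cc] using A .
    then obtain Q where Q: "H.piece ty (- 1) = {Q}" using H.sphere_piece(4)[OF cc] by blast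
    have "V.degenerate_t3 ty a Q"
      unfolding V.degenerate_t3_def
    proof (intro ballI impI)
      fix P' assume P': "P' \<in> topspace (V.hexagon_space ty a)" "V.t ty a 3 P' = V.t ty a 3 Q"
      have Qp: "Q \<in> H.piece ty (- 1)" using Q by simp
      \<comment> \<open>Half the trace depends only on \<open>t\<^sub>3\<close>; it is below - 1 on
        the plane and above - 1 at \<open>Q\<close>, so no point of the plane shares the value at
        \<open>Q\<close>.\<close>
      have "P' \<notin> H.piece ty 1"
      proof
        assume "P' \<in> H.piece ty 1"
        then have "H.tau3 (snd (snd (H.Ht ty P'))) < - 1"
          by (rule H.compact_case_tau(1)[OF cc H.piece_topspace(2)])
        moreover have "\<bar>H.tau3 (snd (snd (H.Ht ty Q)))\<bar> < 1"
          by (rule H.compact_case_tau(2)[OF cc H.piece_topspace(2)[OF Qp]])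
        moreover have "snd (snd (H.Ht ty P')) = snd (snd (H.Ht ty Q))" using P'(2) by (simp add: H.Ht_def)
        ultimately show False by simp
      qed
      then show "P' = Q" using P'(1) Q H.topspace_XX[of ty] by auto
    qed
    moreover have "V.elliptic (V.R03 a Q)"
      by (rule H.compact_piece_kinds(1)[OF cc, where ty = ty]) (simp add: Q)
    ultimately show "\<exists>Q D. {Q} \<noteq> D \<and> connected_components_of (V.hexagon_space ty a) = {{Q}, D} \<and>
           V.degenerate_t3 ty a Q \<and> V.elliptic (V.R03 a Q) \<and>
           is_plane (subtopology (V.hexagon_space ty a) D) \<and> (\<forall>P\<in>D. V.hyperbolic (V.R03 a P))"
      using H.components_compact[OF cc, of ty, unfolded Q] H.compact_piece_kinds(2)[OF cc] H.plane_piece(1)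
      by (intro exI[of _ Q] exI[of _ "H.piece ty 1"] conjI ballI) simp_all
  next
    assume "a 0 + a 3 < pi \<and> pi < a 1 + a 2 \<or> a 1 + a 2 < pi \<and> pi < a 0 + a 3"
    then have neg: "(cos (a 0) + cos (a 3)) * (cos (a 1) + cos (a 2)) < 0" unfolding signs by blast
    then have "\<not> H.compact_case" using cc_pos by linarith
    from H.components_noncompact[OF this] H.piece_mixed[OF neg] H.plane_piece(1)
    show "\<exists>C. connected_components_of (V.hexagon_space ty a) = {C} \<and> is_plane (subtopology (V.hexagon_space ty a) C) \<and>
           (\<exists>P\<in>C. V.elliptic (V.R03 a P)) \<and> (\<exists>P\<in>C. V.parabolic (V.R03 a P)) \<and>
           (\<exists>P\<in>C. V.hyperbolic (V.R03 a P))"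
      by (intro exI[of _ "H.piece ty 1"] conjI)
  next
    assume "a 0 + a 3 = pi \<and> a 1 + a 2 = pi"
    then have z: "cos (a 0) + cos (a 3) = 0" "cos (a 1) + cos (a 2) = 0" using d_iff by blast+
    then have "\<not> H.compact_case" using cc_pos by auto
    from H.components_noncompact[OF this] H.piece_identity[OF z] H.plane_piece(1)
    show "\<exists>C. connected_components_of (V.hexagon_space ty a) = {C} \<and> is_plane (subtopology (V.hexagon_space ty a) C) \<and>
           (\<forall>P\<in>C. V.hyperbolic (V.R03 a P) \<or> V.trivial_in_PU (V.R03 a P))"
      by (intro exI[of _ "H.piece ty 1"] conjI ballI)
  next
    assume A: "pi < (\<Sum>j\<le>3. a j) \<and> a 0 + a 3 < pi \<and> a 1 + a 2 < pi \<or>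
      (\<Sum>j\<le>3. a j) < 3 * pi \<and> pi < a 0 + a 3 \<and> pi < a 1 + a 2 \<or>
      a 0 + a 3 = pi \<and> a 1 + a 2 \<noteq> pi \<or> a 1 + a 2 = pi \<and> a 0 + a 3 \<noteq> pi"
    then have H1: "\<not> (cos (a 0) + cos (a 3)) * (cos (a 1) + cos (a 2)) < 0" unfolding signs by linarith
    then have H2: "0 \<le> (cos (a 0) + cos (a 3)) * (cos (a 1) + cos (a 2))" by simp
    have H3: "\<not> (cos (a 0) + cos (a 3) = 0 \<and> cos (a 1) + cos (a 2) = 0)" unfolding d_iff using A by linarith
    have "\<not> H.compact_case"
    proof
      assume cc: H.compact_case
      then have "(\<Sum>j\<le>3. a j) \<le> pi \<or> 3 * pi \<le> (\<Sum>j\<le>3. a j)" unfolding H.compact_case_iff(1) .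
      moreover have "a 0 + a 3 < pi \<and> a 1 + a 2 < pi \<or> pi < a 0 + a 3 \<and> pi < a 1 + a 2"
        using cc_pos[OF cc] unfolding signs .
      ultimately show False using A unfolding H.angle_sum by linarith
    qed
    from H.components_noncompact[OF this] H.piece_hyperbolic[OF H2 H3] H.plane_piece(1)
    show "\<exists>C. connected_components_of (V.hexagon_space ty a) = {C} \<and> is_plane (subtopology (V.hexagon_space ty a) C) \<and>
           (\<forall>P\<in>C. V.hyperbolic (V.R03 a P))"
      by (intro exI[of _ "H.piece ty 1"] conjI ballI)
  next
    fix C assume C: "C \<in> connected_components_of (V.hexagon_space ty a)" and ns: "\<not> is_singleton C"
    have cases: "C = H.piece ty 1 \<or> (H.compact_case \<and> C = H.piece ty (- 1))"
      using C H.components_compact(1)[of ty] H.components_noncompact[of ty] by (cases H.compact_case) auto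
    show "\<exists>L \<subseteq> C.
           card (connected_components_of (subtopology (V.hexagon_space ty a) (C - L))) = 2 \<and>
           V.t ty a 3 ` C = V.t ty a 3 ` L \<and>
           (if a 0 + a 3 = pi \<and> a 1 + a 2 = pi
            then is_ray (subtopology (V.hexagon_space ty a) {P \<in> L. V.t ty a 3 P = 1}) \<and>
                 (\<forall>s. s \<noteq> 1 \<longrightarrow> finite {P \<in> L. V.t ty a 3 P = s} \<and> card {P \<in> L. V.t ty a 3 P = s} \<le> 2)
            else (\<forall>s. finite {P \<in> L. V.t ty a 3 P = s} \<and> card {P \<in> L. V.t ty a 3 P = s} \<le> 2)) \<and>
           (is_sphere (subtopology (V.hexagon_space ty a) C) \<longrightarrow> is_circle (subtopology (V.hexagon_space ty a) L)) \<and>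
           (is_plane (subtopology (V.hexagon_space ty a) C) \<longrightarrow> is_line (subtopology (V.hexagon_space ty a) L)) \<and>
           (\<forall>P\<in>L. V.hyperbolic (V.R03 a P) \<longrightarrow> V.smooth_by_t3_at ty a L P)"
      using cases
    proof (elim disjE conjE)
      assume C1: "C = H.piece ty 1"
      have sub: "H.curve ty 1 \<subseteq> C" unfolding C1 H.curve_def by blast
      have fib: "if a 0 + a 3 = pi \<and> a 1 + a 2 = pi
            then is_ray (subtopology (V.hexagon_space ty a) {P \<in> H.curve ty 1. V.t ty a 3 P = 1}) \<and>
                 (\<forall>s. s \<noteq> 1 \<longrightarrow> finite {P \<in> H.curve ty 1. V.t ty a 3 P = s} \<and> card {P \<in> H.curve ty 1. V.t ty a 3 P = s} \<le> 2)
            else (\<forall>s. finite {P \<in> H.curve ty 1. V.t ty a 3 P = s} \<and> card {P \<in> H.curve ty 1. V.t ty a 3 P = s} \<le> 2)"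
      proof (cases "a 0 + a 3 = pi \<and> a 1 + a 2 = pi")
        case True
        then have z: "cos (a 0) + cos (a 3) = 0" "cos (a 1) + cos (a 2) = 0" using d_iff by blast+
        show ?thesis unfolding if_P[OF True] using H.curve_ray[OF z] H.curve_fibre_card[of 1] by simp
      next
        case False
        then have "\<not> (cos (a 0) + cos (a 3) = 0 \<and> cos (a 1) + cos (a 2) = 0)" unfolding d_iff .
        then show ?thesis unfolding if_not_P[OF False] using H.curve_fibre_card[of 1] by blast
      qed
      have sm: "V.smooth_by_t3_at ty a (H.curve ty 1) P" if "P \<in> H.curve ty 1" "V.hyperbolic (V.R03 a P)" for P
      proof (rule H.curve_smooth[OF that(1) H.hyperbolic_tau[OF _ _ that(2)]])
        show "P \<in> H.piece ty 1" using that(1) sub unfolding C1 by blast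
      qed simp
      \<comment> \<open>The clause about spheres holds vacuously, since a plane is not
        compact.\<close>
      show ?thesis
        using sub fib sm H.plane_piece[of ty] H.curve_image[of 1 ty] plane_not_sphere[OF H.plane_piece(1)[of ty]]
        unfolding C1 by (intro exI[of _ "H.curve ty 1"] conjI ballI impI) simp_all
    next
      assume cc: H.compact_case and C1: "C = H.piece ty (- 1)"
      have T1: "H.m.T1 \<noteq> 1" using H.sphere_piece(4)[OF cc, of ty] ns unfolding C1 is_singleton_def by blast
      have sub: "H.curve ty (- 1) \<subseteq> C" unfolding C1 H.curve_def by blast
      have ne: "\<not> (cos (a 0) + cos (a 3) = 0 \<and> cos (a 1) + cos (a 2) = 0)" using cc_pos[OF cc] by auto
      then have nd: "\<not> (a 0 + a 3 = pi \<and> a 1 + a 2 = pi)" unfolding d_iff .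
      have fib: "\<forall>s. finite {P \<in> H.curve ty (- 1). V.t ty a 3 P = s} \<and> card {P \<in> H.curve ty (- 1). V.t ty a 3 P = s} \<le> 2"
        using H.curve_fibre_card[of "- 1"] ne by blast
      \<comment> \<open>On the sphere the isometry is elliptic, so the smoothness clause is vacuous
        there.\<close>
      have nh: "\<not> V.hyperbolic (V.R03 a P)" if "P \<in> H.curve ty (- 1)" for P
        using H.compact_piece_kinds(1)[OF cc] V.elliptic_not_hyperbolic that sub unfolding C1 by blast
      show ?thesis
        unfolding if_not_P[OF nd]
        using sub fib nh H.sphere_piece(1-3)[OF cc T1, of ty] H.curve_image[of "- 1" ty]
          sphere_not_plane[OF H.sphere_piece(1)[OF cc T1, of ty]]
        unfolding C1 by (intro exI[of _ "H.curve ty (- 1)"] conjI ballI impI) simp_all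
    qed
  qed
qed

end
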